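(* Let $\sigma\ge1$ be a real number, $n\ge 1$ and $p>1$. Assume that $$2\le p<\infty\ \text{ if } n\le2\sigma,\qquad 2\le p\le\frac{n}{n-2\sigma}\ \text{ if } n\in(2\sigma,4\sigma],$$ and moreover that $p>1+\frac{2\sigma}{n}$. Let $(u_0,u_1)\in\mathcal{A}^\sigma_1:=(L^1\cap H^\sigma)\times(L^1\cap L^2)$ with $\|(u_0,u_1)\|_{\mathcal{A}^\sigma_1}\le\varepsilon$, where $\varepsilon>0$ is a sufficiently small constant, and let $u\in C([0,\infty),H^\sigma)\cap C^1([0,\infty),L^2)$ be the global (in time) small data energy solution to $$u_{tt}+(-\Delta)^\sigma u+u_t+(-\Delta)^\sigma u_t=|u|^p,\quad u(0,x)=u_0(x),\quad u_t(0,x)=u_1(x),\qquad x\in\mathbb{R}^n.$$ Then $$\big\|\partial_t^j|D|^{k\sigma}\big(u(t,\cdot)-M\,G_\sigma(t,\cdot)\big)\big\|_{L^2}=o\big(t^{-\frac{n}{4\sigma}-\frac k2-j}\big)\quad\text{as }t\to\infty,$$ for $j,k\in\{0,1\}$ with $(j,k)\ne(1,1)$, where $$M:=\int_{\mathbb{R}^n}\big(u_0(y)+u_1(y)\big)\,dy+\int_0^\infty\int_{\mathbb{R}^n}|u(\tau,y)|^p\,dy\,d\tau.$$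
   Context: All spaces are over $\mathbb{R}^n$. $G_\sigma(t,x):=\mathcal{F}^{-1}\big(e^{-t|\xi|^{2\sigma}}\big)(x)$, with Fourier convention $\hat f(\xi)=\int e^{-ix\cdot\xi}f(x)\,dx$. $|D|^{s}$ is the Fourier multiplier with symbol $|\xi|^{s}$; $H^\sigma$ is the $L^2$-based Bessel potential space; $\|(u_0,u_1)\|_{\mathcal{A}^\sigma_1}=\|u_0\|_{L^1}+\|u_0\|_{H^\sigma}+\|u_1\|_{L^1}+\|u_1\|_{L^2}$. Solutions are understood in the Duhamel (mild) sense: $$u(t,x)=K_0(t,x)\ast_x u_0(x)+K_1(t,x)\ast_x u_1(x)+\int_0^tK_1(t-\tau,x)\ast_x|u(\tau,x)|^p\,d\tau,$$ with $K_0(t,x)=\mathcal{F}^{-1}\Big(\frac{e^{-t|\xi|^{2\sigma}}-|\xi|^{2\sigma}e^{-t}}{1-|\xi|^{2\sigma}}\Big)$ and $K_1(t,x)=\mathcal{F}^{-1}\Big(\frac{e^{-t|\xi|^{2\sigma}}-e^{-t}}{1-|\xi|^{2\sigma}}\Big)$ (multipliers extended continuously across $|\xi|=1$). The global small data energy solution is the uniquely determined solution which, for real $\sigma\ge1$, $n\ge1$ and $p>1+\frac{2\sigma}{n}$ with $2\le p<\infty$ if $n\le2\sigma$ and $2\le p\le\frac{n}{n-2\sigma}$ if $n\in(2\sigma,4\sigma]$, exists for every data with $\|(u_0,u_1)\|_{\mathcal{A}^\sigma_1}\le\varepsilon$ for a suitable $\varepsilon>0$ and satisfies, for all $t\ge0$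 and with $C$ independent of $t$ and the data, $\|u(t,\cdot)\|_{L^2}\le C(1+t)^{-\frac{n}{4\sigma}}\|(u_0,u_1)\|_{\mathcal{A}^\sigma_1}$, $\||D|^\sigma u(t,\cdot)\|_{L^2}\le C(1+t)^{-\frac{n}{4\sigma}-\frac12}\|(u_0,u_1)\|_{\mathcal{A}^\sigma_1}$, $\|u_t(t,\cdot)\|_{L^2}\le C(1+t)^{-\frac{n}{4\sigma}-1}\|(u_0,u_1)\|_{\mathcal{A}^\sigma_1}$. *)

theory Defs
  imports "HOL-Analysis.Analysis" "HOL-Library.Landau_Symbols"
begin

section \<open>Lebesgue spaces\<close>

text \<open>
  Elements of function spaces are represented by Borel functions; functions that agree almost
  everywhere are never distinguished below. Values are complex, which includes real-valued data
  and solutions.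
\<close>

type_synonym 'n field = "real ^ 'n \<Rightarrow> complex"

definition L1 :: "('n::finite) field set" where
  "L1 = {f. integrable lborel f}"

definition L1norm :: "('n::finite) field \<Rightarrow> real" where
  "L1norm f = (LINT x|lborel. norm (f x))"

definition L2 :: "('n::finite) field set" where
  "L2 = {f. f \<in> borel_measurable lborel \<and> integrable lborel (\<lambda>x. (norm (f x))\<^sup>2)}"

definition L2norm :: "('n::finite) field \<Rightarrow> real" where
  "L2norm f = sqrt (LINT x|lborel. (norm (f x))\<^sup>2)"

text \<open>
  The real number \<^term>\<open>L2norm f\<close> is only meaningful for \<^term>\<open>f \<in> L2\<close>, so membership is part of
  the following notions of limit and integral.
\<close>

definition tendsto_L2 :: "('a \<Rightarrow> ('n::finite) field) \<Rightarrow> 'n field \<Rightarrow> 'a filter \<Rightarrow> bool" where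
  "tendsto_L2 f g F \<longleftrightarrow> g \<in> L2 \<and> (\<forall>\<^sub>F s in F. f s \<in> L2) \<and>
     ((\<lambda>s. L2norm (\<lambda>x. f s x - g x)) \<longlongrightarrow> 0) F"

text \<open>The time variable ranges over \<open>[0, \<infinity>)\<close>; at \<open>t = 0\<close> the derivative is one-sided.\<close>

definition has_L2_deriv :: "(real \<Rightarrow> ('n::finite) field) \<Rightarrow> 'n field \<Rightarrow> real \<Rightarrow> bool" where
  "has_L2_deriv w v t \<longleftrightarrow>
     tendsto_L2 (\<lambda>s x. (w s x - w t x) / of_real (s - t)) v (at t within {0..})"

definition L2_deriv :: "(real \<Rightarrow> ('n::finite) field) \<Rightarrow> real \<Rightarrow> 'n field" where
  "L2_deriv w t = (SOME v. has_L2_deriv w v t)"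

text \<open>
  The integral over \<open>[a, b]\<close> of an \<open>L\<^sup>2\<close>-valued function: the definition of \<^const>\<open>has_integral\<close>
  on an interval, with the norm of \<open>L\<^sup>2\<close>. For integrands continuous in \<open>L\<^sup>2\<close> it is the
  Riemann (and the Bochner) integral.
\<close>

definition has_L2_integral ::
  "(real \<Rightarrow> ('n::finite) field) \<Rightarrow> 'n field \<Rightarrow> real \<Rightarrow> real \<Rightarrow> bool" where
  "has_L2_integral f I a b \<longleftrightarrow> I \<in> L2 \<and> (\<forall>\<tau>\<in>{a..b}. f \<tau> \<in> L2) \<and>
     (\<forall>e>0. \<exists>\<gamma>. gauge \<gamma> \<and>
        (\<forall>\<D>. \<D> tagged_division_of {a..b} \<and> \<gamma> fine \<D> \<longrightarrow>
           L2norm (\<lambda>x. (\<Sum>(\<tau>, J)\<in>\<D>. of_real (measure lborel J) * f \<tau> x) - I x) < e))"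

section \<open>Fourier transform and Fourier multipliers on $L^2$\<close>

definition fourier_integral :: "('n::finite) field \<Rightarrow> 'n field" where
  "fourier_integral f \<xi> = (LINT x|lborel. exp (- (\<i> * of_real (x \<bullet> \<xi>))) * f x)"

text \<open>
  Plancherel extension to \<open>L\<^sup>2\<close>: the transform of \<open>f\<close> is the \<open>L\<^sup>2\<close>-limit of the Fourier integrals
  over the balls of radius \<open>R\<close> (truncations of \<open>f\<close> lie in \<open>L\<^sup>1\<close>). It is a bijection of
  \<open>L\<^sup>2\<close> modulo null sets, so the two choices below are well defined up to null sets.
\<close>

definition has_fourier :: "('n::finite) field \<Rightarrow> 'n field \<Rightarrow> bool" where
  "has_fourier f g \<longleftrightarrow> f \<in> L2 \<and>
     tendsto_L2 (\<lambda>R. fourier_integral (\<lambda>x. if norm x < R then f x else 0)) g at_top"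

definition fourier :: "('n::finite) field \<Rightarrow> 'n field" where
  "fourier f = (SOME g. has_fourier f g)"

definition inv_fourier :: "('n::finite) field \<Rightarrow> 'n field" where
  "inv_fourier g = (SOME f. has_fourier f g)"

definition fourier_mult :: "(real ^ 'n \<Rightarrow> real) \<Rightarrow> ('n::finite) field \<Rightarrow> 'n field" where
  "fourier_mult m f = inv_fourier (\<lambda>\<xi>. of_real (m \<xi>) * fourier f \<xi>)"

text \<open>\<open>|D|\<^sup>s\<close>; for \<open>s = 0\<close> the symbol is \<open>1\<close> off the origin.\<close>

definition abs_D :: "real \<Rightarrow> ('n::finite) field \<Rightarrow> 'n field" where
  "abs_D s = fourier_mult (\<lambda>\<xi>. norm \<xi> powr s)"

definition bessel_symbol :: "real \<Rightarrow> real ^ ('n::finite) \<Rightarrow> real" where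
  "bessel_symbol s \<xi> = (1 + (norm \<xi>)\<^sup>2) powr (s / 2)"

definition Hs :: "real \<Rightarrow> ('n::finite) field set" where
  "Hs s = {f \<in> L2. (\<lambda>\<xi>. of_real (bessel_symbol s \<xi>) * fourier f \<xi>) \<in> L2}"

definition Hs_norm :: "real \<Rightarrow> ('n::finite) field \<Rightarrow> real" where
  "Hs_norm s f = L2norm (fourier_mult (bessel_symbol s) f)"

section \<open>The evolution equation\<close>

definition G :: "real \<Rightarrow> real \<Rightarrow> ('n::finite) field" where
  "G \<sigma> t = inv_fourier (\<lambda>\<xi>. of_real (exp (- t * norm \<xi> powr (2 * \<sigma>))))"

text \<open>
  Symbols of \<open>K\<^sub>0(t)\<close> and \<open>K\<^sub>1(t)\<close> as functions of \<open>r = |\<xi>|\<^bsup>2\<sigma>\<^esup>\<close>; the values at \<open>r = 1\<close> are the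
  limits for \<open>r \<longlongrightarrow> 1\<close>. The kernels are in general only distributions, so convolution
  with them is the corresponding Fourier multiplier.
\<close>

definition k0 :: "real \<Rightarrow> real \<Rightarrow> real" where
  "k0 t r = (if r = 1 then (1 + t) * exp (- t) else (exp (- t * r) - r * exp (- t)) / (1 - r))"

definition k1 :: "real \<Rightarrow> real \<Rightarrow> real" where
  "k1 t r = (if r = 1 then t * exp (- t) else (exp (- t * r) - exp (- t)) / (1 - r))"

definition K0_conv :: "real \<Rightarrow> real \<Rightarrow> ('n::finite) field \<Rightarrow> 'n field" where
  "K0_conv \<sigma> t = fourier_mult (\<lambda>\<xi>. k0 t (norm \<xi> powr (2 * \<sigma>)))"

definition K1_conv :: "real \<Rightarrow> real \<Rightarrow> ('n::finite) field \<Rightarrow> 'n field" where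
  "K1_conv \<sigma> t = fourier_mult (\<lambda>\<xi>. k1 t (norm \<xi> powr (2 * \<sigma>)))"

definition A1 :: "real \<Rightarrow> (('n::finite) field \<times> 'n field) set" where
  "A1 \<sigma> = (L1 \<inter> Hs \<sigma>) \<times> (L1 \<inter> L2)"

definition A1_norm :: "real \<Rightarrow> ('n::finite) field \<Rightarrow> 'n field \<Rightarrow> real" where
  "A1_norm \<sigma> u0 u1 = L1norm u0 + Hs_norm \<sigma> u0 + L1norm u1 + L2norm u1"

text \<open>\<open>C([0,\<infinity>), H\<^sup>\<sigma>) \<inter> C\<^sup>1([0,\<infinity>), L\<^sup>2)\<close>\<close>

definition energy_class :: "real \<Rightarrow> (real \<Rightarrow> ('n::finite) field) set" where
  "energy_class \<sigma> = {u.
     (\<forall>t\<ge>0. u t \<in> Hs \<sigma> \<and>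
        ((\<lambda>s. Hs_norm \<sigma> (\<lambda>x. u s x - u t x)) \<longlongrightarrow> 0) (at t within {0..})) \<and>
     (\<forall>t\<ge>0. has_L2_deriv u (L2_deriv u t) t \<and>
        tendsto_L2 (L2_deriv u) (L2_deriv u t) (at t within {0..}))}"

text \<open>
  For \<open>u(\<tau>) \<in> H\<^sup>\<sigma>\<close> and the exponents admitted in the theorem, \<open>|u(\<tau>)|\<^sup>p \<in> L\<^sup>2\<close> by Sobolev
  embedding, so \<^const>\<open>K1_conv\<close> is applied within its domain.
\<close>

definition mild_solution ::
  "real \<Rightarrow> real \<Rightarrow> ('n::finite) field \<Rightarrow> 'n field \<Rightarrow> (real \<Rightarrow> 'n field) \<Rightarrow> bool" where
  "mild_solution \<sigma> p u0 u1 u \<longleftrightarrow> (\<forall>t\<ge>0. \<exists>N.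
     has_L2_integral (\<lambda>\<tau>. K1_conv \<sigma> (t - \<tau>) (\<lambda>x. of_real (norm (u \<tau> x) powr p))) N 0 t \<and>
     (AE x in lborel. u t x = K0_conv \<sigma> t u0 x + K1_conv \<sigma> t u1 x + N x))"

definition energy_decay ::
  "real \<Rightarrow> real \<Rightarrow> ('n::finite) field \<Rightarrow> 'n field \<Rightarrow> (real \<Rightarrow> 'n field) \<Rightarrow> bool" where
  "energy_decay \<sigma> C u0 u1 u \<longleftrightarrow> (\<forall>t\<ge>0.
     L2norm (u t) \<le> C * (1 + t) powr (- real CARD('n) / (4 * \<sigma>)) * A1_norm \<sigma> u0 u1 \<and>
     L2norm (abs_D \<sigma> (u t)) \<le> C * (1 + t) powr (- real CARD('n) / (4 * \<sigma>) - 1 / 2) * A1_norm \<sigma> u0 u1 \<and>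
     L2norm (L2_deriv u t) \<le> C * (1 + t) powr (- real CARD('n) / (4 * \<sigma>) - 1) * A1_norm \<sigma> u0 u1)"

definition global_energy_solution ::
  "real \<Rightarrow> real \<Rightarrow> ('n::finite) field \<Rightarrow> 'n field \<Rightarrow> (real \<Rightarrow> 'n field) \<Rightarrow> bool" where
  "global_energy_solution \<sigma> p u0 u1 u \<longleftrightarrow>
     u \<in> energy_class \<sigma> \<and> mild_solution \<sigma> p u0 u1 u \<and> (\<exists>C. energy_decay \<sigma> C u0 u1 u)"

end

theory Submission
  imports Defs "HOL-Probability.Probability" "HOL-Real_Asymp.Real_Asymp"
begin

text \<open>
  On the Fourier side \<open>K\<^sub>0 = K\<^sub>1 + e\<^bsup>-t\<^esup>\<close>, so the transform of \<open>u\<close> is the symbol of \<open>K\<^sub>1\<close> applied to that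
  of \<open>u\<^sub>0 + u\<^sub>1\<close>, plus \<open>e\<^bsup>-t\<^esup>\<close> times that of \<open>u\<^sub>0\<close>, plus the Duhamel integral of \<open>h = F(|u|\<^sup>p)\<close>. The assumed energy
  decay and the Gagliardo-Nirenberg inequality give \<open>|u(\<tau>)|\<^sup>p\<close> the decay \<open>(1 + \<tau>)\<^bsup>-\<alpha>\<^esup>\<close> in \<open>L\<^sup>1\<close> and
  \<open>(1 + \<tau>)\<^bsup>-\<alpha>-n/(4\<sigma>)\<^esup>\<close> in \<open>L\<^sup>2\<close>, where \<open>\<alpha> = n(p-1)/(2\<sigma>) > 1\<close>. High frequencies decay exponentially, and the
  sources at times \<open>\<tau> > t/2\<close> are small by this decay. For low frequencies and \<open>\<tau> < t/2\<close> one rescales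
  \<open>\<xi> = t\<^bsup>-1/(2\<sigma>)\<^esup> \<eta>\<close>: the rescaled symbols are dominated by \<open>exp (- |\<eta>|\<^bsup>2\<sigma>\<^esup> / 4)\<close> and converge pointwise to those
  of the heat kernel, the continuous functions \<open>h \<tau>\<close> converge to \<open>h \<tau> 0\<close>, and dominated convergence yields
  the constant \<open>M\<close>. As the decay of \<open>u\<close> is assumed and not proved, any \<open>\<epsilon>\<close> works.
\<close>

text \<open>The obstacle is that the solution is given only up to null sets and through an
  L^2-valued gauge integral, while the asymptotics need pointwise values, above all at frequency 0.
  The bridge is the source: |u|^p is continuous in time with values in L^1, so its transform
  \<open>h\<close> is jointly continuous in time and frequency. This yields measurability for
  Fubini, the numbers \<open>h \<tau> 0\<close> that make up the mass, and the fundamental theorem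
  of calculus for the time derivative. Duhamel's integral is identified by testing against bounded
  functions of bounded support, and u_t by comparing an L^2 limit with a pointwise limit along a
  subsequence. Two features of the damped propagator shape the estimates. On the sphere |\<xi>| = 1
  its symbol is a quotient 0/0: bounds near it cancel a factor 1 - r by hand, and differentiation
  takes place off this null set. At high frequencies it decays like an exponential in time but gains
  no smoothing from the e^(-t) part, so a derivative of u_0 has to be paid for by u_0 in
  H^\<sigma>.\<close>

lemma Cauchy_Schwarz_integral:
  fixes a b :: "'a \<Rightarrow> real"
  assumes [measurable]: "a \<in> borel_measurable M" "b \<in> borel_measurable M"
    and ia: "integrable M (\<lambda>x. (a x)\<^sup>2)" and ib: "integrable M (\<lambda>x. (b x)\<^sup>2)"
  shows "integrable M (\<lambda>x. a x * b x)"
    and "(\<integral>x. a x * b x \<partial>M)\<^sup>2 \<le> (\<integral>x. (a x)\<^sup>2 \<partial>M) * (\<integral>x. (b x)\<^sup>2 \<partial>M)"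
proof -
  have "integrable M (\<lambda>x. (a x)\<^sup>2 + (b x)\<^sup>2)" using ia ib by simp
  then show int: "integrable M (\<lambda>x. a x * b x)"
  proof (rule Bochner_Integration.integrable_bound)
    have "\<bar>a x * b x\<bar> \<le> (a x)\<^sup>2 + (b x)\<^sup>2" for x
    proof -
      have "2 * (\<bar>a x\<bar> * \<bar>b x\<bar>) \<le> (a x)\<^sup>2 + (b x)\<^sup>2"
        using sum_squares_bound[of "\<bar>a x\<bar>" "\<bar>b x\<bar>"] by (simp add: mult.assoc)
      moreover have "0 \<le> \<bar>a x\<bar> * \<bar>b x\<bar>" by simp
      ultimately show ?thesis unfolding abs_mult by linarith
    qed
    then show "AE x in M. norm (a x * b x) \<le> norm ((a x)\<^sup>2 + (b x)\<^sup>2)" by simp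
  qed simp
  let ?A = "\<integral>x. (a x)\<^sup>2 \<partial>M" and ?B = "\<integral>x. (b x)\<^sup>2 \<partial>M" and ?C = "\<integral>x. a x * b x \<partial>M"
  \<comment> \<open>A quadratic form in two real parameters replaces the discriminant:
    \<open>s = ?B\<close>, \<open>t = ?C\<close> makes it \<open>?B\<close> times the desired
    difference, and only \<open>?B = 0\<close> needs another choice.\<close>
  have q: "0 \<le> s\<^sup>2 * ?A - 2 * s * t * ?C + t\<^sup>2 * ?B" for s t :: real
  proof -
    have "0 \<le> (\<integral>x. (s * a x - t * b x)\<^sup>2 \<partial>M)" by simp
    also have "(\<lambda>x. (s * a x - t * b x)\<^sup>2) = (\<lambda>x. s\<^sup>2 * (a x)\<^sup>2 - 2 * s * t * (a x * b x) + t\<^sup>2 * (b x)\<^sup>2)"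
      by (auto simp: power2_eq_square algebra_simps)
    also have "integral\<^sup>L M \<dots> = s\<^sup>2 * ?A - 2 * s * t * ?C + t\<^sup>2 * ?B"
      using ia ib int by simp
    finally show ?thesis .
  qed
  have A: "?A \<ge> 0" and B: "?B \<ge> 0" by simp_all
  show "?C\<^sup>2 \<le> ?A * ?B"
  proof (cases "?B = 0")
    case True
    have "?C = 0"
    proof (rule ccontr)
      assume "?C \<noteq> 0"
      \<comment> \<open>With \<open>?B = 0\<close> the form at \<open>s = 1\<close> is linear in
        \<open>t\<close>; at this \<open>t\<close> it equals -1.\<close>
      then show False
        using q[of 1 "(?A + 1) / (2 * ?C)"] True by (simp add: field_simps)
    qed
    then show ?thesis using True by simp
  next
    case False
    then have "?B > 0" using B by linarith
    have "0 \<le> ?B * (?A * ?B - ?C\<^sup>2)"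
      using q[of ?B ?C] by (simp add: power2_eq_square algebra_simps)
    then show ?thesis using \<open>?B > 0\<close> by (simp add: zero_le_mult_iff)
  qed
qed

section \<open>The space $L^2$\<close>

lemma L2_measurable [measurable_dest]: "f \<in> L2 \<Longrightarrow> f \<in> borel_measurable borel"
  by (simp add: L2_def)

lemma L2_integrable: "f \<in> L2 \<Longrightarrow> integrable lborel (\<lambda>x. (norm (f x))\<^sup>2)"
  by (simp add: L2_def)

lemma L2I:
  "f \<in> borel_measurable borel \<Longrightarrow> integrable lborel (\<lambda>x. (norm (f x))\<^sup>2) \<Longrightarrow> f \<in> L2"
  by (simp add: L2_def)

lemma L1_measurable [measurable_dest]: "f \<in> L1 \<Longrightarrow> f \<in> borel_measurable borel"
  using borel_measurable_integrable by (fastforce simp: L1_def)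

lemma L2_bound:
  assumes "f \<in> L2" and [measurable]: "g \<in> borel_measurable borel"
    and "AE x in lborel. norm (g x) \<le> C * norm (f x)"
  shows "g \<in> L2"
proof (rule L2I)
  have "AE x in lborel. norm ((norm (g x))\<^sup>2) \<le> norm (C\<^sup>2 * (norm (f x))\<^sup>2)"
    using assms(3) by eventually_elim (auto simp flip: power_mult_distrib intro: power_mono)
  moreover have "integrable lborel (\<lambda>x. C\<^sup>2 * (norm (f x))\<^sup>2)" using L2_integrable[OF assms(1)] by simp
  ultimately show "integrable lborel (\<lambda>x. (norm (g x))\<^sup>2)"
    using Bochner_Integration.integrable_bound[of lborel "\<lambda>x. C\<^sup>2 * (norm (f x))\<^sup>2" "\<lambda>x. (norm (g x))\<^sup>2"]
    by simp
qed simp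

lemma L2_cong_AE:
  assumes "f \<in> L2" "g \<in> borel_measurable borel" "AE x in lborel. f x = g x"
  shows "g \<in> L2"
  by (rule L2_bound[of f g 1]) (use assms in auto)

lemma L2_norm_fun: "f \<in> L2 \<Longrightarrow> (\<lambda>x. complex_of_real (norm (f x))) \<in> L2"
  by (rule L2_bound[of f _ 1]) (auto dest: L2_measurable)

lemma L2_cmult: "f \<in> L2 \<Longrightarrow> (\<lambda>x. c * f x) \<in> L2"
  by (rule L2_bound[of f _ "norm c"]) (auto dest: L2_measurable simp: norm_mult)

lemma borel_measurable_cnj [measurable (raw)]:
  "f \<in> borel_measurable M \<Longrightarrow> (\<lambda>x. cnj (f x)) \<in> borel_measurable M"
  by (rule borel_measurable_continuous_on[of cnj]) (auto intro: continuous_intros)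

lemma L2_cnj: "f \<in> L2 \<Longrightarrow> (\<lambda>x. cnj (f x)) \<in> L2"
  by (rule L2_bound[of f _ 1]) (auto dest: L2_measurable)

lemma L2_zero: "(\<lambda>x. 0) \<in> L2"
  by (simp add: L2_def)

lemma L2_add:
  assumes "f \<in> L2" "g \<in> L2" shows "(\<lambda>x. f x + g x) \<in> L2"
proof (rule L2I)
  have [measurable]: "f \<in> borel_measurable borel" "g \<in> borel_measurable borel"
    using assms by (auto dest: L2_measurable)
  show "(\<lambda>x. f x + g x) \<in> borel_measurable borel" by measurable
  have "integrable lborel (\<lambda>x. 2 * (norm (f x))\<^sup>2 + 2 * (norm (g x))\<^sup>2)"
    using assms[THEN L2_integrable] by simp
  then show "integrable lborel (\<lambda>x. (norm (f x + g x))\<^sup>2)"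
  proof (rule Bochner_Integration.integrable_bound)
    have "(norm (f x + g x))\<^sup>2 \<le> 2 * (norm (f x))\<^sup>2 + 2 * (norm (g x))\<^sup>2" for x
    proof -
      have "(norm (f x + g x))\<^sup>2 \<le> (norm (f x) + norm (g x))\<^sup>2"
        by (intro power_mono norm_triangle_ineq) simp
      also have "\<dots> \<le> 2 * (norm (f x))\<^sup>2 + 2 * (norm (g x))\<^sup>2"
        using sum_squares_bound[of "norm (f x)" "norm (g x)"] by (simp add: power2_sum)
      finally show ?thesis .
    qed
    then show "AE x in lborel. norm ((norm (f x + g x))\<^sup>2) \<le> norm (2 * (norm (f x))\<^sup>2 + 2 * (norm (g x))\<^sup>2)"
      by simp
  qed simp
qed

lemma L2_diff:
  assumes "f \<in> L2" "g \<in> L2" shows "(\<lambda>x. f x - g x) \<in> L2"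
  using L2_add[OF assms(1) L2_cmult[OF assms(2), of "-1"]] by simp

lemma L2_sum:
  assumes "\<And>i. i \<in> I \<Longrightarrow> f i \<in> L2" shows "(\<lambda>x. \<Sum>i\<in>I. f i x) \<in> L2"
  using assms by (induction I rule: infinite_finite_induct) (auto intro: L2_zero L2_add)

lemma L2norm_nonneg [simp]: "0 \<le> L2norm f"
  by (simp add: L2norm_def)

lemma L2norm_sq: "(L2norm f)\<^sup>2 = (LINT x|lborel. (norm (f x))\<^sup>2)"
  by (simp add: L2norm_def)

lemma L2norm_cong_AE:
  assumes "AE x in lborel. f x = g x"
    and "f \<in> borel_measurable borel" "g \<in> borel_measurable borel"
  shows "L2norm f = L2norm g"
proof -
  note [measurable] = assms(2,3)
  have "(LINT x|lborel. (norm (f x))\<^sup>2) = (LINT x|lborel. (norm (g x))\<^sup>2)"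
    by (rule integral_cong_AE) (use assms(1) in \<open>auto\<close>)
  then show ?thesis by (simp add: L2norm_def)
qed

lemma L2norm_norm [simp]: "L2norm (\<lambda>x. complex_of_real (norm (f x))) = L2norm f"
  by (simp add: L2norm_def)

lemma L2norm_cnj [simp]: "L2norm (\<lambda>x. cnj (f x)) = L2norm f"
  by (simp add: L2norm_def)

lemma L2norm_minus_commute: "L2norm (\<lambda>x. f x - g x) = L2norm (\<lambda>x. g x - f x)"
  by (simp add: L2norm_def norm_minus_commute)

lemma L2norm_zero [simp]: "L2norm (\<lambda>x. 0) = 0"
  by (simp add: L2norm_def)

lemma L2norm_cmult: "L2norm (\<lambda>x. c * f x) = norm c * L2norm f"
  by (simp add: L2norm_def norm_mult power_mult_distrib real_sqrt_mult)

lemma L2norm_mono: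
  assumes "AE x in lborel. norm (f x) \<le> norm (g x)" "g \<in> L2" "f \<in> borel_measurable borel"
  shows "L2norm f \<le> L2norm g"
proof -
  have f: "f \<in> L2" using L2_bound[OF assms(2,3), of 1] assms(1) by simp
  have "(LINT x|lborel. (norm (f x))\<^sup>2) \<le> (LINT x|lborel. (norm (g x))\<^sup>2)"
    by (rule integral_mono_AE) (use assms f in \<open>auto intro!: L2_integrable power_mono\<close>)
  then show ?thesis by (simp add: L2norm_def)
qed

lemma L2_mult_integrable:
  assumes "f \<in> L2" "g \<in> L2"
  shows "integrable lborel (\<lambda>x. f x * g x)" "integrable lborel (\<lambda>x. norm (f x) * norm (g x))"
    and "(LINT x|lborel. norm (f x) * norm (g x)) \<le> L2norm f * L2norm g"
    and "norm (LINT x|lborel. f x * g x) \<le> L2norm f * L2norm g"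
proof -
  note [measurable] = assms[THEN L2_measurable]
  have cs: "integrable lborel (\<lambda>x. norm (f x) * norm (g x))"
    "(LINT x|lborel. norm (f x) * norm (g x))\<^sup>2 \<le> (LINT x|lborel. (norm (f x))\<^sup>2) * (LINT x|lborel. (norm (g x))\<^sup>2)"
    by (rule Cauchy_Schwarz_integral; use assms[THEN L2_integrable] in simp)+
  show "integrable lborel (\<lambda>x. norm (f x) * norm (g x))" by fact
  then have "integrable lborel (\<lambda>x. norm (f x * g x))" by (simp add: norm_mult)
  then show "integrable lborel (\<lambda>x. f x * g x)"
    by (subst (asm) integrable_norm_iff) auto
  have "(LINT x|lborel. norm (f x) * norm (g x))\<^sup>2 \<le> (L2norm f * L2norm g)\<^sup>2"
    using cs(2) by (simp add: power_mult_distrib L2norm_sq)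
  then show le: "(LINT x|lborel. norm (f x) * norm (g x)) \<le> L2norm f * L2norm g"
    by (rule power2_le_imp_le) simp
  have "norm (LINT x|lborel. f x * g x) \<le> (LINT x|lborel. norm (f x * g x))"
    by (rule integral_norm_bound)
  then show "norm (LINT x|lborel. f x * g x) \<le> L2norm f * L2norm g"
    using le by (simp add: norm_mult)
qed

lemma L2norm_triangle:
  assumes "f \<in> L2" "g \<in> L2"
  shows "L2norm (\<lambda>x. f x + g x) \<le> L2norm f + L2norm g"
proof -
  have "(LINT x|lborel. (norm (f x + g x))\<^sup>2)
      \<le> (LINT x|lborel. (norm (f x))\<^sup>2 + (norm (g x))\<^sup>2 + 2 * (norm (f x) * norm (g x)))"
  proof (rule integral_mono)
    show "integrable lborel (\<lambda>x. (norm (f x + g x))\<^sup>2)" using L2_add[OF assms] by (rule L2_integrable)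
    show "integrable lborel (\<lambda>x. (norm (f x))\<^sup>2 + (norm (g x))\<^sup>2 + 2 * (norm (f x) * norm (g x)))"
      using assms[THEN L2_integrable] L2_mult_integrable(2)[OF assms] by simp
    fix x
    have "(norm (f x + g x))\<^sup>2 \<le> (norm (f x) + norm (g x))\<^sup>2"
      by (intro power_mono norm_triangle_ineq) simp
    then show "(norm (f x + g x))\<^sup>2 \<le> (norm (f x))\<^sup>2 + (norm (g x))\<^sup>2 + 2 * (norm (f x) * norm (g x))"
      by (simp add: power2_sum)
  qed
  also have "\<dots> = (L2norm f)\<^sup>2 + (L2norm g)\<^sup>2 + 2 * (LINT x|lborel. norm (f x) * norm (g x))"
    using assms[THEN L2_integrable] L2_mult_integrable(2)[OF assms] by (simp add: L2norm_sq)
  also have "\<dots> \<le> (L2norm f + L2norm g)\<^sup>2"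
    using L2_mult_integrable(3)[OF assms] by (simp add: power2_sum)
  finally have "(L2norm (\<lambda>x. f x + g x))\<^sup>2 \<le> (L2norm f + L2norm g)\<^sup>2" by (simp add: L2norm_sq)
  then show ?thesis by (rule power2_le_imp_le) simp
qed

lemma L2norm_triangle_diff:
  assumes "f \<in> L2" "g \<in> L2"
  shows "L2norm (\<lambda>x. f x - g x) \<le> L2norm f + L2norm g"
  using L2norm_triangle[OF assms(1) L2_cmult[OF assms(2), of "-1"]] L2norm_cmult[of "-1" g] by simp

lemma L2norm_triangle3:
  assumes "f \<in> L2" "g \<in> L2" "h \<in> L2"
  shows "L2norm (\<lambda>x. f x - h x) \<le> L2norm (\<lambda>x. f x - g x) + L2norm (\<lambda>x. g x - h x)"
  using L2norm_triangle[OF L2_diff[OF assms(1,2)] L2_diff[OF assms(2,3)]] by simp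

lemma L2norm_diff_abs:
  assumes "f \<in> L2" "g \<in> L2"
  shows "\<bar>L2norm f - L2norm g\<bar> \<le> L2norm (\<lambda>x. f x - g x)"
  using L2norm_triangle[OF L2_diff[OF assms] assms(2)]
    L2norm_triangle[OF L2_diff[OF assms(2,1)] assms(1)]
  by (simp add: L2norm_minus_commute[of f g])

lemma L2norm_sum_le:
  assumes "\<And>i. i \<in> I \<Longrightarrow> f i \<in> L2"
  shows "L2norm (\<lambda>x. \<Sum>i\<in>I. f i x) \<le> (\<Sum>i\<in>I. L2norm (f i))"
  using assms
proof (induction I rule: infinite_finite_induct)
  case (insert i I)
  then have "L2norm (\<lambda>x. f i x + (\<Sum>i\<in>I. f i x)) \<le> L2norm (f i) + L2norm (\<lambda>x. \<Sum>i\<in>I. f i x)"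
    by (intro L2norm_triangle L2_sum) auto
  with insert show ?case by fastforce
qed auto

lemma L2norm_eq_0_imp_AE:
  assumes "f \<in> L2" "L2norm f = 0" shows "AE x in lborel. f x = 0"
proof -
  have "(LINT x|lborel. (norm (f x))\<^sup>2) = 0" using assms(2) L2norm_sq[of f] by simp
  then have "AE x in lborel. (norm (f x))\<^sup>2 = 0"
    using integral_nonneg_eq_0_iff_AE[OF L2_integrable[OF assms(1)]] by simp
  then show ?thesis by eventually_elim simp
qed

lemma nn_integral_L2:
  assumes "f \<in> L2" shows "(\<integral>\<^sup>+x. ennreal ((norm (f x))\<^sup>2) \<partial>lborel) = ennreal ((L2norm f)\<^sup>2)"
  using nn_integral_eq_integral[OF L2_integrable[OF assms]] by (simp add: L2norm_sq)

text \<open>The nonnegative integral makes sense before integrability is known, so one estimate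
  delivers membership and norm bound together. Most later L^2 estimates enter here.\<close>

lemma L2_nn_integralI:
  assumes [measurable]: "f \<in> borel_measurable borel"
    and "(\<integral>\<^sup>+x. ennreal ((norm (f x))\<^sup>2) \<partial>lborel) \<le> ennreal (C\<^sup>2)" "C \<ge> 0"
  shows "f \<in> L2" "L2norm f \<le> C"
proof -
  show f: "f \<in> L2"
    by (rule L2I, simp, rule integrableI_bounded) (use assms in \<open>auto intro: le_less_trans\<close>)
  then have "(L2norm f)\<^sup>2 \<le> C\<^sup>2" using assms by (simp add: nn_integral_L2)
  then show "L2norm f \<le> C" using assms(3) by (rule power2_le_imp_le)
qed

section \<open>Pointwise subsequences and completeness of L^2\<close>

lemma L2norm_AE_subseq:
  fixes f :: "nat \<Rightarrow> 'n::finite field"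
  assumes "\<And>k. f k \<in> L2" "g \<in> L2" "(\<lambda>k. L2norm (\<lambda>x. f k x - g x)) \<longlonglongrightarrow> 0"
  shows "\<exists>r::nat\<Rightarrow>nat. strict_mono r \<and> (AE x in lborel. (\<lambda>k. f (r k) x) \<longlonglongrightarrow> g x)"
proof -
  have "\<exists>r::nat\<Rightarrow>nat. strict_mono r \<and> (AE x in lborel. (\<lambda>k. (norm (f (r k) x - g x))\<^sup>2) \<longlonglongrightarrow> 0)"
  proof (rule tendsto_L1_AE_subseq)
    show "integrable lborel (\<lambda>x. (norm (f k x - g x))\<^sup>2)" for k
      by (intro L2_integrable L2_diff assms)
    show "(\<lambda>k. LINT x|lborel. norm ((norm (f k x - g x))\<^sup>2)) \<longlonglongrightarrow> 0"
      using tendsto_power[OF assms(3), of 2] by (simp add: L2norm_sq)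
  qed
  then obtain r :: "nat \<Rightarrow> nat" where r: "strict_mono r"
    and ae: "AE x in lborel. (\<lambda>k. (norm (f (r k) x - g x))\<^sup>2) \<longlonglongrightarrow> 0" by blast
  from ae have "AE x in lborel. (\<lambda>k. f (r k) x) \<longlonglongrightarrow> g x"
  proof eventually_elim
    case (elim x)
    then have "(\<lambda>k. sqrt ((norm (f (r k) x - g x))\<^sup>2)) \<longlonglongrightarrow> sqrt 0" by (intro tendsto_intros)
    then show ?case by (simp add: tendsto_norm_zero_iff LIM_zero_iff)
  qed
  with r show ?thesis by blast
qed

text \<open>Riesz-Fischer. The increments along a fast subsequence have norms at most 2^(-k), so by
  monotone convergence the sum of their moduli is finite almost everywhere and the subsequence
  converges pointwise. Fatou's lemma then carries the Cauchy bound over to the limit.\<close>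

lemma L2_complete:
  fixes f :: "nat \<Rightarrow> 'n::finite field"
  assumes f: "\<And>k. f k \<in> L2"
    and Cau: "\<And>e. e > 0 \<Longrightarrow> \<exists>N. \<forall>m\<ge>N. \<forall>n\<ge>N. L2norm (\<lambda>x. f m x - f n x) < e"
  shows "\<exists>g\<in>L2. (\<lambda>k. L2norm (\<lambda>x. f k x - g x)) \<longlonglongrightarrow> 0"
proof -
  note [measurable] = f[THEN L2_measurable]
  have "\<exists>N. \<forall>m\<ge>N. \<forall>n\<ge>N. L2norm (\<lambda>x. f m x - f n x) < (1/2)^k" for k :: nat
    by (rule Cau) simp
  then obtain N where N: "\<And>k m n. m \<ge> N k \<Longrightarrow> n \<ge> N k \<Longrightarrow> L2norm (\<lambda>x. f m x - f n x) < (1/2)^k"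
    by metis
  \<comment> \<open>Summing the \<open>N i\<close> keeps \<open>r\<close> nondecreasing with
    \<open>N k \<le> r k\<close>; the summand \<open>k\<close> drives \<open>r k\<close> to
    infinity.\<close>
  define r where "r k = (\<Sum>i\<le>k. N i) + k" for k
  have rN: "N k \<le> r k" for k
    unfolding r_def by (metis atMost_iff finite_atMost le_add1 le_trans member_le_sum order_refl zero_le)
  have rS: "r k \<le> r (Suc k)" for k by (simp add: r_def)
  have rk: "k \<le> r k" for k by (simp add: r_def)
  define d where "d k x = norm (f (r (Suc k)) x - f (r k) x)" for k x
  define S where "S m x = (\<Sum>k<m. d k x)" for m x
  have dm [measurable]: "d k \<in> borel_measurable borel" for k unfolding d_def by measurable
  have Sm [measurable]: "S k \<in> borel_measurable borel" for k unfolding S_def by measurable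
  have dL: "(\<lambda>x. complex_of_real (d k x)) \<in> L2" "L2norm (\<lambda>x. complex_of_real (d k x)) \<le> (1/2)^k" for k
    unfolding d_def using L2_norm_fun[OF L2_diff[OF f f]] N[of k "r (Suc k)" "r k"] rN[of k] rS[of k]
    by (auto intro: less_imp_le)
  have Sb: "(\<integral>\<^sup>+x. ennreal ((S m x)\<^sup>2) \<partial>lborel) \<le> ennreal 4" for m
  proof -
    have SL: "(\<lambda>x. \<Sum>k<m. complex_of_real (d k x)) \<in> L2" by (intro L2_sum dL)
    have "L2norm (\<lambda>x. \<Sum>k<m. complex_of_real (d k x)) \<le> (\<Sum>k<m. (1/2)^k)"
      by (rule order_trans[OF L2norm_sum_le]) (auto intro!: sum_mono dL)
    also have "\<dots> \<le> 2" by (simp add: geometric_sum)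
    finally have "(L2norm (\<lambda>x. \<Sum>k<m. complex_of_real (d k x)))\<^sup>2 \<le> 2\<^sup>2" by (intro power_mono) auto
    then show ?thesis using nn_integral_L2[OF SL] ennreal_leI[of _ 4]
      by (simp flip: of_real_sum add: S_def)
  qed
  have Smono: "incseq (\<lambda>m x. ennreal ((S m x)\<^sup>2))"
    by (intro incseq_SucI le_funI ennreal_leI power_mono) (auto simp: S_def d_def intro: sum_nonneg)
  have "(\<integral>\<^sup>+x. (SUP m. ennreal ((S m x)\<^sup>2)) \<partial>lborel) = (SUP m. \<integral>\<^sup>+x. ennreal ((S m x)\<^sup>2) \<partial>lborel)"
    by (rule nn_integral_monotone_convergence_SUP[OF Smono]) measurable
  also have "\<dots> \<le> ennreal 4" by (intro SUP_least Sb)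
  finally have fin: "(\<integral>\<^sup>+x. (SUP m. ennreal ((S m x)\<^sup>2)) \<partial>lborel) \<noteq> \<infinity>"
    by (auto simp: top_unique)
  have "AE x in lborel. (SUP m. ennreal ((S m x)\<^sup>2)) \<noteq> \<infinity>"
    by (rule nn_integral_PInf_AE[OF _ fin]) measurable
  then have ae: "AE x in lborel. convergent (\<lambda>k. f (r k) x)"
  proof eventually_elim
    case (elim x)
    then obtain B where B: "(SUP m. ennreal ((S m x)\<^sup>2)) = ennreal B" "B \<ge> 0"
      by (metis ennreal_cases infinity_ennreal_def)
    have SB: "S m x \<le> sqrt B" for m
    proof -
      have "ennreal ((S m x)\<^sup>2) \<le> ennreal B" unfolding B(1)[symmetric] by (rule SUP_upper) simp
      then show ?thesis using B(2) by (simp add: real_le_rsqrt)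
    qed
    have "summable (\<lambda>k. d k x)"
    proof (rule bounded_imp_summable[where B="sqrt B"])
      show "(\<Sum>k\<le>n. d k x) \<le> sqrt B" for n
        using SB[of "Suc n"] by (simp add: S_def lessThan_Suc_atMost)
    qed (simp add: d_def)
    then have "summable (\<lambda>k. f (r (Suc k)) x - f (r k) x)"
      unfolding d_def by (rule summable_norm_cancel)
    then have "convergent (\<lambda>n. \<Sum>k<n. f (r (Suc k)) x - f (r k) x)"
      by (simp add: summable_iff_convergent)
    then have "convergent (\<lambda>n. f (r n) x - f (r 0) x)"
      using sum_lessThan_telescope[of "\<lambda>k. f (r k) x"] by simp
    then show "convergent (\<lambda>k. f (r k) x)"
      by (simp add: convergent_diff_const_right_iff)
  qed
  define g where "g x = lim (\<lambda>k. f (r k) x)" for x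
  have [measurable]: "g \<in> borel_measurable borel" unfolding g_def by measurable
  have lim: "AE x in lborel. (\<lambda>k. f (r k) x) \<longlonglongrightarrow> g x"
    using ae by eventually_elim (simp add: g_def convergent_LIMSEQ_iff)
  \<comment> \<open>Fatou along the subsequence gives the bound for every late index
    \<open>m\<close>, not only for those of the subsequence. It also shows that the difference lies
    in L^2, from which \<open>g \<in> L2\<close> follows.\<close>
  have key: "(\<lambda>x. f m x - g x) \<in> L2 \<and> L2norm (\<lambda>x. f m x - g x) \<le> e"
    if e: "e > 0" and M: "\<And>m n. m \<ge> M \<Longrightarrow> n \<ge> M \<Longrightarrow> L2norm (\<lambda>x. f m x - f n x) < e" and m: "m \<ge> M" for e M m
  proof -
    have "(\<integral>\<^sup>+x. ennreal ((norm (f m x - g x))\<^sup>2) \<partial>lborel)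
        = (\<integral>\<^sup>+x. liminf (\<lambda>k. ennreal ((norm (f m x - f (r k) x))\<^sup>2)) \<partial>lborel)"
    proof (rule nn_integral_cong_AE)
      show "AE x in lborel. ennreal ((norm (f m x - g x))\<^sup>2) = liminf (\<lambda>k. ennreal ((norm (f m x - f (r k) x))\<^sup>2))"
        using lim
      proof eventually_elim
        case (elim x)
        then have "(\<lambda>k. ennreal ((norm (f m x - f (r k) x))\<^sup>2)) \<longlonglongrightarrow> ennreal ((norm (f m x - g x))\<^sup>2)"
          by (intro tendsto_intros)
        then show ?case by (metis lim_imp_Liminf trivial_limit_sequentially)
      qed
    qed
    also have "\<dots> \<le> liminf (\<lambda>k. \<integral>\<^sup>+x. ennreal ((norm (f m x - f (r k) x))\<^sup>2) \<partial>lborel)"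
      by (rule nn_integral_liminf) measurable
    also have "\<dots> \<le> ennreal (e\<^sup>2)"
    proof (rule Liminf_le)
      show "\<forall>\<^sub>F k in sequentially. (\<integral>\<^sup>+x. ennreal ((norm (f m x - f (r k) x))\<^sup>2) \<partial>lborel) \<le> ennreal (e\<^sup>2)"
        using eventually_ge_at_top[of M]
      proof eventually_elim
        case (elim k)
        have "L2norm (\<lambda>x. f m x - f (r k) x) < e" using M[OF m, of "r k"] elim rk[of k] by auto
        then have "(L2norm (\<lambda>x. f m x - f (r k) x))\<^sup>2 \<le> e\<^sup>2" by (intro power_mono) auto
        then show ?case using nn_integral_L2[OF L2_diff[OF f f, of m "r k"]] by simp
      qed
    qed simp
    finally show ?thesis using L2_nn_integralI[of "\<lambda>x. f m x - g x" e] e by auto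
  qed
  have gL: "g \<in> L2"
  proof -
    obtain M where "\<And>m n. m \<ge> M \<Longrightarrow> n \<ge> M \<Longrightarrow> L2norm (\<lambda>x. f m x - f n x) < 1" using Cau[of 1] by auto
    from key[OF _ this, of M] have "(\<lambda>x. f M x - g x) \<in> L2" by auto
    from L2_diff[OF f[of M] this] show ?thesis by simp
  qed
  have "(\<lambda>k. L2norm (\<lambda>x. f k x - g x)) \<longlonglongrightarrow> 0"
  proof (rule LIMSEQ_I)
    fix e :: real assume "e > 0"
    then obtain M where "\<And>m n. m \<ge> M \<Longrightarrow> n \<ge> M \<Longrightarrow> L2norm (\<lambda>x. f m x - f n x) < e / 2" using Cau[of "e/2"] by auto
    from key[OF _ this] \<open>e > 0\<close> show "\<exists>M. \<forall>n\<ge>M. norm (L2norm (\<lambda>x. f n x - g x) - 0) < e"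
      by (intro exI[of _ M]) (force intro: le_less_trans)
  qed
  with gL show ?thesis by blast
qed

section \<open>Translations and dilations\<close>

lemma nn_integral_lborel_translate:
  fixes f :: "'a::euclidean_space \<Rightarrow> ennreal"
  assumes [measurable]: "f \<in> borel_measurable borel"
  shows "(\<integral>\<^sup>+x. f (x - w) \<partial>lborel) = (\<integral>\<^sup>+x. f x \<partial>lborel)"
  by (subst (2) lborel_distr_plus[symmetric, of "-w"]) (simp add: nn_integral_distr)

lemma L2_translate:
  fixes f :: "'n::finite field"
  assumes "f \<in> L2"
  shows "(\<lambda>x. f (x - w)) \<in> L2" "L2norm (\<lambda>x. f (x - w)) = L2norm f"
proof -
  note [measurable] = L2_measurable[OF assms]
  have eq: "(\<integral>\<^sup>+x. ennreal ((norm (f (x - w)))\<^sup>2) \<partial>lborel) = ennreal ((L2norm f)\<^sup>2)"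
    using nn_integral_lborel_translate[of "\<lambda>x. ennreal ((norm (f x))\<^sup>2)" w] nn_integral_L2[OF assms] by simp
  then show L: "(\<lambda>x. f (x - w)) \<in> L2" by (intro L2_nn_integralI(1)[where C="L2norm f"]) auto
  from nn_integral_L2[OF L] eq have "(L2norm (\<lambda>x. f (x - w)))\<^sup>2 = (L2norm f)\<^sup>2" by simp
  then show "L2norm (\<lambda>x. f (x - w)) = L2norm f" by simp
qed

lemma nn_integral_lborel_scale:
  fixes f :: "'a::euclidean_space \<Rightarrow> ennreal"
  assumes [measurable]: "f \<in> borel_measurable borel" and "c \<noteq> 0"
  shows "(\<integral>\<^sup>+x. f x \<partial>lborel) = ennreal (\<bar>c\<bar> ^ DIM('a)) * (\<integral>\<^sup>+x. f (c *\<^sub>R x) \<partial>lborel)"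
  by (subst lborel_affine[OF assms(2), of 0])
    (simp add: nn_integral_density nn_integral_distr nn_integral_cmult)

lemma integral_lborel_scale:
  fixes f :: "'a::euclidean_space \<Rightarrow> 'b::{banach, second_countable_topology}"
  assumes [measurable]: "f \<in> borel_measurable borel" and "c \<noteq> 0"
  shows "integral\<^sup>L lborel f = (\<bar>c\<bar> ^ DIM('a)) *\<^sub>R (\<integral>x. f (c *\<^sub>R x) \<partial>lborel)"
  by (subst lborel_affine[OF assms(2), of 0])
    (simp add: integral_density integral_distr)

lemma integral_lborel_translate:
  fixes f :: "'a::euclidean_space \<Rightarrow> 'b::{banach, second_countable_topology}"
  assumes [measurable]: "f \<in> borel_measurable borel"
  shows "(\<integral>x. f (w + x) \<partial>lborel) = integral\<^sup>L lborel f"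
  by (subst (2) lborel_distr_plus[symmetric, of w]) (simp add: integral_distr)

text \<open>By regularity E lies between a compact \<open>T\<close> and an open \<open>U\<close>
  whose difference \<open>V\<close> has small measure. A translation shorter than the distance
  \<open>d\<close> keeps \<open>T\<close> inside \<open>U\<close>, so the two indicators can differ
  only on \<open>V\<close> and on its translate. The measure of \<open>V\<close> is at most 2
  (e/4)^2, and two copies of it make (e/2)^2.\<close>

lemma indicator_translation_continuous:
  fixes E :: "(real ^ 'n::finite) set"
  assumes [measurable]: "E \<in> sets borel" and "bounded E"
  shows "((\<lambda>w. L2norm (\<lambda>x. indicator E (x - w) - indicator E x)) \<longlongrightarrow> 0) (nhds 0)"
proof (rule tendstoI)
  fix e :: real assume e: "e > 0"
  have E: "E \<in> sets lebesgue" using assms(1) by (simp add: sets_completionI_sets)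
  have e2: "(e/4)\<^sup>2 > 0" using e by simp
  obtain T where T: "closed T" "T \<subseteq> E" "emeasure lebesgue (E - T) < ennreal ((e/4)\<^sup>2)"
    by (rule sets_lebesgue_inner_closed[OF E e2])
  obtain U where U: "open U" "E \<subseteq> U" "emeasure lebesgue (U - E) < ennreal ((e/4)\<^sup>2)"
    by (rule sets_lebesgue_outer_open[OF E e2])
  have [measurable]: "T \<in> sets borel" "U \<in> sets borel" using T(1) U(1) by auto
  have cT: "compact T" using T \<open>bounded E\<close> bounded_subset compact_eq_bounded_closed by blast
  obtain d where d: "d > 0" "(\<Union>x\<in>T. ball x d) \<subseteq> U"
    using compact_subset_open_imp_ball_epsilon_subset[OF cT U(1)] T(2) U(2) by blast
  define V where "V = U - T"
  have [measurable]: "V \<in> sets borel" unfolding V_def by measurable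
  have "emeasure lborel V \<le> emeasure lborel (E - T) + emeasure lborel (U - E)"
    unfolding V_def using emeasure_subadditive[of "E - T" lborel "U - E"] T U
    by (intro order_trans[OF emeasure_mono[of "U - T" "(E - T) \<union> (U - E)"]]) auto
  also have "emeasure lborel (E - T) = emeasure lebesgue (E - T)"
    by (rule emeasure_completion[symmetric, THEN trans[rotated]]) simp_all
  also have "emeasure lborel (U - E) = emeasure lebesgue (U - E)"
    by (rule emeasure_completion[symmetric, THEN trans[rotated]]) simp_all
  also have "emeasure lebesgue (E - T) + emeasure lebesgue (U - E) \<le> ennreal ((e/4)\<^sup>2) + ennreal ((e/4)\<^sup>2)"
    by (intro add_mono less_imp_le T U)
  finally have V: "emeasure lborel V \<le> ennreal ((e/4)\<^sup>2 + (e/4)\<^sup>2)" using e by (simp flip: ennreal_plus)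
  show "\<forall>\<^sub>F w in nhds 0. dist (L2norm (\<lambda>x. indicator E (x - w) - indicator E x :: complex)) 0 < e"
    unfolding eventually_nhds_metric
  proof (intro exI conjI allI impI)
    fix w :: "real ^ 'n" assume w: "dist w 0 < d"
    have nb: "x + w \<in> U" "x - w \<in> U" if "x \<in> T" for x
      using d(2) that w by (force simp: dist_norm)+
    have "(\<integral>\<^sup>+x. ennreal ((norm (indicator E (x - w) - indicator E x :: complex))\<^sup>2) \<partial>lborel)
        \<le> (\<integral>\<^sup>+x. indicator V x + indicator V (x - w) \<partial>lborel)"
    proof (rule nn_integral_mono)
      fix x
      show "ennreal ((norm (indicator E (x - w) - indicator E x :: complex))\<^sup>2) \<le> indicator V x + indicator V (x - w)"
        using nb[of x] nb[of "x - w"] T(2) U(2) by (auto simp: V_def split: split_indicator)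
    qed
    also have "\<dots> = emeasure lborel V + emeasure lborel V"
      using nn_integral_lborel_translate[of "indicator V" w] by (simp add: nn_integral_add)
    also have "\<dots> \<le> ennreal ((e/4)\<^sup>2 + (e/4)\<^sup>2) + ennreal ((e/4)\<^sup>2 + (e/4)\<^sup>2)" by (intro add_mono V)
    also have "\<dots> = ennreal ((e/2)\<^sup>2)"
      by (subst ennreal_plus[symmetric]) (auto simp: power2_eq_square)
    finally have "L2norm (\<lambda>x. indicator E (x - w) - indicator E x :: complex) \<le> e / 2"
      using e by (intro L2_nn_integralI(2)) auto
    then show "dist (L2norm (\<lambda>x. indicator E (x - w) - indicator E x :: complex)) 0 < e" using e by simp
  qed (use d in auto)
qed

text \<open>Simple functions cut to balls are finite combinations of indicators of bounded sets and
  are dense in L^2; as translation is an isometry, an e/3 argument extends continuity to all of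
  L^2.\<close>

lemma L2_translation_continuous:
  fixes f :: "'n::finite field"
  assumes f: "f \<in> L2"
  shows "((\<lambda>w. L2norm (\<lambda>x. f (x - w) - f x)) \<longlongrightarrow> 0) (nhds 0)"
proof -
  note [measurable] = L2_measurable[OF f]
  obtain s where s: "\<And>i. simple_function lborel (s i)" "\<And>x. (\<lambda>i. s i x) \<longlonglongrightarrow> f x"
    "\<And>i x. dist (s i x) 0 \<le> 2 * dist (f x) 0"
    using borel_measurable_implies_sequence_metric[of f lborel 0] by auto
  define g :: "nat \<Rightarrow> 'n field" where "g i x = (if norm x < real i then s i x else 0)" for i x
  have sm [measurable]: "s i \<in> borel_measurable borel" for i
    using borel_measurable_simple_function[OF s(1)[of i]] by simp
  have gm [measurable]: "g i \<in> borel_measurable borel" for i unfolding g_def by measurable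
  have gb: "norm (g i x) \<le> 2 * norm (f x)" for i x
    using s(3)[of i x] by (auto simp: g_def)
  have gL: "g i \<in> L2" for i by (rule L2_bound[OF f gm, where C=2]) (simp add: gb)
  have glim: "(\<lambda>i. g i x) \<longlonglongrightarrow> f x" for x
  proof (rule Lim_transform_eventually[OF s(2)])
    obtain N where "norm x < real N" using reals_Archimedean2 by blast
    then show "\<forall>\<^sub>F i in sequentially. s i x = g i x"
      by (intro eventually_mono[OF eventually_ge_at_top[of N]]) (auto simp: g_def)
  qed
  have "(\<lambda>i. LINT x|lborel. (norm (g i x - f x))\<^sup>2) \<longlonglongrightarrow> (LINT x|(lborel :: (real ^ 'n) measure). (0::real))"
  proof (rule integral_dominated_convergence[where w="\<lambda>x. 9 * (norm (f x))\<^sup>2"])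
    show "integrable lborel (\<lambda>x. 9 * (norm (f x))\<^sup>2)" using L2_integrable[OF f] by simp
    show "AE x in lborel. (\<lambda>i. (norm (g i x - f x))\<^sup>2) \<longlonglongrightarrow> 0"
    proof (rule AE_I2)
      fix x
      have "(\<lambda>i. (norm (g i x - f x))\<^sup>2) \<longlonglongrightarrow> (norm (f x - f x))\<^sup>2" by (intro tendsto_intros glim)
      then show "(\<lambda>i. (norm (g i x - f x))\<^sup>2) \<longlonglongrightarrow> 0" by simp
    qed
    show "AE x in lborel. norm ((norm (g i x - f x))\<^sup>2) \<le> 9 * (norm (f x))\<^sup>2" for i
    proof (rule AE_I2)
      fix x
      have "(norm (g i x - f x))\<^sup>2 \<le> (3 * norm (f x))\<^sup>2"
        using norm_triangle_ineq4[of "g i x" "f x"] gb[of i x] by (intro power_mono) auto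
      then show "norm ((norm (g i x - f x))\<^sup>2) \<le> 9 * (norm (f x))\<^sup>2" by (simp add: power_mult_distrib)
    qed
  qed measurable
  then have "(\<lambda>i. sqrt (LINT x|lborel. (norm (g i x - f x))\<^sup>2)) \<longlonglongrightarrow> sqrt 0"
    by (intro tendsto_intros) simp
  then have g0: "(\<lambda>i. L2norm (\<lambda>x. g i x - f x)) \<longlonglongrightarrow> 0" by (simp add: L2norm_def)
  have gc: "((\<lambda>w. L2norm (\<lambda>x. g i (x - w) - g i x)) \<longlongrightarrow> 0) (nhds 0)" for i
  proof -
    define R where "R = range (s i)"
    have R: "finite R" using s(1)[of i] by (simp add: simple_function_def R_def)
    define E where "E y = s i -` {y} \<inter> ball 0 (real i)" for y
    have E [measurable]: "E y \<in> sets borel" for y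
      unfolding E_def using measurable_sets[OF sm[of i], of "{y}"] by simp
    have Eb: "bounded (E y)" for y unfolding E_def by (simp add: bounded_Int)
    have IL: "(\<lambda>x. indicator (E y) x :: complex) \<in> L2" for y
    proof (rule L2I)
      have "E y \<subseteq> ball 0 (real i)" by (auto simp: E_def)
      then have "emeasure lborel (E y) < \<infinity>"
        by (intro le_less_trans[OF emeasure_mono emeasure_lborel_ball_finite[of 0 "real i"]]) auto
      then have "integrable lborel (indicator (E y) :: _ \<Rightarrow> real)" by (simp add: integrable_real_indicator)
      also have "(indicator (E y) :: _ \<Rightarrow> real) = (\<lambda>x. (norm (indicator (E y) x :: complex))\<^sup>2)"
        by (auto split: split_indicator)
      finally show "integrable lborel (\<lambda>x. (norm (indicator (E y) x :: complex))\<^sup>2)" .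
    qed simp
    have IT: "(\<lambda>x. indicator (E y) (x - w) - indicator (E y) x :: complex) \<in> L2" for y w
      by (intro L2_diff L2_translate(1)[OF IL] IL)
    have grep: "g i x = (\<Sum>y\<in>R. y * indicator (E y) x)" for x
    proof -
      have "(\<Sum>y\<in>R. y * indicator (E y) x) = (\<Sum>y\<in>R. if s i x = y then g i x else 0)"
        by (intro sum.cong) (auto simp: E_def g_def split: split_indicator)
      also have "\<dots> = g i x" using R by (simp add: R_def)
      finally show ?thesis by simp
    qed
    show ?thesis
    proof (rule tendsto_sandwich[OF _ _ tendsto_const])
      show "\<forall>\<^sub>F w in nhds 0. L2norm (\<lambda>x. g i (x - w) - g i x)
          \<le> (\<Sum>y\<in>R. norm y * L2norm (\<lambda>x. indicator (E y) (x - w) - indicator (E y) x :: complex))"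
      proof (intro always_eventually allI)
        fix w
        have "(\<lambda>x. g i (x - w) - g i x) = (\<lambda>x. \<Sum>y\<in>R. y * (indicator (E y) (x - w) - indicator (E y) x))"
          by (auto simp: grep algebra_simps sum_subtractf)
        then have "L2norm (\<lambda>x. g i (x - w) - g i x)
            \<le> (\<Sum>y\<in>R. L2norm (\<lambda>x. y * (indicator (E y) (x - w) - indicator (E y) x)))"
          using L2norm_sum_le[of R "\<lambda>y x. y * (indicator (E y) (x - w) - indicator (E y) x)"] L2_cmult[OF IT]
          by simp
        then show "L2norm (\<lambda>x. g i (x - w) - g i x)
          \<le> (\<Sum>y\<in>R. norm y * L2norm (\<lambda>x. indicator (E y) (x - w) - indicator (E y) x :: complex))"
          by (simp add: L2norm_cmult)
      qed
      have "((\<lambda>w. \<Sum>y\<in>R. norm y * L2norm (\<lambda>x. indicator (E y) (x - w) - indicator (E y) x :: complex))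
          \<longlongrightarrow> (\<Sum>y\<in>R. norm y * 0)) (nhds 0)"
        by (intro tendsto_intros indicator_translation_continuous E Eb)
      then show "((\<lambda>w. \<Sum>y\<in>R. norm y * L2norm (\<lambda>x. indicator (E y) (x - w) - indicator (E y) x :: complex))
          \<longlongrightarrow> 0) (nhds 0)" by simp
    qed simp
  qed
  show ?thesis
  proof (rule tendstoI)
    fix e :: real assume e: "e > 0"
    obtain i where i: "L2norm (\<lambda>x. g i x - f x) < e / 3"
      using order_tendstoD(2)[OF g0, of "e/3"] e by (auto simp: eventually_sequentially)
    have "\<forall>\<^sub>F w in nhds 0. L2norm (\<lambda>x. g i (x - w) - g i x) < e / 3"
      using order_tendstoD(2)[OF gc, of "e/3"] e by auto
    then show "\<forall>\<^sub>F w in nhds 0. dist (L2norm (\<lambda>x. f (x - w) - f x)) 0 < e"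
    proof eventually_elim
      case (elim w)
      have "L2norm (\<lambda>x. f (x - w) - f x)
          \<le> L2norm (\<lambda>x. f (x - w) - g i (x - w)) + L2norm (\<lambda>x. g i (x - w) - f x)"
        by (intro L2norm_triangle3 L2_translate f gL)
      also have "L2norm (\<lambda>x. g i (x - w) - f x) \<le> L2norm (\<lambda>x. g i (x - w) - g i x) + L2norm (\<lambda>x. g i x - f x)"
        by (intro L2norm_triangle3 L2_translate f gL)
      also have "L2norm (\<lambda>x. f (x - w) - g i (x - w)) = L2norm (\<lambda>x. g i x - f x)"
        using L2_translate(2)[OF L2_diff[OF f gL[of i]], of w] by (simp add: L2norm_minus_commute)
      finally show ?case using i elim by simp
    qed
  qed
qed

section \<open>Gaussians\<close>

definition gauss :: "'a::real_normed_vector \<Rightarrow> real" where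
  "gauss x = exp (- (norm x)\<^sup>2 / 2)"

lemma gauss_pos [simp]: "gauss x > 0"
  and gauss_nonneg [simp]: "gauss x \<ge> 0"
  and gauss_measurable [measurable]: "(gauss :: 'a::real_normed_vector \<Rightarrow> real) \<in> borel_measurable borel"
  by (auto simp: gauss_def[abs_def] intro!: borel_measurable_continuous_onI continuous_intros)

text \<open>Up to the factor sqrt (2 pi) the integral is the characteristic function of the standard
  normal distribution at \<open>- s\<close>.\<close>

lemma fourier_gauss_real:
  "integrable lborel (\<lambda>x::real. exp (- (\<i> * of_real (x * s))) * of_real (gauss x))"
  "(LINT x|lborel. exp (- (\<i> * of_real (x * s))) * of_real (gauss x)) = of_real (sqrt (2 * pi) * gauss s)"
proof -
  have eq: "exp (- (\<i> * of_real (x * s))) * of_real (gauss x)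
      = of_real (sqrt (2 * pi)) * (std_normal_density x *\<^sub>R iexp (- s * x))" for x :: real
    by (simp add: gauss_def normal_density_def scaleR_conv_of_real field_simps)
  have "char std_normal_distribution (- s) = complex_of_real (exp (- s\<^sup>2 / 2))"
    by (simp add: char_std_normal_distribution)
  moreover have "char std_normal_distribution (- s) = (LINT x|lborel. std_normal_density x *\<^sub>R iexp (- s * x))"
    unfolding char_def by (subst integral_density) auto
  ultimately have I: "(LINT x|lborel. std_normal_density x *\<^sub>R iexp (- s * x)) = of_real (gauss s)"
    by (simp add: gauss_def)
  have int: "integrable lborel (\<lambda>x. std_normal_density x *\<^sub>R iexp (- s * x))"
  proof (rule Bochner_Integration.integrable_bound[of _ "std_normal_density"])
    show "integrable lborel std_normal_density" by simp
  qed auto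
  show "integrable lborel (\<lambda>x::real. exp (- (\<i> * of_real (x * s))) * of_real (gauss x))"
    unfolding eq by (intro integrable_mult_right int)
  show "(LINT x|lborel. exp (- (\<i> * of_real (x * s))) * of_real (gauss x)) = of_real (sqrt (2 * pi) * gauss s)"
    unfolding eq integral_mult_right_zero I by simp
qed

text \<open>Both the Gaussian and the exponential factor over the coordinates, and Lebesgue measure
  is the image of a product measure under the coordinate map, so the integral is a product of
  one-dimensional ones.\<close>

lemma fourier_gauss:
  fixes \<xi> :: "real ^ 'n::finite"
  shows "fourier_integral (\<lambda>x. of_real (gauss x)) \<xi> = of_real (sqrt (2 * pi) ^ CARD('n) * gauss \<xi>)"
    and "integrable lborel (\<lambda>x::real ^ 'n. gauss x)"
proof -
  interpret product_sigma_finite "\<lambda>_::real ^ 'n. lborel :: real measure" by standard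
  let ?\<phi> = "\<lambda>\<xi>::real ^ 'n. \<lambda>b t::real. exp (- (\<i> * of_real (t * (\<xi> \<bullet> b)))) * complex_of_real (gauss t)"
  let ?S = "\<lambda>f. \<Sum>b\<in>Basis. f b *\<^sub>R b :: real ^ 'n"
  have comp: "?S f \<bullet> b = f b" if "b \<in> Basis" for f b
    using that by simp
  have gprod: "gauss x = (\<Prod>b\<in>Basis. gauss (x \<bullet> b))" for x :: "real ^ 'n"
    unfolding gauss_def power2_norm_eq_inner
    by (subst euclidean_inner[of x x])
      (simp add: exp_sum sum_divide_distrib power2_eq_square flip: sum_negf)
  have split: "exp (- (\<i> * of_real (?S f \<bullet> \<xi>))) * complex_of_real (gauss (?S f)) = (\<Prod>b\<in>Basis. ?\<phi> \<xi> b (f b))" for f \<xi>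
  proof -
    have "exp (- (\<i> * of_real (?S f \<bullet> \<xi>))) = (\<Prod>b\<in>Basis. exp (- (\<i> * of_real (f b * (\<xi> \<bullet> b)))))"
      by (subst euclidean_inner[of "?S f" \<xi>]) (simp add: comp exp_sum sum_distrib_left flip: of_real_mult sum_negf)
    moreover have "gauss (?S f) = (\<Prod>b\<in>Basis. gauss (f b))"
      by (subst gprod) (simp add: comp)
    ultimately show ?thesis by (simp add: prod.distrib)
  qed
  have m: "?S \<in> measurable (\<Pi>\<^sub>M b\<in>Basis. lborel) borel" by measurable
  have int: "integrable lborel (\<lambda>x. exp (- (\<i> * of_real (x \<bullet> \<xi>))) * complex_of_real (gauss x))" for \<xi> :: "real ^ 'n"
    by (subst lborel_eq, subst integrable_distr_eq[OF m])
      (use product_integrable_prod[of Basis "?\<phi> \<xi>"] fourier_gauss_real(1) in \<open>simp_all add: split\<close>)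
  have "integrable lborel (\<lambda>x::real ^ 'n. complex_of_real (gauss x))" using int[of 0] by simp
  then show "integrable lborel (\<lambda>x::real ^ 'n. gauss x)" by (simp add: complex_of_real_integrable_eq)
  have "fourier_integral (\<lambda>x. of_real (gauss x)) \<xi>
      = (LINT f|(\<Pi>\<^sub>M b\<in>Basis. lborel). (\<Prod>b\<in>Basis. ?\<phi> \<xi> b (f b)))"
    unfolding fourier_integral_def by (subst lborel_eq, subst integral_distr[OF m]) (simp_all add: split)
  also have "\<dots> = (\<Prod>b\<in>Basis. integral\<^sup>L lborel (?\<phi> \<xi> b))"
    by (rule product_integral_prod) (use fourier_gauss_real(1) in auto)
  also have "\<dots> = (\<Prod>b\<in>Basis. of_real (sqrt (2 * pi) * gauss (\<xi> \<bullet> b)))"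
    by (simp only: fourier_gauss_real(2))
  also have "\<dots> = of_real (sqrt (2 * pi) ^ CARD('n) * gauss \<xi>)"
    by (simp add: gprod[of \<xi>] prod.distrib flip: of_real_prod)
  finally show "fourier_integral (\<lambda>x. of_real (gauss x)) \<xi> = of_real (sqrt (2 * pi) ^ CARD('n) * gauss \<xi>)" .
qed

section \<open>The Plancherel theorem\<close>

lemma L1norm_nonneg [simp]: "0 \<le> L1norm f"
  by (simp add: L1norm_def)

lemma fourier_integral_bound: "norm (fourier_integral f \<xi>) \<le> L1norm f"
proof -
  have "norm (fourier_integral f \<xi>) \<le> (LINT x|lborel. norm (exp (- (\<i> * of_real (x \<bullet> \<xi>))) * f x))"
    unfolding fourier_integral_def by (rule integral_norm_bound)
  then show ?thesis by (simp add: norm_mult L1norm_def)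
qed

lemma fourier_kernel_integrable:
  assumes "f \<in> L1" shows "integrable lborel (\<lambda>x. exp (- (\<i> * of_real (x \<bullet> \<xi>))) * f x)"
proof (rule Bochner_Integration.integrable_bound[of _ f])
  show "integrable lborel f" using assms by (simp add: L1_def)
  show "(\<lambda>x. exp (- (\<i> * of_real (x \<bullet> \<xi>))) * f x) \<in> borel_measurable lborel"
    using L1_measurable[OF assms] by simp
qed (simp add: norm_mult)

lemma fourier_integral_diff:
  assumes "f \<in> L1" "g \<in> L1"
  shows "fourier_integral (\<lambda>x. f x - g x) \<xi> = fourier_integral f \<xi> - fourier_integral g \<xi>"
  using assms[THEN fourier_kernel_integrable] by (simp add: fourier_integral_def right_diff_distrib)

lemma fourier_integral_add:
  assumes "f \<in> L1" "g \<in> L1"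
  shows "fourier_integral (\<lambda>x. f x + g x) \<xi> = fourier_integral f \<xi> + fourier_integral g \<xi>"
  using assms[THEN fourier_kernel_integrable] by (simp add: fourier_integral_def distrib_left)

lemma fourier_integral_cmult:
  "fourier_integral (\<lambda>x. c * f x) \<xi> = c * fourier_integral f \<xi>"
  by (simp add: fourier_integral_def mult.left_commute)

lemma fourier_integral_continuous:
  fixes f :: "'n::finite field"
  assumes "f \<in> L1" shows "continuous_on UNIV (fourier_integral f)"
  unfolding continuous_on_sequentially
proof (intro allI impI ballI, elim conjE)
  fix X :: "nat \<Rightarrow> real ^ 'n" and a assume X: "X \<longlonglongrightarrow> a"
  note [measurable] = L1_measurable[OF assms]
  have "(\<lambda>k. LINT x|lborel. exp (- (\<i> * of_real (x \<bullet> X k))) * f x) \<longlonglongrightarrow> (LINT x|lborel. exp (- (\<i> * of_real (x \<bullet> a))) * f x)"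
  proof (rule integral_dominated_convergence[where w="\<lambda>x. norm (f x)"])
    show "integrable lborel (\<lambda>x. norm (f x))" using assms by (simp add: L1_def)
  qed (auto intro!: tendsto_intros X simp: norm_mult)
  then show "(fourier_integral f \<circ> X) \<longlonglongrightarrow> fourier_integral f a"
    by (simp add: fourier_integral_def[abs_def] o_def)
qed

lemma fourier_integral_measurable:
  "f \<in> L1 \<Longrightarrow> fourier_integral f \<in> borel_measurable borel"
  using borel_measurable_continuous_onI fourier_integral_continuous by blast

text \<open>A bounded kernel between two integrable functions is absolutely integrable on the
  product. The multiplication formula takes the Fourier kernel, the regularised Plancherel identity
  its conjugate.\<close>

lemma fubini_kernel:
  fixes a b :: "'n::finite field" and k :: "real ^ 'n \<Rightarrow> real ^ 'n \<Rightarrow> complex"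
  assumes a: "integrable lborel a" and b: "integrable lborel b"
    and [measurable]: "(\<lambda>(x, y). k x y) \<in> borel_measurable (borel \<Otimes>\<^sub>M borel)"
    and B: "\<And>x y. norm (k x y) \<le> B"
  shows "(LINT x|lborel. a x * (LINT y|lborel. k x y * b y)) = (LINT y|lborel. b y * (LINT x|lborel. k x y * a x))"
proof -
  have [measurable]: "a \<in> borel_measurable borel" "b \<in> borel_measurable borel"
    using a b borel_measurable_integrable by fastforce+
  have B0: "B \<ge> 0" using B[of 0 0] norm_ge_zero order_trans by blast
  have km: "k x \<in> borel_measurable borel" for x by measurable
  have bnd: "norm (a x * (k x y * b y)) \<le> norm (a x) * (B * norm (b y))" for x y
    by (simp add: norm_mult mult_left_mono mult_right_mono B)
  have int: "integrable (lborel \<Otimes>\<^sub>M lborel) (\<lambda>(x, y). a x * (k x y * b y))"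
  proof (rule lborel_pair.Fubini_integrable)
    show "(\<lambda>(x, y). a x * (k x y * b y)) \<in> borel_measurable (lborel \<Otimes>\<^sub>M lborel)" by measurable
    have iy: "integrable lborel (\<lambda>y. a x * (k x y * b y))" for x
    proof (rule Bochner_Integration.integrable_bound[of _ "\<lambda>y. norm (a x) * (B * norm (b y))"])
      show "(\<lambda>y. a x * (k x y * b y)) \<in> borel_measurable lborel" using km by measurable
    qed (use b bnd B0 in auto)
    then show "AE x in lborel. integrable lborel (\<lambda>y. case (x, y) of (x, y) \<Rightarrow> a x * (k x y * b y))" by simp
    show "integrable lborel (\<lambda>x. LINT y|lborel. norm (case (x, y) of (x, y) \<Rightarrow> a x * (k x y * b y)))"
    proof (rule Bochner_Integration.integrable_bound[of _ "\<lambda>x. norm (a x) * (B * L1norm b)"])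
      show "AE x in lborel. norm (LINT y|lborel. norm (case (x, y) of (x, y) \<Rightarrow> a x * (k x y * b y)))
          \<le> norm (norm (a x) * (B * L1norm b))"
      proof (rule AE_I2)
        fix x
        have "(LINT y|lborel. norm (a x * (k x y * b y))) \<le> (LINT y|lborel. norm (a x) * (B * norm (b y)))"
          by (rule integral_mono) (use iy b bnd in auto)
        then show "norm (LINT y|lborel. norm (case (x, y) of (x, y) \<Rightarrow> a x * (k x y * b y)))
          \<le> norm (norm (a x) * (B * L1norm b))" using B0 by (simp add: L1norm_def)
      qed
    qed (use a in auto)
  qed
  have "(LINT x|lborel. a x * (LINT y|lborel. k x y * b y)) = (LINT x|lborel. LINT y|lborel. a x * (k x y * b y))"
    by simp
  also have "\<dots> = (LINT y|lborel. LINT x|lborel. a x * (k x y * b y))"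
    using lborel_pair.Fubini_integral[OF int] by simp
  also have "\<dots> = (LINT y|lborel. LINT x|lborel. b y * (k x y * a x))"
    by (simp add: mult_ac)
  also have "\<dots> = (LINT y|lborel. b y * (LINT x|lborel. k x y * a x))" by simp
  finally show ?thesis .
qed

lemma exp_i_pair_measurable [measurable]:
  fixes c :: complex
  shows "(\<lambda>(x :: 'a::euclidean_space, y). exp (c * of_real (y \<bullet> x))) \<in> borel_measurable (borel \<Otimes>\<^sub>M borel)"
  unfolding borel_prod case_prod_beta by (intro borel_measurable_continuous_onI continuous_intros)

lemma fourier_integral_multiplication:
  fixes f g :: "'n::finite field"
  assumes "f \<in> L1" "g \<in> L1"
  shows "(LINT \<xi>|lborel. fourier_integral f \<xi> * g \<xi>) = (LINT x|lborel. f x * fourier_integral g x)"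
proof -
  have "(LINT \<xi>|lborel. g \<xi> * (LINT x|lborel. exp (- (\<i> * of_real (x \<bullet> \<xi>))) * f x))
      = (LINT x|lborel. f x * (LINT \<xi>|lborel. exp (- (\<i> * of_real (x \<bullet> \<xi>))) * g \<xi>))"
    by (rule fubini_kernel[where B=1]) (use assms in \<open>auto simp: L1_def\<close>)
  then show ?thesis by (simp add: fourier_integral_def mult.commute inner_commute)
qed

lemma integrable_gauss_scale:
  assumes "\<epsilon> > 0" shows "integrable lborel (\<lambda>x::real ^ 'n::finite. gauss (\<epsilon> *\<^sub>R x))"
proof (rule integrableI_bounded)
  have "(\<integral>\<^sup>+x. ennreal (gauss (x :: real ^ 'n)) \<partial>lborel) < \<infinity>"
    using fourier_gauss(2)[where 'n='n] by (simp add: integrable_iff_bounded)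
  then have "ennreal (\<epsilon> ^ CARD('n)) * (\<integral>\<^sup>+x. ennreal (gauss (\<epsilon> *\<^sub>R (x :: real ^ 'n))) \<partial>lborel) < \<infinity>"
    using assms by (subst (asm) nn_integral_lborel_scale[of _ \<epsilon>]) auto
  then show "(\<integral>\<^sup>+x. ennreal (norm (gauss (\<epsilon> *\<^sub>R (x :: real ^ 'n)))) \<partial>lborel) < \<infinity>"
    using assms by (auto simp: ennreal_mult_less_top)
qed simp

lemma fourier_gauss_scale:
  fixes \<zeta> :: "real ^ 'n::finite"
  assumes "\<epsilon> > 0"
  shows "fourier_integral (\<lambda>\<xi>. of_real (gauss (\<epsilon> *\<^sub>R \<xi>))) \<zeta>
    = of_real (sqrt (2 * pi) ^ CARD('n) * gauss (\<zeta> /\<^sub>R \<epsilon>) / \<epsilon> ^ CARD('n))"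
proof -
  have "of_real (sqrt (2 * pi) ^ CARD('n) * gauss (\<zeta> /\<^sub>R \<epsilon>))
      = (LINT x|lborel. exp (- (\<i> * of_real (x \<bullet> (\<zeta> /\<^sub>R \<epsilon>)))) * complex_of_real (gauss x))"
    using fourier_gauss(1)[of "\<zeta> /\<^sub>R \<epsilon>"] by (simp add: fourier_integral_def)
  also have "\<dots> = (\<bar>\<epsilon>\<bar> ^ CARD('n)) *\<^sub>R
      (LINT x|lborel. exp (- (\<i> * of_real ((\<epsilon> *\<^sub>R x) \<bullet> (\<zeta> /\<^sub>R \<epsilon>)))) * complex_of_real (gauss (\<epsilon> *\<^sub>R x)))"
    by (subst integral_lborel_scale[of _ \<epsilon>]) (use assms in auto)
  also have "\<dots> = of_real (\<epsilon> ^ CARD('n)) * fourier_integral (\<lambda>\<xi>. of_real (gauss (\<epsilon> *\<^sub>R \<xi>))) \<zeta>"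
  proof -
    have "(\<epsilon> *\<^sub>R x) \<bullet> (\<zeta> /\<^sub>R \<epsilon>) = x \<bullet> \<zeta>" for x using assms by simp
    then show ?thesis by (simp only: fourier_integral_def scaleR_conv_of_real[where 'a=complex]) (use assms in simp)
  qed
  finally show ?thesis using assms by (simp add: field_simps)
qed

text \<open>The transform of an L^1 function is merely bounded, so |F|^2 is first made integrable by
  a wide Gaussian. The multiplication formula moves the transform to the other factor, where it
  turns the conjugate of F times the Gaussian into the convolution of the conjugate of f with a
  narrow Gaussian.\<close>

lemma plancherel_gauss:
  fixes f :: "'n::finite field"
  assumes f: "f \<in> L1" and e: "\<epsilon> > 0"
  shows "(LINT \<xi>|lborel. fourier_integral f \<xi> * (cnj (fourier_integral f \<xi>) * of_real (gauss (\<epsilon> *\<^sub>R \<xi>))))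
    = of_real (sqrt (2 * pi) ^ CARD('n)) * (LINT x|lborel. f x * (LINT z|lborel. cnj (f (x - \<epsilon> *\<^sub>R z)) * of_real (gauss z)))"
proof -
  let ?F = "fourier_integral f" and ?C = "complex_of_real (sqrt (2 * pi) ^ CARD('n))"
  note [measurable] = L1_measurable[OF f] fourier_integral_measurable[OF f]
  have g: "integrable lborel (\<lambda>\<xi>::real ^ 'n. complex_of_real (gauss (\<epsilon> *\<^sub>R \<xi>)))"
    using integrable_gauss_scale[OF e, where 'n='n] by (simp add: complex_of_real_integrable_eq)
  define b where "b \<xi> = cnj (?F \<xi>) * of_real (gauss (\<epsilon> *\<^sub>R \<xi>))" for \<xi>
  have b: "b \<in> L1" unfolding L1_def mem_Collect_eq b_def
  proof (rule Bochner_Integration.integrable_bound[of _ "\<lambda>\<xi>. L1norm f * gauss (\<epsilon> *\<^sub>R \<xi>)"])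
    show "integrable lborel (\<lambda>\<xi>::real ^ 'n. L1norm f * gauss (\<epsilon> *\<^sub>R \<xi>))"
      using integrable_gauss_scale[OF e, where 'n='n] by simp
    show "AE \<xi> in lborel. norm (cnj (?F \<xi>) * of_real (gauss (\<epsilon> *\<^sub>R \<xi>))) \<le> norm (L1norm f * gauss (\<epsilon> *\<^sub>R \<xi>))"
      by (intro AE_I2) (auto simp: norm_mult abs_mult intro!: mult_right_mono fourier_integral_bound)
  qed measurable
  have cF: "cnj (?F \<xi>) = (LINT y|lborel. exp (\<i> * of_real (y \<bullet> \<xi>)) * cnj (f y))" for \<xi>
  proof -
    have "cnj (exp (- (\<i> * of_real (y \<bullet> \<xi>)))) = exp (\<i> * of_real (y \<bullet> \<xi>))" for y
      by (simp add: exp_cnj)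
    then show ?thesis unfolding fourier_integral_def by (simp flip: Bochner_Integration.integral_cnj)
  qed
  have fb: "fourier_integral b x = ?C * (LINT z|lborel. cnj (f (x - \<epsilon> *\<^sub>R z)) * of_real (gauss z))" for x
  proof -
    have "fourier_integral b x
        = (LINT \<xi>|lborel. (exp (- (\<i> * of_real (\<xi> \<bullet> x))) * of_real (gauss (\<epsilon> *\<^sub>R \<xi>)))
            * (LINT y|lborel. exp (\<i> * of_real (y \<bullet> \<xi>)) * cnj (f y)))"
      unfolding fourier_integral_def[of b] b_def cF by (simp add: mult_ac)
    also have "\<dots> = (LINT y|lborel. cnj (f y) * (LINT \<xi>|lborel. exp (\<i> * of_real (y \<bullet> \<xi>))
        * (exp (- (\<i> * of_real (\<xi> \<bullet> x))) * of_real (gauss (\<epsilon> *\<^sub>R \<xi>)))))"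
    proof (rule fubini_kernel[where B=1])
      show "integrable lborel (\<lambda>\<xi>. exp (- (\<i> * of_real (\<xi> \<bullet> x))) * complex_of_real (gauss (\<epsilon> *\<^sub>R \<xi>)))"
        by (rule fourier_kernel_integrable) (use g in \<open>simp add: L1_def\<close>)
      show "integrable lborel (\<lambda>y. cnj (f y))" using f by (simp add: L1_def)
    qed auto
    also have "\<dots> = (LINT y|lborel. cnj (f y) * fourier_integral (\<lambda>\<xi>. of_real (gauss (\<epsilon> *\<^sub>R \<xi>))) (x - y))"
      unfolding fourier_integral_def
      by (simp add: inner_diff_right inner_commute right_diff_distrib exp_diff exp_minus field_simps)
    also have "\<dots> = (LINT y|lborel. cnj (f y) * of_real (sqrt (2 * pi) ^ CARD('n) * gauss ((x - y) /\<^sub>R \<epsilon>) / \<epsilon> ^ CARD('n)))"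
      by (simp only: fourier_gauss_scale[OF e])
    also have "\<dots> = (LINT y|lborel. cnj (f (x + y)) * of_real (sqrt (2 * pi) ^ CARD('n) * gauss ((x - (x + y)) /\<^sub>R \<epsilon>) / \<epsilon> ^ CARD('n)))"
      by (subst integral_lborel_translate[of _ x]) auto
    \<comment> \<open>The substitution y = - \<epsilon> z yields the Jacobian \<epsilon>^n, which
      cancels the amplitude of the narrow Gaussian.\<close>
    also have "\<dots> = (\<bar>- \<epsilon>\<bar> ^ CARD('n)) *\<^sub>R (LINT z|lborel. cnj (f (x + (- \<epsilon>) *\<^sub>R z)) *
        of_real (sqrt (2 * pi) ^ CARD('n) * gauss ((x - (x + (- \<epsilon>) *\<^sub>R z)) /\<^sub>R \<epsilon>) / \<epsilon> ^ CARD('n)))"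
      by (subst integral_lborel_scale[of _ "- \<epsilon>"]) (use e in auto)
    also have "\<dots> = (LINT z|lborel. (\<bar>- \<epsilon>\<bar> ^ CARD('n)) *\<^sub>R (cnj (f (x + (- \<epsilon>) *\<^sub>R z)) *
        of_real (sqrt (2 * pi) ^ CARD('n) * gauss ((x - (x + (- \<epsilon>) *\<^sub>R z)) /\<^sub>R \<epsilon>) / \<epsilon> ^ CARD('n))))"
      by simp
    also have "\<dots> = (LINT z|lborel. ?C * (cnj (f (x - \<epsilon> *\<^sub>R z)) * of_real (gauss z)))"
      by (rule Bochner_Integration.integral_cong)
        (use e in \<open>auto simp: scaleR_conv_of_real[where 'a=complex] field_simps\<close>)
    finally show ?thesis by simp
  qed
  have "(LINT \<xi>|lborel. ?F \<xi> * b \<xi>) = (LINT x|lborel. f x * fourier_integral b x)"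
    by (rule fourier_integral_multiplication[OF f b])
  also have "\<dots> = (LINT x|lborel. ?C * (f x * (LINT z|lborel. cnj (f (x - \<epsilon> *\<^sub>R z)) * of_real (gauss z))))"
    by (simp add: fb mult_ac)
  finally show ?thesis by (simp add: b_def)
qed

lemma gauss_integral:
  "(LINT z|(lborel :: (real ^ 'n::finite) measure). complex_of_real (gauss z)) = of_real (sqrt (2 * pi) ^ CARD('n))"
  using fourier_gauss(1)[where 'n='n and \<xi>=0] by (simp add: fourier_integral_def gauss_def)

text \<open>On the right of the regularised identity stands a Gaussian average of the
  autocorrelation \<open>A\<close>, which is bounded and, by continuity of translations, continuous
  at 0; it tends to \<open>A 0\<close>, the squared norm of f, times the Gaussian mass. On the left
  the Gaussians increase to 1, so monotone convergence gives square integrability and the value at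
  once.\<close>

lemma plancherel_L1_L2:
  fixes f :: "'n::finite field"
  assumes f1: "f \<in> L1" and f2: "f \<in> L2"
  shows "fourier_integral f \<in> L2" "L2norm (fourier_integral f) = sqrt (2 * pi) ^ CARD('n) * L2norm f"
proof -
  let ?F = "fourier_integral f" and ?c = "sqrt (2 * pi) ^ CARD('n)"
  note [measurable] = L1_measurable[OF f1] fourier_integral_measurable[OF f1]
  note gi = fourier_gauss(2)[where 'n='n]
  define A where "A w = (LINT x|lborel. f x * cnj (f (x - w)))" for w
  have tr: "(\<lambda>x. cnj (f (x - w))) \<in> L2" "L2norm (\<lambda>x. cnj (f (x - w))) = L2norm f" for w
    using L2_cnj[OF L2_translate(1)[OF f2]] L2_translate(2)[OF f2, of w] by auto
  have Ab: "norm (A w) \<le> (L2norm f)\<^sup>2" for w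
    unfolding A_def using L2_mult_integrable(4)[OF f2 tr(1)[of w]] tr(2)[of w] by (simp add: power2_eq_square)
  have Am [measurable]: "A \<in> borel_measurable borel" unfolding A_def by measurable
  have A0: "A 0 = of_real ((L2norm f)\<^sup>2)"
    unfolding A_def L2norm_sq by (simp only: integral_complex_of_real[symmetric] complex_norm_square diff_zero)
  have Alim: "(A \<longlongrightarrow> A 0) (nhds 0)"
  proof (rule Lim_null[THEN iffD2], rule Lim_null_comparison)
    show "\<forall>\<^sub>F w in nhds 0. norm (A w - A 0) \<le> L2norm f * L2norm (\<lambda>x. f (x - w) - f x)"
    proof (intro always_eventually allI)
      fix w
      have d: "(\<lambda>x. cnj (f (x - w) - f x)) \<in> L2" by (intro L2_cnj L2_diff L2_translate f2)
      have "A w - A 0 = (LINT x|lborel. f x * cnj (f (x - w) - f x))"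
        unfolding A_def using L2_mult_integrable(1)[OF f2 tr(1)[of w]] L2_mult_integrable(1)[OF f2 tr(1)[of 0]]
        by (simp add: right_diff_distrib)
      then show "norm (A w - A 0) \<le> L2norm f * L2norm (\<lambda>x. f (x - w) - f x)"
        using L2_mult_integrable(4)[OF f2 d] by (simp only: L2norm_cnj)
    qed
    show "((\<lambda>w. L2norm f * L2norm (\<lambda>x. f (x - w) - f x)) \<longlongrightarrow> 0) (nhds 0)"
      using tendsto_mult_left[OF L2_translation_continuous[OF f2], of "L2norm f"] by simp
  qed
  have I: "(LINT x|lborel. f x * (LINT z|lborel. cnj (f (x - \<epsilon> *\<^sub>R z)) * of_real (gauss z)))
      = (LINT z|lborel. of_real (gauss z) * A (\<epsilon> *\<^sub>R z))" for \<epsilon>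
  proof -
    let ?H = "\<lambda>z x. of_real (gauss z) * (f x * cnj (f (x - \<epsilon> *\<^sub>R z)))"
    have int: "integrable (lborel \<Otimes>\<^sub>M lborel) (\<lambda>(z, x). ?H z x)"
    proof (rule lborel_pair.Fubini_integrable)
      show "(\<lambda>(z, x). ?H z x) \<in> borel_measurable (lborel \<Otimes>\<^sub>M lborel)" by measurable
      show "AE z in lborel. integrable lborel (\<lambda>x. case (z, x) of (z, x) \<Rightarrow> ?H z x)"
        using L2_mult_integrable(1)[OF f2 tr(1)] by simp
      show "integrable lborel (\<lambda>z. LINT x|lborel. norm (case (z, x) of (z, x) \<Rightarrow> ?H z x))"
      proof (rule Bochner_Integration.integrable_bound[of _ "\<lambda>z. gauss z * (L2norm f)\<^sup>2"])
        show "AE z in lborel. norm (LINT x|lborel. norm (case (z, x) of (z, x) \<Rightarrow> ?H z x)) \<le> norm (gauss z * (L2norm f)\<^sup>2)"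
        proof (rule AE_I2)
          fix z :: "real ^ 'n"
          have "(LINT x|lborel. norm (f x) * norm (cnj (f (x - \<epsilon> *\<^sub>R z)))) \<le> (L2norm f)\<^sup>2"
            using L2_mult_integrable(3)[OF f2 tr(1)[of "\<epsilon> *\<^sub>R z"]] tr(2)[of "\<epsilon> *\<^sub>R z"] by (simp add: power2_eq_square)
          then have "gauss z * (LINT x|lborel. norm (f x) * norm (f (x - \<epsilon> *\<^sub>R z))) \<le> gauss z * (L2norm f)\<^sup>2"
            by (intro mult_left_mono) auto
          then show "norm (LINT x|lborel. norm (case (z, x) of (z, x) \<Rightarrow> ?H z x)) \<le> norm (gauss z * (L2norm f)\<^sup>2)"
            by (simp add: norm_mult integral_nonneg_AE)
        qed
        show "integrable lborel (\<lambda>z::real ^ 'n. gauss z * (L2norm f)\<^sup>2)" using gi by simp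
      qed measurable
    qed
    have "(LINT z|lborel. of_real (gauss z) * A (\<epsilon> *\<^sub>R z)) = (LINT z|lborel. LINT x|lborel. ?H z x)"
      unfolding A_def by simp
    also have "\<dots> = (LINT x|lborel. LINT z|lborel. ?H z x)"
      using lborel_pair.Fubini_integral[OF int] by simp
    also have "\<dots> = (LINT x|lborel. LINT z|lborel. f x * (cnj (f (x - \<epsilon> *\<^sub>R z)) * of_real (gauss z)))"
      by (simp add: mult_ac)
    finally show ?thesis by simp
  qed
  define \<epsilon> where "\<epsilon> m = 1 / (real m + 1)" for m
  have e0: "\<epsilon> m > 0" for m by (simp add: \<epsilon>_def)
  have elim: "\<epsilon> \<longlonglongrightarrow> 0" unfolding \<epsilon>_def by real_asymp
  have lim: "(\<lambda>m. LINT z|lborel. of_real (gauss z) * A (\<epsilon> m *\<^sub>R z)) \<longlonglongrightarrow> (LINT z|(lborel :: (real ^ 'n) measure). of_real (gauss z) * A 0)"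
  proof (rule integral_dominated_convergence[where w="\<lambda>z. gauss z * (L2norm f)\<^sup>2"])
    show "AE z in lborel. (\<lambda>m. of_real (gauss z) * A (\<epsilon> m *\<^sub>R z)) \<longlonglongrightarrow> of_real (gauss z) * A 0"
    proof (rule AE_I2)
      fix z :: "real ^ 'n"
      have "(\<lambda>m. \<epsilon> m *\<^sub>R z) \<longlonglongrightarrow> 0" using tendsto_scaleR[OF elim tendsto_const, of z] by simp
      then show "(\<lambda>m. of_real (gauss z) * A (\<epsilon> m *\<^sub>R z)) \<longlonglongrightarrow> of_real (gauss z) * A 0"
        by (intro tendsto_intros filterlim_compose[OF Alim])
    qed
    show "AE z in lborel. norm (of_real (gauss z) * A (\<epsilon> m *\<^sub>R z)) \<le> gauss z * (L2norm f)\<^sup>2" for m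
      using Ab by (auto simp: norm_mult mult_left_mono)
  qed (use gi in auto)
  have lim0: "(LINT z|lborel. of_real (gauss (z :: real ^ 'n)) * A 0) = of_real (?c * (L2norm f)\<^sup>2)"
    using gauss_integral[where 'n='n] A0 by simp
  define P where "P m = (LINT \<xi>|lborel. (norm (?F \<xi>))\<^sup>2 * gauss (\<epsilon> m *\<^sub>R \<xi>))" for m
  have "of_real (P m) = of_real ?c * (LINT z|lborel. of_real (gauss z) * A (\<epsilon> m *\<^sub>R z))" for m
  proof -
    have "of_real (P m) = (LINT \<xi>|lborel. ?F \<xi> * (cnj (?F \<xi>) * of_real (gauss (\<epsilon> m *\<^sub>R \<xi>))))"
      unfolding P_def by (simp only: integral_complex_of_real[symmetric] of_real_mult complex_norm_square mult.assoc)
    then show ?thesis using plancherel_gauss[OF f1 e0[of m]] I by simp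
  qed
  then have "(\<lambda>m. complex_of_real (P m)) \<longlonglongrightarrow> of_real ?c * of_real (?c * (L2norm f)\<^sup>2)"
    using tendsto_mult_left[OF lim, of "of_real ?c"] lim0 by simp
  then have "(\<lambda>m. complex_of_real (P m)) \<longlonglongrightarrow> of_real ((?c * L2norm f)\<^sup>2)"
    by (simp add: power2_eq_square mult_ac)
  then have Plim: "P \<longlonglongrightarrow> (?c * L2norm f)\<^sup>2" by (simp only: tendsto_of_real_iff)
  have Pint: "integrable lborel (\<lambda>\<xi>. (norm (?F \<xi>))\<^sup>2 * gauss (\<epsilon> m *\<^sub>R \<xi>))" for m
  proof (rule Bochner_Integration.integrable_bound[of _ "\<lambda>\<xi>. (L1norm f)\<^sup>2 * gauss (\<epsilon> m *\<^sub>R \<xi>)"])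
    show "integrable lborel (\<lambda>\<xi>::real ^ 'n. (L1norm f)\<^sup>2 * gauss (\<epsilon> m *\<^sub>R \<xi>))"
      using integrable_gauss_scale[OF e0, where 'n='n] by simp
    show "AE \<xi> in lborel. norm ((norm (?F \<xi>))\<^sup>2 * gauss (\<epsilon> m *\<^sub>R \<xi>)) \<le> norm ((L1norm f)\<^sup>2 * gauss (\<epsilon> m *\<^sub>R \<xi>))"
      by (intro AE_I2) (auto simp: abs_mult intro!: mult_right_mono power_mono fourier_integral_bound)
  qed measurable
  have "(\<lambda>m. \<integral>\<^sup>+\<xi>. ennreal ((norm (?F \<xi>))\<^sup>2 * gauss (\<epsilon> m *\<^sub>R \<xi>)) \<partial>lborel) \<longlonglongrightarrow> (\<integral>\<^sup>+\<xi>. ennreal ((norm (?F \<xi>))\<^sup>2) \<partial>lborel)"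
  proof (rule nn_integral_LIMSEQ)
    show "incseq (\<lambda>m \<xi>. ennreal ((norm (?F \<xi>))\<^sup>2 * gauss (\<epsilon> m *\<^sub>R \<xi>)))"
    proof (intro incseq_SucI le_funI ennreal_leI mult_left_mono)
      fix m and \<xi> :: "real ^ 'n"
      have "\<epsilon> (Suc m) \<le> \<epsilon> m" by (simp add: \<epsilon>_def field_simps)
      then have "norm (\<epsilon> (Suc m) *\<^sub>R \<xi>) \<le> norm (\<epsilon> m *\<^sub>R \<xi>)"
        using e0[of m] e0[of "Suc m"] by (simp add: mult_right_mono)
      then show "gauss (\<epsilon> m *\<^sub>R \<xi>) \<le> gauss (\<epsilon> (Suc m) *\<^sub>R \<xi>)"
        unfolding gauss_def using power_mono[of "norm (\<epsilon> (Suc m) *\<^sub>R \<xi>)" "norm (\<epsilon> m *\<^sub>R \<xi>)" 2] by simp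
    qed simp
    fix \<xi> :: "real ^ 'n"
    have "(\<lambda>m. gauss (\<epsilon> m *\<^sub>R \<xi>)) \<longlonglongrightarrow> exp (- (norm (0 *\<^sub>R \<xi>))\<^sup>2 / 2)"
      unfolding gauss_def by (intro tendsto_intros elim) simp
    then have "(\<lambda>m. ennreal ((norm (?F \<xi>))\<^sup>2 * gauss (\<epsilon> m *\<^sub>R \<xi>))) \<longlonglongrightarrow> ennreal ((norm (?F \<xi>))\<^sup>2 * 1)"
      by (intro tendsto_intros) simp
    then show "(\<lambda>m. ennreal ((norm (?F \<xi>))\<^sup>2 * gauss (\<epsilon> m *\<^sub>R \<xi>))) \<longlonglongrightarrow> ennreal ((norm (?F \<xi>))\<^sup>2)" by simp
  qed measurable
  moreover have "(\<integral>\<^sup>+\<xi>. ennreal ((norm (?F \<xi>))\<^sup>2 * gauss (\<epsilon> m *\<^sub>R \<xi>)) \<partial>lborel) = ennreal (P m)" for m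
    unfolding P_def by (rule nn_integral_eq_integral[OF Pint]) simp
  ultimately have "(\<lambda>m. ennreal (P m)) \<longlonglongrightarrow> (\<integral>\<^sup>+\<xi>. ennreal ((norm (?F \<xi>))\<^sup>2) \<partial>lborel)" by simp
  moreover have "(\<lambda>m. ennreal (P m)) \<longlonglongrightarrow> ennreal ((?c * L2norm f)\<^sup>2)" by (intro tendsto_intros Plim)
  ultimately have eq: "(\<integral>\<^sup>+\<xi>. ennreal ((norm (?F \<xi>))\<^sup>2) \<partial>lborel) = ennreal ((?c * L2norm f)\<^sup>2)"
    by (rule LIMSEQ_unique)
  then show L: "?F \<in> L2" by (intro L2_nn_integralI(1)[where C="?c * L2norm f"]) auto
  have "(L2norm ?F)\<^sup>2 = (?c * L2norm f)\<^sup>2" using eq nn_integral_L2[OF L] by simp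
  then show "L2norm ?F = ?c * L2norm f" by (subst (asm) power2_eq_iff_nonneg) auto
qed

section \<open>The Fourier transform on $L^2$\<close>

text \<open>(2 pi)^(n/2), by which the transform without normalising factor multiplies the L^2 norm;
  its square is the constant of the inversion formula.\<close>

abbreviation fconst :: "'n::finite itself \<Rightarrow> real" where
  "fconst _ \<equiv> sqrt (2 * pi) ^ CARD('n)"

definition trunc :: "real \<Rightarrow> ('n::finite) field \<Rightarrow> 'n field" where
  "trunc R f x = (if norm x < R then f x else 0)"

lemma trunc_L2: "f \<in> L2 \<Longrightarrow> trunc R f \<in> L2"
  by (rule L2_bound[of f _ 1]) (auto dest: L2_measurable simp: trunc_def[abs_def])

lemma indicator_ball_L2: "(\<lambda>x. of_real (indicator (ball 0 R) x)) \<in> L2"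
  for R :: real
proof (rule L2I)
  have "integrable lborel (indicator (ball (0 :: real ^ 'n) R) :: _ \<Rightarrow> real)"
    using emeasure_lborel_ball_finite[of "0 :: real ^ 'n" R] by (simp add: integrable_real_indicator)
  also have "(indicator (ball 0 R) :: real ^ 'n \<Rightarrow> real) = (\<lambda>x. (norm (complex_of_real (indicator (ball 0 R) x)))\<^sup>2)"
    by (auto split: split_indicator)
  finally show "integrable lborel (\<lambda>x::real ^ 'n. (norm (complex_of_real (indicator (ball 0 R) x)))\<^sup>2)" .
  have [measurable]: "ball (0 :: real ^ 'n) R \<in> sets borel" by simp
  show "(\<lambda>x::real ^ 'n. complex_of_real (indicator (ball 0 R) x)) \<in> borel_measurable borel" by measurable
qed

lemma trunc_L1:
  assumes "f \<in> L2" shows "trunc R f \<in> L1"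
proof -
  have "(\<lambda>x. f x * of_real (indicator (ball 0 R) x)) = trunc R f"
    by (auto simp: trunc_def split: split_indicator)
  then show ?thesis
    using L2_mult_integrable(1)[OF assms indicator_ball_L2[of R]] by (simp add: L1_def)
qed

lemma trunc_tendsto:
  fixes f :: "'n::finite field"
  assumes "f \<in> L2" shows "((\<lambda>R. L2norm (\<lambda>x. trunc R f x - f x)) \<longlongrightarrow> 0) at_top"
proof -
  note [measurable] = L2_measurable[OF assms] trunc_L2[OF assms, THEN L2_measurable]
  have "((\<lambda>R. LINT x|lborel. (norm (trunc R f x - f x))\<^sup>2) \<longlongrightarrow> (LINT x|(lborel :: (real ^ 'n) measure). (0::real))) at_top"
  proof (rule integral_dominated_convergence_at_top[where w="\<lambda>x. (norm (f x))\<^sup>2"])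
    show "AE x in lborel. ((\<lambda>R. (norm (trunc R f x - f x))\<^sup>2) \<longlongrightarrow> 0) at_top"
    proof (rule AE_I2, rule tendsto_eventually)
      fix x
      show "\<forall>\<^sub>F R in at_top. (norm (trunc R f x - f x))\<^sup>2 = 0"
        by (intro eventually_mono[OF eventually_gt_at_top[of "norm x"]]) (simp add: trunc_def)
    qed
  qed (use L2_integrable[OF assms] in \<open>auto simp: trunc_def\<close>)
  then have "((\<lambda>R. sqrt (LINT x|lborel. (norm (trunc R f x - f x))\<^sup>2)) \<longlongrightarrow> sqrt 0) at_top"
    by (intro tendsto_intros) simp
  then show ?thesis by (simp add: L2norm_def)
qed

lemma fi_trunc_L2: "f \<in> L2 \<Longrightarrow> fourier_integral (trunc R f) \<in> L2"
  by (intro plancherel_L1_L2 trunc_L1 trunc_L2)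

lemma has_fourier_iff:
  "has_fourier f g \<longleftrightarrow> f \<in> L2 \<and> g \<in> L2 \<and>
     ((\<lambda>R. L2norm (\<lambda>x. fourier_integral (trunc R f) x - g x)) \<longlongrightarrow> 0) at_top"
proof -
  have "(\<lambda>x. if norm x < R then f x else 0) = trunc R f" for R by (simp add: trunc_def[abs_def])
  then show ?thesis using fi_trunc_L2[of f] by (auto simp: has_fourier_def tendsto_L2_def)
qed

lemma has_fourier_L2: assumes "has_fourier f g" shows "f \<in> L2" "g \<in> L2"
  using assms by (auto simp: has_fourier_iff)

lemma fi_trunc_norm_diff:
  fixes f g :: "'n::finite field"
  assumes "f \<in> L2" "g \<in> L2"
  shows "L2norm (\<lambda>x. fourier_integral (trunc R f) x - fourier_integral (trunc S g) x)
    = fconst TYPE('n) * L2norm (\<lambda>x. trunc R f x - trunc S g x)"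
proof -
  have "fourier_integral (\<lambda>x. trunc R f x - trunc S g x) = (\<lambda>x. fourier_integral (trunc R f) x - fourier_integral (trunc S g) x)"
    using assms by (intro ext fourier_integral_diff trunc_L1)
  moreover have "L2norm (fourier_integral (\<lambda>x. trunc R f x - trunc S g x))
      = fconst TYPE('n) * L2norm (\<lambda>x. trunc R f x - trunc S g x)"
    using trunc_L1[OF assms(1), of R] trunc_L1[OF assms(2), of S]
    by (intro plancherel_L1_L2 L2_diff trunc_L2 assms) (auto simp: L1_def)
  ultimately show ?thesis by simp
qed

lemma L2norm_limit:
  assumes "((\<lambda>s. L2norm (\<lambda>x. h s x - g x)) \<longlongrightarrow> 0) F" "\<And>s. h s \<in> L2" "g \<in> L2"
  shows "((\<lambda>s. L2norm (h s)) \<longlongrightarrow> L2norm g) F"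
proof (rule Lim_null[THEN iffD2], rule Lim_null_comparison[OF _ assms(1)])
  show "\<forall>\<^sub>F s in F. norm (L2norm (h s) - L2norm g) \<le> L2norm (\<lambda>x. h s x - g x)"
    using L2norm_diff_abs[OF assms(2,3)] by simp
qed

lemma L2_pairing_limit:
  assumes "((\<lambda>s. L2norm (\<lambda>x. h s x - h0 x)) \<longlongrightarrow> 0) F" "((\<lambda>s. L2norm (\<lambda>x. l s x - l0 x)) \<longlongrightarrow> 0) F"
    and h: "\<And>s. h s \<in> L2" and h0: "h0 \<in> L2" and l: "\<And>s. l s \<in> L2" and l0: "l0 \<in> L2"
  shows "((\<lambda>s. LINT x|lborel. h s x * l s x) \<longlongrightarrow> (LINT x|lborel. h0 x * l0 x)) F"
proof (rule Lim_null[THEN iffD2], rule Lim_null_comparison)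
  show "((\<lambda>s. L2norm (\<lambda>x. h s x - h0 x) * L2norm (l s) + L2norm h0 * L2norm (\<lambda>x. l s x - l0 x)) \<longlongrightarrow> 0) F"
    using tendsto_add[OF tendsto_mult[OF assms(1) L2norm_limit[OF assms(2) l l0]] tendsto_mult_left[OF assms(2), of "L2norm h0"]]
    by simp
  show "\<forall>\<^sub>F s in F. norm ((LINT x|lborel. h s x * l s x) - (LINT x|lborel. h0 x * l0 x))
      \<le> L2norm (\<lambda>x. h s x - h0 x) * L2norm (l s) + L2norm h0 * L2norm (\<lambda>x. l s x - l0 x)"
  proof (intro always_eventually allI)
    fix s
    note i = L2_mult_integrable(1)
    have "(LINT x|lborel. (h s x - h0 x) * l s x) + (LINT x|lborel. h0 x * (l s x - l0 x))
        = (LINT x|lborel. (h s x - h0 x) * l s x + h0 x * (l s x - l0 x))"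
      by (rule Bochner_Integration.integral_add[symmetric]) (intro i L2_diff h h0 l l0)+
    also have "\<dots> = (LINT x|lborel. h s x * l s x - h0 x * l0 x)" by (simp add: algebra_simps)
    also have "\<dots> = (LINT x|lborel. h s x * l s x) - (LINT x|lborel. h0 x * l0 x)"
      by (rule Bochner_Integration.integral_diff) (intro i h h0 l l0)+
    finally have eq: "(LINT x|lborel. h s x * l s x) - (LINT x|lborel. h0 x * l0 x)
        = (LINT x|lborel. (h s x - h0 x) * l s x) + (LINT x|lborel. h0 x * (l s x - l0 x))" by simp
    show "norm ((LINT x|lborel. h s x * l s x) - (LINT x|lborel. h0 x * l0 x))
      \<le> L2norm (\<lambda>x. h s x - h0 x) * L2norm (l s) + L2norm h0 * L2norm (\<lambda>x. l s x - l0 x)"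
      unfolding eq
      by (intro order_trans[OF norm_triangle_ineq] add_mono L2_mult_integrable(4) L2_diff h h0 l l0)
  qed
qed

lemma has_fourier_exists:
  fixes f :: "'n::finite field"
  assumes f: "f \<in> L2" shows "\<exists>g. has_fourier f g"
proof -
  let ?c = "fconst TYPE('n)"
  have c: "?c > 0" by simp
  have T: "((\<lambda>R. L2norm (\<lambda>x. trunc R f x - f x)) \<longlongrightarrow> 0) at_top" by (rule trunc_tendsto[OF f])
  have d: "L2norm (\<lambda>x. fourier_integral (trunc R f) x - fourier_integral (trunc S f) x)
      \<le> ?c * L2norm (\<lambda>x. trunc R f x - f x) + ?c * L2norm (\<lambda>x. trunc S f x - f x)" for R S
  proof -
    have "L2norm (\<lambda>x. trunc R f x - trunc S f x) \<le> L2norm (\<lambda>x. trunc R f x - f x) + L2norm (\<lambda>x. f x - trunc S f x)"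
      by (intro L2norm_triangle3 trunc_L2 f)
    then show ?thesis unfolding fi_trunc_norm_diff[OF f f]
      by (simp add: L2norm_minus_commute[of f] flip: distrib_left)
  qed
  have Cau: "\<exists>N. \<forall>m\<ge>N. \<forall>n\<ge>N. L2norm (\<lambda>x. fourier_integral (trunc (real m) f) x - fourier_integral (trunc (real n) f) x) < e"
    if e: "e > 0" for e
  proof -
    have "\<forall>\<^sub>F R in at_top. L2norm (\<lambda>x. trunc R f x - f x) < e / (2 * ?c)"
      using order_tendstoD(2)[OF T, of "e / (2 * ?c)"] e c by simp
    then obtain N where N: "\<And>R. R \<ge> N \<Longrightarrow> L2norm (\<lambda>x. trunc R f x - f x) < e / (2 * ?c)"
      by (auto simp: eventually_at_top_linorder)
    obtain M where M: "N \<le> real M" using real_arch_simple by blast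
    show ?thesis
    proof (intro exI[of _ M] allI impI)
      fix m n assume mn: "m \<ge> M" "n \<ge> M"
      have "?c * L2norm (\<lambda>x. trunc (real m) f x - f x) < e / 2" "?c * L2norm (\<lambda>x. trunc (real n) f x - f x) < e / 2"
        using N[of "real m"] N[of "real n"] M mn c by (auto simp: field_simps)
      then show "L2norm (\<lambda>x. fourier_integral (trunc (real m) f) x - fourier_integral (trunc (real n) f) x) < e"
        using d[of "real m" "real n"] by linarith
    qed
  qed
  obtain g where g: "g \<in> L2" and lim: "(\<lambda>k. L2norm (\<lambda>x. fourier_integral (trunc (real k) f) x - g x)) \<longlonglongrightarrow> 0"
    using L2_complete[of "\<lambda>k. fourier_integral (trunc (real k) f)", OF fi_trunc_L2[OF f] Cau] by blast
  \<comment> \<open>Completeness provides a limit along integer radii only, while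
    \<open>has_fourier\<close> asks for all real radii; the Cauchy estimate \<open>d\<close>
    compares a real radius with one late integer radius.\<close>
  have "((\<lambda>R. L2norm (\<lambda>x. fourier_integral (trunc R f) x - g x)) \<longlongrightarrow> 0) at_top"
  proof (rule tendstoI)
    fix e :: real assume e: "e > 0"
    have ev: "\<forall>\<^sub>F R in at_top. L2norm (\<lambda>x. trunc R f x - f x) < e / (3 * ?c)"
      using order_tendstoD(2)[OF T, of "e / (3 * ?c)"] e c by simp
    then have "\<forall>\<^sub>F k in sequentially. L2norm (\<lambda>x. trunc (real k) f x - f x) < e / (3 * ?c)"
      by (rule eventually_compose_filterlim[OF _ filterlim_real_sequentially])
    moreover have "\<forall>\<^sub>F k in sequentially. L2norm (\<lambda>x. fourier_integral (trunc (real k) f) x - g x) < e / 3"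
      using order_tendstoD(2)[OF lim, of "e / 3"] e by simp
    ultimately have "\<forall>\<^sub>F k in sequentially. L2norm (\<lambda>x. trunc (real k) f x - f x) < e / (3 * ?c)
        \<and> L2norm (\<lambda>x. fourier_integral (trunc (real k) f) x - g x) < e / 3" by (rule eventually_conj)
    then obtain k where k: "L2norm (\<lambda>x. trunc (real k) f x - f x) < e / (3 * ?c)"
        "L2norm (\<lambda>x. fourier_integral (trunc (real k) f) x - g x) < e / 3"
      using eventually_happens'[OF sequentially_bot] by blast
    from ev show "\<forall>\<^sub>F R in at_top. dist (L2norm (\<lambda>x. fourier_integral (trunc R f) x - g x)) 0 < e"
    proof eventually_elim
      case (elim R)
      have "L2norm (\<lambda>x. fourier_integral (trunc R f) x - g x)
          \<le> L2norm (\<lambda>x. fourier_integral (trunc R f) x - fourier_integral (trunc (real k) f) x)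
           + L2norm (\<lambda>x. fourier_integral (trunc (real k) f) x - g x)"
        by (intro L2norm_triangle3 fi_trunc_L2 f g)
      moreover have "?c * L2norm (\<lambda>x. trunc R f x - f x) < e / 3" "?c * L2norm (\<lambda>x. trunc (real k) f x - f x) < e / 3"
        using elim k(1) c by (auto simp: field_simps)
      ultimately show ?case using d[of R "real k"] k(2) by simp
    qed
  qed
  then show ?thesis using f g by (auto simp: has_fourier_iff)
qed

lemma has_fourier_norm:
  fixes f g :: "'n::finite field"
  assumes "has_fourier f g" shows "L2norm g = fconst TYPE('n) * L2norm f"
proof (rule tendsto_unique[OF trivial_limit_at_top_linorder])
  have f: "f \<in> L2" and g: "g \<in> L2" using has_fourier_L2[OF assms] by auto
  show "((\<lambda>R. L2norm (fourier_integral (trunc R f))) \<longlongrightarrow> L2norm g) at_top"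
    using assms by (intro L2norm_limit fi_trunc_L2 f g) (simp add: has_fourier_iff)
  have "((\<lambda>R. fconst TYPE('n) * L2norm (trunc R f)) \<longlongrightarrow> fconst TYPE('n) * L2norm f) at_top"
    by (intro tendsto_mult_left L2norm_limit trunc_tendsto trunc_L2 f)
  then show "((\<lambda>R. L2norm (fourier_integral (trunc R f))) \<longlongrightarrow> fconst TYPE('n) * L2norm f) at_top"
    using plancherel_L1_L2(2)[OF trunc_L1[OF f] trunc_L2[OF f]] by simp
qed

text \<open>Transforms and multipliers are defined by choice, so representatives are exchanged
  throughout by this rule.\<close>

lemma has_fourier_cong_AE:
  assumes h: "has_fourier f g" and ae: "AE x in lborel. f x = f' x" "AE x in lborel. g x = g' x"
    and [measurable]: "f' \<in> borel_measurable borel" "g' \<in> borel_measurable borel"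
  shows "has_fourier f' g'"
proof -
  have f: "f \<in> L2" and g: "g \<in> L2" using has_fourier_L2[OF h] by auto
  note [measurable] = L2_measurable[OF f] L2_measurable[OF g]
  have f': "f' \<in> L2" and g': "g' \<in> L2" using L2_cong_AE f g ae assms(4,5) by blast+
  have eq: "fourier_integral (trunc R f') = fourier_integral (trunc R f)" for R
    unfolding fourier_integral_def trunc_def
    by (intro ext integral_cong_AE) (use ae(1) in \<open>auto elim!: eventually_mono\<close>)
  have "L2norm (\<lambda>x. fourier_integral (trunc R f) x - g' x) = L2norm (\<lambda>x. fourier_integral (trunc R f) x - g x)" for R
    using fi_trunc_L2[OF f, of R, THEN L2_measurable]
    by (intro L2norm_cong_AE) (use ae(2) in \<open>auto elim!: eventually_mono\<close>)
  then show ?thesis using h f' g' by (simp add: has_fourier_iff eq)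
qed

lemma has_fourier_cmult:
  assumes "has_fourier f g" shows "has_fourier (\<lambda>x. c * f x) (\<lambda>x. c * g x)"
proof -
  have eq: "fourier_integral (trunc R (\<lambda>x. c * f x)) = (\<lambda>x. c * fourier_integral (trunc R f) x)" for R
  proof -
    have "trunc R (\<lambda>x. c * f x) = (\<lambda>x. c * trunc R f x)" by (auto simp: trunc_def)
    then show ?thesis by (auto simp: fourier_integral_cmult)
  qed
  have "((\<lambda>R. norm c * L2norm (\<lambda>x. fourier_integral (trunc R f) x - g x)) \<longlongrightarrow> norm c * 0) at_top"
    using assms by (intro tendsto_mult_left) (simp add: has_fourier_iff)
  then show ?thesis using has_fourier_L2[OF assms]
    by (simp add: has_fourier_iff eq L2_cmult L2norm_cmult flip: right_diff_distrib)
qed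

lemma has_fourier_add:
  assumes "has_fourier f g" "has_fourier f' g'"
  shows "has_fourier (\<lambda>x. f x + f' x) (\<lambda>x. g x + g' x)"
proof -
  note L = has_fourier_L2[OF assms(1)] has_fourier_L2[OF assms(2)]
  have eq: "fourier_integral (trunc R (\<lambda>x. f x + f' x)) = (\<lambda>x. fourier_integral (trunc R f) x + fourier_integral (trunc R f') x)" for R
  proof -
    have "trunc R (\<lambda>x. f x + f' x) = (\<lambda>x. trunc R f x + trunc R f' x)" by (auto simp: trunc_def)
    then show ?thesis using L by (auto simp: fourier_integral_add trunc_L1)
  qed
  have "((\<lambda>R. L2norm (\<lambda>x. fourier_integral (trunc R f) x + fourier_integral (trunc R f') x - (g x + g' x))) \<longlongrightarrow> 0) at_top"
  proof (rule tendsto_sandwich[OF _ _ tendsto_const])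
    show "((\<lambda>R. L2norm (\<lambda>x. fourier_integral (trunc R f) x - g x) + L2norm (\<lambda>x. fourier_integral (trunc R f') x - g' x)) \<longlongrightarrow> 0) at_top"
      using assms by (intro tendsto_add_zero) (auto simp: has_fourier_iff)
    show "\<forall>\<^sub>F R in at_top. L2norm (\<lambda>x. fourier_integral (trunc R f) x + fourier_integral (trunc R f') x - (g x + g' x))
        \<le> L2norm (\<lambda>x. fourier_integral (trunc R f) x - g x) + L2norm (\<lambda>x. fourier_integral (trunc R f') x - g' x)"
    proof (intro always_eventually allI)
      fix R
      show "L2norm (\<lambda>x. fourier_integral (trunc R f) x + fourier_integral (trunc R f') x - (g x + g' x))
        \<le> L2norm (\<lambda>x. fourier_integral (trunc R f) x - g x) + L2norm (\<lambda>x. fourier_integral (trunc R f') x - g' x)"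
        using L2norm_triangle[of "\<lambda>x. fourier_integral (trunc R f) x - g x" "\<lambda>x. fourier_integral (trunc R f') x - g' x"]
          L fi_trunc_L2[of f R] fi_trunc_L2[of f' R]
        by (simp add: L2_diff algebra_simps)
    qed
  qed simp
  then show ?thesis using L by (simp add: has_fourier_iff eq L2_add)
qed

lemma has_fourier_diff:
  assumes "has_fourier f g" "has_fourier f' g'"
  shows "has_fourier (\<lambda>x. f x - f' x) (\<lambda>x. g x - g' x)"
  using has_fourier_add[OF assms(1) has_fourier_cmult[OF assms(2), of "-1"]] by simp

lemma has_fourier_unique:
  assumes "has_fourier f g" "has_fourier f g'" shows "AE x in lborel. g x = g' x"
proof -
  have d: "has_fourier (\<lambda>x. f x - f x) (\<lambda>x. g x - g' x)" by (rule has_fourier_diff[OF assms])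
  then have "L2norm (\<lambda>x. g x - g' x) = 0" using has_fourier_norm[OF d] by simp
  with L2norm_eq_0_imp_AE[of "\<lambda>x. g x - g' x"] has_fourier_L2[OF d] show ?thesis by simp
qed

lemma has_fourier_unique_inv:
  fixes f f' :: "'n::finite field"
  assumes "has_fourier f g" "has_fourier f' g" shows "AE x in lborel. f x = f' x"
proof -
  have d: "has_fourier (\<lambda>x. f x - f' x) (\<lambda>x. g x - g x)" by (rule has_fourier_diff[OF assms])
  then have "L2norm (\<lambda>x. f x - f' x) = 0" using has_fourier_norm[OF d] by simp
  with L2norm_eq_0_imp_AE[of "\<lambda>x. f x - f' x"] has_fourier_L2[OF d] show ?thesis by simp
qed

lemma has_fourier_L1:
  fixes f :: "'n::finite field"
  assumes "f \<in> L1" "f \<in> L2" shows "has_fourier f (fourier_integral f)"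
proof -
  have "L2norm (\<lambda>x. fourier_integral (trunc R f) x - fourier_integral f x)
      = fconst TYPE('n) * L2norm (\<lambda>x. trunc R f x - f x)" for R
  proof -
    have t: "trunc R f \<in> L1" "trunc R f \<in> L2" using trunc_L1 trunc_L2 assms by auto
    then have "(\<lambda>x. trunc R f x - f x) \<in> L1" "(\<lambda>x. trunc R f x - f x) \<in> L2"
      using assms by (auto simp: L1_def L2_diff)
    from plancherel_L1_L2(2)[OF this] fourier_integral_diff[OF t(1) assms(1)] show ?thesis
      by (simp add: ext[OF fourier_integral_diff[OF t(1) assms(1)]])
  qed
  then have "((\<lambda>R. L2norm (\<lambda>x. fourier_integral (trunc R f) x - fourier_integral f x)) \<longlongrightarrow> 0) at_top"
    using tendsto_mult_left[OF trunc_tendsto[OF assms(2)], of "fconst TYPE('n)"] by simp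
  then show ?thesis using assms plancherel_L1_L2(1)[OF assms] by (simp add: has_fourier_iff)
qed

text \<open>Both sides are limits of the L^1 formula for truncations. This is the device that
  carries an identity between functions of x, tested against a transform, to the frequency
  side.\<close>

lemma has_fourier_multiplication:
  assumes h: "has_fourier f g" "has_fourier \<phi> \<psi>"
  shows "(LINT x|lborel. g x * \<phi> x) = (LINT x|lborel. f x * \<psi> x)"
proof (rule tendsto_unique[OF trivial_limit_at_top_linorder])
  note L = has_fourier_L2[OF h(1)] has_fourier_L2[OF h(2)]
  have *: "((\<lambda>R. L2norm (\<lambda>x. fourier_integral (trunc R f) x - g x)) \<longlongrightarrow> 0) at_top"
    "((\<lambda>R. L2norm (\<lambda>x. fourier_integral (trunc R \<phi>) x - \<psi> x)) \<longlongrightarrow> 0) at_top"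
    using h by (auto simp: has_fourier_iff)
  show "((\<lambda>R. LINT x|lborel. fourier_integral (trunc R f) x * trunc R \<phi> x) \<longlongrightarrow> (LINT x|lborel. g x * \<phi> x)) at_top"
    by (intro L2_pairing_limit * trunc_tendsto fi_trunc_L2 trunc_L2 L)
  have "((\<lambda>R. LINT x|lborel. trunc R f x * fourier_integral (trunc R \<phi>) x) \<longlongrightarrow> (LINT x|lborel. f x * \<psi> x)) at_top"
    by (intro L2_pairing_limit * trunc_tendsto fi_trunc_L2 trunc_L2 L)
  then show "((\<lambda>R. LINT x|lborel. fourier_integral (trunc R f) x * trunc R \<phi> x) \<longlongrightarrow> (LINT x|lborel. f x * \<psi> x)) at_top"
    using L by (simp add: fourier_integral_multiplication trunc_L1)
qed

text \<open>An isometry whose adjoint is an isometry is onto: the adjoint of the Fourier transform is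
  the conjugate of the Fourier transform of the conjugate.\<close>

lemma has_fourier_inverse:
  fixes g h :: "'n::finite field"
  assumes h: "has_fourier (\<lambda>x. cnj (g x)) h"
  shows "has_fourier (\<lambda>x. of_real (1 / (fconst TYPE('n))\<^sup>2) * cnj (h x)) g"
proof -
  let ?c = "fconst TYPE('n)"
  define f where "f x = of_real (1 / ?c\<^sup>2) * cnj (h x)" for x
  have c: "?c > 0" by simp
  note L = has_fourier_L2[OF h]
  have g: "g \<in> L2" using L2_cnj[OF L(1)] by simp
  have f: "f \<in> L2" unfolding f_def by (intro L2_cmult L2_cnj L)
  obtain g' where g': "has_fourier f g'" using has_fourier_exists[OF f] by blast
  note L' = has_fourier_L2[OF g']
  have nh: "L2norm h = ?c * L2norm g" using has_fourier_norm[OF h] by simp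
  have "L2norm f = L2norm h / ?c\<^sup>2"
    unfolding f_def L2norm_cmult L2norm_cnj using c by (simp add: norm_divide norm_power)
  then have ng': "L2norm g' = L2norm g"
    using has_fourier_norm[OF g'] nh c by (simp add: power2_eq_square field_simps)
  have "(LINT x|lborel. g' x * cnj (g x)) = (LINT x|lborel. f x * h x)"
    by (rule has_fourier_multiplication[OF g' h])
  also have "\<dots> = of_real (1 / ?c\<^sup>2) * (LINT x|lborel. of_real ((norm (h x))\<^sup>2))"
    unfolding f_def complex_norm_square by (simp add: mult_ac flip: complex_norm_square)
  also have "\<dots> = of_real ((L2norm g)\<^sup>2)"
    using nh c unfolding integral_complex_of_real L2norm_sq[symmetric]
    by (simp add: power_mult_distrib)
  finally have cross: "(LINT x|lborel. g' x * cnj (g x)) = of_real ((L2norm g)\<^sup>2)" .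
  \<comment> \<open>The squared distance expands into two squared norms minus the cross term and its
    conjugate. All four numbers equal the squared norm of \<open>g\<close>, so the distance is
    0.\<close>
  have "of_real ((L2norm (\<lambda>x. g' x - g x))\<^sup>2) = (LINT x|lborel. (g' x - g x) * cnj (g' x - g x))"
    by (simp only: L2norm_sq integral_complex_of_real[symmetric] complex_norm_square)
  also have "\<dots> = (LINT x|lborel. g' x * cnj (g' x) - g' x * cnj (g x) - (cnj (g' x * cnj (g x)) - g x * cnj (g x)))"
    by (simp add: algebra_simps)
  also have "\<dots> = (LINT x|lborel. g' x * cnj (g' x)) - (LINT x|lborel. g' x * cnj (g x))
      - (cnj (LINT x|lborel. g' x * cnj (g x)) - (LINT x|lborel. g x * cnj (g x)))"
  proof -
    note i = L2_mult_integrable(1)[OF L'(2) L2_cnj[OF L'(2)]] L2_mult_integrable(1)[OF L'(2) L2_cnj[OF g]]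
      L2_mult_integrable(1)[OF g L2_cnj[OF g]] L2_mult_integrable(1)[OF g L2_cnj[OF L'(2)]]
    have "(LINT x|lborel. cnj (g' x * cnj (g x))) = cnj (LINT x|lborel. g' x * cnj (g x))"
      by (rule Bochner_Integration.integral_cnj)
    moreover have "(\<lambda>x. cnj (g' x * cnj (g x))) = (\<lambda>x. g x * cnj (g' x))" by (auto simp: mult.commute)
    ultimately show ?thesis using i by simp
  qed
  also have "(LINT x|lborel. g' x * cnj (g' x)) = of_real ((L2norm g')\<^sup>2)"
    by (simp only: L2norm_sq integral_complex_of_real[symmetric] complex_norm_square)
  also have "(LINT x|lborel. g x * cnj (g x)) = of_real ((L2norm g)\<^sup>2)"
    by (simp only: L2norm_sq integral_complex_of_real[symmetric] complex_norm_square)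
  also note cross
  finally have "(L2norm (\<lambda>x. g' x - g x))\<^sup>2 = 0" using ng' by (simp flip: of_real_power of_real_diff)
  then have "AE x in lborel. g' x = g x"
    using L2norm_eq_0_imp_AE[OF L2_diff[OF L'(2) g]] by simp
  then have "has_fourier f g"
    by (rule has_fourier_cong_AE[OF g' AE_I2[OF refl]]) (use f g in \<open>auto dest: L2_measurable\<close>)
  then show ?thesis unfolding f_def .
qed

lemma has_fourier_surj:
  assumes "g \<in> L2" shows "\<exists>f. has_fourier f g"
  using has_fourier_exists[OF L2_cnj[OF assms]] has_fourier_inverse by blast

text \<open>\<open>has_fourier_inverse\<close> writes the preimage of an integrable \<open>g\<close>
  as an absolutely convergent integral. The bound is only almost everywhere because \<open>f\<close>
  agrees with that integral up to a null set.\<close>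

lemma has_fourier_inverse_bound:
  fixes f g :: "'n::finite field"
  assumes h: "has_fourier f g" and g: "g \<in> L1"
  shows "AE x in lborel. norm (f x) \<le> L1norm g / (fconst TYPE('n))\<^sup>2"
proof -
  let ?c = "fconst TYPE('n)"
  note L = has_fourier_L2[OF h]
  have c: "?c > 0" by simp
  have g1: "(\<lambda>x. cnj (g x)) \<in> L1" using g by (simp add: L1_def)
  have i: "has_fourier (\<lambda>x. of_real (1 / ?c\<^sup>2) * cnj (fourier_integral (\<lambda>x. cnj (g x)) x)) g"
    by (rule has_fourier_inverse[OF has_fourier_L1[OF g1 L2_cnj[OF L(2)]]])
  show ?thesis using has_fourier_unique_inv[OF h i]
  proof eventually_elim
    case (elim x)
    have "norm (fourier_integral (\<lambda>x. cnj (g x)) x) \<le> L1norm g"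
      using fourier_integral_bound[of "\<lambda>x. cnj (g x)" x] by (simp add: L1norm_def)
    then show ?case using elim c by (simp add: norm_mult norm_divide norm_power divide_right_mono)
  qed
qed

lemma has_fourier_fourier: "f \<in> L2 \<Longrightarrow> has_fourier f (fourier f)"
  unfolding fourier_def using has_fourier_exists by (metis someI_ex)

lemma has_fourier_inv_fourier: "g \<in> L2 \<Longrightarrow> has_fourier (inv_fourier g) g"
  unfolding inv_fourier_def using has_fourier_surj by (metis someI_ex)

lemma fourier_L2: "f \<in> L2 \<Longrightarrow> fourier f \<in> L2"
  using has_fourier_fourier has_fourier_L2 by blast

text \<open>\<open>fourier_mult\<close> is built on the chosen transform \<open>fourier f\<close>;
  here any known transform of \<open>f\<close> may take its place, in particular the continuous
  \<open>fourier_integral\<close> of an integrable function.\<close>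

lemma has_fourier_mult:
  assumes f: "has_fourier f g" and m: "m \<in> borel_measurable borel"
    and L: "(\<lambda>\<xi>. of_real (m \<xi>) * g \<xi>) \<in> L2"
  shows "has_fourier (fourier_mult m f) (\<lambda>\<xi>. of_real (m \<xi>) * g \<xi>)"
proof -
  note [measurable] = m fourier_L2[OF has_fourier_L2(1)[OF f], THEN L2_measurable]
  have "AE \<xi> in lborel. fourier f \<xi> = g \<xi>"
    by (rule has_fourier_unique[OF has_fourier_fourier[OF has_fourier_L2(1)[OF f]] f])
  then have ae': "AE \<xi> in lborel. of_real (m \<xi>) * fourier f \<xi> = of_real (m \<xi>) * g \<xi>"
    by eventually_elim simp
  have L': "(\<lambda>\<xi>. of_real (m \<xi>) * fourier f \<xi>) \<in> L2"
    by (rule L2_cong_AE[OF L]) (use ae' in auto)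
  have h: "has_fourier (fourier_mult m f) (\<lambda>\<xi>. of_real (m \<xi>) * fourier f \<xi>)"
    unfolding fourier_mult_def by (rule has_fourier_inv_fourier[OF L'])
  show ?thesis
    by (rule has_fourier_cong_AE[OF h AE_I2[OF refl] ae'])
      (use has_fourier_L2(1)[OF h] L in \<open>auto dest: L2_measurable\<close>)
qed

section \<open>The homogeneous Sobolev inequality\<close>

lemma nn_integral_powr_0:
  assumes "a > -1" "c \<ge> 0"
  shows "(\<integral>\<^sup>+x. ennreal (x powr a) * indicator {0..c} x \<partial>lborel) = ennreal (c powr (a + 1) / (a + 1))"
    and "(\<integral>\<^sup>+x. ennreal (x powr a) * indicator {0<..<c} x \<partial>lborel) = ennreal (c powr (a + 1) / (a + 1))"
proof -
  have "(\<integral>\<^sup>+x. ennreal (indicator {0..c} x * x powr a) \<partial>lborel) = ennreal (c powr (a + 1) / (a + 1))"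
    by (rule nn_integral_has_integral_lebesgue[OF _ has_integral_powr_from_0[OF assms]]) simp
  moreover have "(\<integral>\<^sup>+x. ennreal (indicator {0..c} x * x powr a) \<partial>lborel)
      = (\<integral>\<^sup>+x. ennreal (x powr a) * indicator {0..c} x \<partial>lborel)"
    by (intro nn_integral_cong) (auto split: split_indicator)
  ultimately show *: "(\<integral>\<^sup>+x. ennreal (x powr a) * indicator {0..c} x \<partial>lborel) = ennreal (c powr (a + 1) / (a + 1))"
    by simp
  have "AE x in lborel. ennreal (x powr a) * indicator {0<..<c} x = ennreal (x powr a) * indicator {0..c} x"
    using AE_lborel_singleton[of "0::real"] AE_lborel_singleton[of c]
    by eventually_elim (auto split: split_indicator)
  with * show "(\<integral>\<^sup>+x. ennreal (x powr a) * indicator {0<..<c} x \<partial>lborel) = ennreal (c powr (a + 1) / (a + 1))"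
    by (simp add: nn_integral_cong_AE)
qed

text \<open>A layer-cake argument in place of polar coordinates: |\<xi>|^(-2s) is A^(-2s) plus the
  integral of 2s l^(-2s-1) over l from |\<xi>| to A. After exchanging integrals only volumes of
  balls remain, and l^(n-2s-1) is integrable at 0 because 2s < n.\<close>

lemma nn_integral_norm_powr_ball:
  fixes s n :: real
  defines "n \<equiv> real CARD('n::finite)"
  assumes s: "0 < s" "2 * s < n"
  shows "\<exists>\<kappa>>0. \<forall>A>0. (\<integral>\<^sup>+\<xi>. ennreal (norm \<xi> powr (- 2 * s)) * indicator (ball (0 :: real ^ 'n) A) \<xi> \<partial>lborel)
    \<le> ennreal (\<kappa> * A powr (n - 2 * s))"
proof -
  define v where "v = unit_ball_vol (real CARD('n))"
  have v: "v > 0" unfolding v_def by simp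
  have vol: "emeasure lborel (ball (0 :: real ^ 'n) r) = ennreal (v * r powr n)"
      "emeasure lborel (cball (0 :: real ^ 'n) r) = ennreal (v * r powr n)" if "r > 0" for r
    using that emeasure_ball[of r "0 :: real ^ 'n"] emeasure_cball[of r "0 :: real ^ 'n"]
    by (simp_all add: v_def n_def powr_realpow)
  show ?thesis
  proof (intro exI[of _ "v * (1 + 2 * s / (n - 2 * s))"] conjI allI impI)
    show "v * (1 + 2 * s / (n - 2 * s)) > 0" using s v by (simp add: add_pos_pos)
    fix A :: real assume A: "A > 0"
    let ?h = "\<lambda>(\<xi> :: real ^ 'n) l. ennreal (2 * s * l powr (- 2 * s - 1)) * indicator {norm \<xi>..A} l"
    have cake: "ennreal (norm \<xi> powr (- 2 * s)) \<le> ennreal (A powr (- 2 * s)) + (\<integral>\<^sup>+l. ?h \<xi> l \<partial>lborel)"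
      if x: "\<xi> \<noteq> 0" "norm \<xi> < A" for \<xi> :: "real ^ 'n"
    proof -
      have "(\<integral>\<^sup>+l. ?h \<xi> l \<partial>lborel) = ennreal (- (A powr (- 2 * s)) - - (norm \<xi> powr (- 2 * s)))"
      proof (rule nn_integral_FTC_Icc)
        fix l assume "l \<in> {norm \<xi>..A}"
        then have l: "l > 0" using x by (auto intro: less_le_trans[of 0 "norm \<xi>"])
        show "((\<lambda>l. - (l powr (- 2 * s))) has_real_derivative 2 * s * l powr (- 2 * s - 1)) (at l)"
          using l by (auto intro!: derivative_eq_intros)
        show "0 \<le> 2 * s * l powr (- 2 * s - 1)" using s by simp
      qed (use x in auto)
      moreover have "A powr (- 2 * s) \<le> norm \<xi> powr (- 2 * s)"
        using x s by (intro powr_mono2') auto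
      ultimately show ?thesis by (simp flip: ennreal_plus)
    qed
    have "(\<integral>\<^sup>+\<xi>. ennreal (norm \<xi> powr (- 2 * s)) * indicator (ball (0 :: real ^ 'n) A) \<xi> \<partial>lborel)
        \<le> (\<integral>\<^sup>+\<xi>. ennreal (A powr (- 2 * s)) * indicator (ball (0 :: real ^ 'n) A) \<xi> + (\<integral>\<^sup>+l. ?h \<xi> l \<partial>lborel) \<partial>lborel)"
    proof (rule nn_integral_mono_AE)
      show "AE \<xi> in lborel. ennreal (norm \<xi> powr (- 2 * s)) * indicator (ball (0 :: real ^ 'n) A) \<xi>
        \<le> ennreal (A powr (- 2 * s)) * indicator (ball (0 :: real ^ 'n) A) \<xi> + (\<integral>\<^sup>+l. ?h \<xi> l \<partial>lborel)"
        using AE_lborel_singleton[of "0 :: real ^ 'n"]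
      proof eventually_elim
        case (elim \<xi>)
        then show ?case using cake[of \<xi>] by (cases "norm \<xi> < A") auto
      qed
    qed
    also have "\<dots> = ennreal (A powr (- 2 * s)) * emeasure lborel (ball (0 :: real ^ 'n) A)
        + (\<integral>\<^sup>+\<xi>. (\<integral>\<^sup>+l. ?h \<xi> l \<partial>lborel) \<partial>lborel)"
    proof -
      have "(\<lambda>(\<xi>, l). ?h \<xi> l) \<in> borel_measurable (lborel \<Otimes>\<^sub>M lborel)"
        unfolding indicator_def of_bool_def atLeastAtMost_iff by measurable
      then have m: "(\<lambda>\<xi>. \<integral>\<^sup>+l. ?h \<xi> l \<partial>lborel) \<in> borel_measurable lborel"
        using lborel.borel_measurable_nn_integral by blast
      have b: "ball (0 :: real ^ 'n) A \<in> sets lborel" by simp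
      have I: "(\<integral>\<^sup>+\<xi>. ennreal (A powr (- 2 * s)) * indicator (ball (0 :: real ^ 'n) A) \<xi> \<partial>lborel)
          = ennreal (A powr (- 2 * s)) * emeasure lborel (ball (0 :: real ^ 'n) A)"
        by (rule nn_integral_cmult_indicator[OF b])
      show ?thesis unfolding I[symmetric]
        by (rule nn_integral_add[OF _ m]) (use b in measurable)
    qed
    also have "(\<integral>\<^sup>+\<xi>. (\<integral>\<^sup>+l. ?h \<xi> l \<partial>lborel) \<partial>lborel) = (\<integral>\<^sup>+l. (\<integral>\<^sup>+\<xi>. ?h \<xi> l \<partial>lborel) \<partial>lborel)"
      by (rule lborel_pair.Fubini'[symmetric]) (unfold indicator_def of_bool_def atLeastAtMost_iff greaterThanLessThan_iff mem_Collect_eq, measurable)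
    also have "\<dots> \<le> (\<integral>\<^sup>+l. ennreal (2 * s * v) * (ennreal (l powr (n - 2 * s - 1)) * indicator {0..A} l) \<partial>lborel)"
    proof (rule nn_integral_mono_AE)
      show "AE l in lborel. (\<integral>\<^sup>+\<xi>. ?h \<xi> l \<partial>lborel)
          \<le> ennreal (2 * s * v) * (ennreal (l powr (n - 2 * s - 1)) * indicator {0..A} l)"
        using AE_lborel_singleton[of "0 :: real"]
      proof eventually_elim
        case (elim l)
        show ?case
        proof (cases "0 < l \<and> l \<le> A")
          case True
          have "(\<integral>\<^sup>+\<xi>. ?h \<xi> l \<partial>lborel)
              = (\<integral>\<^sup>+\<xi>. ennreal (2 * s * l powr (- 2 * s - 1)) * indicator (cball (0 :: real ^ 'n) l) \<xi> \<partial>lborel)"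
            by (intro nn_integral_cong) (use True in \<open>auto split: split_indicator\<close>)
          also have "\<dots> = ennreal (2 * s * l powr (- 2 * s - 1)) * ennreal (v * l powr n)"
            using True by (simp add: nn_integral_cmult_indicator vol)
          also have "\<dots> = ennreal (2 * s * v) * ennreal (l powr (n - 2 * s - 1))"
          proof -
            have "l powr (- 2 * s - 1) * l powr n = l powr (n - 2 * s - 1)"
              by (simp add: algebra_simps flip: powr_add)
            then have "2 * s * l powr (- 2 * s - 1) * (v * l powr n) = 2 * s * v * l powr (n - 2 * s - 1)"
              by (simp add: mult_ac)
            then show ?thesis using s v by (simp flip: ennreal_mult)
          qed
          finally show ?thesis using True by simp
        next
          case False
          have z: "?h \<xi> l = 0" for \<xi>
          proof (cases "l \<in> {norm \<xi>..A}")
            case True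
            then have "norm \<xi> \<le> l" "l \<le> A" by auto
            then have "0 \<le> l" using norm_ge_zero[of \<xi>] by linarith
            then show ?thesis using False elim \<open>l \<le> A\<close> by linarith
          qed simp
          show ?thesis unfolding z by simp
        qed
      qed
    qed
    also have "\<dots> = ennreal (2 * s * v) * ennreal (A powr (n - 2 * s) / (n - 2 * s))"
      using nn_integral_powr_0(1)[of "n - 2 * s - 1" A] s A by (subst nn_integral_cmult) auto
    also have "ennreal (A powr (- 2 * s)) * emeasure lborel (ball (0 :: real ^ 'n) A) = ennreal (v * A powr (n - 2 * s))"
    proof -
      have "A powr (- 2 * s) * (v * A powr n) = v * A powr (n - 2 * s)"
        by (simp add: algebra_simps flip: powr_add)
      then show ?thesis using A v by (simp add: vol flip: ennreal_mult)
    qed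
    also have "ennreal (v * A powr (n - 2 * s)) + ennreal (2 * s * v) * ennreal (A powr (n - 2 * s) / (n - 2 * s))
        = ennreal (v * (1 + 2 * s / (n - 2 * s)) * A powr (n - 2 * s))"
      using s v by (simp add: field_simps flip: ennreal_mult ennreal_plus)
    finally show "(\<integral>\<^sup>+\<xi>. ennreal (norm \<xi> powr (- 2 * s)) * indicator (ball (0 :: real ^ 'n) A) \<xi> \<partial>lborel)
        \<le> ennreal (v * (1 + 2 * s / (n - 2 * s)) * A powr (n - 2 * s))"
      by (auto intro: add_left_mono)
  qed
qed

text \<open>Cauchy-Schwarz between |\<xi>|^s g and |\<xi>|^(-s) on the ball puts the truncated
  transform into L^1, hence its preimage is bounded.\<close>

lemma low_frequency_bound:
  fixes f g :: "'n::finite field" and s \<kappa> A B :: real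
  assumes h: "has_fourier f g" and B: "B \<ge> 0" and A: "A > 0"
    and gB: "(\<integral>\<^sup>+\<xi>. ennreal (norm \<xi> powr (2 * s) * (norm (g \<xi>))\<^sup>2) \<partial>lborel) \<le> ennreal (B\<^sup>2)"
    and k: "(\<integral>\<^sup>+\<xi>. ennreal (norm \<xi> powr (- 2 * s)) * indicator (ball (0 :: real ^ 'n) A) \<xi> \<partial>lborel) \<le> ennreal (\<kappa>\<^sup>2)" "\<kappa> \<ge> 0"
  shows "\<exists>fA. has_fourier fA (trunc A g) \<and> (AE x in lborel. norm (fA x) \<le> B * \<kappa> / (fconst TYPE('n))\<^sup>2)"
proof -
  have g: "g \<in> L2" by (rule has_fourier_L2[OF h])
  note [measurable] = L2_measurable[OF g]
  obtain fA where fA: "has_fourier fA (trunc A g)" using has_fourier_surj[OF trunc_L2[OF g]] by blast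
  let ?a = "\<lambda>\<xi>. complex_of_real (norm \<xi> powr s) * g \<xi>"
  let ?b = "\<lambda>\<xi> :: real ^ 'n. complex_of_real (norm \<xi> powr (- s) * indicator (ball 0 A) \<xi>)"
  have [measurable]: "ball (0 :: real ^ 'n) A \<in> sets borel" by simp
  have sq: "(x powr s)\<^sup>2 = x powr (2 * s)" "(x powr (- s))\<^sup>2 = x powr (- 2 * s)" for x :: real
    by (simp_all add: power2_eq_square flip: powr_add)
  have a: "?a \<in> L2" "L2norm ?a \<le> B"
    using gB B by (auto intro!: L2_nn_integralI[of ?a B] simp: norm_mult power_mult_distrib sq)
  have "(\<integral>\<^sup>+\<xi>. ennreal ((norm (?b \<xi>))\<^sup>2) \<partial>lborel) \<le> ennreal (\<kappa>\<^sup>2)"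
    by (rule order_trans[OF _ k(1)])
      (auto intro!: nn_integral_mono split: split_indicator simp: norm_mult power_mult_distrib sq)
  moreover have "?b \<in> borel_measurable borel" by measurable
  ultimately have b: "?b \<in> L2" "L2norm ?b \<le> \<kappa>"
    using L2_nn_integralI[of ?b \<kappa>] k(2) by blast+
  have "L1norm (trunc A g) = (LINT \<xi>|lborel. norm (?a \<xi>) * norm (?b \<xi>))"
    unfolding L1norm_def
  proof (rule integral_cong_AE)
    show "AE \<xi> in lborel. norm (trunc A g \<xi>) = norm (?a \<xi>) * norm (?b \<xi>)"
      using AE_lborel_singleton[of "0 :: real ^ 'n"]
    proof eventually_elim
      case (elim \<xi>)
      then have "norm \<xi> powr s * norm \<xi> powr (- s) = 1" by (simp flip: powr_add)
      then show ?case by (auto simp: trunc_def norm_mult split: split_indicator)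
    qed
  qed (use a(1) b(1) trunc_L2[OF g, of A] in \<open>auto dest!: L2_measurable\<close>)
  also have "\<dots> \<le> L2norm ?a * L2norm ?b" by (rule L2_mult_integrable(3)[OF a(1) b(1)])
  also have "\<dots> \<le> B * \<kappa>" using a b B by (intro mult_mono) auto
  finally have L1: "L1norm (trunc A g) / (fconst TYPE('n))\<^sup>2 \<le> B * \<kappa> / (fconst TYPE('n))\<^sup>2"
    by (rule divide_right_mono) simp
  have "AE x in lborel. norm (fA x) \<le> B * \<kappa> / (fconst TYPE('n))\<^sup>2"
    using has_fourier_inverse_bound[OF fA trunc_L1[OF g]] by eventually_elim (use L1 in linarith)
  with fA show ?thesis by blast
qed

text \<open>Chebyshev and Plancherel: where |f| exceeds l, the low part accounts for at most l/2, so
  the high part is at least l/2 there.\<close>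

lemma high_frequency_bound:
  fixes f g fA :: "'n::finite field"
  assumes h: "has_fourier f g" and hA: "has_fourier fA (trunc A g)" and l: "l > 0"
    and b: "AE x in lborel. norm (fA x) \<le> l / 2"
  shows "emeasure lborel {x. l < norm (f x)}
    \<le> ennreal (4 / (l\<^sup>2 * (fconst TYPE('n))\<^sup>2)) * (\<integral>\<^sup>+\<xi>. ennreal ((norm (g \<xi>))\<^sup>2) * indicator {\<xi>. A \<le> norm \<xi>} \<xi> \<partial>lborel)"
proof -
  let ?c = "fconst TYPE('n)"
  have c: "?c > 0" by simp
  have d: "has_fourier (\<lambda>x. f x - fA x) (\<lambda>\<xi>. g \<xi> - trunc A g \<xi>)" by (rule has_fourier_diff[OF h hA])
  note L = has_fourier_L2[OF h] has_fourier_L2[OF hA] has_fourier_L2[OF d]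
  note [measurable] = L[THEN L2_measurable]
  have "emeasure lborel {x. l < norm (f x)} = (\<integral>\<^sup>+x. indicator {x. l < norm (f x)} x \<partial>lborel)"
    by simp
  also have "\<dots> \<le> (\<integral>\<^sup>+x. ennreal (4 / l\<^sup>2) * ennreal ((norm (f x - fA x))\<^sup>2) \<partial>lborel)"
  proof (rule nn_integral_mono_AE)
    show "AE x in lborel. indicator {x. l < norm (f x)} x \<le> ennreal (4 / l\<^sup>2) * ennreal ((norm (f x - fA x))\<^sup>2)"
      using b
    proof eventually_elim
      case (elim x)
      show ?case
      proof (cases "l < norm (f x)")
        case True
        then have "l / 2 \<le> norm (f x - fA x)" using norm_triangle_ineq2[of "f x" "fA x"] elim by linarith
        then have "(l / 2)\<^sup>2 \<le> (norm (f x - fA x))\<^sup>2" using l by (intro power_mono) auto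
        then have "1 \<le> 4 / l\<^sup>2 * (norm (f x - fA x))\<^sup>2" using l by (simp add: field_simps power2_eq_square)
        then have "ennreal 1 \<le> ennreal (4 / l\<^sup>2 * (norm (f x - fA x))\<^sup>2)" by (rule ennreal_leI)
        also have "\<dots> = ennreal (4 / l\<^sup>2) * ennreal ((norm (f x - fA x))\<^sup>2)" by (rule ennreal_mult) simp_all
        finally show ?thesis using True by simp
      qed simp
    qed
  qed
  also have "\<dots> = ennreal (4 / l\<^sup>2) * ennreal ((L2norm (\<lambda>x. f x - fA x))\<^sup>2)"
    by (subst nn_integral_cmult) (auto simp: nn_integral_L2[OF L(5)])
  also have "(L2norm (\<lambda>x. f x - fA x))\<^sup>2 = 1 / ?c\<^sup>2 * (L2norm (\<lambda>\<xi>. g \<xi> - trunc A g \<xi>))\<^sup>2"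
    using has_fourier_norm[OF d] c by (simp add: power_mult_distrib)
  also have "ennreal (4 / l\<^sup>2) * ennreal (1 / ?c\<^sup>2 * (L2norm (\<lambda>\<xi>. g \<xi> - trunc A g \<xi>))\<^sup>2)
      = ennreal (4 / (l\<^sup>2 * ?c\<^sup>2)) * ennreal ((L2norm (\<lambda>\<xi>. g \<xi> - trunc A g \<xi>))\<^sup>2)"
    by (simp flip: ennreal_mult mult.assoc)
  also have "ennreal ((L2norm (\<lambda>\<xi>. g \<xi> - trunc A g \<xi>))\<^sup>2) = (\<integral>\<^sup>+\<xi>. ennreal ((norm (g \<xi> - trunc A g \<xi>))\<^sup>2) \<partial>lborel)"
    by (rule nn_integral_L2[symmetric, OF L(6)])
  also have "\<dots> = (\<integral>\<^sup>+\<xi>. ennreal ((norm (g \<xi>))\<^sup>2) * indicator {\<xi>. A \<le> norm \<xi>} \<xi> \<partial>lborel)"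
    by (intro nn_integral_cong) (auto simp: trunc_def split: split_indicator)
  finally show ?thesis .
qed

text \<open>Following Chemin and Xu: the superlevel set at height \<open>\<lambda>\<close> is estimated after cutting \<open>f\<close> at a
  frequency that depends on \<open>\<lambda>\<close>, so that the low frequency part stays below \<open>\<lambda> / 2\<close>.\<close>

theorem sobolev_homogeneous:
  fixes s n q :: real
  defines "n \<equiv> real CARD('n::finite)"
  defines "q \<equiv> 2 * n / (n - 2 * s)"
  assumes s: "0 < s" "2 * s < n"
  shows "\<exists>C\<ge>0. \<forall>(f :: 'n field) g B. has_fourier f g \<longrightarrow> B > 0 \<longrightarrow>
     (\<integral>\<^sup>+\<xi>. ennreal (norm \<xi> powr (2 * s) * (norm (g \<xi>))\<^sup>2) \<partial>lborel) \<le> ennreal (B\<^sup>2) \<longrightarrow>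
     (\<integral>\<^sup>+x. ennreal (norm (f x) powr q) \<partial>lborel) \<le> ennreal (C * B powr q)"
proof -
  let ?c = "fconst TYPE('n)"
  have c: "?c > 0" by simp
  have n: "n > 0" using s by linarith
  have q2: "q > 2" using s by (simp add: q_def field_simps)
  have nq: "n / q = (n - 2 * s) / 2" using s n by (simp add: q_def)
  have nq2: "n / q * (q - 2) = 2 * s" using s n by (simp add: q_def field_simps)
  obtain \<kappa> where \<kappa>: "\<kappa> > 0" and kb: "\<And>A. A > 0 \<Longrightarrow>
      (\<integral>\<^sup>+\<xi>. ennreal (norm \<xi> powr (- 2 * s)) * indicator (ball (0 :: real ^ 'n) A) \<xi> \<partial>lborel) \<le> ennreal (\<kappa> * A powr (n - 2 * s))"
    using nn_integral_norm_powr_ball[where 'n='n, of s] s unfolding n_def by blast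
  \<comment> \<open>Chosen so that for the cut-off \<open>A l\<close> the bound of
    \<open>low_frequency_bound\<close> is exactly l/2; this rests on n/q = (n - 2s)/2.\<close>
  define D where "D = 2 * sqrt \<kappa> / ?c\<^sup>2"
  have D: "D > 0" using \<kappa> c by (simp add: D_def)
  show ?thesis
  proof (intro exI[of _ "4 * q * D powr (q - 2) / (?c\<^sup>2 * (q - 2))"] conjI allI impI)
    show "0 \<le> 4 * q * D powr (q - 2) / (?c\<^sup>2 * (q - 2))" using q2 c by simp
    fix f g :: "'n field" and B :: real
    assume h: "has_fourier f g" and B: "B > 0"
      and gB: "(\<integral>\<^sup>+\<xi>. ennreal (norm \<xi> powr (2 * s) * (norm (g \<xi>))\<^sup>2) \<partial>lborel) \<le> ennreal (B\<^sup>2)"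
    note [measurable] = has_fourier_L2[OF h, THEN L2_measurable]
    define A where "A l = (l / (D * B)) powr (q / n)" for l
    have level: "emeasure lborel {x. l < norm (f x)}
        \<le> ennreal (4 / (l\<^sup>2 * ?c\<^sup>2)) * (\<integral>\<^sup>+\<xi>. ennreal ((norm (g \<xi>))\<^sup>2) * indicator {\<xi>. A l \<le> norm \<xi>} \<xi> \<partial>lborel)"
      if l: "l > 0" for l
    proof -
      have A: "A l > 0" using l D B by (simp add: A_def)
      have An: "A l powr (n / q) = l / (D * B)"
        using l D B n q2 by (simp add: A_def powr_powr)
      have "(A l powr (n / q))\<^sup>2 = A l powr (n - 2 * s)"
        by (simp add: nq power2_eq_square flip: powr_add)
      then have "(sqrt \<kappa> * A l powr (n / q))\<^sup>2 = \<kappa> * A l powr (n - 2 * s)"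
        using \<kappa> by (simp add: power_mult_distrib)
      then obtain fA where fA: "has_fourier fA (trunc (A l) g)"
          "AE x in lborel. norm (fA x) \<le> B * (sqrt \<kappa> * A l powr (n / q)) / ?c\<^sup>2"
        using low_frequency_bound[OF h less_imp_le[OF B] A gB, of "sqrt \<kappa> * A l powr (n / q)"] kb[OF A] \<kappa>
        by auto
      have "B * (sqrt \<kappa> * A l powr (n / q)) / ?c\<^sup>2 = l / 2"
        using D B unfolding An D_def using \<kappa> c by (simp add: field_simps)
      from high_frequency_bound[OF h fA(1) l fA(2)[unfolded this]] show ?thesis .
    qed
    let ?w = "\<lambda>l. ennreal (q * l powr (q - 1))"
    \<comment> \<open>Layer cake for the L^q norm. After \<open>level\<close>, the order of
      integration is exchanged again, so that the height l is integrated first for fixed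
      frequency.\<close>
    have "(\<integral>\<^sup>+x. ennreal (norm (f x) powr q) \<partial>lborel)
        = (\<integral>\<^sup>+x. (\<integral>\<^sup>+l. ?w l * indicator {0<..<norm (f x)} l \<partial>lborel) \<partial>lborel)"
    proof (rule nn_integral_cong)
      fix x
      have "(\<integral>\<^sup>+l. ?w l * indicator {0<..<norm (f x)} l \<partial>lborel)
          = (\<integral>\<^sup>+l. ennreal q * (ennreal (l powr (q - 1)) * indicator {0<..<norm (f x)} l) \<partial>lborel)"
        using q2 by (intro nn_integral_cong) (auto simp: ennreal_mult split: split_indicator)
      also have "\<dots> = ennreal q * ennreal (norm (f x) powr q / q)"
        using nn_integral_powr_0(2)[of "q - 1" "norm (f x)"] q2 by (subst nn_integral_cmult) auto
      also have "\<dots> = ennreal (norm (f x) powr q)" using q2 by (simp flip: ennreal_mult)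
      finally show "ennreal (norm (f x) powr q) = (\<integral>\<^sup>+l. ?w l * indicator {0<..<norm (f x)} l \<partial>lborel)" by simp
    qed
    also have "\<dots> = (\<integral>\<^sup>+l. (\<integral>\<^sup>+x. ?w l * indicator {0<..<norm (f x)} l \<partial>lborel) \<partial>lborel)"
      by (rule lborel_pair.Fubini'[symmetric]) (unfold indicator_def of_bool_def atLeastAtMost_iff greaterThanLessThan_iff mem_Collect_eq, measurable)
    also have "\<dots> \<le> (\<integral>\<^sup>+l. (\<integral>\<^sup>+\<xi>. ennreal ((norm (g \<xi>))\<^sup>2) *
        (ennreal (4 * q / ?c\<^sup>2 * l powr (q - 3)) * indicator {l. 0 < l \<and> A l \<le> norm \<xi>} l) \<partial>lborel) \<partial>lborel)"
    proof (rule nn_integral_mono)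
      fix l :: real
      show "(\<integral>\<^sup>+x. ?w l * indicator {0<..<norm (f x)} l \<partial>lborel) \<le> (\<integral>\<^sup>+\<xi>. ennreal ((norm (g \<xi>))\<^sup>2) *
        (ennreal (4 * q / ?c\<^sup>2 * l powr (q - 3)) * indicator {l. 0 < l \<and> A l \<le> norm \<xi>} l) \<partial>lborel)"
      proof (cases "l > 0")
        case True
        have "(\<integral>\<^sup>+x. ?w l * indicator {0<..<norm (f x)} l \<partial>lborel) = (\<integral>\<^sup>+x. ?w l * indicator {x. l < norm (f x)} x \<partial>lborel)"
          using True by (intro nn_integral_cong) (auto split: split_indicator)
        also have "\<dots> = ?w l * emeasure lborel {x. l < norm (f x)}"
          by (rule nn_integral_cmult_indicator) measurable
        also have "\<dots> \<le> ?w l * (ennreal (4 / (l\<^sup>2 * ?c\<^sup>2)) * (\<integral>\<^sup>+\<xi>. ennreal ((norm (g \<xi>))\<^sup>2) * indicator {\<xi>. A l \<le> norm \<xi>} \<xi> \<partial>lborel))"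
          by (intro mult_left_mono level True) simp
        also have "\<dots> = ennreal (4 * q / ?c\<^sup>2 * l powr (q - 3)) * (\<integral>\<^sup>+\<xi>. ennreal ((norm (g \<xi>))\<^sup>2) * indicator {\<xi>. A l \<le> norm \<xi>} \<xi> \<partial>lborel)"
        proof -
          have "l powr (q - 1) = l powr (q - 3) * l\<^sup>2"
            using True powr_add[of l "q - 3" 2] powr_realpow[OF True, of 2] by simp
          then have "q * l powr (q - 1) * (4 / (l\<^sup>2 * ?c\<^sup>2)) = 4 * q / ?c\<^sup>2 * l powr (q - 3)"
            using True by (simp add: field_simps)
          then have "?w l * ennreal (4 / (l\<^sup>2 * ?c\<^sup>2)) = ennreal (4 * q / ?c\<^sup>2 * l powr (q - 3))"
            using q2 by (simp flip: ennreal_mult)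
          then show ?thesis by (simp flip: mult.assoc)
        qed
        also have "\<dots> = (\<integral>\<^sup>+\<xi>. ennreal (4 * q / ?c\<^sup>2 * l powr (q - 3)) * (ennreal ((norm (g \<xi>))\<^sup>2) * indicator {\<xi>. A l \<le> norm \<xi>} \<xi>) \<partial>lborel)"
          by (rule nn_integral_cmult[symmetric]) measurable
        also have "\<dots> = (\<integral>\<^sup>+\<xi>. ennreal ((norm (g \<xi>))\<^sup>2) *
        (ennreal (4 * q / ?c\<^sup>2 * l powr (q - 3)) * indicator {l. 0 < l \<and> A l \<le> norm \<xi>} l) \<partial>lborel)"
          using True by (intro nn_integral_cong) (auto split: split_indicator simp: mult.commute)
        finally show ?thesis .
      qed simp
    qed
    also have "\<dots> = (\<integral>\<^sup>+\<xi>. (\<integral>\<^sup>+l. ennreal ((norm (g \<xi>))\<^sup>2) *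
        (ennreal (4 * q / ?c\<^sup>2 * l powr (q - 3)) * indicator {l. 0 < l \<and> A l \<le> norm \<xi>} l) \<partial>lborel) \<partial>lborel)"
      unfolding A_def by (rule lborel_pair.Fubini') (unfold indicator_def of_bool_def atLeastAtMost_iff greaterThanLessThan_iff mem_Collect_eq, measurable)
    also have "\<dots> \<le> (\<integral>\<^sup>+\<xi>. ennreal (4 * q * D powr (q - 2) / (?c\<^sup>2 * (q - 2)) * B powr (q - 2)) *
        ennreal (norm \<xi> powr (2 * s) * (norm (g \<xi>))\<^sup>2) \<partial>lborel)"
    proof (rule nn_integral_mono)
      fix \<xi> :: "real ^ 'n"
      \<comment> \<open>\<open>A l \<le> norm \<xi>\<close> forces \<open>l \<le> ?L\<close>. The
        integral of l^(q-3) up to \<open>?L\<close> converges since q > 2, and it produces the power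
        (q - 2) n/q = 2s of |\<xi>|, which is the weight of the hypothesis.\<close>
      let ?L = "D * B * norm \<xi> powr (n / q)"
      have sub: "l \<in> {0..?L}" if "0 < l" "A l \<le> norm \<xi>" for l
      proof -
        have "A l powr (n / q) \<le> norm \<xi> powr (n / q)"
          using that n q2 by (intro powr_mono2) (auto simp: A_def)
        moreover have "A l powr (n / q) = l / (D * B)"
          using that D B n q2 by (simp add: A_def powr_powr)
        ultimately show ?thesis using that D B by (simp add: field_simps)
      qed
      have "(\<integral>\<^sup>+l. ennreal ((norm (g \<xi>))\<^sup>2) * (ennreal (4 * q / ?c\<^sup>2 * l powr (q - 3)) * indicator {l. 0 < l \<and> A l \<le> norm \<xi>} l) \<partial>lborel)
          \<le> (\<integral>\<^sup>+l. ennreal ((norm (g \<xi>))\<^sup>2 * (4 * q / ?c\<^sup>2)) * (ennreal (l powr (q - 3)) * indicator {0..?L} l) \<partial>lborel)"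
        using sub q2 by (intro nn_integral_mono) (auto split: split_indicator simp flip: ennreal_mult)
      also have "\<dots> = ennreal ((norm (g \<xi>))\<^sup>2 * (4 * q / ?c\<^sup>2)) * ennreal (?L powr (q - 2) / (q - 2))"
        using nn_integral_powr_0(1)[of "q - 3" ?L] q2 D B by (subst nn_integral_cmult) auto
      also have "\<dots> = ennreal ((norm (g \<xi>))\<^sup>2 * (4 * q / ?c\<^sup>2) * (?L powr (q - 2) / (q - 2)))"
        using q2 by (simp flip: ennreal_mult)
      also have "?L powr (q - 2) = D powr (q - 2) * B powr (q - 2) * norm \<xi> powr (2 * s)"
        using D B nq2 by (simp add: powr_mult powr_powr)
      also have "(norm (g \<xi>))\<^sup>2 * (4 * q / ?c\<^sup>2) * (D powr (q - 2) * B powr (q - 2) * norm \<xi> powr (2 * s) / (q - 2))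
          = 4 * q * D powr (q - 2) / (?c\<^sup>2 * (q - 2)) * B powr (q - 2) * (norm \<xi> powr (2 * s) * (norm (g \<xi>))\<^sup>2)"
        by (simp add: field_simps)
      finally show "(\<integral>\<^sup>+l. ennreal ((norm (g \<xi>))\<^sup>2) * (ennreal (4 * q / ?c\<^sup>2 * l powr (q - 3)) * indicator {l. 0 < l \<and> A l \<le> norm \<xi>} l) \<partial>lborel)
          \<le> ennreal (4 * q * D powr (q - 2) / (?c\<^sup>2 * (q - 2)) * B powr (q - 2)) *
        ennreal (norm \<xi> powr (2 * s) * (norm (g \<xi>))\<^sup>2)"
        using q2 by (simp flip: ennreal_mult)
    qed
    also have "\<dots> = ennreal (4 * q * D powr (q - 2) / (?c\<^sup>2 * (q - 2)) * B powr (q - 2)) *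
        (\<integral>\<^sup>+\<xi>. ennreal (norm \<xi> powr (2 * s) * (norm (g \<xi>))\<^sup>2) \<partial>lborel)"
      by (rule nn_integral_cmult) measurable
    also have "\<dots> \<le> ennreal (4 * q * D powr (q - 2) / (?c\<^sup>2 * (q - 2)) * B powr (q - 2)) * ennreal (B\<^sup>2)"
      by (intro mult_left_mono gB) simp
    also have "\<dots> = ennreal (4 * q * D powr (q - 2) / (?c\<^sup>2 * (q - 2)) * B powr q)"
    proof -
      have "B powr q = B powr (q - 2) * B\<^sup>2"
        using B powr_add[of B "q - 2" 2] powr_realpow[OF B, of 2] by simp
      then show ?thesis using q2 by (simp add: mult.assoc flip: ennreal_mult)
    qed
    finally show "(\<integral>\<^sup>+x. ennreal (norm (f x) powr q) \<partial>lborel)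
        \<le> ennreal (4 * q * D powr (q - 2) / (?c\<^sup>2 * (q - 2)) * B powr q)" .
  qed
qed

text \<open>The energy is weighted with \<open>T\<close> so that the two decay rates of an energy solution enter at
  once; \<open>q\<close> is the Sobolev exponent of \<open>|D|\<^sup>s\<close> with \<open>s = n (1/2 - 1/q) \<le> \<sigma>\<close>.\<close>

lemma gagliardo_nirenberg:
  fixes \<sigma> q n :: real
  defines "n \<equiv> real CARD('n::finite)"
  assumes \<sigma>: "\<sigma> > 0" and q: "q \<ge> 2" and le: "n * (1 / 2 - 1 / q) \<le> \<sigma>"
  shows "\<exists>C\<ge>0. \<forall>(f :: 'n field) g T E. has_fourier f g \<longrightarrow> T > 0 \<longrightarrow> E > 0 \<longrightarrow>
    (\<integral>\<^sup>+\<xi>. ennreal ((1 + T * norm \<xi> powr (2 * \<sigma>)) * (norm (g \<xi>))\<^sup>2) \<partial>lborel) \<le> ennreal E \<longrightarrow>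
    (\<integral>\<^sup>+x. ennreal (norm (f x) powr q) \<partial>lborel) \<le> ennreal (C * (E powr (q / 2) * T powr (- (n * (q / 2 - 1) / (2 * \<sigma>)))))"
proof (cases "q = 2")
  \<comment> \<open>For q = 2 the Sobolev order s would be 0, outside the range of
    \<open>sobolev_homogeneous\<close>; Plancherel alone gives the claim.\<close>
  case True
  let ?c = "fconst TYPE('n)"
  have c: "?c > 0" by simp
  show ?thesis
  proof (intro exI[of _ "1 / ?c\<^sup>2"] conjI allI impI)
    fix f g :: "'n field" and T E :: real
    assume h: "has_fourier f g" and T: "T > 0" and E: "E > 0"
      and b: "(\<integral>\<^sup>+\<xi>. ennreal ((1 + T * norm \<xi> powr (2 * \<sigma>)) * (norm (g \<xi>))\<^sup>2) \<partial>lborel) \<le> ennreal E"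
    note L = has_fourier_L2[OF h]
    have "ennreal ((L2norm g)\<^sup>2) \<le> (\<integral>\<^sup>+\<xi>. ennreal ((1 + T * norm \<xi> powr (2 * \<sigma>)) * (norm (g \<xi>))\<^sup>2) \<partial>lborel)"
      unfolding nn_integral_L2[OF L(2), symmetric]
    proof (intro nn_integral_mono ennreal_leI)
      fix \<xi> :: "real ^ 'n"
      have "1 * (norm (g \<xi>))\<^sup>2 \<le> (1 + T * norm \<xi> powr (2 * \<sigma>)) * (norm (g \<xi>))\<^sup>2"
        using T by (intro mult_right_mono) auto
      then show "(norm (g \<xi>))\<^sup>2 \<le> (1 + T * norm \<xi> powr (2 * \<sigma>)) * (norm (g \<xi>))\<^sup>2" by simp
    qed
    then have "(L2norm g)\<^sup>2 \<le> E" using b E by (meson ennreal_le_iff less_imp_le order_trans)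
    then have "(L2norm f)\<^sup>2 \<le> E / ?c\<^sup>2"
      using has_fourier_norm[OF h] c by (simp add: field_simps power_mult_distrib)
    then have "(\<integral>\<^sup>+x. ennreal ((norm (f x))\<^sup>2) \<partial>lborel) \<le> ennreal (E / ?c\<^sup>2)"
      unfolding nn_integral_L2[OF L(1)] by (rule ennreal_leI)
    then show "(\<integral>\<^sup>+x. ennreal (norm (f x) powr q) \<partial>lborel) \<le> ennreal (1 / ?c\<^sup>2 * (E powr (q / 2) * T powr (- (n * (q / 2 - 1) / (2 * \<sigma>)))))"
      using True E T by (simp add: powr_numeral)
  qed simp
next
  case False
  then have q2: "q > 2" using q by simp
  have n: "n > 0" by (simp add: n_def)
  define s where "s = n * (1 / 2 - 1 / q)"
  define \<theta> where "\<theta> = s / \<sigma>"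
  have s: "0 < s" "2 * s < n" using q2 n by (auto simp: s_def field_simps)
  have \<theta>: "0 < \<theta>" "\<theta> \<le> 1" using s \<sigma> le by (auto simp: \<theta>_def s_def)
  have \<theta>\<sigma>: "\<theta> * \<sigma> = s" using \<sigma> by (simp add: \<theta>_def)
  have nq: "2 * n / (n - 2 * s) = q" using q2 n by (simp add: s_def field_simps)
  obtain C where C: "C \<ge> 0" and sob: "\<And>(f :: 'n field) g B. has_fourier f g \<Longrightarrow> B > 0 \<Longrightarrow>
     (\<integral>\<^sup>+\<xi>. ennreal (norm \<xi> powr (2 * s) * (norm (g \<xi>))\<^sup>2) \<partial>lborel) \<le> ennreal (B\<^sup>2) \<Longrightarrow>
     (\<integral>\<^sup>+x. ennreal (norm (f x) powr q) \<partial>lborel) \<le> ennreal (C * B powr q)"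
    using sobolev_homogeneous[where 'n='n, of s] s nq unfolding n_def by auto
  show ?thesis
  proof (intro exI[of _ C] conjI allI impI C)
    fix f g :: "'n field" and T E :: real
    assume h: "has_fourier f g" and T: "T > 0" and E: "E > 0"
      and b: "(\<integral>\<^sup>+\<xi>. ennreal ((1 + T * norm \<xi> powr (2 * \<sigma>)) * (norm (g \<xi>))\<^sup>2) \<partial>lborel) \<le> ennreal E"
    note [measurable] = has_fourier_L2[OF h, THEN L2_measurable]
    define B where "B = sqrt (T powr (- \<theta>) * E)"
    have B: "B > 0" "B\<^sup>2 = T powr (- \<theta>) * E" using T E by (auto simp: B_def)
    \<comment> \<open>Interpolation at the level of symbols: with y = T |\<xi>|^(2\<sigma>) and
      \<theta> = s/\<sigma> at most 1, the weight |\<xi>|^(2s) is dominated by T^(-\<theta>) times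
      the weight of the energy.\<close>
    have young: "y powr \<theta> \<le> 1 + y" if "y \<ge> 0" for y :: real
    proof (cases "y \<le> 1")
      case True
      then have "y powr \<theta> \<le> 1" using that \<theta> by (simp add: powr_le1)
      then show ?thesis using that by simp
    next
      case False
      then have "y powr \<theta> \<le> y powr 1" using \<theta> by (intro powr_mono) auto
      then show ?thesis using False by simp
    qed
    have pw: "norm \<xi> powr (2 * s) \<le> T powr (- \<theta>) * (1 + T * norm \<xi> powr (2 * \<sigma>))" for \<xi> :: "real ^ 'n"
    proof -
      have "(T * norm \<xi> powr (2 * \<sigma>)) powr \<theta> = T powr \<theta> * norm \<xi> powr (2 * s)"
      proof -
        have "2 * \<sigma> * \<theta> = 2 * s" unfolding \<theta>\<sigma>[symmetric] by simp
        then show ?thesis using T by (simp only: powr_mult powr_powr)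
      qed
      moreover have "T powr (- \<theta>) * T powr \<theta> = 1" using T by (simp flip: powr_add)
      ultimately have "norm \<xi> powr (2 * s) = T powr (- \<theta>) * (T * norm \<xi> powr (2 * \<sigma>)) powr \<theta>"
        by (simp flip: mult.assoc)
      also have "\<dots> \<le> T powr (- \<theta>) * (1 + T * norm \<xi> powr (2 * \<sigma>))"
        using T by (intro mult_left_mono young) auto
      finally show ?thesis .
    qed
    have "(\<integral>\<^sup>+\<xi>. ennreal (norm \<xi> powr (2 * s) * (norm (g \<xi>))\<^sup>2) \<partial>lborel)
        \<le> (\<integral>\<^sup>+\<xi>. ennreal (T powr (- \<theta>)) * ennreal ((1 + T * norm \<xi> powr (2 * \<sigma>)) * (norm (g \<xi>))\<^sup>2) \<partial>lborel)"
    proof (rule nn_integral_mono)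
      fix \<xi> :: "real ^ 'n"
      have "norm \<xi> powr (2 * s) * (norm (g \<xi>))\<^sup>2 \<le> T powr (- \<theta>) * (1 + T * norm \<xi> powr (2 * \<sigma>)) * (norm (g \<xi>))\<^sup>2"
        by (intro mult_right_mono pw) simp
      then have "ennreal (norm \<xi> powr (2 * s) * (norm (g \<xi>))\<^sup>2)
          \<le> ennreal (T powr (- \<theta>) * ((1 + T * norm \<xi> powr (2 * \<sigma>)) * (norm (g \<xi>))\<^sup>2))"
        by (intro ennreal_leI) (simp add: mult.assoc)
      also have "\<dots> = ennreal (T powr (- \<theta>)) * ennreal ((1 + T * norm \<xi> powr (2 * \<sigma>)) * (norm (g \<xi>))\<^sup>2)"
        using T by (intro ennreal_mult) auto
      finally show "ennreal (norm \<xi> powr (2 * s) * (norm (g \<xi>))\<^sup>2)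
          \<le> ennreal (T powr (- \<theta>)) * ennreal ((1 + T * norm \<xi> powr (2 * \<sigma>)) * (norm (g \<xi>))\<^sup>2)" .
    qed
    also have "\<dots> = ennreal (T powr (- \<theta>)) * (\<integral>\<^sup>+\<xi>. ennreal ((1 + T * norm \<xi> powr (2 * \<sigma>)) * (norm (g \<xi>))\<^sup>2) \<partial>lborel)"
      by (rule nn_integral_cmult) measurable
    also have "\<dots> \<le> ennreal (T powr (- \<theta>)) * ennreal E" by (intro mult_left_mono b) simp
    also have "\<dots> = ennreal (B\<^sup>2)" unfolding B(2) using E by (simp flip: ennreal_mult)
    finally have "(\<integral>\<^sup>+x. ennreal (norm (f x) powr q) \<partial>lborel) \<le> ennreal (C * B powr q)"
      by (rule sob[OF h B(1)])
    also have "B powr q = E powr (q / 2) * T powr (- (n * (q / 2 - 1) / (2 * \<sigma>)))"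
    proof -
      have "- \<theta> * (q / 2) = - (n * (q / 2 - 1) / (2 * \<sigma>))"
        using q2 \<sigma> by (simp add: \<theta>_def s_def field_simps)
      then have "(T powr (- \<theta>)) powr (q / 2) = T powr (- (n * (q / 2 - 1) / (2 * \<sigma>)))"
        by (simp only: powr_powr)
      moreover have "B powr q = (T powr (- \<theta>) * E) powr (q / 2)"
        using T E by (simp add: B_def powr_half_sqrt[symmetric] powr_powr)
      ultimately show ?thesis using T E by (simp add: powr_mult mult.commute)
    qed
    finally show "(\<integral>\<^sup>+x. ennreal (norm (f x) powr q) \<partial>lborel)
        \<le> ennreal (C * (E powr (q / 2) * T powr (- (n * (q / 2 - 1) / (2 * \<sigma>)))))" .
  qed
qed

section \<open>Energy solutions\<close>

definition rho :: "real \<Rightarrow> real ^ 'n::finite \<Rightarrow> real" where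
  "rho \<sigma> \<xi> = norm \<xi> powr (2 * \<sigma>)"

lemma rho_measurable [measurable]: "rho \<sigma> \<in> borel_measurable borel"
  unfolding rho_def[abs_def] by measurable

lemma rho_nonneg [simp]: "rho \<sigma> \<xi> \<ge> 0"
  by (simp add: rho_def)

lemma rho_half: "rho \<sigma> \<xi> powr (1 / 2) = norm \<xi> powr \<sigma>"
  by (simp add: rho_def powr_powr)

text \<open>The increment is s - t times a difference quotient, whose norm stays bounded near t.
  Continuity of u in L^2 is thus read off from the C^1 part of the energy class.\<close>

lemma has_L2_deriv_imp_continuous:
  assumes d: "has_L2_deriv u v t" and u: "\<And>s. s \<ge> 0 \<Longrightarrow> u s \<in> L2" and t: "t \<ge> 0"
  shows "((\<lambda>s. L2norm (\<lambda>x. u s x - u t x)) \<longlongrightarrow> 0) (at t within {0..})"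
proof -
  let ?q = "\<lambda>s x. (u s x - u t x) / of_real (s - t)"
  have v: "v \<in> L2" and q: "((\<lambda>s. L2norm (\<lambda>x. ?q s x - v x)) \<longlongrightarrow> 0) (at t within {0..})"
    using d by (auto simp: has_L2_deriv_def tendsto_L2_def)
  have qL: "?q s \<in> L2" if "s \<ge> 0" for s
    using L2_cmult[OF L2_diff[OF u[OF that] u[OF t]], of "1 / of_real (s - t)"] by simp
  have "((\<lambda>s. s - t) \<longlongrightarrow> t - t) (at t within {0..})" by (intro tendsto_intros)
  then have "((\<lambda>s. \<bar>s - t\<bar> * (L2norm (\<lambda>x. ?q s x - v x) + L2norm v)) \<longlongrightarrow> \<bar>t - t\<bar> * (0 + L2norm v)) (at t within {0..})"
    by (intro tendsto_intros q) 
  then have lim: "((\<lambda>s. \<bar>s - t\<bar> * (L2norm (\<lambda>x. ?q s x - v x) + L2norm v)) \<longlongrightarrow> 0) (at t within {0..})" by simp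
  show ?thesis
  proof (rule tendsto_sandwich[OF _ _ tendsto_const lim])
    show "\<forall>\<^sub>F s in at t within {0..}. L2norm (\<lambda>x. u s x - u t x) \<le> \<bar>s - t\<bar> * (L2norm (\<lambda>x. ?q s x - v x) + L2norm v)"
      unfolding eventually_at_filter
    proof (intro always_eventually allI impI)
      fix s assume s: "s \<noteq> t" "s \<in> {0..}"
      have "(\<lambda>x. u s x - u t x) = (\<lambda>x. of_real (s - t) * ?q s x)" using s by (auto simp del: of_real_diff)
      then have "L2norm (\<lambda>x. u s x - u t x) = \<bar>s - t\<bar> * L2norm (?q s)"
        by (simp only: L2norm_cmult norm_of_real)
      also have "L2norm (?q s) \<le> L2norm (\<lambda>x. ?q s x - v x) + L2norm v"
        using L2norm_triangle[OF L2_diff[OF qL v] v, of s] s by simp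
      finally show "L2norm (\<lambda>x. u s x - u t x) \<le> \<bar>s - t\<bar> * (L2norm (\<lambda>x. ?q s x - v x) + L2norm v)"
        by (simp add: mult_left_mono)
    qed
  qed simp
qed

text \<open>Mean value theorem; the symmetric sum of powers spares the later use from knowing which
  argument is larger. It gives the local Lipschitz bound for |u|^p.\<close>

lemma powr_diff_le:
  fixes a b p :: real
  assumes "a \<ge> 0" "b \<ge> 0" "p \<ge> 1"
  shows "\<bar>a powr p - b powr p\<bar> \<le> p * (a powr (p - 1) + b powr (p - 1)) * \<bar>a - b\<bar>"
proof -
  have key: "y powr p - x powr p \<le> p * y powr (p - 1) * (y - x)" if "0 \<le> x" "x < y" for x y
  proof -
    have der: "((\<lambda>z. z powr p) has_real_derivative p * z powr (p - 1)) (at z)" if "z > 0" for z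
      using that by (auto intro!: derivative_eq_intros)
    have "\<exists>l z. x < z \<and> z < y \<and> ((\<lambda>z. z powr p) has_real_derivative l) (at z) \<and> y powr p - x powr p = (y - x) * l"
    proof (rule MVT[OF that(2)])
      show "continuous_on {x..y} (\<lambda>z. z powr p)"
        using that assms by (intro continuous_on_powr' continuous_intros) auto
      show "(\<lambda>z. z powr p) differentiable (at z)" if "x < z" "z < y" for z
        using der[of z] that \<open>0 \<le> x\<close> real_differentiable_def by auto
    qed
    then obtain l z where z: "x < z" "z < y" "((\<lambda>z. z powr p) has_real_derivative l) (at z)" "y powr p - x powr p = (y - x) * l"
      by blast
    have "l = p * z powr (p - 1)" using DERIV_unique[OF z(3) der[of z]] z that by linarith
    with z(4) have z4: "y powr p - x powr p = (y - x) * (p * z powr (p - 1))" by simp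
    have "z powr (p - 1) \<le> y powr (p - 1)" using z that assms by (intro powr_mono2) auto
    then show ?thesis unfolding z4 using that assms by (simp add: mult_left_mono mult_ac)
  qed
  have "0 \<le> p * a powr (p - 1) * \<bar>a - b\<bar>" "0 \<le> p * b powr (p - 1) * \<bar>a - b\<bar>" using assms by auto
  note nonneg = this
  have split: "p * (a powr (p - 1) + b powr (p - 1)) * \<bar>a - b\<bar>
      = p * a powr (p - 1) * \<bar>a - b\<bar> + p * b powr (p - 1) * \<bar>a - b\<bar>"
    by (simp only: distrib_left distrib_right)
  have mono: "x powr p \<le> y powr p" if "0 \<le> x" "x < y" for x y using that assms by (intro powr_mono2) auto
  show ?thesis
  proof (cases a b rule: linorder_cases)
    case less
    then have e: "\<bar>a - b\<bar> = b - a" "\<bar>a powr p - b powr p\<bar> = b powr p - a powr p"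
      using mono[of a b] assms by auto
    show ?thesis using key[OF assms(1) less] nonneg unfolding split unfolding e by linarith
  next
    case greater
    then have e: "\<bar>a - b\<bar> = a - b" "\<bar>a powr p - b powr p\<bar> = a powr p - b powr p"
      using mono[of b a] assms by auto
    show ?thesis using key[OF assms(2) greater] nonneg unfolding split unfolding e by linarith
  qed simp
qed

text \<open>\<open>sobolev_p\<close> says that the Sobolev order belonging to the exponent 2p is at
  most \<sigma>, equivalently p (n - 2\<sigma>) \<le> n. It covers both dimension ranges at once and
  is the form that \<open>gagliardo_nirenberg\<close> consumes.\<close>

locale energy_solution =
  fixes \<sigma> p n :: real and u0 u1 :: "'n::finite field" and u :: "real \<Rightarrow> 'n field"
  assumes n_eq: "n = real CARD('n)" and sigma: "\<sigma> \<ge> 1" and p2: "p \<ge> 2"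
    and sobolev_p: "n * (1 / 2 - 1 / (2 * p)) \<le> \<sigma>"
    and supercritical: "p > 1 + 2 * \<sigma> / n"
    and data: "(u0, u1) \<in> A1 \<sigma>" and sol: "global_energy_solution \<sigma> p u0 u1 u"
begin

section \<open>Decay and time continuity of the source\<close>

definition "\<alpha> = n * (p - 1) / (2 * \<sigma>)"

definition "\<beta> = \<alpha> + n / (4 * \<sigma>)"

lemma n_pos: "n > 0"
  by (simp add: n_eq)

lemma alpha_gt_1: "\<alpha> > 1"
  using supercritical sigma n_pos by (simp add: \<alpha>_def field_simps)

lemma u_L2: "t \<ge> 0 \<Longrightarrow> u t \<in> L2"
  and u_deriv: "t \<ge> 0 \<Longrightarrow> has_L2_deriv u (L2_deriv u t) t"
  and u_Hs: "t \<ge> 0 \<Longrightarrow> (\<lambda>\<xi>. of_real (bessel_symbol \<sigma> \<xi>) * fourier (u t) \<xi>) \<in> L2"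
  using sol by (auto simp: global_energy_solution_def energy_class_def Hs_def)

text \<open>The decay assumption speaks about the norm of \<open>abs_D \<sigma> (u t)\<close>.
  Comparing |\<xi>|^\<sigma> with the Bessel symbol shows that this multiplier acts within its
  domain, so Plancherel may be applied to it.\<close>

lemma bessel_weight:
  fixes f :: "'n field"
  assumes f: "f \<in> L2" "(\<lambda>\<xi>. of_real (bessel_symbol \<sigma> \<xi>) * fourier f \<xi>) \<in> L2"
  shows "(\<lambda>\<xi>. of_real (norm \<xi> powr \<sigma>) * fourier f \<xi>) \<in> L2"
proof (rule L2_bound[OF f(2), where C=1])
  have [measurable]: "fourier f \<in> borel_measurable borel" by (rule L2_measurable[OF fourier_L2[OF f(1)]])
  show "(\<lambda>\<xi>. of_real (norm \<xi> powr \<sigma>) * fourier f \<xi>) \<in> borel_measurable borel" by measurable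
  have nn: "bessel_symbol \<sigma> \<xi> \<ge> 0" for \<xi> :: "real ^ 'n" by (simp add: bessel_symbol_def)
  have "norm \<xi> powr \<sigma> \<le> bessel_symbol \<sigma> \<xi>" for \<xi> :: "real ^ 'n"
  proof -
    have "norm \<xi> powr \<sigma> = ((norm \<xi>)\<^sup>2) powr (\<sigma> / 2)"
      by (cases "\<xi> = 0") (simp_all add: powr_powr flip: powr_numeral)
    also have "\<dots> \<le> bessel_symbol \<sigma> \<xi>" unfolding bessel_symbol_def
      using sigma by (intro powr_mono2) auto
    finally show ?thesis .
  qed
  then show "AE \<xi> in lborel. norm (of_real (norm \<xi> powr \<sigma>) * fourier f \<xi>)
      \<le> 1 * norm (of_real (bessel_symbol \<sigma> \<xi>) * fourier f \<xi>)"
    by (intro AE_I2) (simp add: norm_mult nn mult_right_mono)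
qed

text \<open>The gradient term decays by an extra (1 + t)^(-1/2), which its square turns into exactly
  the weight 1 + t. Both terms then share one rate.\<close>

lemma energy_bound:
  "\<exists>K>0. \<forall>t\<ge>0. (\<integral>\<^sup>+\<xi>. ennreal ((1 + (1 + t) * norm \<xi> powr (2 * \<sigma>)) * (norm (fourier (u t) \<xi>))\<^sup>2) \<partial>lborel)
     \<le> ennreal (K * (1 + t) powr (- (n / (2 * \<sigma>))))"
proof -
  let ?c = "fconst TYPE('n)"
  obtain C where C: "energy_decay \<sigma> C u0 u1 u" using sol by (auto simp: global_energy_solution_def)
  \<comment> \<open>The sign of \<open>C\<close> is unknown and \<open>gagliardo_nirenberg\<close>
    wants a strictly positive energy, hence the absolute value and the added 1.\<close>
  define C' where "C' = \<bar>C * A1_norm \<sigma> u0 u1\<bar> + 1"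
  have C': "C' > 0" "C * A1_norm \<sigma> u0 u1 \<le> C'" by (auto simp: C'_def)
  show ?thesis
  proof (intro exI[of _ "2 * (?c * C')\<^sup>2"] conjI allI impI)
    show "2 * (?c * C')\<^sup>2 > 0" using C' by simp
    fix t :: real assume t: "t \<ge> 0"
    have g: "has_fourier (u t) (fourier (u t))" by (rule has_fourier_fourier[OF u_L2[OF t]])
    note gL = has_fourier_L2(2)[OF g]
    let ?G = "\<lambda>\<xi>. of_real (norm \<xi> powr \<sigma>) * fourier (u t) \<xi>"
    have GL: "?G \<in> L2" by (rule bessel_weight[OF u_L2[OF t] u_Hs[OF t]])
    have hG: "has_fourier (abs_D \<sigma> (u t)) ?G"
      unfolding abs_D_def by (rule has_fourier_mult[OF g _ GL]) measurable
    note [measurable] = L2_measurable[OF gL]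
    have b1: "L2norm (fourier (u t)) \<le> ?c * (C' * (1 + t) powr (- (n / (4 * \<sigma>))))"
    proof -
      have "L2norm (u t) \<le> C * (1 + t) powr (- (n / (4 * \<sigma>))) * A1_norm \<sigma> u0 u1"
        using C t by (auto simp: energy_decay_def n_eq)
      also have "\<dots> = (C * A1_norm \<sigma> u0 u1) * (1 + t) powr (- (n / (4 * \<sigma>)))" by simp
      also have "\<dots> \<le> C' * (1 + t) powr (- (n / (4 * \<sigma>)))" by (intro mult_right_mono C') simp
      finally show ?thesis unfolding has_fourier_norm[OF g] by (intro mult_left_mono) simp_all
    qed
    have b2: "L2norm ?G \<le> ?c * (C' * (1 + t) powr (- (n / (4 * \<sigma>)) - 1 / 2))"
    proof -
      have "L2norm (abs_D \<sigma> (u t)) \<le> C * (1 + t) powr (- (n / (4 * \<sigma>)) - 1 / 2) * A1_norm \<sigma> u0 u1"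
        using C t by (auto simp: energy_decay_def n_eq)
      also have "\<dots> = (C * A1_norm \<sigma> u0 u1) * (1 + t) powr (- (n / (4 * \<sigma>)) - 1 / 2)" by simp
      also have "\<dots> \<le> C' * (1 + t) powr (- (n / (4 * \<sigma>)) - 1 / 2)" by (intro mult_right_mono C') simp
      finally show ?thesis unfolding has_fourier_norm[OF hG] by (intro mult_left_mono) simp_all
    qed
    have sq: "(x powr \<sigma>)\<^sup>2 = x powr (2 * \<sigma>)" for x :: real
      by (simp add: power2_eq_square flip: powr_add)
    have "(\<integral>\<^sup>+\<xi>. ennreal ((1 + (1 + t) * norm \<xi> powr (2 * \<sigma>)) * (norm (fourier (u t) \<xi>))\<^sup>2) \<partial>lborel)
        = (\<integral>\<^sup>+\<xi>. ennreal ((norm (fourier (u t) \<xi>))\<^sup>2) + ennreal (1 + t) * ennreal ((norm (?G \<xi>))\<^sup>2) \<partial>lborel)"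
    proof (rule nn_integral_cong)
      fix \<xi> :: "real ^ 'n"
      have "(1 + (1 + t) * norm \<xi> powr (2 * \<sigma>)) * (norm (fourier (u t) \<xi>))\<^sup>2
          = (norm (fourier (u t) \<xi>))\<^sup>2 + (1 + t) * (norm (?G \<xi>))\<^sup>2"
        by (simp add: norm_mult power_mult_distrib sq algebra_simps)
      then show "ennreal ((1 + (1 + t) * norm \<xi> powr (2 * \<sigma>)) * (norm (fourier (u t) \<xi>))\<^sup>2)
          = ennreal ((norm (fourier (u t) \<xi>))\<^sup>2) + ennreal (1 + t) * ennreal ((norm (?G \<xi>))\<^sup>2)"
        using t by (simp flip: ennreal_mult ennreal_plus)
    qed
    also have "\<dots> = ennreal ((L2norm (fourier (u t)))\<^sup>2) + ennreal (1 + t) * ennreal ((L2norm ?G)\<^sup>2)"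
      unfolding nn_integral_L2[OF gL, symmetric] nn_integral_L2[OF GL, symmetric]
      by (subst nn_integral_add) (simp_all add: nn_integral_cmult)
    also have "\<dots> = ennreal ((L2norm (fourier (u t)))\<^sup>2 + (1 + t) * (L2norm ?G)\<^sup>2)"
      using t by (simp flip: ennreal_mult ennreal_plus)
    also have "\<dots> \<le> ennreal (2 * (?c * C')\<^sup>2 * (1 + t) powr (- (n / (2 * \<sigma>))))"
    proof (rule ennreal_leI)
      have sq': "(?c * (C' * x))\<^sup>2 = (?c * C')\<^sup>2 * x\<^sup>2" for x by (simp add: power_mult_distrib)
      have e1: "((1 + t) powr (- (n / (4 * \<sigma>))))\<^sup>2 = (1 + t) powr (- (n / (2 * \<sigma>)))"
        by (simp add: power2_eq_square flip: powr_add)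
      have e2: "(1 + t) * ((1 + t) powr (- (n / (4 * \<sigma>)) - 1 / 2))\<^sup>2 = (1 + t) powr (- (n / (2 * \<sigma>)))"
      proof -
        have "(1 + t) * ((1 + t) powr (- (n / (4 * \<sigma>)) - 1 / 2))\<^sup>2
            = (1 + t) powr 1 * ((1 + t) powr (- (n / (4 * \<sigma>)) - 1 / 2) * (1 + t) powr (- (n / (4 * \<sigma>)) - 1 / 2))"
          using t by (simp add: power2_eq_square)
        also have "\<dots> = (1 + t) powr (1 + ((- (n / (4 * \<sigma>)) - 1 / 2) + (- (n / (4 * \<sigma>)) - 1 / 2)))"
          by (simp only: powr_add)
        also have "1 + ((- (n / (4 * \<sigma>)) - 1 / 2) + (- (n / (4 * \<sigma>)) - 1 / 2)) = - (n / (2 * \<sigma>))"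
          using sigma by (simp add: field_simps)
        finally show ?thesis .
      qed
      have "(L2norm (fourier (u t)))\<^sup>2 \<le> (?c * C')\<^sup>2 * (1 + t) powr (- (n / (2 * \<sigma>)))"
        using power_mono[OF b1, of 2] by (simp only: L2norm_nonneg sq' e1)
      moreover have "(1 + t) * (L2norm ?G)\<^sup>2 \<le> (1 + t) * (?c * (C' * (1 + t) powr (- (n / (4 * \<sigma>)) - 1 / 2)))\<^sup>2"
        using t by (intro mult_left_mono power_mono b2) auto
      moreover have "(1 + t) * (?c * (C' * (1 + t) powr (- (n / (4 * \<sigma>)) - 1 / 2)))\<^sup>2
          = (?c * C')\<^sup>2 * (1 + t) powr (- (n / (2 * \<sigma>)))"
        unfolding sq' e2[symmetric] by (simp only: mult_ac)
      ultimately show "(L2norm (fourier (u t)))\<^sup>2 + (1 + t) * (L2norm ?G)\<^sup>2 \<le> 2 * (?c * C')\<^sup>2 * (1 + t) powr (- (n / (2 * \<sigma>)))"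
        by linarith
    qed
    finally show "(\<integral>\<^sup>+\<xi>. ennreal ((1 + (1 + t) * norm \<xi> powr (2 * \<sigma>)) * (norm (fourier (u t) \<xi>))\<^sup>2) \<partial>lborel)
     \<le> ennreal (2 * (?c * C')\<^sup>2 * (1 + t) powr (- (n / (2 * \<sigma>))))" .
  qed
qed

text \<open>With T = 1 + t the energy rate and the interpolation factor add up to n (q -
  1)/(2\<sigma>), the rate of the q-th power of the L^q norm of the heat kernel. It is used for q =
  p, 2p and 2(p - 1).\<close>

lemma u_Lq_decay:
  assumes q: "2 \<le> q" "q \<le> 2 * p"
  shows "\<exists>C\<ge>0. \<forall>t\<ge>0. (\<integral>\<^sup>+x. ennreal (norm (u t x) powr q) \<partial>lborel) \<le> ennreal (C * (1 + t) powr (- (n * (q - 1) / (2 * \<sigma>))))"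
proof -
  obtain K where K: "K > 0" and Kb: "\<And>t. t \<ge> 0 \<Longrightarrow>
     (\<integral>\<^sup>+\<xi>. ennreal ((1 + (1 + t) * norm \<xi> powr (2 * \<sigma>)) * (norm (fourier (u t) \<xi>))\<^sup>2) \<partial>lborel)
     \<le> ennreal (K * (1 + t) powr (- (n / (2 * \<sigma>))))"
    using energy_bound by blast
  have "1 / (2 * p) \<le> 1 / q" using q p2 by (intro divide_left_mono) auto
  then have "n * (1 / 2 - 1 / q) \<le> n * (1 / 2 - 1 / (2 * p))" by (intro mult_left_mono) (use n_pos in auto)
  then have le: "n * (1 / 2 - 1 / q) \<le> \<sigma>" using sobolev_p by linarith
  obtain C where C: "C \<ge> 0" and gn: "\<And>(f :: 'n field) g T E. has_fourier f g \<Longrightarrow> T > 0 \<Longrightarrow> E > 0 \<Longrightarrow>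
    (\<integral>\<^sup>+\<xi>. ennreal ((1 + T * norm \<xi> powr (2 * \<sigma>)) * (norm (g \<xi>))\<^sup>2) \<partial>lborel) \<le> ennreal E \<Longrightarrow>
    (\<integral>\<^sup>+x. ennreal (norm (f x) powr q) \<partial>lborel) \<le> ennreal (C * (E powr (q / 2) * T powr (- (n * (q / 2 - 1) / (2 * \<sigma>)))))"
    using gagliardo_nirenberg[where 'n='n, of \<sigma> q] sigma q le unfolding n_eq by auto
  show ?thesis
  proof (intro exI[of _ "C * K powr (q / 2)"] conjI allI impI)
    show "C * K powr (q / 2) \<ge> 0" using C by simp
    fix t :: real assume t: "t \<ge> 0"
    have "(\<integral>\<^sup>+x. ennreal (norm (u t x) powr q) \<partial>lborel)
        \<le> ennreal (C * ((K * (1 + t) powr (- (n / (2 * \<sigma>)))) powr (q / 2) * (1 + t) powr (- (n * (q / 2 - 1) / (2 * \<sigma>)))))"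
      by (rule gn[OF has_fourier_fourier[OF u_L2[OF t]] _ _ Kb[OF t]]) (use t K in auto)
    also have "C * ((K * (1 + t) powr (- (n / (2 * \<sigma>)))) powr (q / 2) * (1 + t) powr (- (n * (q / 2 - 1) / (2 * \<sigma>))))
        = C * K powr (q / 2) * ((1 + t) powr (- (n / (2 * \<sigma>)) * (q / 2)) * (1 + t) powr (- (n * (q / 2 - 1) / (2 * \<sigma>))))"
      using t K by (simp add: powr_mult powr_powr)
    also have "(1 + t) powr (- (n / (2 * \<sigma>)) * (q / 2)) * (1 + t) powr (- (n * (q / 2 - 1) / (2 * \<sigma>)))
        = (1 + t) powr (- (n / (2 * \<sigma>)) * (q / 2) + - (n * (q / 2 - 1) / (2 * \<sigma>)))"
      by (rule powr_add[symmetric])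
    also have "- (n / (2 * \<sigma>)) * (q / 2) + - (n * (q / 2 - 1) / (2 * \<sigma>)) = - (n * (q - 1) / (2 * \<sigma>))"
      using sigma by (simp add: field_simps)
    finally show "(\<integral>\<^sup>+x. ennreal (norm (u t x) powr q) \<partial>lborel) \<le> ennreal (C * K powr (q / 2) * (1 + t) powr (- (n * (q - 1) / (2 * \<sigma>))))" .
  qed
qed

definition F :: "real \<Rightarrow> 'n field" where
  "F \<tau> x = of_real (norm (u \<tau> x) powr p)"

text \<open>The L^1 norm is the case q = p and the squared L^2 norm the case q = 2p, for which n (2p
  - 1)/(2\<sigma>) = 2\<beta>.\<close>

lemma F_bounds:
  "\<exists>C>0. \<forall>\<tau>\<ge>0. F \<tau> \<in> L1 \<and> F \<tau> \<in> L2 \<and> L1norm (F \<tau>) \<le> C * (1 + \<tau>) powr (- \<alpha>) \<and> L2norm (F \<tau>) \<le> C * (1 + \<tau>) powr (- \<beta>)"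
proof -
  obtain C1 where C1: "C1 \<ge> 0" "\<And>t. t \<ge> 0 \<Longrightarrow> (\<integral>\<^sup>+x. ennreal (norm (u t x) powr p) \<partial>lborel) \<le> ennreal (C1 * (1 + t) powr (- \<alpha>))"
    using u_Lq_decay[of p] p2 unfolding \<alpha>_def by auto
  obtain C2 where C2: "C2 \<ge> 0" "\<And>t. t \<ge> 0 \<Longrightarrow> (\<integral>\<^sup>+x. ennreal (norm (u t x) powr (2 * p)) \<partial>lborel)
      \<le> ennreal (C2 * (1 + t) powr (- (n * (2 * p - 1) / (2 * \<sigma>))))"
    using u_Lq_decay[of "2 * p"] p2 by auto
  have e2b: "- (n * (2 * p - 1) / (2 * \<sigma>)) = - \<beta> + - \<beta>"
    using sigma by (simp add: \<alpha>_def \<beta>_def field_simps)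
  show ?thesis
  proof (intro exI[of _ "C1 + sqrt C2 + 1"] conjI allI impI)
    show "C1 + sqrt C2 + 1 > 0" using C1(1) C2(1) real_sqrt_ge_zero[of C2] by linarith
    fix \<tau> :: real assume t: "\<tau> \<ge> 0"
    note [measurable] = L2_measurable[OF u_L2[OF t]]
    have Fm [measurable]: "F \<tau> \<in> borel_measurable borel" unfolding F_def[abs_def] by measurable
    have n1: "(\<integral>\<^sup>+x. ennreal (norm (F \<tau> x)) \<partial>lborel) \<le> ennreal (C1 * (1 + \<tau>) powr (- \<alpha>))"
      using C1(2)[OF t] by (simp add: F_def)
    show L1: "F \<tau> \<in> L1" unfolding L1_def mem_Collect_eq
      by (rule integrableI_bounded) (use n1 in \<open>auto intro: le_less_trans\<close>)
    have "ennreal (L1norm (F \<tau>)) = (\<integral>\<^sup>+x. ennreal (norm (F \<tau> x)) \<partial>lborel)"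
      unfolding L1norm_def using L1 by (intro nn_integral_eq_integral[symmetric]) (auto simp: L1_def)
    then have "ennreal (L1norm (F \<tau>)) \<le> ennreal (C1 * (1 + \<tau>) powr (- \<alpha>))" using n1 by simp
    then have "L1norm (F \<tau>) \<le> C1 * (1 + \<tau>) powr (- \<alpha>)"
      by (subst (asm) ennreal_le_iff) (use C1(1) in auto)
    also have "\<dots> \<le> (C1 + sqrt C2 + 1) * (1 + \<tau>) powr (- \<alpha>)" using C1 C2 by (intro mult_right_mono) auto
    finally show "L1norm (F \<tau>) \<le> (C1 + sqrt C2 + 1) * (1 + \<tau>) powr (- \<alpha>)" .
    have "(norm (F \<tau> x))\<^sup>2 = norm (u \<tau> x) powr (2 * p)" for x
      by (simp add: F_def power2_eq_square flip: powr_add)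
    then have "(\<integral>\<^sup>+x. ennreal ((norm (F \<tau> x))\<^sup>2) \<partial>lborel) \<le> ennreal ((sqrt C2 * (1 + \<tau>) powr (- \<beta>))\<^sup>2)"
    proof -
      have "(sqrt C2 * (1 + \<tau>) powr (- \<beta>))\<^sup>2 = C2 * ((1 + \<tau>) powr (- \<beta>) * (1 + \<tau>) powr (- \<beta>))"
        using C2(1) by (simp add: power_mult_distrib) (simp add: power2_eq_square)
      then show ?thesis using C2(2)[OF t] \<open>\<And>x. (norm (F \<tau> x))\<^sup>2 = norm (u \<tau> x) powr (2 * p)\<close>
        unfolding e2b powr_add by simp
    qed
    then have L2: "F \<tau> \<in> L2" "L2norm (F \<tau>) \<le> sqrt C2 * (1 + \<tau>) powr (- \<beta>)"
      using L2_nn_integralI[of "F \<tau>" "sqrt C2 * (1 + \<tau>) powr (- \<beta>)"] C2(1) by auto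
    show "F \<tau> \<in> L2" by fact
    have "sqrt C2 * (1 + \<tau>) powr (- \<beta>) \<le> (C1 + sqrt C2 + 1) * (1 + \<tau>) powr (- \<beta>)"
      using C1 C2 by (intro mult_right_mono) auto
    with L2(2) show "L2norm (F \<tau>) \<le> (C1 + sqrt C2 + 1) * (1 + \<tau>) powr (- \<beta>)" by linarith
  qed
qed

lemma F_L1: "\<tau> \<ge> 0 \<Longrightarrow> F \<tau> \<in> L1" and F_L2: "\<tau> \<ge> 0 \<Longrightarrow> F \<tau> \<in> L2"
  using F_bounds by blast+

text \<open>By \<open>powr_diff_le\<close> and Cauchy-Schwarz the L^1 distance is controlled by the
  L^2 distance of u times the L^2 norm of |u|^(p-1). The latter is bounded uniformly in time because
  2(p - 1) lies between 2 and 2p, which uses p \<ge> 2.\<close>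

lemma F_continuous:
  assumes t: "t \<ge> 0"
  shows "((\<lambda>s. L1norm (\<lambda>x. F s x - F t x)) \<longlongrightarrow> 0) (at t within {0..})"
proof -
  let ?v = "\<lambda>s x. complex_of_real (norm (u s x) powr (p - 1))"
  obtain C1 where C1: "C1 \<ge> 0" "\<And>t. t \<ge> 0 \<Longrightarrow> (\<integral>\<^sup>+x. ennreal (norm (u t x) powr (2 * (p - 1))) \<partial>lborel)
      \<le> ennreal (C1 * (1 + t) powr (- (n * (2 * (p - 1) - 1) / (2 * \<sigma>))))"
    using u_Lq_decay[of "2 * (p - 1)"] p2 by auto
  have v: "?v s \<in> L2" "L2norm (?v s) \<le> sqrt C1" if s: "s \<ge> 0" for s
  proof -
    note [measurable] = L2_measurable[OF u_L2[OF s]]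
    have "(1 + s) powr (- (n * (2 * (p - 1) - 1) / (2 * \<sigma>))) \<le> (1 + s) powr 0"
      using s p2 sigma n_pos by (intro powr_mono) auto
    then have "C1 * (1 + s) powr (- (n * (2 * (p - 1) - 1) / (2 * \<sigma>))) \<le> (sqrt C1)\<^sup>2"
      using C1(1) s mult_left_mono[of "(1 + s) powr (- (n * (2 * (p - 1) - 1) / (2 * \<sigma>)))" 1 C1] by auto
    moreover have "(norm (?v s x))\<^sup>2 = norm (u s x) powr (2 * (p - 1))" for x
      by (simp add: power2_eq_square flip: powr_add)
    ultimately have "(\<integral>\<^sup>+x. ennreal ((norm (?v s x))\<^sup>2) \<partial>lborel) \<le> ennreal ((sqrt C1)\<^sup>2)"
      by (simp only:) (rule order_trans[OF C1(2)[OF s] ennreal_leI])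
    then show "?v s \<in> L2" "L2norm (?v s) \<le> sqrt C1"
      using L2_nn_integralI[of "?v s" "sqrt C1"] C1(1) by auto
  qed
  have b: "L1norm (\<lambda>x. F s x - F t x) \<le> p * (2 * sqrt C1) * L2norm (\<lambda>x. u s x - u t x)" if s: "s \<ge> 0" for s
  proof -
    have d: "(\<lambda>x. u s x - u t x) \<in> L2" by (intro L2_diff u_L2 s t)
    have w: "(\<lambda>x. ?v s x + ?v t x) \<in> L2" by (intro L2_add v s t)
    have "L1norm (\<lambda>x. F s x - F t x) \<le> (LINT x|lborel. p * (norm (?v s x + ?v t x) * norm (u s x - u t x)))"
      unfolding L1norm_def
    proof (rule integral_mono)
      show "integrable lborel (\<lambda>x. norm (F s x - F t x))" using F_L1[OF s] F_L1[OF t] by (simp add: L1_def)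
      show "integrable lborel (\<lambda>x. p * (norm (?v s x + ?v t x) * norm (u s x - u t x)))"
        using L2_mult_integrable(2)[OF w d] by simp
      fix x
      have "norm (F s x - F t x) = \<bar>norm (u s x) powr p - norm (u t x) powr p\<bar>"
        unfolding F_def by (simp flip: of_real_diff)
      also have "\<dots> \<le> p * (norm (u s x) powr (p - 1) + norm (u t x) powr (p - 1)) * \<bar>norm (u s x) - norm (u t x)\<bar>"
        by (rule powr_diff_le) (use p2 in auto)
      also have "\<dots> \<le> p * (norm (u s x) powr (p - 1) + norm (u t x) powr (p - 1)) * norm (u s x - u t x)"
        using p2 by (intro mult_left_mono norm_triangle_ineq3) auto
      also have "norm (u s x) powr (p - 1) + norm (u t x) powr (p - 1) = norm (?v s x + ?v t x)"
        by (simp flip: of_real_add)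
      finally show "norm (F s x - F t x) \<le> p * (norm (?v s x + ?v t x) * norm (u s x - u t x))" by (simp add: mult.assoc)
    qed
    also have "\<dots> = p * (LINT x|lborel. norm (?v s x + ?v t x) * norm (u s x - u t x))" by simp
    also have "\<dots> \<le> p * (L2norm (\<lambda>x. ?v s x + ?v t x) * L2norm (\<lambda>x. u s x - u t x))"
      using p2 by (intro mult_left_mono L2_mult_integrable(3) w d) auto
    also have "\<dots> \<le> p * (2 * sqrt C1 * L2norm (\<lambda>x. u s x - u t x))"
    proof (intro mult_left_mono mult_right_mono)
      show "L2norm (\<lambda>x. ?v s x + ?v t x) \<le> 2 * sqrt C1"
        using L2norm_triangle[OF v(1)[OF s] v(1)[OF t]] v(2)[OF s] v(2)[OF t] by linarith
    qed (use p2 in auto)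
    finally show ?thesis by (simp add: mult.assoc)
  qed
  have lim: "((\<lambda>s. p * (2 * sqrt C1) * L2norm (\<lambda>x. u s x - u t x)) \<longlongrightarrow> 0) (at t within {0..})"
    using tendsto_mult_left[OF has_L2_deriv_imp_continuous[OF u_deriv[OF t] u_L2 t], of "p * (2 * sqrt C1)"] by simp
  show ?thesis
    by (rule tendsto_sandwich[OF _ _ tendsto_const lim]) (auto simp: eventually_at_filter intro!: always_eventually b)
qed

text \<open>Freezing at negative times lets the function be continuous on all of time and frequency,
  so measurability on the product holds without restriction to a half-line.\<close>

definition h :: "real \<Rightarrow> 'n field" where
  "h \<tau> = fourier_integral (F (max 0 \<tau>))"

lemma h_bound: "norm (h \<tau> \<xi>) \<le> L1norm (F (max 0 \<tau>))"
  unfolding h_def by (rule fourier_integral_bound)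

text \<open>The L^1 norm bounds the transform uniformly in \<xi>, so L^1 continuity in time is
  uniform in frequency; together with continuity in \<xi> at a fixed time this gives joint
  continuity.\<close>

lemma h_continuous: "continuous_on UNIV (\<lambda>(\<tau>, \<xi>). h \<tau> \<xi>)"
proof -
  have "((\<lambda>z. case z of (\<tau>, \<xi>) \<Rightarrow> h \<tau> \<xi>) \<longlongrightarrow> h t \<zeta>) (at (t, \<zeta>))" for t \<zeta>
  proof -
    let ?t = "max 0 t" and ?\<Phi> = "\<lambda>s. L1norm (\<lambda>x. F s x - F (max 0 t) x)"
    have z: "?\<Phi> ?t = 0" by (simp add: L1norm_def)
    have c: "continuous (at ?t within {0..}) ?\<Phi>"
      unfolding continuous_within z by (rule F_continuous) simp
    have fs: "((\<lambda>z. fst z) \<longlongrightarrow> fst (t, \<zeta>)) (at (t, \<zeta>))" "((\<lambda>z. snd z) \<longlongrightarrow> snd (t, \<zeta>)) (at (t, \<zeta>))"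
      by (rule tendsto_fst[OF tendsto_ident_at] tendsto_snd[OF tendsto_ident_at])+
    have mx: "((\<lambda>z. max 0 (fst z)) \<longlongrightarrow> ?t) (at (t, \<zeta>))"
      by (rule tendsto_max[OF tendsto_const fs(1)[unfolded fst_conv]])
    have "((\<lambda>z. ?\<Phi> (max 0 (fst z))) \<longlongrightarrow> ?\<Phi> ?t) (at (t, \<zeta>))"
      by (rule continuous_within_tendsto_compose[OF c _ mx]) (rule always_eventually, simp)
    then have l1: "((\<lambda>z. ?\<Phi> (max 0 (fst z))) \<longlongrightarrow> 0) (at (t, \<zeta>))" unfolding z .
    have "continuous (at \<zeta>) (h t)"
      using fourier_integral_continuous[OF F_L1[of ?t]] by (simp add: h_def continuous_on_eq_continuous_at)
    then have "((\<lambda>z. h t (snd z)) \<longlongrightarrow> h t \<zeta>) (at (t, \<zeta>))"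
      by (rule continuous_within_tendsto_compose[OF _ _ fs(2)[unfolded snd_conv]]) simp
    then have "((\<lambda>z. norm (h t (snd z) - h t \<zeta>)) \<longlongrightarrow> 0) (at (t, \<zeta>))"
      by (simp add: LIM_zero tendsto_norm_zero)
    from tendsto_add_zero[OF l1 this]
    have l2: "((\<lambda>z. ?\<Phi> (max 0 (fst z)) + norm (h t (snd z) - h t \<zeta>)) \<longlongrightarrow> 0) (at (t, \<zeta>))" .
    show ?thesis
    proof (rule Lim_null[THEN iffD2], rule Lim_null_comparison[OF _ l2], intro always_eventually allI)
      fix z :: "real \<times> (real ^ 'n)"
      have "h (fst z) (snd z) - h t \<zeta> = fourier_integral (\<lambda>x. F (max 0 (fst z)) x - F ?t x) (snd z) + (h t (snd z) - h t \<zeta>)"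
        by (simp add: h_def fourier_integral_diff F_L1)
      also have "norm \<dots> \<le> ?\<Phi> (max 0 (fst z)) + norm (h t (snd z) - h t \<zeta>)"
        by (intro order_trans[OF norm_triangle_ineq] add_mono fourier_integral_bound order_refl)
      finally show "norm ((case z of (\<tau>, \<xi>) \<Rightarrow> h \<tau> \<xi>) - h t \<zeta>) \<le> ?\<Phi> (max 0 (fst z)) + norm (h t (snd z) - h t \<zeta>)"
        by (simp add: case_prod_beta)
    qed
  qed
  then show ?thesis by (auto simp: continuous_on_def)
qed

end

section \<open>The symbols of the propagators\<close>

text \<open>\<open>k1\<close> solves y' + y = exp (- x r) with y(0) = 0, hence its time derivative
  has this form, which is valid at r = 1 as well.\<close>

definition m1 :: "real \<Rightarrow> real \<Rightarrow> real" where
  "m1 x r = exp (- x * r) - k1 x r"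

lemma k1_0 [simp]: "k1 0 r = 0"
  by (simp add: k1_def)

lemma k0_eq: "k0 t r = k1 t r + exp (- t)"
  by (simp add: k0_def k1_def field_simps)

lemma m1_eq: "r \<noteq> 1 \<Longrightarrow> m1 x r = (exp (- x) - r * exp (- x * r)) / (1 - r)"
  by (simp add: m1_def k1_def field_simps)

lemma k1_measurable [measurable]: "(\<lambda>(x, r). k1 x r) \<in> borel_measurable (borel \<Otimes>\<^sub>M borel)"
  unfolding k1_def by measurable

lemma m1_measurable [measurable]: "(\<lambda>(x, r). m1 x r) \<in> borel_measurable (borel \<Otimes>\<^sub>M borel)"
  unfolding m1_def k1_def by measurable

section \<open>Bounds of the symbols at low and high frequencies\<close>

lemma exp_minus_diff_le:
  fixes a b :: real
  shows "\<bar>exp (- a) - exp (- b)\<bar> \<le> \<bar>a - b\<bar> * exp (- min a b)"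
proof -
  have key: "\<bar>exp (- a) - exp (- b)\<bar> \<le> (b - a) * exp (- a)" if "a \<le> b" for a b :: real
  proof -
    have "exp (- b) = exp (- (b - a)) * exp (- a)" by (simp flip: exp_add)
    moreover have "1 - (b - a) \<le> exp (- (b - a))" using exp_ge_add_one_self[of "- (b - a)"] by linarith
    then have "(1 - (b - a)) * exp (- a) \<le> exp (- (b - a)) * exp (- a)" by (intro mult_right_mono) auto
    ultimately have "exp (- a) - exp (- b) \<le> (b - a) * exp (- a)" by (simp add: algebra_simps)
    then show ?thesis using that by simp
  qed
  show ?thesis using key[of a b] key[of b a] by (cases "a \<le> b") (auto simp: min_def abs_minus_commute)
qed

text \<open>The difference of the exponentials carries a factor |1 - r| that cancels the
  denominator, so the bound passes through r = 1 without loss.\<close>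

lemma k1_abs_le: "0 \<le> x \<Longrightarrow> \<bar>k1 x r\<bar> \<le> x * exp (- x * min r 1)"
proof (cases "r = 1")
  case False
  assume x: "0 \<le> x"
  have "\<bar>exp (- (x * r)) - exp (- x)\<bar> \<le> \<bar>x * r - x\<bar> * exp (- min (x * r) x)"
    by (rule exp_minus_diff_le)
  also have "\<bar>x * r - x\<bar> = x * \<bar>1 - r\<bar>"
  proof -
    have "x * r - x = x * (r - 1)" by (simp add: algebra_simps)
    then show ?thesis using x by (simp add: abs_mult abs_minus_commute)
  qed
  also have "min (x * r) x = x * min r 1" using x by (auto simp: min_def mult_le_cancel_left2 mult_left_le)
  finally show ?thesis using False by (simp add: k1_def field_simps)
qed (simp add: k1_def)

lemma x_exp_le: "0 < c \<Longrightarrow> x * exp (- (c * x)) \<le> 1 / c" for x c :: real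
proof -
  assume c: "0 < c"
  have "c * x \<le> exp (c * x)" using exp_ge_add_one_self[of "c * x"] by linarith
  then have "c * x * exp (- (c * x)) \<le> 1" by (simp add: exp_minus field_simps)
  then show ?thesis using c by (simp add: field_simps)
qed

lemma k1_low:
  assumes "0 \<le> r" "r \<le> 1 / 2" "0 \<le> x"
  shows "\<bar>k1 x r\<bar> \<le> 2 * exp (- (x * r))"
proof -
  have "x * r \<le> x" using assms mult_left_le[of r x] by simp
  then have "0 \<le> exp (- (x * r)) - exp (- x)" by simp
  moreover have "exp (- (x * r)) - exp (- x) \<le> exp (- (x * r)) * (2 * (1 - r))"
  proof -
    have "exp (- (x * r)) * 1 \<le> exp (- (x * r)) * (2 * (1 - r))" using assms by (intro mult_left_mono) auto
    then show ?thesis using exp_gt_zero[of "- x"] by linarith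
  qed
  ultimately show ?thesis using assms by (simp add: k1_def field_simps)
qed

text \<open>Up to r = 2 the weight r^(1/2) is at most 2 and \<open>k1_abs_le\<close> serves; beyond,
  r^(1/2) \<le> r \<le> 2 (r - 1) is absorbed by the denominator. Half of the rate 1/2 is spent on
  the factor x.\<close>

lemma k1_high:
  assumes "1 / 2 \<le> r" "0 \<le> x"
  shows "\<bar>k1 x r\<bar> \<le> 4 * exp (- x / 4)" "r powr (1 / 2) * \<bar>k1 x r\<bar> \<le> 8 * exp (- x / 4)"
proof -
  have "\<bar>k1 x r\<bar> \<le> x * exp (- x * min r 1)" by (rule k1_abs_le[OF assms(2)])
  also have "\<dots> \<le> x * exp (- x / 2)"
  proof -
    have "x * (1 / 2) \<le> x * min r 1" using assms by (intro mult_left_mono) auto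
    then show ?thesis using assms by (intro mult_left_mono) auto
  qed
  also have "x * exp (- x / 2) = (x * exp (- (1 / 4 * x))) * exp (- x / 4)"
    by (simp add: mult.assoc flip: exp_add)
  also have "\<dots> \<le> 4 * exp (- x / 4)" using x_exp_le[of "1 / 4" x] by (intro mult_right_mono) auto
  finally show k: "\<bar>k1 x r\<bar> \<le> 4 * exp (- x / 4)" .
  show "r powr (1 / 2) * \<bar>k1 x r\<bar> \<le> 8 * exp (- x / 4)"
  proof (cases "r \<le> 2")
    case True
    have "r powr (1 / 2) \<le> 4 powr (1 / 2)" using True assms by (intro powr_mono2) auto
    then have "r powr (1 / 2) \<le> 2" by (simp add: powr_half_sqrt)
    then have "r powr (1 / 2) * \<bar>k1 x r\<bar> \<le> 2 * (4 * exp (- x / 4))" by (intro mult_mono k) auto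
    then show ?thesis by simp
  next
    case False
    have "r powr (1 / 2) \<le> r powr 1" using False by (intro powr_mono) auto
    then have sr: "r powr (1 / 2) \<le> 2 * (r - 1)" using False by simp
    have "x \<le> x * r" using False assms mult_left_mono[of 1 r x] by simp
    then have "exp (- (x * r)) \<le> exp (- x)" by simp
    then have "\<bar>exp (- (x * r)) - exp (- x)\<bar> \<le> exp (- x)" using exp_gt_zero[of "- (x * r)"] by linarith
    also have "exp (- x) \<le> exp (- x / 4)" using assms by simp
    finally have "\<bar>k1 x r\<bar> \<le> exp (- x / 4) / (r - 1)"
      using False by (simp add: k1_def abs_divide divide_right_mono)
    then have "r powr (1 / 2) * \<bar>k1 x r\<bar> \<le> 2 * (r - 1) * (exp (- x / 4) / (r - 1))"
      using sr False by (intro mult_mono) auto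
    also have "\<dots> = 2 * exp (- x / 4)" using False by (simp add: nonzero_divide_eq_eq)
    also have "\<dots> \<le> 8 * exp (- x / 4)" by simp
    finally show ?thesis .
  qed
qed

text \<open>The symbol of \<open>\<partial>\<^sub>t\<^sup>j |D|\<^bsup>k\<sigma>\<^esup> K\<^sub>1\<close> at time \<open>x\<close>, in the variable \<open>r = |\<xi>|\<^bsup>2\<sigma>\<^esup>\<close>; \<open>m1\<close> is the time derivative
  of \<open>k1\<close>.\<close>

definition Ksym :: "nat \<Rightarrow> nat \<Rightarrow> real \<Rightarrow> real \<Rightarrow> real" where
  "Ksym j k x r = r powr (real k / 2) * (if j = 0 then k1 x r else m1 x r)"

lemma Ksym_measurable [measurable]: "(\<lambda>(x, r). Ksym j k x r) \<in> borel_measurable (borel \<Otimes>\<^sub>M borel)"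
  unfolding Ksym_def by (cases "j = 0") (simp_all, measurable)

text \<open>The pair (1, 1) has to be left out: \<open>m1 0 r = 1\<close>, so its symbol at time 0
  is r^(1/2), which is unbounded at high frequencies.\<close>

definition order_pairs :: "(nat \<times> nat) set" where
  "order_pairs = {(0, 0), (0, 1), (1, 0)}"

lemma Ksym_high:
  assumes jk: "(j, k) \<in> order_pairs" and r: "1 / 2 \<le> r" and x: "0 \<le> x"
  shows "\<bar>Ksym j k x r\<bar> \<le> 8 * exp (- x / 4)"
proof -
  have "\<bar>m1 x r\<bar> \<le> exp (- x * r) + \<bar>k1 x r\<bar>" unfolding m1_def using exp_gt_zero[of "- x * r"] by linarith
  moreover have "exp (- x * r) \<le> exp (- x / 4)"
  proof -
    have "x * (1 / 4) \<le> x * r" using r x by (intro mult_left_mono) auto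
    then show ?thesis by simp
  qed
  ultimately have "\<bar>m1 x r\<bar> \<le> 8 * exp (- x / 4)" using k1_high(1)[OF r x] exp_gt_zero[of "- x / 4"] by linarith
  then show ?thesis using k1_high[OF r x] jk exp_gt_zero[of "- x / 4"] r
    by (auto simp: order_pairs_def Ksym_def abs_mult)
qed

text \<open>Away from r = 1 the denominator is at least 1/2. In the weighted bound half of the
  exponential absorbs the power of x r, and the other half is kept as the integrable majorant in
  frequency.\<close>

lemma Ksym_low:
  assumes jk: "(j, k) \<in> order_pairs" and r: "0 \<le> r" "r \<le> 1 / 2" and x: "0 \<le> x"
  shows "\<bar>Ksym j k x r\<bar> \<le> 8"
    and "x powr (real k / 2 + real j) * \<bar>Ksym j k x r\<bar> \<le> 8 * exp (- (x * r / 2))"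
proof -
  note k1 = k1_low[OF r x]
  have xr: "0 \<le> x * r" using r x by simp
  have rx: "x * r \<le> x" using r x mult_left_le[of r x] by simp
  have half: "exp (- (x * r)) \<le> exp (- (x * r / 2))" unfolding exp_le_cancel_iff using xr by linarith
  have e1: "exp (- (x * r)) \<le> 1" using xr by simp
  have m: "\<bar>m1 x r\<bar> \<le> 2 * (exp (- x) + r * exp (- (x * r)))"
  proof -
    have "\<bar>exp (- x) - r * exp (- (x * r))\<bar> \<le> exp (- x) + r * exp (- (x * r))"
      using r mult_nonneg_nonneg[of r "exp (- (x * r))"] exp_gt_zero[of "- x"] by (simp add: abs_le_iff)
    moreover have "(exp (- x) + r * exp (- (x * r))) * 1 \<le> (exp (- x) + r * exp (- (x * r))) * (2 * (1 - r))"
      using r by (intro mult_left_mono) auto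
    ultimately have "\<bar>exp (- x) - r * exp (- (x * r))\<bar> \<le> (exp (- x) + r * exp (- (x * r))) * (2 * (1 - r))"
      unfolding mult_1_right by (rule order_trans)
    also have "\<dots> = (2 * (exp (- x) + r * exp (- (x * r)))) * (1 - r)" by (simp only: mult_ac)
    finally have "\<bar>exp (- x) - r * exp (- (x * r))\<bar> \<le> (2 * (exp (- x) + r * exp (- (x * r)))) * (1 - r)" .
    then show ?thesis using r by (simp add: m1_eq abs_divide pos_divide_le_eq)
  qed
  have m8: "\<bar>m1 x r\<bar> \<le> 8"
  proof -
    have a: "r * exp (- (x * r)) \<le> 1 * 1" using r e1 by (intro mult_mono) auto
    have b: "exp (- x) \<le> 1" using x by simp
    have "2 * (exp (- x) + r * exp (- (x * r))) \<le> 2 * (1 + 1 * 1)"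
      by (intro mult_left_mono add_mono a b) simp
    then show ?thesis by (intro order_trans[OF m]) simp
  qed
  have sr: "r powr (1 / 2) \<le> 1" using r by (simp add: powr_le1)
  have k2: "\<bar>k1 x r\<bar> \<le> 2" using k1 e1 by linarith
  have k8: "r powr (1 / 2) * \<bar>k1 x r\<bar> \<le> 8"
  proof -
    have "r powr (1 / 2) * \<bar>k1 x r\<bar> \<le> 1 * 2" using sr k2 by (intro mult_mono) auto
    then show ?thesis by simp
  qed
  show "\<bar>Ksym j k x r\<bar> \<le> 8" using k2 m8 k8 jk r
    by (auto simp: order_pairs_def Ksym_def abs_mult)
  have s: "sqrt y * exp (- y) \<le> exp (- (y / 2))" if "y \<ge> 0" for y :: real
  proof -
    have "sqrt y \<le> 1 + y / 2" using that arith_geo_mean_sqrt[of 1 y] by simp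
    also have "\<dots> \<le> exp (y / 2)" by (rule exp_ge_add_one_self)
    finally have "sqrt y * exp (- y) \<le> exp (y / 2) * exp (- y)" by (intro mult_right_mono) auto
    also have "\<dots> = exp (- (y / 2))" by (simp flip: exp_add)
    finally show ?thesis .
  qed
  have l: "y * exp (- y) \<le> 2 * exp (- (y / 2))" for y :: real
  proof -
    have "y * exp (- y) = (y * exp (- (1 / 2 * y))) * exp (- (y / 2))" by (simp add: mult.assoc flip: exp_add)
    also have "\<dots> \<le> 2 * exp (- (y / 2))" using x_exp_le[of "1 / 2" y] by (intro mult_right_mono) auto
    finally show ?thesis .
  qed
  have pos: "0 < exp (- (x * r / 2))" by simp
  have c00: "x powr 0 * (r powr 0 * \<bar>k1 x r\<bar>) \<le> 8 * exp (- (x * r / 2))"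
  proof -
    have "\<bar>k1 x r\<bar> \<le> 8 * exp (- (x * r / 2))" using k1 half pos by linarith
    then show ?thesis by auto
  qed
  have c01: "x powr (1 / 2) * (r powr (1 / 2) * \<bar>k1 x r\<bar>) \<le> 8 * exp (- (x * r / 2))"
  proof -
    have "x powr (1 / 2) * (r powr (1 / 2) * \<bar>k1 x r\<bar>) = sqrt (x * r) * \<bar>k1 x r\<bar>"
      using r x by (simp add: powr_half_sqrt real_sqrt_mult)
    also have "\<dots> \<le> sqrt (x * r) * (2 * exp (- (x * r)))" using k1 xr by (intro mult_left_mono) auto
    also have "\<dots> \<le> 2 * exp (- (x * r / 2))" using s[OF xr] by simp
    finally show ?thesis using pos by linarith
  qed
  \<comment> \<open>The summand exp (- x) has no factor r to pair with x, but it decays in x itself,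
    and x r \<le> x brings it under the common majorant.\<close>
  have c10: "x powr 1 * (r powr 0 * \<bar>m1 x r\<bar>) \<le> 8 * exp (- (x * r / 2))"
  proof -
    have "x powr 1 * (r powr 0 * \<bar>m1 x r\<bar>) \<le> x * \<bar>m1 x r\<bar>" using x by auto
    also have "\<dots> \<le> x * (2 * (exp (- x) + r * exp (- (x * r))))" using m x by (intro mult_left_mono)
    also have "\<dots> = 2 * (x * exp (- x)) + 2 * ((x * r) * exp (- (x * r)))" by (simp add: algebra_simps)
    also have "\<dots> \<le> 2 * (2 * exp (- (x / 2))) + 2 * (2 * exp (- (x * r / 2)))"
      by (intro add_mono mult_left_mono l) auto
    also have "exp (- (x / 2)) \<le> exp (- (x * r / 2))" using rx by simp
    finally show ?thesis by simp
  qed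
  show "x powr (real k / 2 + real j) * \<bar>Ksym j k x r\<bar> \<le> 8 * exp (- (x * r / 2))"
    using jk c00 c01 c10 by (auto simp: order_pairs_def Ksym_def abs_mult)
qed

lemma Ksym_bounded:
  assumes "(j, k) \<in> order_pairs" "0 \<le> r" "0 \<le> x" shows "\<bar>Ksym j k x r\<bar> \<le> 8"
proof (cases "r \<le> 1 / 2")
  case False
  then have "\<bar>Ksym j k x r\<bar> \<le> 8 * exp (- x / 4)" using assms by (intro Ksym_high) auto
  also have "\<dots> \<le> 8" using assms by simp
  finally show ?thesis .
qed (use Ksym_low assms in auto)

text \<open>Interpolation between boundedness and the full decay, uniformly in r. The freedom in
  \<gamma> is needed because the full power is not integrable at x = 0 when j = 1. The constant is 8
  from the symbol bound times 4 from \<open>x_exp_le\<close>.\<close>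

lemma Ksym_decay:
  assumes jk: "(j, k) \<in> order_pairs" and r: "0 \<le> r" and x: "0 < x"
    and \<gamma>: "0 \<le> \<gamma>" "\<gamma> \<le> real k / 2 + real j"
  shows "\<bar>Ksym j k x r\<bar> \<le> 32 * x powr (- \<gamma>)"
proof -
  have \<gamma>1: "\<gamma> \<le> 1" using jk \<gamma> by (auto simp: order_pairs_def)
  have "x powr \<gamma> * \<bar>Ksym j k x r\<bar> \<le> 32"
  proof (cases "x \<le> 1")
    case True
    then have "x powr \<gamma> \<le> 1" using x \<gamma> by (simp add: powr_le1)
    then have "x powr \<gamma> * \<bar>Ksym j k x r\<bar> \<le> 1 * 8"
      using Ksym_bounded[OF jk r, of x] x by (intro mult_mono) auto
    then show ?thesis by simp
  next
    case x1: False
    show ?thesis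
    proof (cases "r \<le> 1 / 2")
      case True
      have "x powr \<gamma> \<le> x powr (real k / 2 + real j)" using x1 \<gamma> by (intro powr_mono) auto
      then have "x powr \<gamma> * \<bar>Ksym j k x r\<bar> \<le> x powr (real k / 2 + real j) * \<bar>Ksym j k x r\<bar>"
        by (intro mult_right_mono) auto
      also have "\<dots> \<le> 8 * exp (- (x * r / 2))" using x by (intro Ksym_low jk r True) auto
      also have "\<dots> \<le> 8" using x r by simp
      finally show ?thesis by simp
    next
      case False
      have "x powr \<gamma> \<le> x powr 1" using x1 \<gamma>1 by (intro powr_mono) auto
      then have "x powr \<gamma> * \<bar>Ksym j k x r\<bar> \<le> x * (8 * exp (- x / 4))"
        using False x by (intro mult_mono Ksym_high jk) auto
      also have "\<dots> = 8 * (x * exp (- (1 / 4 * x)))" by simp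
      also have "x * exp (- (1 / 4 * x)) \<le> 4" using x_exp_le[of "1 / 4" x] by simp
      finally show ?thesis by simp
    qed
  qed
  then show ?thesis using x by (simp add: powr_minus field_simps)
qed

text \<open>At r = s/t the terms exp (- t) die out, the denominator tends to 1 and the delay \<tau>
  disappears in the limit; what survives is the symbol of the heat kernel.\<close>

lemma Ksym_limit:
  assumes jk: "(j, k) \<in> order_pairs" and s: "s > 0"
  shows "((\<lambda>t. t powr (real k / 2 + real j) * Ksym j k (t - \<tau>) (s / t)) \<longlongrightarrow> s powr (real k / 2) * (- s) ^ j * exp (- s)) at_top"
proof -
  have pw: "\<forall>\<^sub>F t in at_top. t powr (real k / 2) * (s / t) powr (real k / 2) = s powr (real k / 2)"
    using eventually_gt_at_top[of 0] by eventually_elim (use s in \<open>simp add: powr_divide\<close>)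
  have ne: "\<forall>\<^sub>F t in at_top. s / t \<noteq> 1 \<and> t > 0 \<and> t \<noteq> s"
    using eventually_gt_at_top[of "max 0 s"] by eventually_elim auto
  have l0: "((\<lambda>t. k1 (t - \<tau>) (s / t)) \<longlongrightarrow> exp (- s)) at_top"
  proof (rule Lim_transform_eventually)
    show "((\<lambda>t. (exp (- (t - \<tau>) * (s / t)) - exp (- (t - \<tau>))) / (1 - s / t)) \<longlongrightarrow> exp (- s)) at_top"
      using s by real_asymp
    show "\<forall>\<^sub>F t in at_top. (exp (- (t - \<tau>) * (s / t)) - exp (- (t - \<tau>))) / (1 - s / t) = k1 (t - \<tau>) (s / t)"
      using ne by eventually_elim (simp add: k1_def)
  qed
  have l1: "((\<lambda>t. t * m1 (t - \<tau>) (s / t)) \<longlongrightarrow> - s * exp (- s)) at_top"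
  proof (rule Lim_transform_eventually)
    show "((\<lambda>t. t * ((exp (- (t - \<tau>)) - (s / t) * exp (- (t - \<tau>) * (s / t))) / (1 - s / t))) \<longlongrightarrow> - s * exp (- s)) at_top"
      using s by real_asymp
    show "\<forall>\<^sub>F t in at_top. t * ((exp (- (t - \<tau>)) - (s / t) * exp (- (t - \<tau>) * (s / t))) / (1 - s / t)) = t * m1 (t - \<tau>) (s / t)"
      using ne by eventually_elim (simp add: m1_eq)
  qed
  show ?thesis
  proof (cases "j = 0")
    case True
    have "((\<lambda>t. s powr (real k / 2) * k1 (t - \<tau>) (s / t)) \<longlongrightarrow> s powr (real k / 2) * exp (- s)) at_top"
      by (intro tendsto_intros l0)
    then have "((\<lambda>t. t powr (real k / 2) * (s / t) powr (real k / 2) * k1 (t - \<tau>) (s / t)) \<longlongrightarrow> s powr (real k / 2) * exp (- s)) at_top"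
      by (rule Lim_transform_eventually) (use pw in \<open>eventually_elim, simp\<close>)
    then show ?thesis using True by (simp add: Ksym_def mult.assoc)
  next
    case False
    then have jk': "j = 1" "k = 0" using jk by (auto simp: order_pairs_def)
    have "((\<lambda>t. t powr (real k / 2 + real j) * Ksym j k (t - \<tau>) (s / t)) \<longlongrightarrow> - s * exp (- s)) at_top"
      by (rule Lim_transform_eventually[OF l1])
        (rule eventually_mono[OF ne], use s in \<open>auto simp: jk' Ksym_def\<close>)
    then show ?thesis using jk' s by simp
  qed
qed

section \<open>Superpositions in $L^2$\<close>

text \<open>A form of Minkowski's integral inequality: weighted Cauchy-Schwarz bounds the square of
  the integral by the mass of \<open>a\<close> times the integral of a |H|^2, and Tonelli exchanges
  \<tau> and \<xi>. The pointwise bound \<open>B\<close> serves to make a |H|^2 integrable in \<tau>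
  for each \<xi>.\<close>

lemma L2_weighted_integral:
  fixes H :: "real \<Rightarrow> 'n::finite field" and K :: "real \<Rightarrow> real ^ 'n \<Rightarrow> real" and a :: "real \<Rightarrow> real"
  assumes [measurable]: "(\<lambda>(\<tau>, \<xi>). K \<tau> \<xi>) \<in> borel_measurable (borel \<Otimes>\<^sub>M borel)"
      "(\<lambda>(\<tau>, \<xi>). H \<tau> \<xi>) \<in> borel_measurable (borel \<Otimes>\<^sub>M borel)"
    and K: "\<And>\<tau> \<xi>. \<bar>K \<tau> \<xi>\<bar> \<le> a \<tau>" and a: "integrable lborel a"
    and B: "\<And>\<tau> \<xi>. norm (H \<tau> \<xi>) \<le> B"
    and \<Lambda>: "\<And>\<tau>. a \<tau> \<noteq> 0 \<Longrightarrow> H \<tau> \<in> L2 \<and> L2norm (H \<tau>) \<le> \<Lambda>" "\<Lambda> \<ge> 0"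
  shows "(\<lambda>\<xi>. LINT \<tau>|lborel. of_real (K \<tau> \<xi>) * H \<tau> \<xi>) \<in> L2"
    and "L2norm (\<lambda>\<xi>. LINT \<tau>|lborel. of_real (K \<tau> \<xi>) * H \<tau> \<xi>) \<le> (LINT \<tau>|lborel. a \<tau>) * \<Lambda>"
proof -
  let ?V = "\<lambda>\<xi>. LINT \<tau>|lborel. of_real (K \<tau> \<xi>) * H \<tau> \<xi>" and ?A = "LINT \<tau>|lborel. a \<tau>"
  have a0: "a \<tau> \<ge> 0" for \<tau> using K[of \<tau> 0] by linarith
  have A0: "?A \<ge> 0" using a0 by simp
  have [measurable]: "a \<in> borel_measurable borel" using borel_measurable_integrable[OF a] by simp
  have Hm [measurable]: "(\<lambda>\<tau>. H \<tau> \<xi>) \<in> borel_measurable borel" for \<xi> by measurable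
  have Hm' [measurable]: "H \<tau> \<in> borel_measurable borel" for \<tau> by measurable
  have Km [measurable]: "(\<lambda>\<tau>. K \<tau> \<xi>) \<in> borel_measurable borel" for \<xi> by measurable
  have Vm: "?V \<in> borel_measurable borel" by measurable
  have i2: "integrable lborel (\<lambda>\<tau>. a \<tau> * (norm (H \<tau> \<xi>))\<^sup>2)" for \<xi>
  proof (rule Bochner_Integration.integrable_bound[of _ "\<lambda>\<tau>. a \<tau> * B\<^sup>2"])
    show "AE \<tau> in lborel. norm (a \<tau> * (norm (H \<tau> \<xi>))\<^sup>2) \<le> norm (a \<tau> * B\<^sup>2)"
      using a0 B by (intro AE_I2) (auto simp: abs_mult intro!: mult_left_mono power_mono)
  qed (use a in auto)
  have pt: "ennreal ((norm (?V \<xi>))\<^sup>2) \<le> ennreal ?A * (\<integral>\<^sup>+\<tau>. ennreal (a \<tau> * (norm (H \<tau> \<xi>))\<^sup>2) \<partial>lborel)" for \<xi>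
  proof -
    have sq1: "(sqrt (a \<tau>))\<^sup>2 = a \<tau>" for \<tau> using a0 by simp
    have cs: "integrable lborel (\<lambda>\<tau>. sqrt (a \<tau>) * (sqrt (a \<tau>) * norm (H \<tau> \<xi>)))"
        "(LINT \<tau>|lborel. sqrt (a \<tau>) * (sqrt (a \<tau>) * norm (H \<tau> \<xi>)))\<^sup>2
        \<le> (LINT \<tau>|lborel. (sqrt (a \<tau>))\<^sup>2) * (LINT \<tau>|lborel. (sqrt (a \<tau>) * norm (H \<tau> \<xi>))\<^sup>2)"
      by (rule Cauchy_Schwarz_integral; use a i2[of \<xi>] in \<open>simp add: sq1 power_mult_distrib\<close>)+
    have e: "sqrt (a \<tau>) * (sqrt (a \<tau>) * norm (H \<tau> \<xi>)) = a \<tau> * norm (H \<tau> \<xi>)" for \<tau>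
      using a0 by (simp flip: mult.assoc)
    have "norm (?V \<xi>) \<le> (LINT \<tau>|lborel. norm (of_real (K \<tau> \<xi>) * H \<tau> \<xi>))" by (rule integral_norm_bound)
    also have "\<dots> \<le> (LINT \<tau>|lborel. a \<tau> * norm (H \<tau> \<xi>))"
    proof (rule integral_mono)
      show i: "integrable lborel (\<lambda>\<tau>. a \<tau> * norm (H \<tau> \<xi>))" using cs(1) by (simp only: e)
      show "integrable lborel (\<lambda>\<tau>. norm (of_real (K \<tau> \<xi>) * H \<tau> \<xi>))"
        by (rule Bochner_Integration.integrable_bound[OF i])
          (use K a0 in \<open>auto simp: norm_mult abs_mult intro!: mult_right_mono\<close>)
    qed (use K in \<open>auto simp: norm_mult intro!: mult_right_mono\<close>)
    finally have "(norm (?V \<xi>))\<^sup>2 \<le> (LINT \<tau>|lborel. a \<tau> * norm (H \<tau> \<xi>))\<^sup>2" by (intro power_mono) auto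
    also have "\<dots> \<le> ?A * (LINT \<tau>|lborel. a \<tau> * (norm (H \<tau> \<xi>))\<^sup>2)"
      using cs(2) by (simp add: e sq1 power_mult_distrib)
    finally have "ennreal ((norm (?V \<xi>))\<^sup>2) \<le> ennreal (?A * (LINT \<tau>|lborel. a \<tau> * (norm (H \<tau> \<xi>))\<^sup>2))"
      by (rule ennreal_leI)
    also have "\<dots> = ennreal ?A * ennreal (LINT \<tau>|lborel. a \<tau> * (norm (H \<tau> \<xi>))\<^sup>2)"
      using A0 a0 by (intro ennreal_mult) auto
    also have "ennreal (LINT \<tau>|lborel. a \<tau> * (norm (H \<tau> \<xi>))\<^sup>2) = (\<integral>\<^sup>+\<tau>. ennreal (a \<tau> * (norm (H \<tau> \<xi>))\<^sup>2) \<partial>lborel)"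
      using a0 by (intro nn_integral_eq_integral[symmetric] i2) auto
    finally show ?thesis .
  qed
  have "(\<integral>\<^sup>+\<xi>. ennreal ((norm (?V \<xi>))\<^sup>2) \<partial>lborel)
      \<le> (\<integral>\<^sup>+\<xi>. ennreal ?A * (\<integral>\<^sup>+\<tau>. ennreal (a \<tau> * (norm (H \<tau> \<xi>))\<^sup>2) \<partial>lborel) \<partial>lborel)"
    by (intro nn_integral_mono pt)
  also have "\<dots> = ennreal ?A * (\<integral>\<^sup>+\<xi>. (\<integral>\<^sup>+\<tau>. ennreal (a \<tau> * (norm (H \<tau> \<xi>))\<^sup>2) \<partial>lborel) \<partial>lborel)"
    by (rule nn_integral_cmult) measurable
  finally have outer: "(\<integral>\<^sup>+\<xi>. ennreal ((norm (?V \<xi>))\<^sup>2) \<partial>lborel)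
      \<le> ennreal ?A * (\<integral>\<^sup>+\<xi>. (\<integral>\<^sup>+\<tau>. ennreal (a \<tau> * (norm (H \<tau> \<xi>))\<^sup>2) \<partial>lborel) \<partial>lborel)" .
  have "(\<integral>\<^sup>+\<xi>. (\<integral>\<^sup>+\<tau>. ennreal (a \<tau> * (norm (H \<tau> \<xi>))\<^sup>2) \<partial>lborel) \<partial>lborel)
      = (\<integral>\<^sup>+\<tau>. (\<integral>\<^sup>+\<xi>. ennreal (a \<tau> * (norm (H \<tau> \<xi>))\<^sup>2) \<partial>lborel) \<partial>lborel)"
    by (rule lborel_pair.Fubini') measurable
  also have "\<dots> \<le> (\<integral>\<^sup>+\<tau>. ennreal (a \<tau>) * ennreal (\<Lambda>\<^sup>2) \<partial>lborel)"
  proof (rule nn_integral_mono)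
    fix \<tau>
    have "(\<integral>\<^sup>+\<xi>. ennreal (a \<tau> * (norm (H \<tau> \<xi>))\<^sup>2) \<partial>lborel) = ennreal (a \<tau>) * (\<integral>\<^sup>+\<xi>. ennreal ((norm (H \<tau> \<xi>))\<^sup>2) \<partial>lborel)"
      using a0[of \<tau>] by (subst nn_integral_cmult[symmetric]) (auto simp: ennreal_mult)
    also have "\<dots> \<le> ennreal (a \<tau>) * ennreal (\<Lambda>\<^sup>2)"
    proof (cases "a \<tau> = 0")
      case False
      with \<Lambda>(1)[OF False] show ?thesis
        by (intro mult_left_mono) (auto simp: nn_integral_L2 intro!: ennreal_leI power_mono)
    qed simp
    finally show "(\<integral>\<^sup>+\<xi>. ennreal (a \<tau> * (norm (H \<tau> \<xi>))\<^sup>2) \<partial>lborel) \<le> ennreal (a \<tau>) * ennreal (\<Lambda>\<^sup>2)" .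
  qed
  also have "\<dots> = ennreal ?A * ennreal (\<Lambda>\<^sup>2)"
    using nn_integral_eq_integral[OF a] a0 by (simp add: nn_integral_multc)
  finally have "(\<integral>\<^sup>+\<xi>. ennreal ((norm (?V \<xi>))\<^sup>2) \<partial>lborel) \<le> ennreal ?A * (ennreal ?A * ennreal (\<Lambda>\<^sup>2))"
    by (intro order_trans[OF outer] mult_left_mono) auto
  also have "\<dots> = ennreal ((?A * \<Lambda>)\<^sup>2)"
    using A0 \<Lambda>(2) by (simp add: power2_eq_square mult_ac flip: ennreal_mult)
  finally show "?V \<in> L2" "L2norm ?V \<le> ?A * \<Lambda>"
    using L2_nn_integralI[OF Vm, of "?A * \<Lambda>"] A0 \<Lambda>(2) by auto
qed

section \<open>Diffusive asymptotics on the Fourier side\<close>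

lemma integrable_decay:
  fixes \<alpha> :: real assumes "\<alpha> > 1"
  shows "integrable lborel (\<lambda>\<tau>. indicator {0..} \<tau> * (1 + \<tau>) powr (- \<alpha>))"
proof (rule integrableI_bounded)
  have "(\<integral>\<^sup>+\<tau>. ennreal ((1 + \<tau>) powr (- \<alpha>)) * indicator {0..} \<tau> \<partial>lborel)
      = ennreal (0 - (1 + 0) powr (1 - \<alpha>) / (1 - \<alpha>))"
  proof (rule nn_integral_FTC_atLeast)
    show "((\<lambda>\<tau>. (1 + \<tau>) powr (1 - \<alpha>) / (1 - \<alpha>)) has_real_derivative (1 + \<tau>) powr (- \<alpha>)) (at \<tau>)" if "0 \<le> \<tau>" for \<tau>
      using that assms by (auto intro!: derivative_eq_intros)
    show "((\<lambda>\<tau>. (1 + \<tau>) powr (1 - \<alpha>) / (1 - \<alpha>)) \<longlongrightarrow> 0) at_top" using assms by real_asymp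
  qed auto
  moreover have "(\<integral>\<^sup>+\<tau>. ennreal (norm (indicator {0..} \<tau> * (1 + \<tau>) powr (- \<alpha>))) \<partial>lborel)
      = (\<integral>\<^sup>+\<tau>. ennreal ((1 + \<tau>) powr (- \<alpha>)) * indicator {0..} \<tau> \<partial>lborel)"
    by (intro nn_integral_cong) (auto split: split_indicator)
  ultimately show "(\<integral>\<^sup>+\<tau>. ennreal (norm (indicator {0..} \<tau> * (1 + \<tau>) powr (- \<alpha>))) \<partial>lborel) < \<infinity>" by simp
qed measurable

text \<open>The reflection x = t - \<tau> moves the singularity at \<tau> = t to the origin.\<close>

lemma integral_powr_endpoint:
  fixes t \<gamma> :: real assumes t: "t > 0" and \<gamma>: "\<gamma> < 1"
  shows "integrable lborel (\<lambda>\<tau>. indicator {t / 2..<t} \<tau> * (t - \<tau>) powr (- \<gamma>))"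
    and "(LINT \<tau>|lborel. indicator {t / 2..<t} \<tau> * (t - \<tau>) powr (- \<gamma>)) = (t / 2) powr (1 - \<gamma>) / (1 - \<gamma>)"
proof -
  let ?g = "\<lambda>x. indicator {0..t / 2} x * x powr (- \<gamma>)"
  have "(\<integral>\<^sup>+x. ennreal (?g x) \<partial>lborel) = (\<integral>\<^sup>+x. ennreal (x powr (- \<gamma>)) * indicator {0..t / 2} x \<partial>lborel)"
    by (intro nn_integral_cong) (auto split: split_indicator)
  also have "\<dots> = ennreal ((t / 2) powr (1 - \<gamma>) / (1 - \<gamma>))"
    using nn_integral_powr_0(1)[of "- \<gamma>" "t / 2"] assms by simp
  finally have "has_bochner_integral lborel ?g ((t / 2) powr (1 - \<gamma>) / (1 - \<gamma>))"
    using assms by (intro has_bochner_integral_nn_integral) auto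
  then have "has_bochner_integral lborel (\<lambda>x. ?g (t + (- 1) * x)) ((t / 2) powr (1 - \<gamma>) / (1 - \<gamma>) /\<^sub>R \<bar>- 1\<bar>)"
    by (subst (asm) lborel_has_bochner_integral_real_affine_iff[of "- 1" _ _ t]) auto
  then have b: "has_bochner_integral lborel (\<lambda>x. ?g (t - x)) ((t / 2) powr (1 - \<gamma>) / (1 - \<gamma>))" by simp
  have "has_bochner_integral lborel (\<lambda>\<tau>. indicator {t / 2..<t} \<tau> * (t - \<tau>) powr (- \<gamma>)) ((t / 2) powr (1 - \<gamma>) / (1 - \<gamma>))"
  proof (rule has_bochner_integralI_AE[OF b])
    show "AE x in lborel. ?g (t - x) = indicator {t / 2..<t} x * (t - x) powr (- \<gamma>)"
      using AE_lborel_singleton[of t] by eventually_elim (auto split: split_indicator)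
  qed measurable
  then show "integrable lborel (\<lambda>\<tau>. indicator {t / 2..<t} \<tau> * (t - \<tau>) powr (- \<gamma>))"
    "(LINT \<tau>|lborel. indicator {t / 2..<t} \<tau> * (t - \<tau>) powr (- \<gamma>)) = (t / 2) powr (1 - \<gamma>) / (1 - \<gamma>)"
    by (simp_all add: has_bochner_integral_iff)
qed

text \<open>As \<sigma> \<ge> 1, |\<xi>|^2 \<le> 1 + |\<xi>|^(2\<sigma>), so the square is dominated
  by exp (2c) times the Gaussian exp (- 2c |\<xi>|^2).\<close>

lemma exp_rho_L2:
  assumes "\<sigma> \<ge> 1" "c > 0" shows "(\<lambda>\<xi>. complex_of_real (exp (- (c * rho \<sigma> \<xi>)))) \<in> L2"
proof (rule L2I)
  have c4: "sqrt (4 * c) > 0" using assms by simp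
  show "integrable lborel (\<lambda>\<xi>::real ^ 'n. (norm (complex_of_real (exp (- (c * rho \<sigma> \<xi>)))))\<^sup>2)"
  proof (rule Bochner_Integration.integrable_bound[of _ "\<lambda>\<xi>. exp (2 * c) * gauss (sqrt (4 * c) *\<^sub>R \<xi>)"])
    show "integrable lborel (\<lambda>\<xi>::real ^ 'n. exp (2 * c) * gauss (sqrt (4 * c) *\<^sub>R \<xi>))"
      by (intro integrable_mult_right integrable_gauss_scale c4)
    have "(exp (- (c * rho \<sigma> \<xi>)))\<^sup>2 \<le> exp (2 * c) * gauss (sqrt (4 * c) *\<^sub>R \<xi>)" for \<xi> :: "real ^ 'n"
    proof -
      have "(norm \<xi>)\<^sup>2 \<le> 1 + rho \<sigma> \<xi>"
      proof (cases "norm \<xi> \<le> 1")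
        case True
        then have "(norm \<xi>)\<^sup>2 \<le> 1" by (simp add: power_le_one)
        then show ?thesis using rho_nonneg[of \<sigma> \<xi>] by linarith
      next
        case False
        then have "norm \<xi> powr 2 \<le> rho \<sigma> \<xi>" unfolding rho_def using assms by (intro powr_mono) auto
        then show ?thesis using False by (simp add: powr_numeral)
      qed
      then have "2 * c * (norm \<xi>)\<^sup>2 \<le> 2 * c * (1 + rho \<sigma> \<xi>)" using assms by (intro mult_left_mono) auto
      then have "- (2 * c * rho \<sigma> \<xi>) \<le> 2 * c + - (norm (sqrt (4 * c) *\<^sub>R \<xi>))\<^sup>2 / 2"
        using assms by (simp add: power_mult_distrib algebra_simps)
      then have "exp (- (2 * c * rho \<sigma> \<xi>)) \<le> exp (2 * c) * gauss (sqrt (4 * c) *\<^sub>R \<xi>)"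
        unfolding gauss_def exp_add[symmetric] by simp
      moreover have "(exp (- (c * rho \<sigma> \<xi>)))\<^sup>2 = exp (- (2 * c * rho \<sigma> \<xi>))"
        by (simp add: power2_eq_square flip: exp_add)
      ultimately show ?thesis by simp
    qed
    then show "AE \<xi> in lborel. norm ((norm (complex_of_real (exp (- (c * rho \<sigma> \<xi>)))))\<^sup>2)
        \<le> norm (exp (2 * c) * gauss (sqrt (4 * c) *\<^sub>R (\<xi> :: real ^ 'n)))"
      by (intro AE_I2) simp
  qed measurable
qed measurable

lemma rho_scale:
  assumes "\<sigma> > 0" "t > 0" shows "rho \<sigma> (t powr (- (1 / (2 * \<sigma>))) *\<^sub>R \<eta>) = rho \<sigma> \<eta> / t"
proof -
  have "norm (t powr (- (1 / (2 * \<sigma>))) *\<^sub>R \<eta>) = t powr (- (1 / (2 * \<sigma>))) * norm \<eta>" by simp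
  moreover have "(t powr (- (1 / (2 * \<sigma>)))) powr (2 * \<sigma>) = 1 / t"
  proof -
    have "- (1 / (2 * \<sigma>)) * (2 * \<sigma>) = - 1" using assms by simp
    then have "(t powr (- (1 / (2 * \<sigma>)))) powr (2 * \<sigma>) = t powr (- 1)" by (simp only: powr_powr)
    then show ?thesis using assms by (simp add: powr_minus_divide)
  qed
  ultimately show ?thesis using assms by (simp add: rho_def powr_mult)
qed

text \<open>\<open>h\<close> is the Fourier transform of \<open>|u|\<^sup>p\<close>, frozen for negative times; \<open>w0\<close> and \<open>a0\<close> are those of
  \<open>u\<^sub>0 + u\<^sub>1\<close> and \<open>u\<^sub>0\<close>.\<close>

locale diffusion_profile =
  fixes \<sigma> \<alpha> C W n :: real and j k :: nat
    and h :: "real \<Rightarrow> 'n::finite field" and w0 a0 :: "'n field"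
  assumes n_eq: "n = real CARD('n)" and sigma: "\<sigma> \<ge> 1" and alpha: "\<alpha> > 1" and C0: "C \<ge> 0"
    and jk: "(j, k) \<in> order_pairs"
    and h_cont: "continuous_on UNIV (\<lambda>(\<tau>, \<xi>). h \<tau> \<xi>)"
    and h_neg: "\<And>\<tau>. \<tau> \<le> 0 \<Longrightarrow> h \<tau> = h 0"
    and h_bd: "\<And>\<tau> \<xi>. \<tau> \<ge> 0 \<Longrightarrow> norm (h \<tau> \<xi>) \<le> C * (1 + \<tau>) powr (- \<alpha>)"
    and h_L2: "\<And>\<tau>. \<tau> \<ge> 0 \<Longrightarrow> h \<tau> \<in> L2 \<and> L2norm (h \<tau>) \<le> C * (1 + \<tau>) powr (- (\<alpha> + n / (4 * \<sigma>)))"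
    and w_cont: "continuous_on UNIV w0" and w_bd: "\<And>\<xi>. norm (w0 \<xi>) \<le> W" and w_L2: "w0 \<in> L2"
    and a_L2: "(\<lambda>\<xi>. of_real (rho \<sigma> \<xi> powr (real k / 2)) * a0 \<xi>) \<in> L2"
begin

definition e :: real where "e = real k / 2 + real j"

text \<open>The kernel \<open>(t - \<tau>)\<^bsup>-e\<^esup>\<close> is not integrable at \<open>\<tau> = t\<close> when \<open>e = 1\<close>. For late sources it is replaced by
  \<open>(t - \<tau>)\<^bsup>-e(1-\<delta>)\<^esup>\<close>, and \<open>1 + e \<delta> < \<alpha>\<close> makes up for the lost power.\<close>

definition \<delta> :: real where "\<delta> = min (1 / 2) ((\<alpha> - 1) / 2)"

definition rate :: "real \<Rightarrow> real" where "rate t = t powr (- (n / (4 * \<sigma>)) - e)"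

definition M :: complex where "M = w0 0 + (LINT \<tau>:{0..}|lborel. h \<tau> 0)"

lemma e_bounds: "0 \<le> e" "e \<le> 1"
  using jk by (auto simp: e_def order_pairs_def)

lemma n_pos: "n > 0"
  by (simp add: n_eq)

lemma delta: "0 < \<delta>" "\<delta> \<le> 1 / 2" "1 + e * \<delta> < \<alpha>"
proof -
  show d: "0 < \<delta>" "\<delta> \<le> 1 / 2" using alpha by (auto simp: \<delta>_def)
  have "1 + e * \<delta> \<le> 1 + 1 * \<delta>" using e_bounds d by (intro add_left_mono mult_right_mono) auto
  also have "\<delta> \<le> (\<alpha> - 1) / 2" unfolding \<delta>_def by (rule min.cobounded2)
  then have "1 + 1 * \<delta> < \<alpha>" using alpha by simp
  finally show "1 + e * \<delta> < \<alpha>" .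
qed

lemma h_measurable [measurable]: "(\<lambda>(\<tau>, \<xi>). h \<tau> \<xi>) \<in> borel_measurable (borel \<Otimes>\<^sub>M borel)"
  unfolding borel_prod by (rule borel_measurable_continuous_onI[OF h_cont])

lemma w0_measurable [measurable]: "w0 \<in> borel_measurable borel"
  by (rule borel_measurable_continuous_onI[OF w_cont])

lemma h_le: "norm (h \<tau> \<xi>) \<le> C"
proof -
  have le: "norm (h \<tau> \<xi>) \<le> C" if t: "\<tau> \<ge> 0" for \<tau>
  proof -
    have "(1 + \<tau>) powr (- \<alpha>) \<le> (1 + \<tau>) powr 0" using t alpha by (intro powr_mono) auto
    then have "C * (1 + \<tau>) powr (- \<alpha>) \<le> C * 1" using C0 t by (intro mult_left_mono) auto
    then show ?thesis using h_bd[OF t, of \<xi>] by linarith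
  qed
  show ?thesis using le[of \<tau>] le[of 0] h_neg[of \<tau>] by (cases "\<tau> \<ge> 0") auto
qed

lemma h_slice_continuous: "continuous_on UNIV (h \<tau>)"
proof -
  have "continuous_on UNIV (\<lambda>\<xi> :: real ^ 'n. (\<tau>, \<xi>))" by (intro continuous_intros)
  from continuous_on_compose2[OF h_cont this] show ?thesis by simp
qed

section \<open>Decomposition of the error and its rapidly small pieces\<close>

definition late :: "real \<Rightarrow> 'n field" where
  "late t \<xi> = (LINT \<tau>|lborel. of_real (indicator {t / 2..<t} \<tau> * Ksym j k (t - \<tau>) (rho \<sigma> \<xi>)) * h \<tau> \<xi>)"

definition early_high :: "real \<Rightarrow> 'n field" where
  "early_high t \<xi> = (LINT \<tau>|lborel. of_real (indicator {0..<t / 2} \<tau> * indicator {1 / 2<..} (rho \<sigma> \<xi>) * Ksym j k (t - \<tau>) (rho \<sigma> \<xi>)) * h \<tau> \<xi>)"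

definition data_high :: "real \<Rightarrow> 'n field" where
  "data_high t \<xi> = of_real (indicator {1 / 2<..} (rho \<sigma> \<xi>) * Ksym j k t (rho \<sigma> \<xi>)) * w0 \<xi>"

text \<open>The part exp (- t) u_0 of K_0 u_0 after \<partial>_t^j |D|^(k\<sigma>). It is not
  smoothed at all, so for k = 1 its finiteness rests on u_0 in H^\<sigma>, which enters as
  \<open>a_L2\<close>.\<close>

definition data_fast :: "real \<Rightarrow> 'n field" where
  "data_fast t \<xi> = of_real ((- 1) ^ j * exp (- t)) * (of_real (rho \<sigma> \<xi> powr (real k / 2)) * a0 \<xi>)"

text \<open>The solution terms are cut at \<rho> = 1/2, but the profile is subtracted at every
  frequency: under the rescaling its high part is covered by the same majorant and needs no estimate
  of its own.\<close>

definition low :: "real \<Rightarrow> 'n field" where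
  "low t \<xi> = of_real (indicator {..1 / 2} (rho \<sigma> \<xi>)) * (of_real (Ksym j k t (rho \<sigma> \<xi>)) * w0 \<xi>
      + (LINT \<tau>|lborel. of_real (indicator {0..<t / 2} \<tau> * Ksym j k (t - \<tau>) (rho \<sigma> \<xi>)) * h \<tau> \<xi>))
    - M * of_real (rho \<sigma> \<xi> powr (real k / 2) * (- rho \<sigma> \<xi>) ^ j * exp (- (t * rho \<sigma> \<xi>)))"

definition low_scaled :: "real \<Rightarrow> 'n field" where
  "low_scaled t \<eta> = of_real (t powr e) * low t (t powr (- (1 / (2 * \<sigma>))) *\<^sub>R \<eta>)"

text \<open>On [t/2, t) the source is small in L^2, of order t^(-\<beta>) with \<beta> = \<alpha> +
  n/(4\<sigma>), while the kernel is integrated with exponent e (1 - \<delta>) < 1. No regularity of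
  the source in frequency is used.\<close>

lemma late_bound:
  assumes t: "t > 0"
  shows "late t \<in> L2"
    and "L2norm (late t) \<le> (32 * C / (1 - e * (1 - \<delta>))) * (t / 2) powr (1 - e * (1 - \<delta>) - (\<alpha> + n / (4 * \<sigma>)))"
proof -
  let ?\<gamma> = "e * (1 - \<delta>)" and ?\<beta> = "\<alpha> + n / (4 * \<sigma>)"
  have "?\<gamma> \<le> 1 * (1 - \<delta>)" using e_bounds delta by (intro mult_right_mono) auto
  also have "\<dots> < 1" using delta by simp
  finally have "?\<gamma> < 1" .
  then have \<gamma>: "0 \<le> ?\<gamma>" "?\<gamma> < 1" "?\<gamma> \<le> e" using e_bounds delta mult_left_le[of "1 - \<delta>" e] by auto
  let ?a = "\<lambda>\<tau>. 32 * (indicator {t / 2..<t} \<tau> * (t - \<tau>) powr (- ?\<gamma>))"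
  let ?\<Lambda> = "C * (t / 2) powr (- ?\<beta>)"
  have \<beta>: "?\<beta> > 0" using alpha n_pos sigma by (simp add: add_pos_pos)
  let ?K = "\<lambda>\<tau> \<xi>. indicator {t / 2..<t} \<tau> * Ksym j k (t - \<tau>) (rho \<sigma> \<xi>)"
  have K: "\<bar>?K \<tau> \<xi>\<bar> \<le> ?a \<tau>" for \<tau> and \<xi> :: "real ^ 'n"
    proof (cases "\<tau> \<in> {t / 2..<t}")
      case True
      then have "\<bar>Ksym j k (t - \<tau>) (rho \<sigma> \<xi>)\<bar> \<le> 32 * (t - \<tau>) powr (- ?\<gamma>)"
        using \<gamma> by (intro Ksym_decay jk) (auto simp: e_def)
      then show ?thesis using True by simp
    qed simp
  have hb: "h \<tau> \<in> L2 \<and> L2norm (h \<tau>) \<le> ?\<Lambda>" if "?a \<tau> \<noteq> 0" for \<tau>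
    proof -
      have \<tau>: "t / 2 \<le> \<tau>" using that by (auto split: split_indicator_asm)
      have "(1 + \<tau>) powr (- ?\<beta>) \<le> (t / 2) powr (- ?\<beta>)" using \<tau> t \<beta> by (intro powr_mono2') auto
      then have "C * (1 + \<tau>) powr (- ?\<beta>) \<le> ?\<Lambda>" using C0 by (intro mult_left_mono)
      then show ?thesis using h_L2[of \<tau>] \<tau> t by auto
    qed
  have i: "integrable lborel ?a" using integral_powr_endpoint(1)[OF t \<gamma>(2)] by simp
  have m: "(\<lambda>(\<tau>, \<xi>). ?K \<tau> \<xi>) \<in> borel_measurable (borel \<Otimes>\<^sub>M borel)" by measurable
  have \<Lambda>: "?\<Lambda> \<ge> 0" using C0 by simp
  note W = L2_weighted_integral[where K="?K" and a="?a" and \<Lambda>="?\<Lambda>", OF m h_measurable K i h_le hb \<Lambda>]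
  show "late t \<in> L2" unfolding late_def[abs_def] by (rule W(1))
  have "(LINT \<tau>|lborel. ?a \<tau>) * ?\<Lambda> = (32 * C / (1 - ?\<gamma>)) * ((t / 2) powr (1 - ?\<gamma>) * (t / 2) powr (- ?\<beta>))"
    using integral_powr_endpoint(2)[OF t \<gamma>(2)] by simp
  also have "(t / 2) powr (1 - ?\<gamma>) * (t / 2) powr (- ?\<beta>) = (t / 2) powr (1 - ?\<gamma> - ?\<beta>)"
    by (simp add: algebra_simps flip: powr_add)
  finally show "L2norm (late t) \<le> (32 * C / (1 - ?\<gamma>)) * (t / 2) powr (1 - ?\<gamma> - ?\<beta>)" unfolding late_def[abs_def] using W(2) by simp
qed

text \<open>For \<tau> < t/2 the elapsed time exceeds t/2, so the high frequency factor exp (- (t -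
  \<tau>)/4) is at most exp (- t/8); integration over an interval of length t/2 gives the factor
  t.\<close>

lemma early_high_bound:
  assumes t: "t > 0"
  shows "early_high t \<in> L2" and "L2norm (early_high t) \<le> 4 * C * (t * exp (- t / 8))"
proof -
  let ?\<beta> = "\<alpha> + n / (4 * \<sigma>)"
  let ?a = "\<lambda>\<tau>. 8 * exp (- t / 8) * indicator {0..<t / 2} \<tau>"
  have \<beta>: "?\<beta> > 0" using alpha n_pos sigma by (simp add: add_pos_pos)
  have i: "integrable lborel (indicator {0..<t / 2} :: real \<Rightarrow> real)"
    using t by (intro integrable_real_indicator) auto
  let ?K = "\<lambda>\<tau> \<xi>. indicator {0..<t / 2} \<tau> * indicator {1 / 2<..} (rho \<sigma> \<xi>) * Ksym j k (t - \<tau>) (rho \<sigma> \<xi>)"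
  have K: "\<bar>?K \<tau> \<xi>\<bar> \<le> ?a \<tau>" for \<tau> and \<xi> :: "real ^ 'n"
    proof (cases "\<tau> \<in> {0..<t / 2} \<and> 1 / 2 < rho \<sigma> \<xi>")
      case True
      then have "\<bar>Ksym j k (t - \<tau>) (rho \<sigma> \<xi>)\<bar> \<le> 8 * exp (- (t - \<tau>) / 4)"
        by (intro Ksym_high jk) auto
      also have "\<dots> \<le> 8 * exp (- t / 8)" using True by auto
      finally show ?thesis using True by simp
    next
      case False
      then have z: "indicator {0..<t / 2} \<tau> * indicator {1 / 2<..} (rho \<sigma> \<xi>) = (0 :: real)" by (auto split: split_indicator)
      show ?thesis unfolding z by (simp split: split_indicator)
    qed
  have hb: "h \<tau> \<in> L2 \<and> L2norm (h \<tau>) \<le> C" if "?a \<tau> \<noteq> 0" for \<tau>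
    proof -
      have \<tau>: "0 \<le> \<tau>" using that by (auto split: split_indicator_asm)
      have "(1 + \<tau>) powr (- ?\<beta>) \<le> (1 + \<tau>) powr 0" using \<tau> \<beta> by (intro powr_mono) auto
      then have "C * (1 + \<tau>) powr (- ?\<beta>) \<le> C * 1" using C0 \<tau> by (intro mult_left_mono) auto
      then show ?thesis using h_L2[OF \<tau>] by auto
    qed
  have ia: "integrable lborel ?a" using i by simp
  have m: "(\<lambda>(\<tau>, \<xi>). ?K \<tau> \<xi>) \<in> borel_measurable (borel \<Otimes>\<^sub>M borel)" by measurable
  note W = L2_weighted_integral[where K="?K" and a="?a" and \<Lambda>=C, OF m h_measurable K ia h_le hb C0]
  show "early_high t \<in> L2" unfolding early_high_def[abs_def] by (rule W(1))
  have "measure lborel {0..<t / 2} = t / 2" using t by (simp add: measure_def)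
  then have A: "(LINT \<tau>|lborel. ?a \<tau>) * C = 4 * C * (t * exp (- t / 8))" using t by simp
  show "L2norm (early_high t) \<le> 4 * C * (t * exp (- t / 8))"
    unfolding early_high_def[abs_def] by (rule W(2)[unfolded A])
qed

lemma data_high_bound:
  assumes t: "t > 0"
  shows "data_high t \<in> L2" and "L2norm (data_high t) \<le> 8 * exp (- t / 4) * L2norm w0"
proof -
  have b: "norm (data_high t \<xi>) \<le> 8 * exp (- t / 4) * norm (w0 \<xi>)" for \<xi>
    unfolding data_high_def norm_mult
    by (intro mult_right_mono) (use Ksym_high[OF jk, of "rho \<sigma> \<xi>" t] t in \<open>auto simp: abs_mult split: split_indicator\<close>)
  have m: "data_high t \<in> borel_measurable borel" unfolding data_high_def[abs_def] by measurable
  show "data_high t \<in> L2" by (rule L2_bound[OF w_L2 m]) (use b in auto)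
  have "L2norm (data_high t) \<le> L2norm (\<lambda>\<xi>. of_real (8 * exp (- t / 4)) * w0 \<xi>)"
    by (rule L2norm_mono[OF _ L2_cmult[OF w_L2] m]) (use b in \<open>auto simp: norm_mult\<close>)
  then show "L2norm (data_high t) \<le> 8 * exp (- t / 4) * L2norm w0"
    unfolding L2norm_cmult norm_of_real by simp
qed

lemma data_fast_bound:
  "data_fast t \<in> L2" "L2norm (data_fast t) = exp (- t) * L2norm (\<lambda>\<xi>. of_real (rho \<sigma> \<xi> powr (real k / 2)) * a0 \<xi>)"
  unfolding data_fast_def[abs_def] by (intro L2_cmult a_L2) (simp add: L2norm_cmult norm_mult norm_power)

end

lemma exp_smallo_powr:
  fixes a :: real
  shows "(\<lambda>t. t * exp (- t / 8)) \<in> o[at_top](\<lambda>t. t powr a)"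
    and "(\<lambda>t. exp (- t / 4)) \<in> o[at_top](\<lambda>t. t powr a)"
    and "(\<lambda>t::real. exp (- t)) \<in> o[at_top](\<lambda>t. t powr a)"
  by real_asymp+

lemma cmult_in_smallo:
  fixes f g :: "real \<Rightarrow> real"
  shows "f \<in> o[F](g) \<Longrightarrow> (\<lambda>x. c * f x) \<in> o[F](g)"
  by (cases "c = 0") simp_all

section \<open>Low frequencies under the diffusive rescaling\<close>

context diffusion_profile
begin

text \<open>The symbol of \<partial>_t^j |D|^(k\<sigma>) applied to the heat kernel at time 1, in
  the variable s = |\<eta>|^(2\<sigma>).\<close>

definition profile :: "real \<Rightarrow> real" where
  "profile s = s powr (real k / 2) * (- s) ^ j * exp (- s)"

lemma profile_scale:
  assumes "t > 0" "s \<ge> 0"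
  shows "t powr e * ((s / t) powr (real k / 2) * (- (s / t)) ^ j * exp (- (t * (s / t)))) = profile s"
proof -
  have "j = 0 \<and> k = 0 \<or> j = 0 \<and> k = 1 \<or> j = 1 \<and> k = 0" using jk by (auto simp: order_pairs_def)
  then show ?thesis
    using assms unfolding profile_def e_def by (elim disjE conjE) (auto simp: powr_divide)
qed

text \<open>The exponent s/4 is weaker than necessary and is chosen to agree with
  \<open>Ksym_scaled_bound\<close>, so that all parts of \<open>low_scaled\<close> have one
  majorant.\<close>

lemma profile_bound:
  assumes s: "s \<ge> 0" shows "\<bar>profile s\<bar> \<le> 2 * exp (- (s / 4))"
proof -
  have h: "exp (- (s / 2)) \<le> exp (- (s / 4))" using s by simp
  have f: "exp (- s) \<le> exp (- (s / 2))" using s by simp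
  have l: "s * exp (- s) \<le> 2 * exp (- (s / 2))"
  proof -
    have "s * exp (- s) = (s * exp (- (1 / 2 * s))) * exp (- (s / 2))" by (simp add: mult.assoc flip: exp_add)
    also have "\<dots> \<le> 2 * exp (- (s / 2))" using x_exp_le[of "1 / 2" s] by (intro mult_right_mono) auto
    finally show ?thesis .
  qed
  have r: "s powr (1 / 2) * exp (- s) \<le> 2 * exp (- (s / 2))"
  proof -
    have "s powr (1 / 2) \<le> 1 + s" using s arith_geo_mean_sqrt[of 1 s] by (simp add: powr_half_sqrt)
    then have "s powr (1 / 2) * exp (- s) \<le> (1 + s) * exp (- s)" by (intro mult_right_mono) auto
    also have "(1 + s) * exp (- s) \<le> 2 * exp (- (s / 2))"
    proof -
      have "1 + s \<le> 2 * (1 + s / 2)" by simp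
      also have "\<dots> \<le> 2 * exp (s / 2)" by (intro mult_left_mono exp_ge_add_one_self) simp
      finally have "(1 + s) * exp (- s) \<le> 2 * exp (s / 2) * exp (- s)" by (intro mult_right_mono) auto
      also have "\<dots> = 2 * exp (- (s / 2))" by (simp add: mult.assoc flip: exp_add)
      finally show ?thesis .
    qed
    finally show ?thesis .
  qed
  have a: "exp (- s) \<le> 2 * exp (- (s / 4))" using f h exp_gt_zero[of "- (s / 4)"] by linarith
  have b: "s powr (1 / 2) * exp (- s) \<le> 2 * exp (- (s / 4))" using r h by linarith
  have c: "s * exp (- s) \<le> 2 * exp (- (s / 4))" using l h by linarith
  have "j = 0 \<and> k = 0 \<or> j = 0 \<and> k = 1 \<or> j = 1 \<and> k = 0" using jk by (auto simp: order_pairs_def)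
  then show ?thesis
    using a b c s unfolding profile_def by (elim disjE conjE) (auto simp: abs_mult)
qed

text \<open>Uniform in t and \<tau>: because t \<le> 2 (t - \<tau>), the power t^e costs a factor at
  most 2 against (t - \<tau>)^e, and (t - \<tau>) s/t is at least s/2, which halves the exponent of
  \<open>Ksym_low\<close> to s/4.\<close>

lemma Ksym_scaled_bound:
  assumes "t > 0" "0 \<le> \<tau>" "\<tau> < t / 2" "s \<ge> 0" "s / t \<le> 1 / 2"
  shows "t powr e * \<bar>Ksym j k (t - \<tau>) (s / t)\<bar> \<le> 16 * exp (- (s / 4))"
proof -
  let ?x = "t - \<tau>"
  have "t powr e \<le> (2 * ?x) powr e" using assms e_bounds by (intro powr_mono2) auto
  also have "\<dots> = 2 powr e * ?x powr e" using assms by (intro powr_mult) 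
  also have "\<dots> \<le> 2 * ?x powr e"
    using e_bounds powr_mono[of e 1 2] by (intro mult_right_mono) auto
  finally have "t powr e * \<bar>Ksym j k ?x (s / t)\<bar> \<le> 2 * ?x powr e * \<bar>Ksym j k ?x (s / t)\<bar>"
    by (intro mult_right_mono) auto
  also have "\<dots> = 2 * (?x powr (real k / 2 + real j) * \<bar>Ksym j k ?x (s / t)\<bar>)" by (simp add: e_def mult.assoc)
  also have "\<dots> \<le> 2 * (8 * exp (- (?x * (s / t) / 2)))"
    by (intro mult_left_mono Ksym_low(2) jk) (use assms in auto)
  also have "\<dots> = 16 * exp (- (?x * (s / t) / 2))" by simp
  also have "\<dots> \<le> 16 * exp (- (s / 4))"
  proof -
    have "t / 2 * (s / t) \<le> ?x * (s / t)" using assms by (intro mult_right_mono) auto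
    moreover have "t / 2 * (s / t) = s / 2" using assms by simp
    ultimately have "s / 2 \<le> ?x * (s / t)" by metis
    then have "s / 2 / 2 \<le> ?x * (s / t) / 2" by (intro divide_right_mono) auto
    moreover have "s / 2 / 2 = s / 4" by simp
    ultimately have "- (?x * (s / t) / 2) \<le> - (s / 4)" by (metis neg_le_iff_le)
    then have "exp (- (?x * (s / t) / 2)) \<le> exp (- (s / 4))" by (simp only: exp_le_cancel_iff)
    then show ?thesis by (intro mult_left_mono) simp_all
  qed
  finally show ?thesis .
qed

definition decay_mass :: real where
  "decay_mass = (LINT \<tau>|lborel. indicator {0..} \<tau> * (1 + \<tau>) powr (- \<alpha>))"

abbreviation dil :: "real \<Rightarrow> real ^ 'n \<Rightarrow> real ^ 'n" where
  "dil t \<eta> \<equiv> t powr (- (1 / (2 * \<sigma>))) *\<^sub>R \<eta>"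

definition low_data :: "real \<Rightarrow> 'n field" where
  "low_data t \<eta> = of_real (t powr e * (indicator {..1 / 2} (rho \<sigma> \<eta> / t) * Ksym j k t (rho \<sigma> \<eta> / t))) * w0 (dil t \<eta>)"

definition low_source_at :: "real \<Rightarrow> real \<Rightarrow> 'n field" where
  "low_source_at t \<tau> \<eta> = of_real (t powr e * (indicator {..1 / 2} (rho \<sigma> \<eta> / t) * (indicator {0..<t / 2} \<tau> * Ksym j k (t - \<tau>) (rho \<sigma> \<eta> / t))))
     * h \<tau> (dil t \<eta>)"

lemma low_scaled_eq:
  assumes t: "t > 0"
  shows "low_scaled t \<eta> = low_data t \<eta> + (LINT \<tau>|lborel. low_source_at t \<tau> \<eta>) - M * of_real (profile (rho \<sigma> \<eta>))"
proof -
  have r: "rho \<sigma> (dil t \<eta>) = rho \<sigma> \<eta> / t" by (rule rho_scale) (use sigma t in auto)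
  have src: "(LINT \<tau>|lborel. low_source_at t \<tau> \<eta>) = of_real (t powr e * indicator {..1 / 2} (rho \<sigma> \<eta> / t)) *
      (LINT \<tau>|lborel. of_real (indicator {0..<t / 2} \<tau> * Ksym j k (t - \<tau>) (rho \<sigma> \<eta> / t)) * h \<tau> (dil t \<eta>))"
    unfolding low_source_at_def integral_mult_right_zero[symmetric]
    by (simp only: of_real_mult mult.assoc)
  have "low_scaled t \<eta> = of_real (t powr e) * (of_real (indicator {..1 / 2} (rho \<sigma> \<eta> / t)) * (of_real (Ksym j k t (rho \<sigma> \<eta> / t)) * w0 (dil t \<eta>)
      + (LINT \<tau>|lborel. of_real (indicator {0..<t / 2} \<tau> * Ksym j k (t - \<tau>) (rho \<sigma> \<eta> / t)) * h \<tau> (dil t \<eta>)))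
      - M * of_real ((rho \<sigma> \<eta> / t) powr (real k / 2) * (- (rho \<sigma> \<eta> / t)) ^ j * exp (- (t * (rho \<sigma> \<eta> / t)))))"
    unfolding low_scaled_def low_def r ..
  also have "\<dots> = low_data t \<eta> + (LINT \<tau>|lborel. low_source_at t \<tau> \<eta>)
      - M * of_real (t powr e * ((rho \<sigma> \<eta> / t) powr (real k / 2) * (- (rho \<sigma> \<eta> / t)) ^ j * exp (- (t * (rho \<sigma> \<eta> / t)))))"
    unfolding src low_data_def by (simp only: of_real_mult right_diff_distrib distrib_left mult_ac)
  finally show ?thesis unfolding profile_scale[OF t rho_nonneg] .
qed

text \<open>The majorant is a product of an integrable function of \<tau> and a square integrable
  function of \<eta>. It therefore serves both limits: inside the time integral at fixed \<eta>, and
  afterwards in the norm.\<close>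

lemma low_source_bound:
  assumes t: "t > 0"
  shows "norm (low_source_at t \<tau> \<eta>) \<le> 16 * C * exp (- (rho \<sigma> \<eta> / 4)) * (indicator {0..} \<tau> * (1 + \<tau>) powr (- \<alpha>))"
proof (cases "\<tau> \<in> {0..<t / 2} \<and> rho \<sigma> \<eta> / t \<le> 1 / 2")
  case True
  then have \<tau>: "0 \<le> \<tau>" "\<tau> < t / 2" by auto
  have "norm (low_source_at t \<tau> \<eta>) = (t powr e * \<bar>Ksym j k (t - \<tau>) (rho \<sigma> \<eta> / t)\<bar>) * norm (h \<tau> (dil t \<eta>))"
    using True by (simp add: low_source_at_def norm_mult abs_mult)
  also have "\<dots> \<le> (16 * exp (- (rho \<sigma> \<eta> / 4))) * (C * (1 + \<tau>) powr (- \<alpha>))"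
    using True \<tau> t by (intro mult_mono Ksym_scaled_bound h_bd) auto
  finally show ?thesis using True by (simp add: mult_ac)
next
  case False
  then have "low_source_at t \<tau> \<eta> = 0" by (auto simp: low_source_at_def split: split_indicator)
  then show ?thesis using C0 by simp
qed

lemma low_data_bound:
  assumes t: "t > 0"
  shows "norm (low_data t \<eta>) \<le> 16 * W * exp (- (rho \<sigma> \<eta> / 4))"
proof (cases "rho \<sigma> \<eta> / t \<le> 1 / 2")
  case True
  have "norm (low_data t \<eta>) = (t powr e * \<bar>Ksym j k (t - 0) (rho \<sigma> \<eta> / t)\<bar>) * norm (w0 (dil t \<eta>))"
    using True by (simp add: low_data_def norm_mult abs_mult)
  also have "\<dots> \<le> (16 * exp (- (rho \<sigma> \<eta> / 4))) * W"
    using True t by (intro mult_mono Ksym_scaled_bound w_bd) auto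
  finally show ?thesis by (simp add: mult_ac)
next
  case False
  have "0 \<le> W" using w_bd[of 0] norm_ge_zero order_trans by blast
  then show ?thesis using False by (simp add: low_data_def)
qed

lemma low_source_measurable [measurable]:
  "(\<lambda>(\<tau>, \<eta>). low_source_at t \<tau> \<eta>) \<in> borel_measurable (borel \<Otimes>\<^sub>M borel)"
  unfolding low_source_at_def by measurable

lemma low_scaled_bound:
  assumes t: "t > 0"
  shows "norm (low_scaled t \<eta>) \<le> (16 * W + 16 * C * decay_mass + 2 * norm M) * exp (- (rho \<sigma> \<eta> / 4))"
proof -
  let ?E = "exp (- (rho \<sigma> \<eta> / 4))"
  let ?g = "\<lambda>\<tau>. 16 * C * ?E * (indicator {0..} \<tau> * (1 + \<tau>) powr (- \<alpha>))"
  have g: "integrable lborel ?g" using integrable_decay[OF alpha] by simp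
  have i: "integrable lborel (\<lambda>\<tau>. low_source_at t \<tau> \<eta>)"
    by (rule Bochner_Integration.integrable_bound[OF g])
      (use low_source_bound[OF t] C0 in \<open>auto simp: abs_mult\<close>)
  have "norm (LINT \<tau>|lborel. low_source_at t \<tau> \<eta>) \<le> (LINT \<tau>|lborel. norm (low_source_at t \<tau> \<eta>))"
    by (rule integral_norm_bound)
  also have "\<dots> \<le> (LINT \<tau>|lborel. ?g \<tau>)"
    by (rule integral_mono[OF integrable_norm[OF i] g low_source_bound[OF t]])
  also have "\<dots> = 16 * C * ?E * decay_mass" by (simp add: decay_mass_def)
  finally have s: "norm (LINT \<tau>|lborel. low_source_at t \<tau> \<eta>) \<le> 16 * C * ?E * decay_mass" .
  have p: "norm (M * of_real (profile (rho \<sigma> \<eta>))) \<le> norm M * (2 * ?E)"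
    unfolding norm_mult norm_of_real by (intro mult_left_mono profile_bound) auto
  have "norm (low_scaled t \<eta>) \<le> norm (low_data t \<eta>) + norm (LINT \<tau>|lborel. low_source_at t \<tau> \<eta>)
      + norm (M * of_real (profile (rho \<sigma> \<eta>)))"
    unfolding low_scaled_eq[OF t] by (intro order_trans[OF norm_triangle_ineq4] add_right_mono norm_triangle_ineq)
  also have "\<dots> \<le> 16 * W * ?E + 16 * C * ?E * decay_mass + norm M * (2 * ?E)"
    by (intro add_mono low_data_bound t s p)
  also have "\<dots> = (16 * W + 16 * C * decay_mass + 2 * norm M) * ?E" by (simp add: algebra_simps)
  finally show ?thesis .
qed

lemma low_measurable [measurable]: "low t \<in> borel_measurable borel"
  unfolding low_def[abs_def] by measurable

lemma low_scaled_measurable [measurable]: "low_scaled t \<in> borel_measurable borel"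
  unfolding low_scaled_def[abs_def] by measurable

lemma dil_tendsto: "((\<lambda>t. dil t \<eta>) \<longlongrightarrow> 0) at_top"
proof -
  have "((\<lambda>t. t powr (- (1 / (2 * \<sigma>)))) \<longlongrightarrow> 0) at_top"
    using sigma by (intro tendsto_neg_powr filterlim_ident) auto
  from tendsto_scaleR[OF this tendsto_const, of \<eta>] show ?thesis by simp
qed

text \<open>At a fixed \<eta> the frequency cut-off and the restriction \<tau> < t/2 become inactive
  for large t, and both the data and the source are evaluated at frequencies shrinking to 0. The
  limit is the profile times w0(0) plus the integrated h(\<tau>, 0), minus M times the profile, and
  \<open>M\<close> is defined to make this vanish. The point \<eta> = 0 is excluded because
  \<open>Ksym_limit\<close> needs s > 0.\<close>

lemma low_scaled_limit:
  assumes "\<eta> \<noteq> 0" shows "((\<lambda>t. low_scaled t \<eta>) \<longlongrightarrow> 0) at_top"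
proof -
  let ?s = "rho \<sigma> \<eta>"
  have s: "?s > 0" using assms by (simp add: rho_def)
  have small: "\<forall>\<^sub>F t in at_top. ?s / t \<le> 1 / 2"
    using eventually_gt_at_top[of "2 * ?s"]
  proof eventually_elim
    case (elim t)
    then have "t > 0" using s by linarith
    then show ?case using elim by (simp add: field_simps)
  qed
  have K: "((\<lambda>t. t powr e * Ksym j k (t - \<tau>) (?s / t)) \<longlongrightarrow> profile ?s) at_top" for \<tau>
    using Ksym_limit[OF jk s, of \<tau>] by (simp add: e_def profile_def)
  have w: "((\<lambda>t. w0 (dil t \<eta>)) \<longlongrightarrow> w0 0) at_top"
    using w_cont by (intro isCont_tendsto_compose[OF _ dil_tendsto]) (simp add: continuous_on_eq_continuous_at)
  have hl: "((\<lambda>t. h \<tau> (dil t \<eta>)) \<longlongrightarrow> h \<tau> 0) at_top" for \<tau>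
    using h_slice_continuous[of \<tau>] by (intro isCont_tendsto_compose[OF _ dil_tendsto]) (simp add: continuous_on_eq_continuous_at)
  have "((\<lambda>t. of_real (t powr e * Ksym j k (t - 0) (?s / t)) * w0 (dil t \<eta>)) \<longlongrightarrow> of_real (profile ?s) * w0 0) at_top"
    by (intro tendsto_intros K w)
  then have l1: "((\<lambda>t. low_data t \<eta>) \<longlongrightarrow> of_real (profile ?s) * w0 0) at_top"
    by (rule Lim_transform_eventually) (rule eventually_mono[OF small], simp add: low_data_def)
  have "((\<lambda>t. LINT \<tau>|lborel. low_source_at t \<tau> \<eta>) \<longlongrightarrow> (LINT \<tau>|lborel. indicator {0..} \<tau> *\<^sub>R (of_real (profile ?s) * h \<tau> 0))) at_top"
  proof (rule integral_dominated_convergence_at_top[where w="\<lambda>\<tau>. 16 * C * exp (- (?s / 4)) * (indicator {0..} \<tau> * (1 + \<tau>) powr (- \<alpha>))"])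
    show "integrable lborel (\<lambda>\<tau>. 16 * C * exp (- (?s / 4)) * (indicator {0..} \<tau> * (1 + \<tau>) powr (- \<alpha>)))"
      using integrable_decay[OF alpha] by simp
    show "\<forall>\<^sub>F t in at_top. AE \<tau> in lborel. norm (low_source_at t \<tau> \<eta>) \<le> 16 * C * exp (- (?s / 4)) * (indicator {0..} \<tau> * (1 + \<tau>) powr (- \<alpha>))"
      by (rule eventually_mono[OF eventually_gt_at_top[of 0]]) (intro AE_I2 low_source_bound)
    show "AE \<tau> in lborel. ((\<lambda>t. low_source_at t \<tau> \<eta>) \<longlongrightarrow> indicator {0..} \<tau> *\<^sub>R (of_real (profile ?s) * h \<tau> 0)) at_top"
    proof (rule AE_I2)
      fix \<tau> :: real
      show "((\<lambda>t. low_source_at t \<tau> \<eta>) \<longlongrightarrow> indicator {0..} \<tau> *\<^sub>R (of_real (profile ?s) * h \<tau> 0)) at_top"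
      proof (cases "\<tau> \<ge> 0")
        case True
        have "((\<lambda>t. of_real (t powr e * Ksym j k (t - \<tau>) (?s / t)) * h \<tau> (dil t \<eta>)) \<longlongrightarrow> of_real (profile ?s) * h \<tau> 0) at_top"
          by (intro tendsto_intros K hl)
        moreover have "\<forall>\<^sub>F t in at_top. of_real (t powr e * Ksym j k (t - \<tau>) (?s / t)) * h \<tau> (dil t \<eta>) = low_source_at t \<tau> \<eta>"
          using small eventually_gt_at_top[of "2 * \<tau>"]
          by eventually_elim (use True in \<open>simp add: low_source_at_def\<close>)
        ultimately show ?thesis using True by (simp add: Lim_transform_eventually)
      qed (simp add: low_source_at_def)
    qed
  qed measurable
  also have "(LINT \<tau>|lborel. indicator {0..} \<tau> *\<^sub>R (of_real (profile ?s) * h \<tau> 0)) = of_real (profile ?s) * (LINT \<tau>:{0..}|lborel. h \<tau> 0)"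
    unfolding set_lebesgue_integral_def by (simp flip: mult_scaleR_right)
  finally have l2: "((\<lambda>t. LINT \<tau>|lborel. low_source_at t \<tau> \<eta>) \<longlongrightarrow> of_real (profile ?s) * (LINT \<tau>:{0..}|lborel. h \<tau> 0)) at_top" .
  have "((\<lambda>t. low_data t \<eta> + (LINT \<tau>|lborel. low_source_at t \<tau> \<eta>) - M * of_real (profile ?s)) \<longlongrightarrow>
      of_real (profile ?s) * w0 0 + of_real (profile ?s) * (LINT \<tau>:{0..}|lborel. h \<tau> 0) - M * of_real (profile ?s)) at_top"
    by (intro tendsto_intros l1 l2)
  moreover have "of_real (profile ?s) * w0 0 + of_real (profile ?s) * (LINT \<tau>:{0..}|lborel. h \<tau> 0) - M * of_real (profile ?s) = 0"
    unfolding M_def by (simp add: algebra_simps)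
  ultimately have "((\<lambda>t. low_data t \<eta> + (LINT \<tau>|lborel. low_source_at t \<tau> \<eta>) - M * of_real (profile ?s)) \<longlongrightarrow> 0) at_top"
    by simp
  then show ?thesis
    by (rule Lim_transform_eventually) (rule eventually_mono[OF eventually_gt_at_top[of 0]], simp add: low_scaled_eq)
qed

lemma low_scaled_L2:
  assumes "t > 0" shows "low_scaled t \<in> L2"
proof (rule L2_bound)
  show "(\<lambda>\<eta> :: real ^ 'n. complex_of_real (exp (- (rho \<sigma> \<eta> / 4)))) \<in> L2"
    using exp_rho_L2[OF sigma, of "1 / 4"] by simp
  show "AE \<eta> in lborel. norm (low_scaled t \<eta>)
      \<le> (16 * W + 16 * C * decay_mass + 2 * norm M) * norm (complex_of_real (exp (- (rho \<sigma> \<eta> / 4))))"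
    using low_scaled_bound[OF assms] by (intro AE_I2) simp
qed measurable

text \<open>The second dominated convergence, now in \<eta>. The majorant in
  \<open>low_scaled_bound\<close> has an exponent independent of t, which is what the rescaling was
  made for.\<close>

lemma low_scaled_tendsto: "((\<lambda>t. L2norm (low_scaled t)) \<longlongrightarrow> 0) at_top"
proof -
  let ?B = "16 * W + 16 * C * decay_mass + 2 * norm M"
  have "((\<lambda>t. LINT \<eta>|lborel. (norm (low_scaled t \<eta>))\<^sup>2) \<longlongrightarrow> (LINT \<eta>|(lborel :: (real ^ 'n) measure). (0::real))) at_top"
  proof (rule integral_dominated_convergence_at_top[where w="\<lambda>\<eta>. ?B\<^sup>2 * (norm (complex_of_real (exp (- (rho \<sigma> \<eta> / 4)))))\<^sup>2"])
    show "integrable lborel (\<lambda>\<eta> :: real ^ 'n. ?B\<^sup>2 * (norm (complex_of_real (exp (- (rho \<sigma> \<eta> / 4)))))\<^sup>2)"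
      using exp_rho_L2[OF sigma, of "1 / 4"] by (intro integrable_mult_right L2_integrable) simp
    show "AE \<eta> in lborel. ((\<lambda>t. (norm (low_scaled t \<eta>))\<^sup>2) \<longlongrightarrow> 0) at_top"
      using AE_lborel_singleton[of "0 :: real ^ 'n"]
    proof eventually_elim
      case (elim \<eta>)
      have "((\<lambda>t. (norm (low_scaled t \<eta>))\<^sup>2) \<longlongrightarrow> (norm (0 :: complex))\<^sup>2) at_top"
        by (intro tendsto_intros low_scaled_limit elim)
      then show ?case by simp
    qed
    show "\<forall>\<^sub>F t in at_top. AE \<eta> in lborel. norm ((norm (low_scaled t \<eta>))\<^sup>2) \<le> ?B\<^sup>2 * (norm (complex_of_real (exp (- (rho \<sigma> \<eta> / 4)))))\<^sup>2"
      using eventually_gt_at_top[of 0]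
    proof eventually_elim
      case (elim t)
      show ?case
      proof (rule AE_I2)
        fix \<eta>
        have "(norm (low_scaled t \<eta>))\<^sup>2 \<le> (?B * exp (- (rho \<sigma> \<eta> / 4)))\<^sup>2"
          by (intro power_mono low_scaled_bound elim) simp
        then show "norm ((norm (low_scaled t \<eta>))\<^sup>2) \<le> ?B\<^sup>2 * (norm (complex_of_real (exp (- (rho \<sigma> \<eta> / 4)))))\<^sup>2"
          by (simp add: power_mult_distrib)
      qed
    qed
  qed measurable
  then have "((\<lambda>t. sqrt (LINT \<eta>|lborel. (norm (low_scaled t \<eta>))\<^sup>2)) \<longlongrightarrow> sqrt 0) at_top"
    by (intro tendsto_intros) simp
  then show ?thesis by (simp add: L2norm_def)
qed

text \<open>Undoing the dilation: its Jacobian t^(-n/(2\<sigma>)) and the normalising factor t^(-2e)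
  combine to the square of \<open>rate t\<close>.\<close>

lemma low_bound:
  assumes t: "t > 0"
  shows "low t \<in> L2" "L2norm (low t) \<le> rate t * L2norm (low_scaled t)"
proof -
  let ?c = "t powr (- (1 / (2 * \<sigma>)))"
  have c: "?c > 0" using t by simp
  have "(\<integral>\<^sup>+\<xi>. ennreal ((norm (low t \<xi>))\<^sup>2) \<partial>lborel)
      = ennreal (\<bar>?c\<bar> ^ DIM(real ^ 'n)) * (\<integral>\<^sup>+\<eta>. ennreal ((norm (low t (dil t \<eta>)))\<^sup>2) \<partial>lborel)"
    using c by (intro nn_integral_lborel_scale) auto
  also have "(\<integral>\<^sup>+\<eta>. ennreal ((norm (low t (dil t \<eta>)))\<^sup>2) \<partial>lborel)
      = (\<integral>\<^sup>+\<eta>. ennreal (t powr (- 2 * e)) * ennreal ((norm (low_scaled t \<eta>))\<^sup>2) \<partial>lborel)"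
  proof (rule nn_integral_cong)
    fix \<eta> :: "real ^ 'n"
    have "t powr (- 2 * e) * (t powr e)\<^sup>2 = 1" using t by (simp add: power2_eq_square flip: powr_add)
    then have "(norm (low t (dil t \<eta>)))\<^sup>2 = t powr (- 2 * e) * (norm (low_scaled t \<eta>))\<^sup>2"
      by (simp add: low_scaled_def norm_mult power_mult_distrib flip: mult.assoc)
    then show "ennreal ((norm (low t (dil t \<eta>)))\<^sup>2) = ennreal (t powr (- 2 * e)) * ennreal ((norm (low_scaled t \<eta>))\<^sup>2)"
      by (simp add: ennreal_mult)
  qed
  also have "\<dots> = ennreal (t powr (- 2 * e)) * ennreal ((L2norm (low_scaled t))\<^sup>2)"
    by (subst nn_integral_cmult) (simp_all add: nn_integral_L2[OF low_scaled_L2[OF t]])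
  also have "ennreal (\<bar>?c\<bar> ^ DIM(real ^ 'n)) * (ennreal (t powr (- 2 * e)) * ennreal ((L2norm (low_scaled t))\<^sup>2))
      = ennreal ((rate t * L2norm (low_scaled t))\<^sup>2)"
  proof -
    have "\<bar>?c\<bar> ^ DIM(real ^ 'n) = t powr (- (n / (2 * \<sigma>)))"
      using c by (simp add: n_eq powr_powr flip: powr_realpow)
    moreover have "t powr (- (n / (2 * \<sigma>))) * t powr (- 2 * e) = (rate t)\<^sup>2"
      by (simp add: rate_def power2_eq_square flip: powr_add)
    ultimately have "\<bar>?c\<bar> ^ DIM(real ^ 'n) * (t powr (- 2 * e) * (L2norm (low_scaled t))\<^sup>2) = (rate t * L2norm (low_scaled t))\<^sup>2"
      by (simp add: power_mult_distrib flip: mult.assoc)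
    then show ?thesis by (simp flip: ennreal_mult)
  qed
  finally have "(\<integral>\<^sup>+\<xi>. ennreal ((norm (low t \<xi>))\<^sup>2) \<partial>lborel) \<le> ennreal ((rate t * L2norm (low_scaled t))\<^sup>2)" by simp
  then show "low t \<in> L2" "L2norm (low t) \<le> rate t * L2norm (low_scaled t)"
    using L2_nn_integralI[of "low t" "rate t * L2norm (low_scaled t)"] by (auto simp: rate_def)
qed

text \<open>The Fourier transform of \<partial>_t^j |D|^(k\<sigma>) (u - M G) at time t; this
  identification is made in \<open>asymptotics\<close>, where the locale is instantiated.\<close>

definition error :: "real \<Rightarrow> 'n field" where
  "error t \<xi> = of_real (Ksym j k t (rho \<sigma> \<xi>)) * w0 \<xi> + data_fast t \<xi>
    + (LINT \<tau>|lborel. of_real (indicator {0..<t} \<tau> * Ksym j k (t - \<tau>) (rho \<sigma> \<xi>)) * h \<tau> \<xi>)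
    - M * of_real (rho \<sigma> \<xi> powr (real k / 2) * (- rho \<sigma> \<xi>) ^ j * exp (- (t * rho \<sigma> \<xi>)))"

lemma source_integrable:
  assumes "b \<le> t"
  shows "integrable lborel (\<lambda>\<tau>. of_real (indicator {a..<b} \<tau> * Ksym j k (t - \<tau>) (rho \<sigma> \<xi>)) * h \<tau> \<xi>)"
proof (rule Bochner_Integration.integrable_bound[of _ "\<lambda>\<tau>. 8 * C * indicator {a..<b} \<tau>"])
  show "integrable lborel (\<lambda>\<tau>. 8 * C * indicator {a..<b} \<tau> :: real)"
  proof (intro integrable_mult_right integrable_real_indicator)
    show "emeasure lborel {a..<b} < \<infinity>" by (cases "a \<le> b") auto
  qed simp
  show "AE \<tau> in lborel. norm (of_real (indicator {a..<b} \<tau> * Ksym j k (t - \<tau>) (rho \<sigma> \<xi>)) * h \<tau> \<xi>)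
      \<le> norm (8 * C * indicator {a..<b} \<tau> :: real)"
  proof (rule AE_I2)
    fix \<tau>
    show "norm (of_real (indicator {a..<b} \<tau> * Ksym j k (t - \<tau>) (rho \<sigma> \<xi>)) * h \<tau> \<xi>)
      \<le> norm (8 * C * indicator {a..<b} \<tau> :: real)"
    proof (cases "\<tau> \<in> {a..<b}")
      case True
      then have "\<bar>Ksym j k (t - \<tau>) (rho \<sigma> \<xi>)\<bar> * norm (h \<tau> \<xi>) \<le> 8 * C"
        using assms by (intro mult_mono Ksym_bounded jk h_le) auto
      then show ?thesis using True C0 by (simp add: norm_mult)
    qed simp
  qed
qed measurable

lemma error_split:
  assumes t: "t > 0"
  shows "error t = (\<lambda>\<xi>. low t \<xi> + early_high t \<xi> + late t \<xi> + data_high t \<xi> + data_fast t \<xi>)"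
proof
  fix \<xi> :: "real ^ 'n"
  let ?S = "\<lambda>A. LINT \<tau>|lborel. of_real (indicator A \<tau> * Ksym j k (t - \<tau>) (rho \<sigma> \<xi>)) * h \<tau> \<xi>"
  have "?S {0..<t} = (LINT \<tau>|lborel. of_real (indicator {0..<t / 2} \<tau> * Ksym j k (t - \<tau>) (rho \<sigma> \<xi>)) * h \<tau> \<xi>
      + of_real (indicator {t / 2..<t} \<tau> * Ksym j k (t - \<tau>) (rho \<sigma> \<xi>)) * h \<tau> \<xi>)"
    by (rule Bochner_Integration.integral_cong) (use t in \<open>auto split: split_indicator\<close>)
  also have "\<dots> = ?S {0..<t / 2} + ?S {t / 2..<t}"
    by (rule Bochner_Integration.integral_add) (rule source_integrable, use t in simp)+
  finally have s: "?S {0..<t} = ?S {0..<t / 2} + late t \<xi>" by (simp add: late_def)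
  show "error t \<xi> = low t \<xi> + early_high t \<xi> + late t \<xi> + data_high t \<xi> + data_fast t \<xi>"
  proof (cases "rho \<sigma> \<xi> \<le> 1 / 2")
    case True
    have e: "early_high t \<xi> = 0" "data_high t \<xi> = 0"
      using True by (simp_all add: early_high_def data_high_def)
    have i: "indicator {..1 / 2} (rho \<sigma> \<xi>) = (1 :: real)" using True by simp
    show ?thesis unfolding error_def s low_def e i by simp
  next
    case False
    have i: "indicator {..1 / 2} (rho \<sigma> \<xi>) = (0 :: real)" "indicator {1 / 2<..} (rho \<sigma> \<xi>) = (1 :: real)" using False by auto
    show ?thesis unfolding error_def s low_def early_high_def data_high_def i by simp
  qed
qed

lemma error_L2:
  assumes "t > 0" shows "error t \<in> L2"
  unfolding error_split[OF assms]
  by (intro L2_add low_bound early_high_bound late_bound data_high_bound data_fast_bound assms)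

theorem error_asymptotics: "(\<lambda>t. L2norm (error t)) \<in> o[at_top](rate)"
proof -
  let ?A = "32 * C / (1 - e * (1 - \<delta>))" and ?p = "1 - e * (1 - \<delta>) - (\<alpha> + n / (4 * \<sigma>))"
  let ?a = "L2norm (\<lambda>\<xi>. of_real (rho \<sigma> \<xi> powr (real k / 2)) * a0 \<xi>)"
  let ?b = "\<lambda>t. rate t * L2norm (low_scaled t) + 4 * C * (t * exp (- t / 8)) + ?A * (t / 2) powr ?p
      + 8 * L2norm w0 * exp (- t / 4) + ?a * exp (- t)"
  have ne: "rate t \<noteq> 0" if "t > 0" for t using that by (simp add: rate_def)
  have "((\<lambda>t. rate t * L2norm (low_scaled t) / rate t) \<longlongrightarrow> 0) at_top"
    by (rule Lim_transform_eventually[OF low_scaled_tendsto])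
      (rule eventually_mono[OF eventually_gt_at_top[of 0]], simp add: ne)
  then have 1: "(\<lambda>t. rate t * L2norm (low_scaled t)) \<in> o[at_top](rate)"
    by (rule smalloI_tendsto) (rule eventually_mono[OF eventually_gt_at_top[of 0]], simp add: ne)
  have 2: "(\<lambda>t. 4 * C * (t * exp (- t / 8))) \<in> o[at_top](rate)"
    "(\<lambda>t. 8 * L2norm w0 * exp (- t / 4)) \<in> o[at_top](rate)" "(\<lambda>t. ?a * exp (- t)) \<in> o[at_top](rate)"
    unfolding rate_def[abs_def] by (intro cmult_in_smallo exp_smallo_powr)+
  \<comment> \<open>The exponent of the late sources beats the rate exactly when 1 + e \<delta> <
    \<alpha>, the condition under which \<open>\<delta>\<close> was chosen.\<close>
  have "?p < - (n / (4 * \<sigma>)) - e"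
    using delta(3) by (simp add: algebra_simps)
  then have "(\<lambda>t. t powr ?p) \<in> o[at_top](rate)"
    unfolding rate_def[abs_def] by (subst powr_smallo_iff) (auto simp: filterlim_ident)
  then have "(\<lambda>t. (?A / 2 powr ?p) * t powr ?p) \<in> o[at_top](rate)"
    by (rule cmult_in_smallo)
  then have 3: "(\<lambda>t. ?A * (t / 2) powr ?p) \<in> o[at_top](rate)"
    by (rule landau_o.small.in_cong[THEN iffD1, rotated])
      (rule eventually_mono[OF eventually_gt_at_top[of 0]], simp add: powr_divide)
  have b: "?b \<in> o[at_top](rate)" by (intro sum_in_smallo 1 2 3)
  have "(\<lambda>t. L2norm (error t)) \<in> O[at_top](?b)"
  proof (rule bigoI[where c=1], rule eventually_mono[OF eventually_gt_at_top[of 0]])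
    fix t :: real assume t: "0 < t"
    note L = low_bound(1)[OF t] early_high_bound(1)[OF t] late_bound(1)[OF t] data_high_bound(1)[OF t] data_fast_bound(1)[of t]
    have "L2norm (error t) \<le> L2norm (low t) + L2norm (early_high t) + L2norm (late t) + L2norm (data_high t) + L2norm (data_fast t)"
      unfolding error_split[OF t]
      by (intro order_trans[OF L2norm_triangle] add_right_mono L2_add L order_refl)
    also have "\<dots> \<le> ?b t"
    proof (intro add_mono)
      show "L2norm (data_high t) \<le> 8 * L2norm w0 * exp (- t / 4)" using data_high_bound(2)[OF t] by (simp add: mult_ac)
      show "L2norm (data_fast t) \<le> ?a * exp (- t)" using data_fast_bound(2)[of t] by simp
    qed (intro low_bound early_high_bound late_bound t)+
    also have "\<dots> \<le> norm (?b t)" by simp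
    finally show "norm (L2norm (error t)) \<le> 1 * norm (?b t)" by simp
  qed
  from this b show ?thesis by (rule landau_o.big_small_trans)
qed

end

section \<open>The Fourier transform of the solution\<close>

text \<open>Pairing with a fixed \<psi> is a bounded linear functional and so maps Riemann sums to
  Riemann sums; the same gauge works. The L^2-valued integral becomes a family of scalar gauge
  integrals, which can be compared with Lebesgue integrals.\<close>

lemma has_L2_integral_pairing:
  fixes f :: "real \<Rightarrow> 'n::finite field"
  assumes I: "has_L2_integral f I a b" and \<psi>: "\<psi> \<in> L2"
  shows "((\<lambda>\<tau>. LINT x|lborel. f \<tau> x * \<psi> x) has_integral (LINT x|lborel. I x * \<psi> x)) {a..b}"
  unfolding has_integral_real
proof (intro allI impI)
  fix e :: real assume e: "e > 0"
  have IL: "I \<in> L2" and fL: "\<And>\<tau>. \<tau> \<in> {a..b} \<Longrightarrow> f \<tau> \<in> L2" using I by (auto simp: has_L2_integral_def)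
  define e' where "e' = e / (L2norm \<psi> + 1)"
  have p: "L2norm \<psi> + 1 > 0" by (simp add: add_nonneg_pos)
  then have e': "e' > 0" using e by (simp add: e'_def)
  obtain \<gamma> where \<gamma>: "gauge \<gamma>" and fine: "\<And>\<D>. \<D> tagged_division_of {a..b} \<and> \<gamma> fine \<D> \<Longrightarrow>
      L2norm (\<lambda>x. (\<Sum>(\<tau>, J)\<in>\<D>. of_real (measure lborel J) * f \<tau> x) - I x) < e'"
    using I e' unfolding has_L2_integral_def by blast
  show "\<exists>\<gamma>. gauge \<gamma> \<and> (\<forall>\<D>. \<D> tagged_division_of {a..b} \<and> \<gamma> fine \<D> \<longrightarrow>
      norm ((\<Sum>(\<tau>, J)\<in>\<D>. measure lborel J *\<^sub>R (LINT x|lborel. f \<tau> x * \<psi> x)) - (LINT x|lborel. I x * \<psi> x)) < e)"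
  proof (intro exI[of _ \<gamma>] conjI allI impI \<gamma>)
    fix \<D> assume D: "\<D> tagged_division_of {a..b} \<and> \<gamma> fine \<D>"
    let ?S = "\<lambda>x. \<Sum>(\<tau>, J)\<in>\<D>. of_real (measure lborel J) * f \<tau> x"
    have tag: "\<tau> \<in> {a..b}" if "(\<tau>, J) \<in> \<D>" for \<tau> J
      using D that tagged_division_ofD(2,3)[of \<D> "{a..b}" \<tau> J] by blast
    have tL: "(\<lambda>x. of_real (measure lborel (snd z)) * f (fst z) x) \<in> L2" if "z \<in> \<D>" for z
      using tag[of "fst z" "snd z"] that by (intro L2_cmult fL) auto
    have SL: "?S \<in> L2" unfolding case_prod_beta by (intro L2_sum tL)
    have "(LINT x|lborel. ?S x * \<psi> x) = (LINT x|lborel. (\<Sum>z\<in>\<D>. of_real (measure lborel (snd z)) * f (fst z) x * \<psi> x))"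
      by (simp add: case_prod_beta sum_distrib_right)
    also have "\<dots> = (\<Sum>z\<in>\<D>. LINT x|lborel. of_real (measure lborel (snd z)) * f (fst z) x * \<psi> x)"
      by (rule Bochner_Integration.integral_sum) (rule L2_mult_integrable(1)[OF tL \<psi>])
    also have "\<dots> = (\<Sum>(\<tau>, J)\<in>\<D>. measure lborel J *\<^sub>R (LINT x|lborel. f \<tau> x * \<psi> x))"
      by (simp add: case_prod_beta mult.assoc scaleR_conv_of_real[where 'a=complex])
    finally have "(\<Sum>(\<tau>, J)\<in>\<D>. measure lborel J *\<^sub>R (LINT x|lborel. f \<tau> x * \<psi> x)) - (LINT x|lborel. I x * \<psi> x)
        = (LINT x|lborel. ?S x * \<psi> x) - (LINT x|lborel. I x * \<psi> x)" by simp
    also have "\<dots> = (LINT x|lborel. (?S x - I x) * \<psi> x)"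
      using L2_mult_integrable(1)[OF SL \<psi>] L2_mult_integrable(1)[OF IL \<psi>] by (simp add: left_diff_distrib)
    also have "norm \<dots> \<le> L2norm (\<lambda>x. ?S x - I x) * L2norm \<psi>"
      by (intro L2_mult_integrable(4) L2_diff SL IL \<psi>)
    also have "\<dots> \<le> e' * L2norm \<psi>" using fine[OF D] by (intro mult_right_mono) auto
    also have "\<dots> < e" using e p by (simp add: e'_def field_simps)
    finally show "norm ((\<Sum>(\<tau>, J)\<in>\<D>. measure lborel J *\<^sub>R (LINT x|lborel. f \<tau> x * \<psi> x)) - (LINT x|lborel. I x * \<psi> x)) < e" .
  qed
qed

lemma mult_cnj_sgn: "z * cnj (sgn z) = of_real (norm z)" for z :: complex
proof (cases "z = 0")
  case False
  have s: "sgn z = of_real (inverse (norm z)) * z"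
    by (simp add: sgn_div_norm scaleR_conv_of_real[where 'a=complex])
  have "z * cnj (sgn z) = of_real (inverse (norm z)) * (z * cnj z)" unfolding s by (simp add: mult_ac)
  also have "\<dots> = of_real (inverse (norm z) * (norm z)\<^sup>2)"
    by (simp only: complex_norm_square[symmetric] of_real_mult)
  also have "inverse (norm z) * (norm z)\<^sup>2 = norm z" using False by (simp add: power2_eq_square)
  finally show ?thesis .
qed simp

lemma AE_eq_if_pairings_eq:
  fixes f g :: "'n::finite field"
  assumes f: "f \<in> L2" and [measurable]: "g \<in> borel_measurable borel" and g: "\<And>x. norm (g x) \<le> B"
    and eq: "\<And>\<phi> R. \<phi> \<in> borel_measurable borel \<Longrightarrow> (\<And>x. norm (\<phi> x) \<le> 1) \<Longrightarrow> (\<And>x. R \<le> norm x \<Longrightarrow> \<phi> x = 0) \<Longrightarrow>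
      (LINT x|lborel. f x * \<phi> x) = (LINT x|lborel. g x * \<phi> x)"
  shows "AE x in lborel. f x = g x"
proof -
  note [measurable] = L2_measurable[OF f]
  have "AE x in lborel. norm x < real R \<longrightarrow> f x = g x" for R :: nat
  proof -
    define \<phi> where "\<phi> x = (if norm x < real R then cnj (sgn (f x - g x)) else 0)" for x
    have [measurable]: "\<phi> \<in> borel_measurable borel" unfolding \<phi>_def sgn_div_norm by measurable
    have b: "norm (\<phi> x) \<le> indicator (ball 0 (real R)) x" for x
      by (auto simp: \<phi>_def norm_sgn)
    have phi1: "norm (\<phi> x) \<le> 1" for x using b[of x] by (auto split: split_indicator_asm)
    have \<phi>L: "\<phi> \<in> L2"
      by (rule L2_bound[OF indicator_ball_L2[of "real R"], where C=1]) (use b in auto)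
    have i1: "integrable lborel (\<lambda>x. f x * \<phi> x)" by (rule L2_mult_integrable(1)[OF f \<phi>L])
    have ib: "integrable lborel (\<lambda>x :: real ^ 'n. B * indicator (ball 0 (real R)) x)"
      using emeasure_lborel_ball_finite[of "0 :: real ^ 'n" "real R"]
      by (intro integrable_mult_right integrable_real_indicator) auto
    have i2: "integrable lborel (\<lambda>x. g x * \<phi> x)"
    proof (rule Bochner_Integration.integrable_bound[OF ib])
      have B: "B \<ge> 0" using g[of 0] norm_ge_zero order_trans by blast
      show "AE x in lborel. norm (g x * \<phi> x) \<le> norm (B * indicator (ball 0 (real R)) x)"
        using g b B by (intro AE_I2) (auto simp: norm_mult intro!: mult_mono)
    qed measurable
    have d: "(f x - g x) * \<phi> x = of_real (norm (\<phi> x) * norm (f x - g x))" for x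
    proof (cases "norm x < real R \<and> f x \<noteq> g x")
      case True
      then have "\<phi> x = cnj (sgn (f x - g x))" "norm (\<phi> x) = 1" by (simp_all add: \<phi>_def norm_sgn)
      then show ?thesis using mult_cnj_sgn[of "f x - g x"] by simp
    qed (auto simp: \<phi>_def)
    have "(LINT x|lborel. (f x - g x) * \<phi> x) = 0"
      using eq[of \<phi> "real R"] phi1 i1 i2 by (simp add: left_diff_distrib \<phi>_def)
    then have "complex_of_real (LINT x|lborel. norm (\<phi> x) * norm (f x - g x)) = 0"
      unfolding d integral_complex_of_real .
    then have z: "(LINT x|lborel. norm (\<phi> x) * norm (f x - g x)) = 0" by simp
    have "integrable lborel (\<lambda>x. (f x - g x) * \<phi> x)" using i1 i2 by (simp add: left_diff_distrib)
    then have "integrable lborel (\<lambda>x. norm ((f x - g x) * \<phi> x))" by (rule integrable_norm)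
    then have "integrable lborel (\<lambda>x. norm (\<phi> x) * norm (f x - g x))" by (simp add: norm_mult mult.commute)
    from integral_nonneg_eq_0_iff_AE[OF this] z have "AE x in lborel. norm (\<phi> x) * norm (f x - g x) = 0" by simp
    then show ?thesis
      by eventually_elim (auto simp: \<phi>_def norm_sgn sgn_zero_iff split: if_splits)
  qed
  then have "AE x in lborel. \<forall>R::nat. norm x < real R \<longrightarrow> f x = g x" unfolding AE_all_countable by blast
  then show ?thesis by eventually_elim (meson reals_Archimedean2)
qed

lemma k1_le: assumes "0 \<le> x" "0 \<le> r" shows "\<bar>k1 x r\<bar> \<le> 4"
proof (cases "r \<le> 1 / 2")
  case True
  have "exp (- (x * r)) \<le> 1" using assms by simp
  then show ?thesis using k1_low[OF assms(2) True assms(1)] by linarith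
next
  case False
  have "exp (- x / 4) \<le> 1" using assms by simp
  then show ?thesis using k1_high(1)[of r x] False assms by linarith
qed

section \<open>The Duhamel representation on the Fourier side\<close>

context energy_solution
begin

lemma u0_L1: "u0 \<in> L1" and u0_L2: "u0 \<in> L2" and u1_L1: "u1 \<in> L1" and u1_L2: "u1 \<in> L2"
  and u0_Hs: "(\<lambda>\<xi>. of_real (bessel_symbol \<sigma> \<xi>) * fourier u0 \<xi>) \<in> L2"
  using data by (auto simp: A1_def Hs_def)

definition W where "W \<xi> = fourier_integral u0 \<xi> + fourier_integral u1 \<xi>"

definition J :: "real \<Rightarrow> 'n field" where
  "J t \<xi> = (LINT \<tau>|lborel. of_real (indicator {0..<t} \<tau> * k1 (t - \<tau>) (rho \<sigma> \<xi>)) * h \<tau> \<xi>)"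

definition J' :: "real \<Rightarrow> 'n field" where
  "J' t \<xi> = (LINT \<tau>|lborel. of_real (indicator {0..<t} \<tau> * m1 (t - \<tau>) (rho \<sigma> \<xi>)) * h \<tau> \<xi>)"

definition U :: "real \<Rightarrow> 'n field" where
  "U t \<xi> = of_real (k1 t (rho \<sigma> \<xi>)) * W \<xi> + of_real (exp (- t)) * fourier_integral u0 \<xi> + J t \<xi>"

definition V :: "real \<Rightarrow> 'n field" where
  "V t \<xi> = of_real (m1 t (rho \<sigma> \<xi>)) * W \<xi> - of_real (exp (- t)) * fourier_integral u0 \<xi> + J' t \<xi>"

lemma h_measurable [measurable]: "(\<lambda>(\<tau>, \<xi>). h \<tau> \<xi>) \<in> borel_measurable (borel \<Otimes>\<^sub>M borel)"
  unfolding borel_prod by (rule borel_measurable_continuous_onI[OF h_continuous])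

lemma fi_measurable [measurable]:
  "fourier_integral u0 \<in> borel_measurable borel" "fourier_integral u1 \<in> borel_measurable borel"
  by (rule fourier_integral_measurable, rule u0_L1 u1_L1)+

lemma W_measurable [measurable]: "W \<in> borel_measurable borel"
  unfolding W_def[abs_def] by measurable

lemma J_measurable [measurable]: "J t \<in> borel_measurable borel" "J' t \<in> borel_measurable borel"
  unfolding J_def[abs_def] J'_def[abs_def] by measurable

lemma UV_measurable [measurable]: "U t \<in> borel_measurable borel" "V t \<in> borel_measurable borel"
  unfolding U_def[abs_def] V_def[abs_def] by measurable

lemma h_bounded: "\<exists>C\<ge>0. \<forall>\<tau> \<xi>. norm (h \<tau> \<xi>) \<le> C"
proof -
  obtain C where C: "C > 0" "\<And>\<tau>. \<tau> \<ge> 0 \<Longrightarrow> L1norm (F \<tau>) \<le> C * (1 + \<tau>) powr (- \<alpha>)" using F_bounds by blast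
  have "norm (h \<tau> \<xi>) \<le> C" for \<tau> \<xi>
  proof -
    have "(1 + max 0 \<tau>) powr (- \<alpha>) \<le> (1 + max 0 \<tau>) powr 0" using alpha_gt_1 by (intro powr_mono) auto
    also have "\<dots> = 1" by simp
    finally have "C * (1 + max 0 \<tau>) powr (- \<alpha>) \<le> C * 1" using C by (intro mult_left_mono) auto
    then show ?thesis using h_bound[of \<tau> \<xi>] C(2)[of "max 0 \<tau>"] by simp
  qed
  then show ?thesis using C(1) by (intro exI[of _ C]) auto
qed

text \<open>The integral defining \<open>N\<close> converges in L^2 and cannot be evaluated
  pointwise in \<xi>, so its transform is compared with \<open>J t\<close> through pairings. Bounded
  support of the test together with the bounds on \<open>k1\<close> and \<open>h\<close> makes the
  double integral absolutely convergent, and Fubini applies.\<close>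

lemma duhamel_fourier:
  assumes t: "t \<ge> 0" and I: "has_L2_integral (\<lambda>\<tau>. K1_conv \<sigma> (t - \<tau>) (F \<tau>)) N 0 t"
  shows "has_fourier N (J t)"
proof -
  obtain C where C: "C \<ge> 0" "\<And>\<tau> \<xi>. norm (h \<tau> \<xi>) \<le> C" using h_bounded by blast
  have NL: "N \<in> L2" using I by (simp add: has_L2_integral_def)
  let ?N = "fourier N"
  have hN: "has_fourier N ?N" by (rule has_fourier_fourier[OF NL])
  \<comment> \<open>The closed interval matches \<open>has_L2_integral\<close>, the half-open one in
    \<open>J\<close> matches the splitting of the error at t/2; they differ by the null set \<tau> =
    t.\<close>
  let ?k = "\<lambda>\<tau> \<xi>. of_real (indicator {0..t} \<tau> * k1 (t - \<tau>) (rho \<sigma> \<xi>)) * h \<tau> \<xi> :: complex"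
  have kb: "norm (?k \<tau> \<xi>) \<le> 4 * C * indicator {0..t} \<tau>" for \<tau> \<xi>
  proof (cases "\<tau> \<in> {0..t}")
    case True
    then have "\<bar>k1 (t - \<tau>) (rho \<sigma> \<xi>)\<bar> * norm (h \<tau> \<xi>) \<le> 4 * C" by (intro mult_mono k1_le C(2)) auto
    then show ?thesis using True by (simp add: norm_mult)
  qed simp
  have km [measurable]: "(\<lambda>(\<tau>, \<xi>). ?k \<tau> \<xi>) \<in> borel_measurable (borel \<Otimes>\<^sub>M borel)" by measurable
  have J_eq: "J t \<xi> = (LINT \<tau>|lborel. ?k \<tau> \<xi>)" for \<xi>
    unfolding J_def
  proof (rule integral_cong_AE)
    show "AE \<tau> in lborel. of_real (indicator {0..<t} \<tau> * k1 (t - \<tau>) (rho \<sigma> \<xi>)) * h \<tau> \<xi> = ?k \<tau> \<xi>"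
      using AE_lborel_singleton[of t] by eventually_elim (auto split: split_indicator)
  qed measurable
  have ki: "integrable lborel (\<lambda>\<tau>. ?k \<tau> \<xi>)" for \<xi>
    by (rule Bochner_Integration.integrable_bound[of _ "\<lambda>\<tau>. 4 * C * indicator {0..t} \<tau>"])
      (use kb C(1) in \<open>auto intro!: integrable_mult_right integrable_real_indicator simp: emeasure_lborel_Icc_eq\<close>)
  have Jb: "norm (J t \<xi>) \<le> 4 * C * t" for \<xi>
  proof -
    have "norm (J t \<xi>) \<le> (LINT \<tau>|lborel. norm (?k \<tau> \<xi>))" unfolding J_eq by (rule integral_norm_bound)
    also have "\<dots> \<le> (LINT \<tau>|lborel. 4 * C * indicator {0..t} \<tau>)"
      by (rule integral_mono[OF integrable_norm[OF ki] _ kb])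
        (auto intro!: integrable_mult_right integrable_real_indicator simp: emeasure_lborel_Icc_eq)
    also have "\<dots> = 4 * C * t" using t by simp
    finally show ?thesis .
  qed
  have "AE \<xi> in lborel. ?N \<xi> = J t \<xi>"
  proof (rule AE_eq_if_pairings_eq[OF has_fourier_L2(2)[OF hN] J_measurable(1) Jb])
    fix \<phi> :: "'n field" and R :: real
    assume \<phi>m [measurable]: "\<phi> \<in> borel_measurable borel" and \<phi>1: "\<And>x. norm (\<phi> x) \<le> 1" and \<phi>0: "\<And>x. R \<le> norm x \<Longrightarrow> \<phi> x = 0"
    have \<phi>b: "norm (\<phi> x) \<le> indicator (ball 0 R) x" for x
      using \<phi>1[of x] \<phi>0[of x] by (auto split: split_indicator)
    have \<phi>L: "\<phi> \<in> L2" by (rule L2_bound[OF indicator_ball_L2[of R], where C=1]) (use \<phi>b in auto)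
    have ib: "integrable lborel (\<lambda>x :: real ^ 'n. indicator (ball 0 R) x :: real)"
      using emeasure_lborel_ball_finite[of "0 :: real ^ 'n" R] by (intro integrable_real_indicator) auto
    have \<phi>i: "integrable lborel (\<lambda>x. norm (\<phi> x))"
      by (rule Bochner_Integration.integrable_bound[OF ib]) (use \<phi>b in auto)
    have h\<phi>: "has_fourier \<phi> (fourier \<phi>)" by (rule has_fourier_fourier[OF \<phi>L])
    let ?P = "\<lambda>\<tau>. LINT \<xi>|lborel. ?k \<tau> \<xi> * \<phi> \<xi>"
    \<comment> \<open>The pairing is taken with the transform of \<phi>, so that the multiplication
      formula turns both the integrand and the integral into pairings of transforms with \<phi>
      itself.\<close>
    have "((\<lambda>\<tau>. LINT x|lborel. K1_conv \<sigma> (t - \<tau>) (F \<tau>) x * fourier \<phi> x) has_integral (LINT x|lborel. N x * fourier \<phi> x)) {0..t}"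
      by (rule has_L2_integral_pairing[OF I fourier_L2[OF \<phi>L]])
    also have "(LINT x|lborel. N x * fourier \<phi> x) = (LINT x|lborel. ?N x * \<phi> x)"
      by (rule has_fourier_multiplication[OF hN h\<phi>, symmetric])
    finally have "(?P has_integral (LINT x|lborel. ?N x * \<phi> x)) {0..t}"
    proof (rule has_integral_eq[rotated])
      fix \<tau> assume \<tau>: "\<tau> \<in> {0..t}"
      have hF: "has_fourier (F \<tau>) (h \<tau>)"
        using has_fourier_L1[OF F_L1 F_L2, of \<tau>] \<tau> by (simp add: h_def)
      have L: "(\<lambda>\<xi>. of_real (k1 (t - \<tau>) (rho \<sigma> \<xi>)) * h \<tau> \<xi>) \<in> L2"
        by (rule L2_bound[OF has_fourier_L2(2)[OF hF], where C=4])
          (use k1_le[of "t - \<tau>"] \<tau> in \<open>auto simp: norm_mult intro!: mult_right_mono\<close>)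
      have hK: "has_fourier (K1_conv \<sigma> (t - \<tau>) (F \<tau>)) (\<lambda>\<xi>. of_real (k1 (t - \<tau>) (rho \<sigma> \<xi>)) * h \<tau> \<xi>)"
        unfolding K1_conv_def rho_def[symmetric] by (rule has_fourier_mult[OF hF _ L]) measurable
      show "(LINT x|lborel. K1_conv \<sigma> (t - \<tau>) (F \<tau>) x * fourier \<phi> x) = ?P \<tau>"
        using has_fourier_multiplication[OF hK h\<phi>] \<tau> by simp
    qed
    moreover
    have iP: "integrable (lborel \<Otimes>\<^sub>M lborel) (\<lambda>(\<tau>, \<xi>). ?k \<tau> \<xi> * \<phi> \<xi>)"
    proof (rule lborel_pair.Fubini_integrable)
      show "(\<lambda>(\<tau>, \<xi>). ?k \<tau> \<xi> * \<phi> \<xi>) \<in> borel_measurable (lborel \<Otimes>\<^sub>M lborel)" by measurable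
      have b: "norm (?k \<tau> \<xi> * \<phi> \<xi>) \<le> 4 * C * indicator {0..t} \<tau> * norm (\<phi> \<xi>)" for \<tau> \<xi>
        unfolding norm_mult[of "?k \<tau> \<xi>"] by (intro mult_right_mono kb) simp
      have ii: "integrable lborel (\<lambda>\<xi>. ?k \<tau> \<xi> * \<phi> \<xi>)" for \<tau>
      proof (rule Bochner_Integration.integrable_bound[of _ "\<lambda>\<xi>. 4 * C * indicator {0..t} \<tau> * norm (\<phi> \<xi>)"])
        show "AE \<xi> in lborel. norm (?k \<tau> \<xi> * \<phi> \<xi>) \<le> norm (4 * C * indicator {0..t} \<tau> * norm (\<phi> \<xi>))"
          using b[of \<tau>] C(1) by (intro AE_I2) (simp add: abs_mult)
      qed (use \<phi>i in \<open>simp, measurable\<close>)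
      then show "AE \<tau> in lborel. integrable lborel (\<lambda>\<xi>. case (\<tau>, \<xi>) of (\<tau>, \<xi>) \<Rightarrow> ?k \<tau> \<xi> * \<phi> \<xi>)" by simp
      show "integrable lborel (\<lambda>\<tau>. LINT \<xi>|lborel. norm (case (\<tau>, \<xi>) of (\<tau>, \<xi>) \<Rightarrow> ?k \<tau> \<xi> * \<phi> \<xi>))"
      proof (rule Bochner_Integration.integrable_bound[of _ "\<lambda>\<tau>. 4 * C * indicator {0..t} \<tau> * L1norm \<phi>"])
        show "integrable lborel (\<lambda>\<tau>. 4 * C * indicator {0..t} \<tau> * L1norm \<phi>)"
          by (intro integrable_mult_left integrable_mult_right integrable_real_indicator) (auto simp: emeasure_lborel_Icc_eq)
        show "AE \<tau> in lborel. norm (LINT \<xi>|lborel. norm (case (\<tau>, \<xi>) of (\<tau>, \<xi>) \<Rightarrow> ?k \<tau> \<xi> * \<phi> \<xi>)) \<le> norm (4 * C * indicator {0..t} \<tau> * L1norm \<phi>)"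
        proof (rule AE_I2)
          fix \<tau>
          have "(LINT \<xi>|lborel. norm (?k \<tau> \<xi> * \<phi> \<xi>)) \<le> (LINT \<xi>|lborel. 4 * C * indicator {0..t} \<tau> * norm (\<phi> \<xi>))"
            by (rule integral_mono[OF integrable_norm[OF ii] integrable_mult_right[OF \<phi>i] b])
          also have "\<dots> = 4 * C * indicator {0..t} \<tau> * L1norm \<phi>" by (simp add: L1norm_def)
          finally show "norm (LINT \<xi>|lborel. norm (case (\<tau>, \<xi>) of (\<tau>, \<xi>) \<Rightarrow> ?k \<tau> \<xi> * \<phi> \<xi>)) \<le> norm (4 * C * indicator {0..t} \<tau> * L1norm \<phi>)"
            using C(1) by (simp add: abs_mult)
        qed
      qed measurable
    qed
    \<comment> \<open>Integrability of \<open>?P\<close> in the Lebesgue sense identifies its gauge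
      integral with a Lebesgue integral, to which Fubini can be applied.\<close>
    have "integrable lborel ?P" using lborel_pair.integrable_fst'[OF iP] by simp
    then have "set_integrable lborel {0..t} ?P" unfolding set_integrable_def by (intro integrable_mult_indicator) auto
    then have "(?P has_integral (LINT \<tau>:{0..t}|lborel. ?P \<tau>)) {0..t}"
      by (simp only: set_borel_integral_eq_integral integrable_integral)
    ultimately have "(LINT x|lborel. ?N x * \<phi> x) = (LINT \<tau>:{0..t}|lborel. ?P \<tau>)" by (rule has_integral_unique)
    also have "\<dots> = (LINT \<tau>|lborel. ?P \<tau>)"
      unfolding set_lebesgue_integral_def
      by (rule Bochner_Integration.integral_cong) (auto split: split_indicator)
    also have "\<dots> = (LINT \<xi>|lborel. LINT \<tau>|lborel. ?k \<tau> \<xi> * \<phi> \<xi>)"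
      using lborel_pair.Fubini_integral[OF iP] by simp
    also have "\<dots> = (LINT \<xi>|lborel. J t \<xi> * \<phi> \<xi>)" unfolding J_eq by simp
    finally show "(LINT x|lborel. ?N x * \<phi> x) = (LINT x|lborel. J t x * \<phi> x)" .
  qed
  then show ?thesis
    by (rule has_fourier_cong_AE[OF hN AE_I2[OF refl]]) (use NL in \<open>auto dest: L2_measurable\<close>)
qed

lemma has_fourier_u:
  assumes t: "t \<ge> 0" shows "has_fourier (u t) (U t)"
proof -
  have Fe: "(\<lambda>x. complex_of_real (norm (u \<tau> x) powr p)) = F \<tau>" for \<tau> by (auto simp: F_def)
  obtain N where I: "has_L2_integral (\<lambda>\<tau>. K1_conv \<sigma> (t - \<tau>) (F \<tau>)) N 0 t"
    and rep: "AE x in lborel. u t x = K0_conv \<sigma> t u0 x + K1_conv \<sigma> t u1 x + N x"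
    using sol t unfolding global_energy_solution_def mild_solution_def Fe by blast
  have hN: "has_fourier N (J t)" by (rule duhamel_fourier[OF t I])
  have h0: "has_fourier u0 (fourier_integral u0)" by (rule has_fourier_L1[OF u0_L1 u0_L2])
  have h1: "has_fourier u1 (fourier_integral u1)" by (rule has_fourier_L1[OF u1_L1 u1_L2])
  have k0b: "\<bar>k0 t r\<bar> \<le> 5" if "r \<ge> 0" for r
  proof -
    have "exp (- t) \<le> 1" using t by simp
    then show ?thesis unfolding k0_eq using k1_le[OF t that] exp_gt_zero[of "- t"] by linarith
  qed
  have [measurable]: "(\<lambda>\<xi>. k0 t (rho \<sigma> \<xi>)) \<in> borel_measurable borel" unfolding k0_eq by measurable
  have L0: "(\<lambda>\<xi>. of_real (k0 t (rho \<sigma> \<xi>)) * fourier_integral u0 \<xi>) \<in> L2"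
    by (rule L2_bound[OF has_fourier_L2(2)[OF h0], where C=5])
      (use k0b in \<open>auto simp: norm_mult intro!: mult_right_mono\<close>)
  have L1: "(\<lambda>\<xi>. of_real (k1 t (rho \<sigma> \<xi>)) * fourier_integral u1 \<xi>) \<in> L2"
    by (rule L2_bound[OF has_fourier_L2(2)[OF h1], where C=4])
      (use k1_le t in \<open>auto simp: norm_mult intro!: mult_right_mono\<close>)
  have hK0: "has_fourier (K0_conv \<sigma> t u0) (\<lambda>\<xi>. of_real (k0 t (rho \<sigma> \<xi>)) * fourier_integral u0 \<xi>)"
    unfolding K0_conv_def rho_def[symmetric] by (rule has_fourier_mult[OF h0 _ L0]) measurable
  have hK1: "has_fourier (K1_conv \<sigma> t u1) (\<lambda>\<xi>. of_real (k1 t (rho \<sigma> \<xi>)) * fourier_integral u1 \<xi>)"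
    unfolding K1_conv_def rho_def[symmetric] by (rule has_fourier_mult[OF h1 _ L1]) measurable
  have "has_fourier (\<lambda>x. K0_conv \<sigma> t u0 x + K1_conv \<sigma> t u1 x + N x)
      (\<lambda>\<xi>. of_real (k0 t (rho \<sigma> \<xi>)) * fourier_integral u0 \<xi> + of_real (k1 t (rho \<sigma> \<xi>)) * fourier_integral u1 \<xi> + J t \<xi>)"
    by (intro has_fourier_add hK0 hK1 hN)
  also have "(\<lambda>\<xi>. of_real (k0 t (rho \<sigma> \<xi>)) * fourier_integral u0 \<xi> + of_real (k1 t (rho \<sigma> \<xi>)) * fourier_integral u1 \<xi> + J t \<xi>) = U t"
    by (auto simp: U_def W_def k0_eq algebra_simps)
  finally have hs: "has_fourier (\<lambda>x. K0_conv \<sigma> t u0 x + K1_conv \<sigma> t u1 x + N x) (U t)" .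
  have "AE x in lborel. K0_conv \<sigma> t u0 x + K1_conv \<sigma> t u1 x + N x = u t x" using rep by eventually_elim simp
  then show ?thesis
    by (rule has_fourier_cong_AE[OF hs _ AE_I2[OF refl]]) (use u_L2[OF t] in \<open>auto dest: L2_measurable\<close>)
qed

end

section \<open>The time derivative\<close>

text \<open>Limits at t within the half-line are tested along this sequence, which also shows that
  the filter is not trivial, as uniqueness of the derivative requires.\<close>

lemma right_sequence:
  assumes "t \<ge> 0" shows "filterlim (\<lambda>m. t + 1 / (real m + 1)) (at t within {0..}) sequentially"
proof -
  have pos: "0 < t + 1 / (real m + 1)" for m using assms by (intro add_nonneg_pos) auto
  have "(\<lambda>m. t + 1 / (real m + 1)) \<longlonglongrightarrow> t" by real_asymp
  moreover have "t + 1 / (real m + 1) \<noteq> t" for m by simp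
  ultimately show ?thesis
    using pos by (auto simp: filterlim_at intro!: always_eventually less_imp_le)
qed

text \<open>The difference quotients converge in L^2, hence so do their transforms, and along a
  subsequence these converge almost everywhere. Pointwise differentiability of the transforms then
  identifies the limit; no domination of the quotients is required.\<close>

lemma has_fourier_L2_deriv:
  fixes w :: "real \<Rightarrow> 'n::finite field"
  assumes d: "has_L2_deriv w v t" and t: "t \<ge> 0" and hw: "\<And>s. s \<ge> t \<Longrightarrow> has_fourier (w s) (U s)"
    and der: "AE \<xi> in lborel. ((\<lambda>s. U s \<xi>) has_vector_derivative V \<xi>) (at t)"
    and V [measurable]: "V \<in> borel_measurable borel"
  shows "has_fourier v V"
proof -
  let ?c = "fconst TYPE('n)"
  define e where "e m = 1 / (real m + 1)" for m :: nat
  have e0: "e m > 0" for m by (simp add: e_def)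
  have e_lim: "e \<longlonglongrightarrow> 0" unfolding e_def by real_asymp
  have e_at: "filterlim e (at 0) sequentially"
    using e_lim e0 by (auto simp: filterlim_at less_imp_neq[symmetric])
  have s_lim: "filterlim (\<lambda>m. t + e m) (at t within {0..}) sequentially"
    unfolding e_def by (rule right_sequence[OF t])
  let ?q = "\<lambda>m x. (w (t + e m) x - w t x) / of_real (t + e m - t)"
  let ?Q = "\<lambda>m \<xi>. (U (t + e m) \<xi> - U t \<xi>) / of_real (e m)"
  have vL: "v \<in> L2" and lim: "((\<lambda>s. L2norm (\<lambda>x. (w s x - w t x) / of_real (s - t) - v x)) \<longlongrightarrow> 0) (at t within {0..})"
    using d by (auto simp: has_L2_deriv_def tendsto_L2_def)
  have q_lim: "(\<lambda>m. L2norm (\<lambda>x. ?q m x - v x)) \<longlonglongrightarrow> 0" by (rule filterlim_compose[OF lim s_lim])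
  have hq: "has_fourier (?q m) (?Q m)" for m
    using has_fourier_cmult[OF has_fourier_diff[OF hw[of "t + e m"] hw[of t]], of "1 / of_real (e m)"] e0[of m]
    by simp
  have hv: "has_fourier v (fourier v)" by (rule has_fourier_fourier[OF vL])
  have "L2norm (\<lambda>\<xi>. ?Q m \<xi> - fourier v \<xi>) = ?c * L2norm (\<lambda>x. ?q m x - v x)" for m
    by (rule has_fourier_norm[OF has_fourier_diff[OF hq hv]])
  then have "(\<lambda>m. L2norm (\<lambda>\<xi>. ?Q m \<xi> - fourier v \<xi>)) \<longlonglongrightarrow> 0"
    using tendsto_mult_left[OF q_lim, of ?c] by simp
  then obtain r :: "nat \<Rightarrow> nat" where r: "strict_mono r"
    and ae: "AE \<xi> in lborel. (\<lambda>m. ?Q (r m) \<xi>) \<longlonglongrightarrow> fourier v \<xi>"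
    using L2norm_AE_subseq[of ?Q "fourier v", OF has_fourier_L2(2)[OF hq] fourier_L2[OF vL]] by blast
  from ae der have "AE \<xi> in lborel. fourier v \<xi> = V \<xi>"
  proof eventually_elim
    case (elim \<xi>)
    have "(\<lambda>y. norm (U (t + y) \<xi> - U t \<xi> - y *\<^sub>R V \<xi>) / norm y) \<midarrow>0\<rightarrow> 0"
      using elim(2) by (simp add: has_vector_derivative_def has_derivative_at)
    then have "(\<lambda>m. norm (U (t + e m) \<xi> - U t \<xi> - e m *\<^sub>R V \<xi>) / norm (e m)) \<longlonglongrightarrow> 0"
      by (rule filterlim_compose[OF _ e_at])
    moreover have "norm (U (t + e m) \<xi> - U t \<xi> - e m *\<^sub>R V \<xi>) / norm (e m) = norm (?Q m \<xi> - V \<xi>)" for m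
    proof -
      have "?Q m \<xi> - V \<xi> = (U (t + e m) \<xi> - U t \<xi> - e m *\<^sub>R V \<xi>) / of_real (e m)"
        using e0[of m] by (simp add: diff_divide_distrib scaleR_conv_of_real[where 'a=complex])
      then show ?thesis using e0[of m] by (simp add: norm_divide)
    qed
    ultimately have "(\<lambda>m. ?Q m \<xi>) \<longlonglongrightarrow> V \<xi>" by (simp add: tendsto_norm_zero_iff LIM_zero_iff)
    then have "(\<lambda>m. ?Q (r m) \<xi>) \<longlonglongrightarrow> V \<xi>" using LIMSEQ_subseq_LIMSEQ[OF _ r] by (auto simp: o_def)
    then show ?case using elim(1) LIMSEQ_unique by blast
  qed
  then show ?thesis
    by (rule has_fourier_cong_AE[OF hv AE_I2[OF refl]]) (use vL in \<open>auto dest: L2_measurable\<close>)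
qed

text \<open>\<open>L2_deriv\<close> is a choice, so an explicitly computed derivative has to be
  matched with the chosen one almost everywhere.\<close>

lemma has_L2_deriv_unique:
  assumes "has_L2_deriv w v t" "has_L2_deriv w v' t" "t \<ge> 0"
  shows "AE x in lborel. v x = v' x"
proof -
  let ?F = "at t within {0..}" and ?q = "\<lambda>s x. (w s x - w t x) / of_real (s - t)"
  have v: "v \<in> L2" "v' \<in> L2" and qL: "\<forall>\<^sub>F s in ?F. ?q s \<in> L2"
    and lim: "((\<lambda>s. L2norm (\<lambda>x. ?q s x - v x)) \<longlongrightarrow> 0) ?F" "((\<lambda>s. L2norm (\<lambda>x. ?q s x - v' x)) \<longlongrightarrow> 0) ?F"
    using assms by (auto simp: has_L2_deriv_def tendsto_L2_def)
  have nt: "?F \<noteq> bot"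
  proof
    assume "?F = bot"
    then have "eventually (\<lambda>_. False) ?F" by simp
    with right_sequence[OF assms(3)] have "eventually (\<lambda>_. False) sequentially"
      unfolding filterlim_iff by blast
    then show False by simp
  qed
  have "L2norm (\<lambda>x. v x - v' x) \<le> 0 + 0"
  proof (rule tendsto_lowerbound[OF tendsto_add[OF lim] _ nt])
    show "\<forall>\<^sub>F s in ?F. L2norm (\<lambda>x. v x - v' x) \<le> L2norm (\<lambda>x. ?q s x - v x) + L2norm (\<lambda>x. ?q s x - v' x)"
      using qL
    proof eventually_elim
      case (elim s)
      show ?case using L2norm_triangle3[OF v(1) elim v(2)] by (simp add: L2norm_minus_commute[of v])
    qed
  qed
  then have "L2norm (\<lambda>x. v x - v' x) = 0" using L2norm_nonneg[of "\<lambda>x. v x - v' x"] by linarith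
  then show ?thesis using L2norm_eq_0_imp_AE[OF L2_diff[OF v]] by simp
qed

section \<open>The heat kernel and its derivative in L^2\<close>

lemma has_fourier_G:
  assumes "\<sigma> \<ge> 1" "t > 0"
  shows "has_fourier (G \<sigma> t) (\<lambda>\<xi>. of_real (exp (- (t * rho \<sigma> \<xi>))))"
proof -
  have "G \<sigma> t = inv_fourier (\<lambda>\<xi>. of_real (exp (- (t * rho \<sigma> \<xi>))))" by (simp add: G_def rho_def)
  then show ?thesis using has_fourier_inv_fourier[OF exp_rho_L2[OF assms]] by metis
qed

text \<open>A second order remainder whose exponential factor is present only for positive z; this
  is what lets one bound serve difference quotients from both sides.\<close>

lemma exp_remainder: "\<bar>exp z - 1 - z\<bar> \<le> z\<^sup>2 * exp (max z 0)" for z :: real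
proof (cases "z \<ge> 0")
  case True
  have "1 \<le> exp (- z) + z" using exp_ge_add_one_self[of "- z"] by linarith
  then have "exp z * 1 \<le> exp z * (exp (- z) + z)" by (intro mult_left_mono) auto
  then have "exp z - 1 \<le> z * exp z" by (simp add: algebra_simps flip: exp_add)
  then have "z * (exp z - 1) \<le> z * (z * exp z)" using True by (intro mult_left_mono) auto
  moreover have "exp z - 1 - z \<le> z * (exp z - 1)"
  proof -
    have "exp z - 1 \<le> z * exp z" by fact
    then show ?thesis by (simp add: algebra_simps)
  qed
  moreover have "0 \<le> exp z - 1 - z" using exp_ge_add_one_self[of z] by linarith
  ultimately show ?thesis using True by (simp add: power2_eq_square mult.assoc)
next
  case False
  define w where "w = - z"
  have w: "w > 0" using False by (simp add: w_def)
  have "1 + w \<le> exp w" by (rule exp_ge_add_one_self)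
  then have "exp (- w) \<le> 1 / (1 + w)" using w by (simp add: exp_minus field_simps)
  also have "\<dots> \<le> 1 - w + w\<^sup>2"
  proof -
    have "1 \<le> (1 - w + w\<^sup>2) * (1 + w)" using w by (simp add: algebra_simps power2_eq_square)
    then show ?thesis using w by (simp add: pos_divide_le_eq)
  qed
  finally have "exp z - 1 - z \<le> z\<^sup>2" by (simp add: w_def)
  moreover have "0 \<le> exp z - 1 - z" using exp_ge_add_one_self[of z] by linarith
  ultimately show ?thesis using False by simp
qed

text \<open>The time derivative of the heat kernel, prescribed through its symbol;
  \<open>has_L2_deriv_G\<close> justifies the name.\<close>

definition G' :: "real \<Rightarrow> real \<Rightarrow> ('n::finite) field" where
  "G' \<sigma> t = inv_fourier (\<lambda>\<xi>. of_real (- rho \<sigma> \<xi> * exp (- (t * rho \<sigma> \<xi>))))"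

lemma x_sq_exp_le:
  fixes x c :: real assumes "c > 0" "x \<ge> 0"
  shows "x\<^sup>2 * exp (- (2 * c * x)) \<le> (1 / c)\<^sup>2"
proof -
  have "(x * exp (- (c * x)))\<^sup>2 \<le> (1 / c)\<^sup>2" using assms x_exp_le[of c x] by (intro power_mono) auto
  moreover have "(x * exp (- (c * x)))\<^sup>2 = x\<^sup>2 * exp (- (2 * c * x))"
    by (simp add: power_mult_distrib power2_eq_square flip: exp_add)
  ultimately show ?thesis by simp
qed

lemma has_fourier_G':
  assumes \<sigma>: "\<sigma> \<ge> 1" and t: "t > 0"
  shows "has_fourier (G' \<sigma> t :: 'n::finite field) (\<lambda>\<xi>. of_real (- rho \<sigma> \<xi> * exp (- (t * rho \<sigma> \<xi>))))"
  unfolding G'_def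
proof (rule has_fourier_inv_fourier, rule L2_bound[OF exp_rho_L2[OF \<sigma>, of "t / 2"]])
  have "rho \<sigma> \<xi> * exp (- (t * rho \<sigma> \<xi>)) \<le> 2 / t * exp (- (t / 2 * rho \<sigma> \<xi>))" for \<xi> :: "real ^ 'n"
  proof -
    have "rho \<sigma> \<xi> * exp (- (t * rho \<sigma> \<xi>)) = rho \<sigma> \<xi> * exp (- (t / 2 * rho \<sigma> \<xi>)) * exp (- (t / 2 * rho \<sigma> \<xi>))"
      by (simp add: mult.assoc flip: exp_add)
    also have "\<dots> \<le> 2 / t * exp (- (t / 2 * rho \<sigma> \<xi>))"
      using x_exp_le[of "t / 2" "rho \<sigma> \<xi>"] t by (intro mult_right_mono) auto
    finally show ?thesis .
  qed
  then show "AE \<xi> in lborel. norm (complex_of_real (- rho \<sigma> \<xi> * exp (- (t * rho \<sigma> \<xi>))))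
      \<le> 2 / t * norm (complex_of_real (exp (- (t / 2 * rho \<sigma> (\<xi> :: real ^ 'n)))))"
    by (intro AE_I2) (simp add: norm_mult)
qed (use t in simp_all)

text \<open>On the Fourier side the quotient minus the derivative is a Taylor remainder divided by s
  - t. For s at least t/2 it is at most |s - t| times a fixed L^2 function, and Plancherel carries
  the estimate back.\<close>

lemma has_L2_deriv_G:
  assumes \<sigma>: "\<sigma> \<ge> 1" and t: "t > 0"
  shows "has_L2_deriv (G \<sigma> :: real \<Rightarrow> 'n::finite field) (G' \<sigma> t) t"
proof -
  let ?c = "fconst TYPE('n)" and ?F = "at t within {0..}"
  let ?q = "\<lambda>s (x :: real ^ 'n). (G \<sigma> s x - G \<sigma> t x) / of_real (s - t) :: complex"
  let ?E = "\<lambda>\<xi> :: real ^ 'n. complex_of_real (exp (- (t / 4 * rho \<sigma> \<xi>)))"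
  let ?Q = "\<lambda>s (\<xi> :: real ^ 'n). (complex_of_real (exp (- (s * rho \<sigma> \<xi>))) - of_real (exp (- (t * rho \<sigma> \<xi>)))) / of_real (s - t)
      - of_real (- rho \<sigma> \<xi> * exp (- (t * rho \<sigma> \<xi>)))"
  have E: "?E \<in> L2" by (rule exp_rho_L2[OF \<sigma>]) (use t in simp)
  have hQ: "has_fourier (\<lambda>x. ?q s x - G' \<sigma> t x) (?Q s)" if "s > 0" for s
    using has_fourier_diff[OF has_fourier_cmult[OF has_fourier_diff[OF has_fourier_G[OF \<sigma> that] has_fourier_G[OF \<sigma> t]], of "1 / of_real (s - t)"]
        has_fourier_G'[OF \<sigma> t]]
    by simp
  have qL: "?q s \<in> L2" if "s > 0" for s
    using L2_cmult[OF L2_diff[OF has_fourier_L2(1)[OF has_fourier_G[OF \<sigma> that]] has_fourier_L2(1)[OF has_fourier_G[OF \<sigma> t]]], of "1 / of_real (s - t)"]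
    by simp
  have b: "L2norm (\<lambda>x. ?q s x - G' \<sigma> t x) \<le> \<bar>s - t\<bar> * ((8 / t)\<^sup>2 * L2norm ?E / ?c)" if s: "t / 2 \<le> s" "s \<noteq> t" for s
  proof -
    have s0: "s > 0" using s t by linarith
    have pt: "norm (?Q s \<xi>) \<le> norm (of_real (\<bar>s - t\<bar> * (8 / t)\<^sup>2) * ?E \<xi>)" for \<xi>
    proof -
      let ?r = "rho \<sigma> \<xi>" and ?z = "- (s - t) * rho \<sigma> \<xi>"
      have "exp (- (s * ?r)) = exp (- (t * ?r)) * exp ?z" by (simp add: algebra_simps flip: exp_add)
      then have "exp (- (s * ?r)) - exp (- (t * ?r)) + (s - t) * (?r * exp (- (t * ?r))) = exp (- (t * ?r)) * (exp ?z - 1 - ?z)"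
        by (simp add: algebra_simps)
      then have "\<bar>exp (- (s * ?r)) - exp (- (t * ?r)) + (s - t) * (?r * exp (- (t * ?r)))\<bar> = exp (- (t * ?r)) * \<bar>exp ?z - 1 - ?z\<bar>"
        by (simp add: abs_mult)
      also have "\<dots> \<le> exp (- (t * ?r)) * (?z\<^sup>2 * exp (max ?z 0))" by (intro mult_left_mono exp_remainder) simp
      also have "\<dots> \<le> exp (- (t * ?r)) * (?z\<^sup>2 * exp (t / 2 * ?r))"
      proof -
        have "?z \<le> t / 2 * ?r" using s by (intro mult_right_mono) auto
        moreover have "0 \<le> t / 2 * ?r" using t by simp
        ultimately have "max ?z 0 \<le> t / 2 * ?r" by simp
        then have "exp (max ?z 0) \<le> exp (t / 2 * ?r)" by (simp only: exp_le_cancel_iff)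
        then show ?thesis by (intro mult_left_mono) auto
      qed
      \<comment> \<open>The decay exp (- t \<rho>) is shared out: one half cancels the growth of the
        remainder, a quarter absorbs \<rho>^2, and the last quarter is left as the square integrable
        majorant.\<close>
      also have "\<dots> = (s - t)\<^sup>2 * (?r\<^sup>2 * exp (- (2 * (t / 8) * ?r))) * exp (- (t / 4 * ?r))"
      proof -
        have "exp (- (t * ?r)) * exp (t / 2 * ?r) = exp (- (2 * (t / 8) * ?r)) * exp (- (t / 4 * ?r))"
          by (simp add: field_simps flip: exp_add)
        moreover have "?z\<^sup>2 = (s - t)\<^sup>2 * ?r\<^sup>2" by (simp add: power_mult_distrib power2_commute)
        ultimately show ?thesis by (simp add: mult_ac)
      qed
      also have "\<dots> \<le> (s - t)\<^sup>2 * (1 / (t / 8))\<^sup>2 * exp (- (t / 4 * ?r))"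
        using t by (intro mult_right_mono mult_left_mono x_sq_exp_le) auto
      finally have m: "\<bar>exp (- (s * ?r)) - exp (- (t * ?r)) + (s - t) * (?r * exp (- (t * ?r)))\<bar> \<le> (s - t)\<^sup>2 * (8 / t)\<^sup>2 * exp (- (t / 4 * ?r))"
        by simp
      have "?Q s \<xi> = of_real ((exp (- (s * ?r)) - exp (- (t * ?r)) + (s - t) * (?r * exp (- (t * ?r)))) / (s - t))"
        using s(2) by (simp add: add_divide_distrib flip: of_real_diff of_real_mult of_real_divide of_real_minus of_real_add)
      then have "norm (?Q s \<xi>) = \<bar>exp (- (s * ?r)) - exp (- (t * ?r)) + (s - t) * (?r * exp (- (t * ?r)))\<bar> / \<bar>s - t\<bar>"
        by (simp only: norm_of_real abs_divide)
      also have "\<dots> \<le> (s - t)\<^sup>2 * (8 / t)\<^sup>2 * exp (- (t / 4 * ?r)) / \<bar>s - t\<bar>" by (intro divide_right_mono m) simp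
      also have "\<dots> = \<bar>s - t\<bar> * (8 / t)\<^sup>2 * exp (- (t / 4 * ?r))"
      proof -
        have "(s - t)\<^sup>2 / \<bar>s - t\<bar> = \<bar>s - t\<bar> * \<bar>s - t\<bar> / \<bar>s - t\<bar>" by (simp add: power2_eq_square)
        also have "\<dots> = \<bar>s - t\<bar>" by (rule nonzero_mult_div_cancel_right) (use s(2) in simp)
        finally have "(s - t)\<^sup>2 / \<bar>s - t\<bar> * ((8 / t)\<^sup>2 * exp (- (t / 4 * ?r))) = \<bar>s - t\<bar> * ((8 / t)\<^sup>2 * exp (- (t / 4 * ?r)))"
          by (rule arg_cong)
        then show ?thesis by (simp only: times_divide_eq_left mult.assoc)
      qed
      also have "\<dots> = norm (of_real (\<bar>s - t\<bar> * (8 / t)\<^sup>2) * ?E \<xi>)"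
        by (simp only: norm_mult norm_of_real) (simp add: abs_mult)
      finally show ?thesis .
    qed
    have "L2norm (?Q s) \<le> L2norm (\<lambda>\<xi>. of_real (\<bar>s - t\<bar> * (8 / t)\<^sup>2) * ?E \<xi>)"
      by (rule L2norm_mono[OF _ L2_cmult[OF E]]) (use pt has_fourier_L2(2)[OF hQ[OF s0]] in \<open>auto dest: L2_measurable\<close>)
    also have "\<dots> = \<bar>s - t\<bar> * (8 / t)\<^sup>2 * L2norm ?E" by (simp only: L2norm_cmult norm_of_real) simp
    finally have "?c * L2norm (\<lambda>x. ?q s x - G' \<sigma> t x) \<le> \<bar>s - t\<bar> * (8 / t)\<^sup>2 * L2norm ?E"
      unfolding has_fourier_norm[OF hQ[OF s0]] .
    then have "L2norm (\<lambda>x. ?q s x - G' \<sigma> t x) \<le> \<bar>s - t\<bar> * (8 / t)\<^sup>2 * L2norm ?E / ?c"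
      by (subst pos_le_divide_eq) (simp_all only: mult.commute zero_less_power real_sqrt_gt_0_iff pi_gt_zero zero_less_mult_iff zero_less_numeral simp_thms)
    then show ?thesis by (simp only: times_divide_eq_right mult.assoc)
  qed
  have ev: "\<forall>\<^sub>F s in ?F. t / 2 < s \<and> s \<noteq> t"
  proof -
    have "\<forall>\<^sub>F s in ?F. t / 2 < s" using t by (intro order_tendstoD(1)[OF tendsto_ident_at]) auto
    moreover have "\<forall>\<^sub>F s in ?F. s \<noteq> t" by (auto simp: eventually_at_filter)
    ultimately show ?thesis by (rule eventually_conj)
  qed
  have "((\<lambda>s. \<bar>s - t\<bar> * ((8 / t)\<^sup>2 * L2norm ?E / ?c)) \<longlongrightarrow> \<bar>t - t\<bar> * ((8 / t)\<^sup>2 * L2norm ?E / ?c)) ?F"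
    by (intro tendsto_intros)
  then have lim: "((\<lambda>s. \<bar>s - t\<bar> * ((8 / t)\<^sup>2 * L2norm ?E / ?c)) \<longlongrightarrow> 0) ?F" by simp
  have "((\<lambda>s. L2norm (\<lambda>x. ?q s x - G' \<sigma> t x)) \<longlongrightarrow> 0) ?F"
    by (rule tendsto_sandwich[OF _ _ tendsto_const lim])
      (simp, rule eventually_mono[OF ev], use b in auto)
  moreover have "\<forall>\<^sub>F s in ?F. ?q s \<in> L2" by (rule eventually_mono[OF ev]) (use qL t in auto)
  ultimately show ?thesis
    unfolding has_L2_deriv_def tendsto_L2_def using has_fourier_L2(1)[OF has_fourier_G'[OF \<sigma> t]] by blast
qed

text \<open>Off the unit sphere, a null set, \<open>k1\<close> is given by its quotient formula,
  which is what \<open>U_deriv\<close> differentiates.\<close>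

lemma AE_rho_neq_1:
  assumes "\<sigma> > 0" shows "AE \<xi> in lborel. rho \<sigma> (\<xi> :: real ^ 'n::finite) \<noteq> 1"
proof -
  have "sphere (0 :: real ^ 'n) 1 \<in> null_sets lborel"
    using negligible_sphere[of "0 :: real ^ 'n" 1] by (auto simp: null_sets_completion_iff negligible_iff_null_sets)
  then have "AE \<xi> in lborel. \<xi> \<notin> sphere (0 :: real ^ 'n) 1" by (rule AE_not_in)
  then show ?thesis
  proof eventually_elim
    case (elim \<xi>)
    show ?case
    proof
      assume "rho \<sigma> \<xi> = 1"
      then have "(norm \<xi> powr (2 * \<sigma>)) powr (1 / (2 * \<sigma>)) = 1" by (simp add: rho_def)
      then have "norm \<xi> = 1" using assms by (simp add: powr_powr)
      then show False using elim by simp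
    qed
  qed
qed

section \<open>Time derivatives of the solution and of its difference to the profile\<close>

context energy_solution
begin

lemma h_slice_continuous: "continuous_on A (\<lambda>\<tau>. h \<tau> \<xi>)"
proof -
  have "continuous_on A (\<lambda>\<tau>. (\<tau>, \<xi>))" by (intro continuous_intros)
  from continuous_on_compose2[OF h_continuous this] show ?thesis by simp
qed

lemma source_integral:
  fixes \<kappa> :: "real \<Rightarrow> real"
  assumes s: "s \<ge> 0" and \<kappa>: "continuous_on UNIV \<kappa>"
  shows "(LINT \<tau>|lborel. of_real (indicator {0..<s} \<tau> * \<kappa> \<tau>) * h \<tau> \<xi>) = integral {0..s} (\<lambda>\<tau>. of_real (\<kappa> \<tau>) * h \<tau> \<xi>)"
proof -
  have [measurable]: "\<kappa> \<in> borel_measurable borel" by (rule borel_measurable_continuous_onI[OF \<kappa>])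
  have hm [measurable]: "(\<lambda>\<tau>. h \<tau> \<xi>) \<in> borel_measurable borel" by measurable
  have "continuous_on {0..s} (\<lambda>\<tau>. of_real (\<kappa> \<tau>) * h \<tau> \<xi>)"
    by (intro continuous_intros h_slice_continuous continuous_on_subset[OF \<kappa>]) auto
  then have "set_integrable lborel {0..s} (\<lambda>\<tau>. of_real (\<kappa> \<tau>) * h \<tau> \<xi>)"
    by (rule borel_integrable_atLeastAtMost')
  then have "(LINT \<tau>:{0..s}|lborel. of_real (\<kappa> \<tau>) * h \<tau> \<xi>) = integral {0..s} (\<lambda>\<tau>. of_real (\<kappa> \<tau>) * h \<tau> \<xi>)"
    by (rule set_borel_integral_eq_integral)
  moreover have "(LINT \<tau>|lborel. of_real (indicator {0..<s} \<tau> * \<kappa> \<tau>) * h \<tau> \<xi>) = (LINT \<tau>:{0..s}|lborel. of_real (\<kappa> \<tau>) * h \<tau> \<xi>)"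
    unfolding set_lebesgue_integral_def
  proof (rule integral_cong_AE)
    show "AE \<tau> in lborel. of_real (indicator {0..<s} \<tau> * \<kappa> \<tau>) * h \<tau> \<xi> = indicator {0..s} \<tau> *\<^sub>R (of_real (\<kappa> \<tau>) * h \<tau> \<xi>)"
      using AE_lborel_singleton[of s] by eventually_elim (auto split: split_indicator)
  qed measurable
  ultimately show ?thesis by simp
qed

text \<open>In J the variable s occurs both in the kernel and in the upper limit. For r distinct
  from 1 the kernel is a difference of products of a function of s and a function of \<tau>, so J
  becomes a combination of exponentials in s times antiderivatives \<open>P\<close>; the product
  rule and the fundamental theorem of calculus suffice, and no differentiation under the integral is
  needed.\<close>

lemma U_deriv:
  assumes t: "t > 0" and r1: "rho \<sigma> \<xi> \<noteq> 1"
  shows "((\<lambda>s. U s \<xi>) has_vector_derivative V t \<xi>) (at t)"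
proof -
  let ?r = "rho \<sigma> \<xi>"
  define P where "P c s = integral {0..s} (\<lambda>\<tau>. of_real (exp (c * \<tau>)) * h \<tau> \<xi>)" for c s :: real
  have Pi: "(\<lambda>\<tau>. of_real (exp (c * \<tau>)) * h \<tau> \<xi>) integrable_on {0..s}" for c s :: real
    by (intro integrable_continuous_interval continuous_intros h_slice_continuous)
  have Pd: "(P c has_vector_derivative of_real (exp (c * t)) * h t \<xi>) (at t)" for c
  proof -
    have "(P c has_vector_derivative of_real (exp (c * t)) * h t \<xi>) (at t within {0..t + 1})"
      unfolding P_def[abs_def] using t
      by (intro integral_has_vector_derivative continuous_intros h_slice_continuous) auto
    moreover have "at t within {0..t + 1} = at t" using t by (intro at_within_Icc_at) auto
    ultimately show ?thesis by simp
  qed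
  have k1c: "continuous_on UNIV (\<lambda>\<tau>. k1 (s - \<tau>) ?r)" "continuous_on UNIV (\<lambda>\<tau>. m1 (s - \<tau>) ?r)" for s
    using r1 unfolding m1_def k1_def by (auto intro!: continuous_intros)
  have J_eq: "J s \<xi> = (of_real (exp (- (s * ?r))) * P ?r s - of_real (exp (- s)) * P 1 s) / of_real (1 - ?r)" if s: "s \<ge> 0" for s
  proof -
    have "J s \<xi> = integral {0..s} (\<lambda>\<tau>. of_real (k1 (s - \<tau>) ?r) * h \<tau> \<xi>)"
      unfolding J_def by (rule source_integral[OF s k1c(1)])
    also have "\<dots> = integral {0..s} (\<lambda>\<tau>. of_real (exp (- (s * ?r)) / (1 - ?r)) * (of_real (exp (?r * \<tau>)) * h \<tau> \<xi>)
        - of_real (exp (- s) / (1 - ?r)) * (of_real (exp (1 * \<tau>)) * h \<tau> \<xi>))"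
    proof (rule Henstock_Kurzweil_Integration.integral_cong)
      fix \<tau>
      have "k1 (s - \<tau>) ?r = exp (- (s * ?r)) / (1 - ?r) * exp (?r * \<tau>) - exp (- s) / (1 - ?r) * exp (1 * \<tau>)"
        using r1 by (simp add: k1_def diff_divide_distrib algebra_simps flip: exp_add)
      then show "of_real (k1 (s - \<tau>) ?r) * h \<tau> \<xi> = of_real (exp (- (s * ?r)) / (1 - ?r)) * (of_real (exp (?r * \<tau>)) * h \<tau> \<xi>)
        - of_real (exp (- s) / (1 - ?r)) * (of_real (exp (1 * \<tau>)) * h \<tau> \<xi>)"
        by (simp only: of_real_diff of_real_mult left_diff_distrib mult.assoc)
    qed
    also have "\<dots> = of_real (exp (- (s * ?r)) / (1 - ?r)) * P ?r s - of_real (exp (- s) / (1 - ?r)) * P 1 s"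
      unfolding P_def by (subst Henstock_Kurzweil_Integration.integral_diff) (intro integrable_on_mult_right Pi, intro integrable_on_mult_right Pi, simp)
    finally show ?thesis by (simp add: diff_divide_distrib)
  qed
  have J'_eq: "J' t \<xi> = (of_real (exp (- t)) * P 1 t - of_real (?r * exp (- (t * ?r))) * P ?r t) / of_real (1 - ?r)"
  proof -
    have "J' t \<xi> = integral {0..t} (\<lambda>\<tau>. of_real (m1 (t - \<tau>) ?r) * h \<tau> \<xi>)"
      unfolding J'_def by (rule source_integral[OF less_imp_le[OF t] k1c(2)])
    also have "\<dots> = integral {0..t} (\<lambda>\<tau>. of_real (exp (- t) / (1 - ?r)) * (of_real (exp (1 * \<tau>)) * h \<tau> \<xi>)
        - of_real (?r * exp (- (t * ?r)) / (1 - ?r)) * (of_real (exp (?r * \<tau>)) * h \<tau> \<xi>))"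
    proof (rule Henstock_Kurzweil_Integration.integral_cong)
      fix \<tau>
      have "m1 (t - \<tau>) ?r = exp (- t) / (1 - ?r) * exp (1 * \<tau>) - ?r * exp (- (t * ?r)) / (1 - ?r) * exp (?r * \<tau>)"
        using r1 by (simp add: m1_eq diff_divide_distrib algebra_simps flip: exp_add)
      then show "of_real (m1 (t - \<tau>) ?r) * h \<tau> \<xi> = of_real (exp (- t) / (1 - ?r)) * (of_real (exp (1 * \<tau>)) * h \<tau> \<xi>)
        - of_real (?r * exp (- (t * ?r)) / (1 - ?r)) * (of_real (exp (?r * \<tau>)) * h \<tau> \<xi>)"
        by (simp only: of_real_diff of_real_mult left_diff_distrib mult.assoc)
    qed
    also have "\<dots> = of_real (exp (- t) / (1 - ?r)) * P 1 t - of_real (?r * exp (- (t * ?r)) / (1 - ?r)) * P ?r t"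
      unfolding P_def by (subst Henstock_Kurzweil_Integration.integral_diff) (intro integrable_on_mult_right Pi, intro integrable_on_mult_right Pi, simp)
    finally show ?thesis by (simp add: diff_divide_distrib)
  qed
  have e1: "((\<lambda>s. exp (- (s * ?r))) has_real_derivative - ?r * exp (- (t * ?r))) (at t)"
    by (auto intro!: derivative_eq_intros)
  have e2: "((\<lambda>s. exp (- s)) has_real_derivative - exp (- t)) (at t)"
    by (auto intro!: derivative_eq_intros)
  have kd: "((\<lambda>s. k1 s ?r) has_real_derivative m1 t ?r) (at t)"
  proof -
    have "((\<lambda>s. (exp (- (s * ?r)) - exp (- s)) / (1 - ?r)) has_real_derivative (- ?r * exp (- (t * ?r)) - (- exp (- t))) / (1 - ?r)) (at t)"
      by (rule DERIV_cdivide[OF DERIV_diff[OF e1 e2]])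
    moreover have "(\<lambda>s. (exp (- (s * ?r)) - exp (- s)) / (1 - ?r)) = (\<lambda>s. k1 s ?r)" using r1 by (simp add: k1_def)
    moreover have "(- ?r * exp (- (t * ?r)) - (- exp (- t))) / (1 - ?r) = m1 t ?r" by (simp add: m1_eq[OF r1])
    ultimately show ?thesis by simp
  qed
  have "((\<lambda>s. of_real (exp (- (s * ?r))) * P ?r s - of_real (exp (- s)) * P 1 s) has_vector_derivative
      (of_real (exp (- (t * ?r))) * (of_real (exp (?r * t)) * h t \<xi>) + of_real (- ?r * exp (- (t * ?r))) * P ?r t)
      - (of_real (exp (- t)) * (of_real (exp (1 * t)) * h t \<xi>) + of_real (- exp (- t)) * P 1 t)) (at t)"
    by (intro has_vector_derivative_diff has_vector_derivative_mult has_vector_derivative_of_real Pd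
        e1 e2)
  also have "of_real (exp (- (t * ?r))) * (of_real (exp (?r * t)) * h t \<xi>) + of_real (- ?r * exp (- (t * ?r))) * P ?r t
      - (of_real (exp (- t)) * (of_real (exp (1 * t)) * h t \<xi>) + of_real (- exp (- t)) * P 1 t)
      = of_real (exp (- t)) * P 1 t - of_real (?r * exp (- (t * ?r))) * P ?r t"
  proof -
    \<comment> \<open>The two boundary terms are both \<open>h t \<xi>\<close> and cancel, in
      accordance with the vanishing of \<open>k1\<close> at time 0.\<close>
    have "complex_of_real (exp (- (t * ?r))) * of_real (exp (?r * t)) = 1" "complex_of_real (exp (- t)) * of_real (exp (1 * t)) = 1"
      by (simp_all add: mult.commute flip: of_real_mult exp_add)
    then show ?thesis by (simp flip: mult.assoc)
  qed
  finally have "((\<lambda>s. (of_real (exp (- (s * ?r))) * P ?r s - of_real (exp (- s)) * P 1 s) / of_real (1 - ?r)) has_vector_derivative J' t \<xi>) (at t)"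
    unfolding J'_eq by (rule has_vector_derivative_divide)
  then have Jd: "((\<lambda>s. J s \<xi>) has_vector_derivative J' t \<xi>) (at t)"
    by (rule has_vector_derivative_transform_within_open[of _ _ _ "{0<..}"]) (use t J_eq in auto)
  have "((\<lambda>s. of_real (k1 s ?r) * W \<xi> + of_real (exp (- s)) * fourier_integral u0 \<xi> + J s \<xi>) has_vector_derivative
      of_real (m1 t ?r) * W \<xi> + of_real (- exp (- t)) * fourier_integral u0 \<xi> + J' t \<xi>) (at t)"
    by (intro has_vector_derivative_add has_vector_derivative_mult_left has_vector_derivative_of_real Jd
        kd e2)
  then show ?thesis unfolding U_def V_def by simp
qed

lemma has_fourier_ut:
  assumes t: "t > 0" shows "has_fourier (L2_deriv u t) (V t)"
proof (rule has_fourier_L2_deriv[OF u_deriv])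
  show "AE \<xi> in lborel. ((\<lambda>s. U s \<xi>) has_vector_derivative V t \<xi>) (at t)"
    using AE_rho_neq_1[of \<sigma>, where 'n='n] sigma U_deriv[OF t] by auto
qed (use t has_fourier_u in auto)

text \<open>\<open>L2_deriv\<close> is not linear by definition. The difference of the two known
  derivatives is shown to be a derivative of the difference, and uniqueness transfers the transform
  to the chosen one.\<close>

lemma w_deriv:
  assumes t: "t > 0"
  shows "has_fourier (L2_deriv (\<lambda>t x. u t x - m * G \<sigma> t x) t)
    (\<lambda>\<xi>. V t \<xi> - m * of_real (- rho \<sigma> \<xi> * exp (- (t * rho \<sigma> \<xi>))))"
proof -
  let ?w = "\<lambda>t x. u t x - m * G \<sigma> t x" and ?F = "at t within {0..}"
  let ?v = "\<lambda>x. L2_deriv u t x - m * G' \<sigma> t x"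
  have hv: "has_fourier ?v (\<lambda>\<xi>. V t \<xi> - m * of_real (- rho \<sigma> \<xi> * exp (- (t * rho \<sigma> \<xi>))))"
    by (intro has_fourier_diff has_fourier_cmult has_fourier_ut has_fourier_G' sigma t)
  let ?qu = "\<lambda>s x. (u s x - u t x) / of_real (s - t)" and ?qg = "\<lambda>s (x :: real ^ 'n). (G \<sigma> s x - G \<sigma> t x) / of_real (s - t) :: complex"
  have du: "L2_deriv u t \<in> L2" "\<forall>\<^sub>F s in ?F. ?qu s \<in> L2" "((\<lambda>s. L2norm (\<lambda>x. ?qu s x - L2_deriv u t x)) \<longlongrightarrow> 0) ?F"
    using u_deriv[of t] t by (auto simp: has_L2_deriv_def tendsto_L2_def)
  have dg: "(G' \<sigma> t :: 'n field) \<in> L2" "\<forall>\<^sub>F s in ?F. (?qg s :: 'n field) \<in> L2" "((\<lambda>s. L2norm (\<lambda>x :: real ^ 'n. ?qg s x - G' \<sigma> t x)) \<longlongrightarrow> 0) ?F"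
    using has_L2_deriv_G[OF sigma t, where 'n='n] by (auto simp: has_L2_deriv_def tendsto_L2_def)
  have qw: "(?w s x - ?w t x) / of_real (s - t) = ?qu s x - m * ?qg s x" for s x
    by (simp add: diff_divide_distrib right_diff_distrib)
  have ev: "\<forall>\<^sub>F s in ?F. ?qu s \<in> L2 \<and> (?qg s :: 'n field) \<in> L2" by (rule eventually_conj[OF du(2) dg(2)])
  have "has_L2_deriv ?w ?v t"
    unfolding has_L2_deriv_def tendsto_L2_def qw
  proof (intro conjI)
    show "?v \<in> L2" by (intro L2_diff L2_cmult du dg)
    show "\<forall>\<^sub>F s in ?F. (\<lambda>x. ?qu s x - m * ?qg s x) \<in> L2"
      using ev by eventually_elim (intro L2_diff L2_cmult, auto)
    have lim: "((\<lambda>s. L2norm (\<lambda>x. ?qu s x - L2_deriv u t x) + norm m * L2norm (\<lambda>x :: real ^ 'n. ?qg s x - G' \<sigma> t x)) \<longlongrightarrow> 0) ?F"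
      using tendsto_add[OF du(3) tendsto_mult_left[OF dg(3), of "norm m"]] by simp
    show "((\<lambda>s. L2norm (\<lambda>x. ?qu s x - m * ?qg s x - ?v x)) \<longlongrightarrow> 0) ?F"
    proof (rule tendsto_sandwich[OF _ _ tendsto_const lim])
      show "\<forall>\<^sub>F s in ?F. L2norm (\<lambda>x. ?qu s x - m * ?qg s x - ?v x)
          \<le> L2norm (\<lambda>x. ?qu s x - L2_deriv u t x) + norm m * L2norm (\<lambda>x :: real ^ 'n. ?qg s x - G' \<sigma> t x)"
        using ev
      proof eventually_elim
        case (elim s)
        have "L2norm (\<lambda>x. (?qu s x - L2_deriv u t x) - m * (?qg s x - G' \<sigma> t x))
            \<le> L2norm (\<lambda>x. ?qu s x - L2_deriv u t x) + L2norm (\<lambda>x. m * (?qg s x - G' \<sigma> t x))"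
          using elim by (intro L2norm_triangle_diff L2_cmult L2_diff du dg) auto
        moreover have "(?qu s x - L2_deriv u t x) - m * (?qg s x - G' \<sigma> t x) = ?qu s x - m * ?qg s x - ?v x" for x
          by (simp add: right_diff_distrib)
        ultimately show ?case by (simp only: L2norm_cmult)
      qed
    qed simp
  qed
  then have "has_L2_deriv ?w (L2_deriv ?w t) t" unfolding L2_deriv_def[of ?w t] by (rule someI[where P="\<lambda>v. has_L2_deriv ?w v t"])
  note d = this \<open>has_L2_deriv ?w ?v t\<close>
  have "AE x in lborel. ?v x = L2_deriv ?w t x"
    by (rule has_L2_deriv_unique[OF d(2,1)]) (use t in simp)
  then show ?thesis
  proof (rule has_fourier_cong_AE[OF hv _ AE_I2[OF refl]])
    show "L2_deriv ?w t \<in> borel_measurable borel"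
      using d(1) by (auto simp: has_L2_deriv_def tendsto_L2_def dest: L2_measurable)
    show "(\<lambda>\<xi>. V t \<xi> - m * of_real (- rho \<sigma> \<xi> * exp (- (t * rho \<sigma> \<xi>)))) \<in> borel_measurable borel" by measurable
  qed
qed

end

section \<open>The asymptotic profile\<close>

context energy_solution
begin

lemma power_integrable: "\<tau> \<ge> 0 \<Longrightarrow> integrable lborel (\<lambda>y. norm (u \<tau> y) powr p)"
  using integrable_norm[of lborel "F \<tau>"] F_L1[of \<tau>] by (simp add: L1_def F_def)

lemma h_at_0:
  assumes "\<tau> \<ge> 0" shows "h \<tau> 0 = of_real (LINT y|lborel. norm (u \<tau> y) powr p)"
  using assms by (simp add: h_def fourier_integral_def F_def)

text \<open>Measurability in \<tau> of the mass of |u(\<tau>)|^p comes from its identification with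
  \<open>h \<tau> 0\<close>, which is continuous in \<tau>; integrability then follows from \<alpha>
  > 1.\<close>

lemma power_set_integrable: "set_integrable lborel {0..} (\<lambda>\<tau>. LINT y|lborel. norm (u \<tau> y) powr p)"
  unfolding set_integrable_def
proof -
  obtain C where C: "C > 0" "\<And>\<tau>. \<tau> \<ge> 0 \<Longrightarrow> L1norm (F \<tau>) \<le> C * (1 + \<tau>) powr (- \<alpha>)" using F_bounds by blast
  have eq: "indicator {0..} \<tau> *\<^sub>R (LINT y|lborel. norm (u \<tau> y) powr p) = indicator {0..} \<tau> * Re (h \<tau> 0)" for \<tau>
    using h_at_0[of \<tau>] by (auto split: split_indicator)
  have "integrable lborel (\<lambda>\<tau>. indicator {0..} \<tau> * Re (h \<tau> 0))"
  proof (rule Bochner_Integration.integrable_bound[of _ "\<lambda>\<tau>. C * (indicator {0..} \<tau> * (1 + \<tau>) powr (- \<alpha>))"])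
    show "integrable lborel (\<lambda>\<tau>. C * (indicator {0..} \<tau> * (1 + \<tau>) powr (- \<alpha>)))"
      by (intro integrable_mult_right integrable_decay alpha_gt_1)
    have "(\<lambda>\<tau>. h \<tau> 0) \<in> borel_measurable borel" by measurable
    then have "(\<lambda>\<tau>. Re (h \<tau> 0)) \<in> borel_measurable borel" by measurable
    then show "(\<lambda>\<tau>. indicator {0..} \<tau> * Re (h \<tau> 0)) \<in> borel_measurable lborel" by measurable
    show "AE \<tau> in lborel. norm (indicator {0..} \<tau> * Re (h \<tau> 0)) \<le> norm (C * (indicator {0..} \<tau> * (1 + \<tau>) powr (- \<alpha>)))"
    proof (rule AE_I2)
      fix \<tau> :: real
      show "norm (indicator {0..} \<tau> * Re (h \<tau> 0)) \<le> norm (C * (indicator {0..} \<tau> * (1 + \<tau>) powr (- \<alpha>)))"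
      proof (cases "\<tau> \<ge> 0")
        case True
        have "\<bar>Re (h \<tau> 0)\<bar> \<le> norm (h \<tau> 0)" by (rule abs_Re_le_cmod)
        also have "\<dots> \<le> C * (1 + \<tau>) powr (- \<alpha>)" using h_bound[of \<tau> 0] C(2)[OF True] True by simp
        finally show ?thesis using True C(1) by simp
      qed simp
    qed
  qed
  then show "integrable lborel (\<lambda>\<tau>. indicator {0..} \<tau> *\<^sub>R (LINT y|lborel. norm (u \<tau> y) powr p))"
    unfolding eq .
qed

definition mass :: complex where
  "mass = (LINT y|lborel. u0 y + u1 y) + of_real (LINT \<tau>:{0..}|lborel. LINT y|lborel. norm (u \<tau> y) powr p)"

lemma mass_eq: "W 0 + (LINT \<tau>:{0..}|lborel. h \<tau> 0) = mass"
proof -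
  have "W 0 = (LINT y|lborel. u0 y + u1 y)"
    using u0_L1 u1_L1 by (simp add: W_def fourier_integral_def L1_def)
  moreover have "(LINT \<tau>:{0..}|lborel. h \<tau> 0) = of_real (LINT \<tau>:{0..}|lborel. LINT y|lborel. norm (u \<tau> y) powr p)"
    unfolding set_lebesgue_integral_def integral_complex_of_real[symmetric]
    by (rule Bochner_Integration.integral_cong) (auto simp: h_at_0 split: split_indicator)
  ultimately show ?thesis by (simp add: mass_def)
qed

lemma diffusion_profile_exists:
  assumes jk: "(j, k) \<in> order_pairs"
  shows "\<exists>C B. diffusion_profile \<sigma> \<alpha> C B n j k h W (fourier_integral u0)"
proof -
  let ?c = "fconst TYPE('n)"
  obtain C where C: "C > 0" "\<And>\<tau>. \<tau> \<ge> 0 \<Longrightarrow> L1norm (F \<tau>) \<le> C * (1 + \<tau>) powr (- \<alpha>)"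
      "\<And>\<tau>. \<tau> \<ge> 0 \<Longrightarrow> L2norm (F \<tau>) \<le> C * (1 + \<tau>) powr (- \<beta>)"
    using F_bounds by blast
  have h0: "has_fourier u0 (fourier_integral u0)" by (rule has_fourier_L1[OF u0_L1 u0_L2])
  have h1: "has_fourier u1 (fourier_integral u1)" by (rule has_fourier_L1[OF u1_L1 u1_L2])
  \<comment> \<open>One constant has to serve two bounds: \<open>C\<close> for the supremum of
    \<open>h\<close> through the L^1 norm, and \<open>?c * C\<close> for its L^2 norm through
    Plancherel.\<close>
  have "diffusion_profile \<sigma> \<alpha> (C * (1 + ?c)) (L1norm u0 + L1norm u1) n j k h W (fourier_integral u0)"
  proof
    show "C * (1 + ?c) \<ge> 0" using C(1) by simp
    show "h \<tau> = h 0" if "\<tau> \<le> 0" for \<tau> using that by (simp add: h_def max_def)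
    show "norm (h \<tau> \<xi>) \<le> C * (1 + ?c) * (1 + \<tau>) powr (- \<alpha>)" if \<tau>: "\<tau> \<ge> 0" for \<tau> \<xi>
    proof -
      have "norm (h \<tau> \<xi>) \<le> C * (1 + \<tau>) powr (- \<alpha>)" using h_bound[of \<tau> \<xi>] C(2)[OF \<tau>] \<tau> by simp
      also have "\<dots> \<le> C * (1 + ?c) * (1 + \<tau>) powr (- \<alpha>)" using C(1) by (intro mult_right_mono) auto
      finally show ?thesis .
    qed
    show "h \<tau> \<in> L2 \<and> L2norm (h \<tau>) \<le> C * (1 + ?c) * (1 + \<tau>) powr (- (\<alpha> + n / (4 * \<sigma>)))" if \<tau>: "\<tau> \<ge> 0" for \<tau>
    proof
      have ht: "h \<tau> = fourier_integral (F \<tau>)" using \<tau> by (simp add: h_def)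
      note P = plancherel_L1_L2[OF F_L1[OF \<tau>] F_L2[OF \<tau>]]
      show "h \<tau> \<in> L2" unfolding ht by (rule P)
      have "L2norm (h \<tau>) \<le> ?c * (C * (1 + \<tau>) powr (- \<beta>))"
        unfolding ht P(2) by (intro mult_left_mono C(3) \<tau>) simp
      also have "\<dots> \<le> C * (1 + ?c) * (1 + \<tau>) powr (- \<beta>)" using C(1) by (simp add: algebra_simps)
      finally show "L2norm (h \<tau>) \<le> C * (1 + ?c) * (1 + \<tau>) powr (- (\<alpha> + n / (4 * \<sigma>)))" by (simp add: \<beta>_def)
    qed
    show "continuous_on UNIV W"
      unfolding W_def[abs_def] by (intro continuous_intros fourier_integral_continuous u0_L1 u1_L1)
    show "norm (W \<xi>) \<le> L1norm u0 + L1norm u1" for \<xi>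
      unfolding W_def by (intro order_trans[OF norm_triangle_ineq] add_mono fourier_integral_bound)
    show "W \<in> L2" unfolding W_def[abs_def] by (intro L2_add has_fourier_L2(2)[OF h0] has_fourier_L2(2)[OF h1])
    show "(\<lambda>\<xi>. of_real (rho \<sigma> \<xi> powr (real k / 2)) * fourier_integral u0 \<xi>) \<in> L2"
    proof (cases "k = 0")
      case True
      show ?thesis
        by (rule L2_bound[OF has_fourier_L2(2)[OF h0], where C=1]) (simp_all add: True norm_mult)
    next
      \<comment> \<open>For k = 1 the weight is |\<xi>|^\<sigma>, so membership comes from the
        Bessel weight of u_0 after exchanging the chosen transform for the integral one.\<close>
      case False
      then have k: "k = 1" using jk by (auto simp: order_pairs_def)
      have "AE \<xi> in lborel. fourier u0 \<xi> = fourier_integral u0 \<xi>"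
        by (rule has_fourier_unique[OF has_fourier_fourier[OF u0_L2] h0])
      then have "AE \<xi> in lborel. of_real (norm \<xi> powr \<sigma>) * fourier u0 \<xi> = of_real (rho \<sigma> \<xi> powr (real k / 2)) * fourier_integral u0 \<xi>"
        by eventually_elim (simp add: k rho_half)
      then show ?thesis
        by (rule L2_cong_AE[OF bessel_weight[OF u0_L2 u0_Hs], rotated]) measurable
    qed
  qed (use n_eq sigma alpha_gt_1 jk h_continuous in auto)
  then show ?thesis by blast
qed

text \<open>For t > 0 the transform of the quantity is \<open>D.error t\<close>, so by Plancherel
  the two norms differ by the constant factor \<open>?c\<close>, and
  \<open>error_asymptotics\<close> applies.\<close>

lemma asymptotics:
  assumes jk: "(j, k) \<in> order_pairs"
  defines "w \<equiv> \<lambda>t x. u t x - mass * G \<sigma> t x"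
  shows "(\<forall>t>0. abs_D (real k * \<sigma>) ((L2_deriv ^^ j) w t) \<in> L2) \<and>
    (\<lambda>t. L2norm (abs_D (real k * \<sigma>) ((L2_deriv ^^ j) w t))) \<in> o[at_top](\<lambda>t. t powr (- n / (4 * \<sigma>) - real k / 2 - real j))"
proof -
  let ?c = "fconst TYPE('n)"
  obtain C B where "diffusion_profile \<sigma> \<alpha> C B n j k h W (fourier_integral u0)"
    using diffusion_profile_exists[OF jk] by blast
  then interpret D: diffusion_profile \<sigma> \<alpha> C B n j k h W "fourier_integral u0" .
  have M: "D.M = mass" unfolding D.M_def by (rule mass_eq)
  have sym: "norm \<xi> powr (real k * \<sigma>) = rho \<sigma> \<xi> powr (real k / 2)" for \<xi> :: "real ^ 'n"
    by (simp add: rho_def powr_powr mult.commute)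
  have key: "has_fourier (abs_D (real k * \<sigma>) ((L2_deriv ^^ j) w t)) (D.error t)" if t: "t > 0" for t
  proof -
    obtain g where hg: "has_fourier ((L2_deriv ^^ j) w t) g"
      and eg: "D.error t = (\<lambda>\<xi>. of_real (norm \<xi> powr (real k * \<sigma>)) * g \<xi>)"
    proof (cases "j = 0")
      case True
      let ?g = "\<lambda>\<xi>. U t \<xi> - mass * of_real (exp (- (t * rho \<sigma> \<xi>)))"
      have "has_fourier (w t) ?g"
        unfolding w_def using t by (intro has_fourier_diff has_fourier_cmult has_fourier_u has_fourier_G sigma) auto
      moreover have "D.error t = (\<lambda>\<xi>. of_real (norm \<xi> powr (real k * \<sigma>)) * ?g \<xi>)"
      proof
        fix \<xi> :: "real ^ 'n"
        have s: "(LINT \<tau>|lborel. of_real (indicator {0..<t} \<tau> * Ksym j k (t - \<tau>) (rho \<sigma> \<xi>)) * h \<tau> \<xi>)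
            = of_real (rho \<sigma> \<xi> powr (real k / 2)) * J t \<xi>"
          unfolding J_def integral_mult_right_zero[symmetric] by (simp add: Ksym_def True mult_ac)
        show "D.error t \<xi> = of_real (norm \<xi> powr (real k * \<sigma>)) * ?g \<xi>"
          unfolding D.error_def s sym M D.data_fast_def U_def by (simp add: True Ksym_def algebra_simps)
      qed
      ultimately show ?thesis using that True by simp
    next
      case False
      then have jk': "j = 1" "k = 0" using jk by (auto simp: order_pairs_def)
      let ?g = "\<lambda>\<xi>. V t \<xi> - mass * of_real (- rho \<sigma> \<xi> * exp (- (t * rho \<sigma> \<xi>)))"
      have "has_fourier (L2_deriv w t) ?g" unfolding w_def by (rule w_deriv[OF t])
      moreover have "D.error t = (\<lambda>\<xi>. of_real (norm \<xi> powr (real k * \<sigma>)) * ?g \<xi>)"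
      proof
        fix \<xi> :: "real ^ 'n"
        have s: "(LINT \<tau>|lborel. of_real (indicator {0..<t} \<tau> * Ksym j k (t - \<tau>) (rho \<sigma> \<xi>)) * h \<tau> \<xi>)
            = of_real (rho \<sigma> \<xi> powr (real k / 2)) * J' t \<xi>"
          unfolding J'_def integral_mult_right_zero[symmetric] by (simp add: Ksym_def jk'(1) mult_ac)
        show "D.error t \<xi> = of_real (norm \<xi> powr (real k * \<sigma>)) * ?g \<xi>"
          unfolding D.error_def s sym M D.data_fast_def V_def by (simp add: jk'(1) Ksym_def algebra_simps)
      qed
      ultimately show ?thesis using that jk'(1) by simp
    qed
    have "(\<lambda>\<xi>. of_real (norm \<xi> powr (real k * \<sigma>)) * g \<xi>) \<in> L2" using D.error_L2[OF t] unfolding eg .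
    from has_fourier_mult[OF hg _ this] show ?thesis unfolding eg abs_D_def by measurable
  qed
  have rate: "D.rate = (\<lambda>t. t powr (- n / (4 * \<sigma>) - real k / 2 - real j))"
    by (simp add: D.rate_def[abs_def] D.e_def algebra_simps)
  have "(\<lambda>t. 1 / ?c * L2norm (D.error t)) \<in> o[at_top](D.rate)"
    by (rule cmult_in_smallo[OF D.error_asymptotics])
  moreover have "L2norm (abs_D (real k * \<sigma>) ((L2_deriv ^^ j) w t)) = 1 / ?c * L2norm (D.error t)" if "t > 0" for t
    using has_fourier_norm[OF key[OF that]] by simp
  then have "\<forall>\<^sub>F t in at_top. 1 / ?c * L2norm (D.error t) = L2norm (abs_D (real k * \<sigma>) ((L2_deriv ^^ j) w t))"
    by (intro eventually_mono[OF eventually_gt_at_top[of 0]]) simp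
  ultimately have "(\<lambda>t. L2norm (abs_D (real k * \<sigma>) ((L2_deriv ^^ j) w t))) \<in> o[at_top](D.rate)"
    by (subst (asm) landau_o.small.in_cong) simp_all
  then show ?thesis unfolding rate by (intro conjI allI impI has_fourier_L2(1)[OF key])
qed

end

theorem theorem1p4:
  fixes \<sigma> p :: real
  assumes "\<sigma> \<ge> 1" and "p > 1"
    and "(real CARD('n::finite) \<le> 2 * \<sigma> \<and> 2 \<le> p) \<or>
         (2 * \<sigma> < real CARD('n) \<and> real CARD('n) \<le> 4 * \<sigma> \<and>
          2 \<le> p \<and> p \<le> real CARD('n) / (real CARD('n) - 2 * \<sigma>))"
    and "p > 1 + 2 * \<sigma> / real CARD('n)"
  shows "\<exists>\<epsilon>>0. \<forall>(u0 :: 'n field) (u1 :: 'n field) u.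
    (u0, u1) \<in> A1 \<sigma> \<longrightarrow> A1_norm \<sigma> u0 u1 \<le> \<epsilon> \<longrightarrow> global_energy_solution \<sigma> p u0 u1 u \<longrightarrow>
    (\<forall>\<tau>\<ge>0. integrable lborel (\<lambda>y. norm (u \<tau> y) powr p)) \<and>
    set_integrable lborel {0..} (\<lambda>\<tau>. LINT y|lborel. norm (u \<tau> y) powr p) \<and>
    (let M = (LINT y|lborel. u0 y + u1 y)
             + of_real (LINT \<tau>:{0..}|lborel. LINT y|lborel. norm (u \<tau> y) powr p);
         w = (\<lambda>t x. u t x - M * G \<sigma> t x)
     in \<forall>j\<in>{0,1}. \<forall>k\<in>{0,1}. (j, k) \<noteq> (1, 1) \<longrightarrow>
          (\<forall>t>0. abs_D (real k * \<sigma>) ((L2_deriv ^^ j) w t) \<in> L2) \<and>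
          (\<lambda>t. L2norm (abs_D (real k * \<sigma>) ((L2_deriv ^^ j) w t)))
            \<in> o[at_top](\<lambda>t. t powr (- real CARD('n) / (4 * \<sigma>) - real k / 2 - real j)))"
proof (intro exI[of _ "1 :: real"] conjI allI impI)
  have p2: "p \<ge> 2" using assms(3) by auto
  have sob: "real CARD('n) * (1 / 2 - 1 / (2 * p)) \<le> \<sigma>"
  proof (cases "real CARD('n) \<le> 2 * \<sigma>")
    case True
    have "real CARD('n) * (1 / 2 - 1 / (2 * p)) \<le> real CARD('n) * (1 / 2)"
      using p2 by (intro mult_left_mono) auto
    also have "\<dots> \<le> \<sigma>" using True by simp
    finally show ?thesis .
  next
    case False
    then have "p \<le> real CARD('n) / (real CARD('n) - 2 * \<sigma>)" using assms(3) by auto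
    \<comment> \<open>Dividing this by 2p gives the Sobolev condition of the locale; in the
      low-dimensional case the condition holds for every p since n/2 \<le> \<sigma>.\<close>
    then have "p * (real CARD('n) - 2 * \<sigma>) \<le> real CARD('n)" using False by (simp add: pos_le_divide_eq)
    then show ?thesis using p2 by (simp add: field_simps)
  qed
  fix u0 u1 :: "'n field" and u :: "real \<Rightarrow> 'n field"
  assume "(u0, u1) \<in> A1 \<sigma>" "global_energy_solution \<sigma> p u0 u1 u"
  then interpret energy_solution \<sigma> p "real CARD('n)" u0 u1 u
    using assms p2 sob by unfold_locales auto
  show "integrable lborel (\<lambda>y. norm (u \<tau> y) powr p)" if "\<tau> \<ge> 0" for \<tau> by (rule power_integrable[OF that])
  show "set_integrable lborel {0..} (\<lambda>\<tau>. LINT y|lborel. norm (u \<tau> y) powr p)" by (rule power_set_integrable)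
  show "let M = (LINT y|lborel. u0 y + u1 y)
             + of_real (LINT \<tau>:{0..}|lborel. LINT y|lborel. norm (u \<tau> y) powr p);
         w = (\<lambda>t x. u t x - M * G \<sigma> t x)
     in \<forall>j\<in>{0,1}. \<forall>k\<in>{0,1}. (j, k) \<noteq> (1, 1) \<longrightarrow>
          (\<forall>t>0. abs_D (real k * \<sigma>) ((L2_deriv ^^ j) w t) \<in> L2) \<and>
          (\<lambda>t. L2norm (abs_D (real k * \<sigma>) ((L2_deriv ^^ j) w t)))
            \<in> o[at_top](\<lambda>t. t powr (- real CARD('n) / (4 * \<sigma>) - real k / 2 - real j))"
    unfolding mass_def[symmetric] Let_def
  proof (intro ballI impI)
    fix j k :: nat assume "j \<in> {0, 1}" "k \<in> {0, 1}" "(j, k) \<noteq> (1, 1)"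
    then have "(j, k) \<in> order_pairs" by (auto simp: order_pairs_def)
    then show "(\<forall>t>0. abs_D (real k * \<sigma>) ((L2_deriv ^^ j) (\<lambda>t x. u t x - mass * G \<sigma> t x) t) \<in> L2) \<and>
        (\<lambda>t. L2norm (abs_D (real k * \<sigma>) ((L2_deriv ^^ j) (\<lambda>t x. u t x - mass * G \<sigma> t x) t)))
          \<in> o[at_top](\<lambda>t. t powr (- real CARD('n) / (4 * \<sigma>) - real k / 2 - real j))"
      by (rule asymptotics)
  qed
qed simp

end
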